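(* Let $q^{1/2}$ be a primitive $(2N)$-th root of unity. (i) For the modules $V=V_{2N-4k}$ and $V=V_{2|k|}^{\epsilon,\delta}$ over $\mathbb Z_{\ddot q}$ of types $(\alpha),(\breve\gamma)$ and those obtained from them upon applying $\iota$, the group $\tilde{\mathfrak B}^\dag$ (the image $\tilde{\mathfrak B}$ of $\mathcal B_1$ in automorphisms of $V$ divided by its center) is a natural quotient of $\Delta(2N,2N,2N;2N)$: $$a\mapsto\tilde A=XT,\quad b\mapsto\tilde B=q^{1/4}XTY,\quad c\mapsto\tilde C=T^{-1}Y,\quad x\mapsto q^{1/4}Y,$$ $$y\mapsto q^{1/4}T^{-1}X^{-1}T=q^{1/4}XT^2,\quad z\mapsto Y^{-1}X^{-1}=q^{1/4}Y^{-1}\tau_-(X^{-1})Y.$$ Namely, the orders of the images of $x,y,z$ are $2N$, as well as the order of the image of $abac$, which (up to a scalar) is $YXY=\tau_-\tau_+(Y)$. Assuming the semisimplicity of $T$ (i.e. $t\ne-1$), the order of the image $\tilde T=q^{1/4}T=\tilde A\tilde B\tilde C$ of $abc$ modulo scalar matrices is $\mathrm{ord}(-t)=2N/\gcd(2N,N-2|k|)$. Also, the order of the image $\tilde T^2$ of $xzy$ in $GL(V)/\mathbb C^*$ equals $\mathrm{ord}(t^2)=N/\gcd(N,2|k|)$. (ii) For odd $N$, for $(\breve\alpha^\checkmark)$ with even $2k$ and for $(\breve\gamma^\checkmark)$, substitute $q\mapsto q^\checkmark=q^2$, $t\mapsto t^\checkmark=t^2$ in these formulas: $$a\mapsto XT^\checkmark,\quad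 b\mapsto q^{1/2}XT^\checkmark Y^\checkmark,\quad c\mapsto(T^\checkmark)^{-1}Y^\checkmark,$$ $$x\mapsto q^{1/2}Y^\checkmark,\quad y\mapsto q^{1/2}(T^\checkmark)^{-1}X^{-1}T^\checkmark,\quad z\mapsto (Y^\checkmark)^{-1}X^{-1}.$$ Then the orders of the images of $x,y,z$ modulo scalars are $N$, as well as the order of the image of $abac$. Accordingly, the images of $a,b,c,x,y,z$ satisfy the relations from $\Delta(N,N,N;N)$. The dimensions of the corresponding spaces $V^\checkmark$ are $N-2k$ for $(\breve\alpha^\checkmark)$ and $2|k|$ for $(\breve\gamma^\checkmark)$. Since $t^\checkmark\ne-1$ ($N$ is odd), the image $q^{1/2}T^\checkmark$ of $abc$ modulo scalar matrices is of order $\mathrm{ord}(-t^2)=2N/\gcd(N,2|k|)$, and the order of $(T^\checkmark)^2$ modulo scalars is $N/\gcd(N,2|k|)$.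
   Context: DAHA of type $A_1$. $\mathcal H=\mathcal H_{q^{1/2},t^{1/2}}$ is generated by $X^{\pm1},Y^{\pm1},T$ over $\mathbb Z[q^{\pm1/2},t^{\pm1/2}]$ (with $q^{\pm1/4}$ added), with relations $(T-t^{1/2})(T+t^{-1/2})=0$, $TXT=X^{-1}$, $T^{-1}YT^{-1}=Y^{-1}$, $Y^{-1}X^{-1}YXT^2q^{1/2}=1$; $\pi=YT^{-1}$. Automorphisms: $\tau_+$: $X\mapsto X$, $T\mapsto T$, $Y\mapsto q^{-1/4}XY$; $\tau_-$: $Y\mapsto Y$, $T\mapsto T$, $X\mapsto q^{1/4}YX$; $\varsigma_x$: $X\mapsto-X$ fixing $T,Y$; $\varsigma_y$: $Y\mapsto-Y$ fixing $T,X$; $\iota$: $T\mapsto-T$, $X\mapsto X$, $Y\mapsto Y$, $t^{1/2}\mapsto t^{-1/2}$. $\varphi(V)$ is $V$ with action twisted by $\varphi$. Polynomial representation $\mathscr X$ = Laurent polynomials in $X$: $X$ acts by multiplication, $T=t^{1/2}s+\frac{t^{1/2}-t^{-1/2}}{X^2-1}(s-1)$, $Y=\pi T$, $s(X^n)=X^{-n}$, $\pi(X^n)=q^{n/2}X^{-n}$. The polynomials $e_n$ ($n\in\mathbb Z$) are defined for generic $q,t$ by $Ye_n=(t^{1/2}q^{|n|/2})^{-\mathrm{sign}(n)}e_n$ ($\mathrm{sign}(0)=-1$), $e_n=X^n+$ lower terms (combinations of $X^{\pm m}$, $|m|<|n|$, and, for $n<0$, also of $X^{|n|}$), and by specialization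 when regular. Parameters. $k\in\mathbb Z/2$, $t=(q^{1/2})^{2k}$, $t^{1/2}=\pm(q^{1/2})^k$; for half-integral $k$, $q^{1/4}$ is the square root of $q^{1/2}$ with $t^{1/2}=(q^{1/4})^{2k}$. $\ddot q=q^{1/4}$ for even $2k$, $\ddot q=q^{1/2}$ for odd $2k$. Modules. $(\alpha)$: $V_{2N-4k}=\mathscr X/(e_{-n})$, $n=N-2k$, $0<2k<N$. $(\breve\gamma)$: $V^{\epsilon,\delta}_{2|k|}=\varsigma_x^\epsilon\varsigma_y^\delta(V^+_{2|k|})$, $\epsilon,\delta\in\{0,1\}$, $k=-1/2-l$, $l\in\mathbb Z_+$, $|k|<N/2$, $V^+_{2|k|}=\mathscr X/(e_{l+1}-t^{-1/2}e_{-l})$. For odd $N=2n+1$: $\mathcal H^\checkmark=\mathcal H_{q,t}$ is the algebra with $q^{1/2},t^{1/2}$ replaced by $(q^\checkmark)^{1/2}=q,\ (t^\checkmark)^{1/2}=t$; $T^\checkmark,Y^\checkmark$ denote its generators in its modules, and $\mathscr X^\checkmark,e_m^\checkmark$ its polynomial representation and $e$-polynomials. $(\breve\alpha^\checkmark)$, integral $k$, $0<k<N/2$: $\varsigma_x^\epsilon\varsigma_y^\delta(V^{+\checkmark}_{N-2k})$, $V^{+\checkmark}_{N-2k}=\mathscr X^\checkmark/(e^\checkmark_{n-k+1}-(t^\checkmark)^{-1/2}e^\checkmark_{k-n})$. $(\breve\gamma^\checkmark)$, $k=-1/2-l$, $l\in\mathbb Z_+$, $|k|<N/2$: $\varsigma_x^\epsilon\varsigma_y^\delta(V^{+\checkmark}_{2|k|})$,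 $V^{+\checkmark}_{2|k|}=\mathscr X^\checkmark/(e^\checkmark_{l+1}-(t^\checkmark)^{-1/2}e^\checkmark_{-l})$. $\mathcal B_1$ is the group generated by $\tilde X,\tilde Y,\tilde T$ with relations $\tilde T\tilde X\tilde T=\tilde X^{-1}$, $\tilde T^{-1}\tilde Y\tilde T^{-1}=\tilde Y^{-1}$, $\tilde Y^{-1}\tilde X^{-1}\tilde Y\tilde X\tilde T^2=1$; it acts in $\mathcal H$-modules by $\tilde T=q^{1/4}T$, $\tilde Y=q^{1/4}Y$, $\tilde X=q^{-1/4}X$. Triangle groups: $\Delta(l,m,n)=\langle a,b,c\mid a^2=b^2=c^2=1=(ab)^l=(bc)^m=(ca)^n\rangle$, $x=ab$, $y=bc$, $z=ca$ (so $xyz=1$); $\Delta(l,m,n;r)$ is its quotient by the additional relation $(abac)^r=1$, i.e. $(xz^{-1})^r=1$. Orders of images are understood in $\tilde{\mathfrak B}^\dag$, i.e. modulo scalar matrices.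
   Formalization: The exact-order claims are stated only for k ≠ −1/2 and 2k ≠ N−1: in those excluded cases T acts as a scalar and x, y, z have order 1 or 2 modulo scalars, so the claimed orders are false there; all other claims are unrestricted. *)

theory Defs
  imports
    Complex_Main
    "HOL-Library.Poly_Mapping"
    "HOL-Computational_Algebra.Fraction_Field"
    "HOL-Computational_Algebra.Polynomial"
    "HOL-Algebra.Bij"
    "HOL-Algebra.QuotRing"
    "HOL-Algebra.Embedded_Algebras"
    "HOL-Algebra.Multiplicative_Group"
begin

hide_const (open) Multiset.mult Poly_Mapping.range

section \<open>Groups given by generators and relators\<close>

text \<open>A letter \<open>(g, True)\<close> stands for the generator \<open>g\<close>, and \<open>(g, False)\<close> for its inverse.\<close>

type_synonym 'g word = "('g \<times> bool) list"

inductive pres_eq :: "'g word set \<Rightarrow> 'g word \<Rightarrow> 'g word \<Rightarrow> bool" for R where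
  pres_refl: "pres_eq R w w"
| pres_sym: "pres_eq R v w \<Longrightarrow> pres_eq R w v"
| pres_trans: "pres_eq R u v \<Longrightarrow> pres_eq R v w \<Longrightarrow> pres_eq R u w"
| pres_cancel: "pres_eq R (u @ [(g, b), (g, \<not> b)] @ w) (u @ w)"
| pres_relator: "r \<in> R \<Longrightarrow> pres_eq R (u @ r @ w) (u @ w)"

definition pres_class :: "'g word set \<Rightarrow> 'g word \<Rightarrow> 'g word set" where
  "pres_class R w = {w'. pres_eq R w w'}"

definition presented_group :: "'g word set \<Rightarrow> 'g word set monoid" where
  "presented_group R =
     \<lparr>carrier = range (pres_class R),
      mult = (\<lambda>A B. \<Union>x\<in>A. \<Union>y\<in>B. pres_class R (x @ y)),
      one = pres_class R []\<rparr>"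

definition gen :: "'g \<Rightarrow> 'g word" where "gen g = [(g, True)]"
definition gen_inv :: "'g \<Rightarrow> 'g word" where "gen_inv g = [(g, False)]"
definition word_pow :: "'g word \<Rightarrow> nat \<Rightarrow> 'g word" where
  "word_pow w n = concat (replicate n w)"

datatype B1_gen = bX | bY | bT

definition B1_relators :: "B1_gen word set" where
  "B1_relators =
     {gen bT @ gen bX @ gen bT @ gen bX,
      gen_inv bT @ gen bY @ gen_inv bT @ gen bY,
      gen_inv bY @ gen_inv bX @ gen bY @ gen bX @ gen bT @ gen bT}"

definition B1 :: "B1_gen word set monoid" where
  "B1 = presented_group B1_relators"

datatype tri_gen = ta | tb | tc

text \<open>Here \<open>x z\<inverse> = (ab)(ca)\<inverse> = abac\<close> modulo the involution relations.\<close>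

definition triangle_relators :: "nat \<Rightarrow> nat \<Rightarrow> nat \<Rightarrow> nat \<Rightarrow> tri_gen word set" where
  "triangle_relators l m n r =
     {gen ta @ gen ta, gen tb @ gen tb, gen tc @ gen tc,
      word_pow (gen ta @ gen tb) l,
      word_pow (gen tb @ gen tc) m,
      word_pow (gen tc @ gen ta) n,
      word_pow (gen ta @ gen tb @ gen ta @ gen tc) r}"

definition triangle_group :: "nat \<Rightarrow> nat \<Rightarrow> nat \<Rightarrow> nat \<Rightarrow> tri_gen word set monoid" where
  "triangle_group l m n r = presented_group (triangle_relators l m n r)"


section \<open>Generalities on groups and roots of unity\<close>

definition group_center :: "('a, 'b) monoid_scheme \<Rightarrow> 'a set" where
  "group_center G = {z \<in> carrier G. \<forall>g\<in>carrier G. z \<otimes>\<^bsub>G\<^esub> g = g \<otimes>\<^bsub>G\<^esub> z}"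

definition complex_units :: "complex monoid" where
  "complex_units = \<lparr>carrier = - {0}, mult = (*), one = 1\<rparr>"

definition complex_ord :: "complex \<Rightarrow> nat" where
  "complex_ord z = group.ord complex_units z"

definition primitive_root_of_unity :: "nat \<Rightarrow> complex \<Rightarrow> bool" where
  "primitive_root_of_unity n z \<longleftrightarrow>
     0 < n \<and> z ^ n = 1 \<and> (\<forall>m. 0 < m \<and> m < n \<longrightarrow> z ^ m \<noteq> 1)"


section \<open>The polynomial representation\<close>

text \<open>
  A Laurent polynomial is a finitely supported function on the integers, with the convolution
  product of \<^theory>\<open>HOL-Library.Poly_Mapping\<close>. Throughout, \<open>u\<close>, \<open>v\<close>, \<open>r\<close> stand for
  \<open>q\<^sup>1\<^sup>/\<^sup>2\<close>, \<open>t\<^sup>1\<^sup>/\<^sup>2\<close>, \<open>q\<^sup>1\<^sup>/\<^sup>4\<close>.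
\<close>

type_synonym 'a laurent = "int \<Rightarrow>\<^sub>0 'a"

definition lX :: "'a::field laurent" where "lX = Poly_Mapping.single 1 1"

definition lconst :: "'a::field \<Rightarrow> 'a laurent" where "lconst c = Poly_Mapping.single 0 c"

definition pol_s :: "'a::field laurent \<Rightarrow> 'a laurent" where
  "pol_s f = (\<Sum>n\<in>Poly_Mapping.keys f. Poly_Mapping.single (- n) (Poly_Mapping.lookup f n))"

definition pol_pi :: "'a::field \<Rightarrow> 'a laurent \<Rightarrow> 'a laurent" where
  "pol_pi u f = (\<Sum>n\<in>Poly_Mapping.keys f. Poly_Mapping.single (- n) (u powi n * Poly_Mapping.lookup f n))"

definition pol_X :: "'a::field laurent \<Rightarrow> 'a laurent" where "pol_X f = lX * f"

definition pol_T :: "'a::field \<Rightarrow> 'a laurent \<Rightarrow> 'a laurent" where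
  "pol_T v f = lconst v * pol_s f
     + lconst (v - inverse v) * (THE g. (lX ^ 2 - 1) * g = pol_s f - f)"

definition pol_Y :: "'a::field \<Rightarrow> 'a \<Rightarrow> 'a laurent \<Rightarrow> 'a laurent" where
  "pol_Y u v f = pol_pi u (pol_T v f)"


section \<open>The nonsymmetric polynomials\<close>

definition sign0 :: "int \<Rightarrow> int" where "sign0 n = (if 0 < n then 1 else - 1)"

definition is_e_polynomial :: "'a::field \<Rightarrow> 'a \<Rightarrow> int \<Rightarrow> 'a laurent \<Rightarrow> bool" where
  "is_e_polynomial u v n E \<longleftrightarrow>
     pol_Y u v E = lconst ((v * u ^ nat \<bar>n\<bar>) powi (- sign0 n)) * E
     \<and> Poly_Mapping.lookup E n = 1
     \<and> (\<forall>m. m \<noteq> n \<and> Poly_Mapping.lookup E m \<noteq> 0 \<longrightarrow> \<bar>m\<bar> < \<bar>n\<bar> \<or> (n < 0 \<and> m = - n))"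

text \<open>
  Generic \<open>q, t\<close> means that \<open>q\<^sup>1\<^sup>/\<^sup>2\<close> and \<open>t\<^sup>1\<^sup>/\<^sup>2\<close> are indeterminates: in \<^typ>\<open>complex poly poly\<close>
  the inner variable is \<open>q\<^sup>1\<^sup>/\<^sup>2\<close> and the outer one is \<open>t\<^sup>1\<^sup>/\<^sup>2\<close>. A rational function is
  regular at a point if it is a fraction whose denominator does not vanish there.
\<close>

type_synonym ratfun = "complex poly poly fract"

definition gen_q12 :: ratfun where "gen_q12 = Fraction_Field.Fract [:[:0, 1:]:] 1"
definition gen_t12 :: ratfun where "gen_t12 = Fraction_Field.Fract [:0, 1:] 1"

definition eval2 :: "complex \<Rightarrow> complex \<Rightarrow> complex poly poly \<Rightarrow> complex" where
  "eval2 u v P = poly (poly P [:v:]) u"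

definition specializes_to :: "complex \<Rightarrow> complex \<Rightarrow> ratfun \<Rightarrow> complex \<Rightarrow> bool" where
  "specializes_to u v F z \<longleftrightarrow>
     (\<exists>P Q. eval2 u v Q \<noteq> 0 \<and> F = Fraction_Field.Fract P Q \<and> z = eval2 u v P / eval2 u v Q)"

text \<open>Meaningful only when all coefficients of the generic polynomial are regular at \<open>(u, v)\<close>.\<close>

definition e_poly :: "complex \<Rightarrow> complex \<Rightarrow> int \<Rightarrow> complex laurent" where
  "e_poly u v n = (THE p. \<exists>E. is_e_polynomial gen_q12 gen_t12 n E
     \<and> (\<forall>m. specializes_to u v (Poly_Mapping.lookup E m) (Poly_Mapping.lookup p m)))"


section \<open>Quotients of the polynomial representation\<close>

definition laurent_ring :: "complex laurent ring" where
  "laurent_ring = \<lparr>carrier = UNIV, mult = (*), one = 1, zero = 0, add = (+)\<rparr>"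

definition quot :: "complex laurent \<Rightarrow> complex laurent set ring" where
  "quot p = laurent_ring Quot (PIdl\<^bsub>laurent_ring\<^esub> p)"

definition quot_class :: "complex laurent \<Rightarrow> complex laurent \<Rightarrow> complex laurent set" where
  "quot_class p f = (PIdl\<^bsub>laurent_ring\<^esub> p) +>\<^bsub>laurent_ring\<^esub> f"

text \<open>The complex scalar \<open>c\<close> acts on the quotient as multiplication by the class of \<open>c\<close>.\<close>

definition scal :: "complex laurent \<Rightarrow> complex \<Rightarrow> complex laurent set \<Rightarrow> complex laurent set" where
  "scal p c = (\<lambda>w\<in>carrier (quot p). quot_class p (lconst c) \<otimes>\<^bsub>quot p\<^esub> w)"

definition quot_dim :: "complex laurent \<Rightarrow> nat \<Rightarrow> bool" where
  "quot_dim p d \<longleftrightarrow>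
     ring.dimension (quot p) d (range (\<lambda>c. quot_class p (lconst c))) (carrier (quot p))"

type_synonym quot_map = "complex laurent set \<Rightarrow> complex laurent set"

definition GL_quot :: "complex laurent \<Rightarrow> quot_map monoid" where
  "GL_quot p = BijGroup (carrier (quot p))
     \<lparr>carrier := {g \<in> Bij (carrier (quot p)).
        (\<forall>w\<in>carrier (quot p). \<forall>w'\<in>carrier (quot p). g (w \<oplus>\<^bsub>quot p\<^esub> w') = g w \<oplus>\<^bsub>quot p\<^esub> g w')
        \<and> (\<forall>c. \<forall>w\<in>carrier (quot p). g (scal p c w) = scal p c (g w))}\<rparr>"

definition scalars :: "complex laurent \<Rightarrow> quot_map set" where
  "scalars p = {scal p c | c. c \<noteq> 0}"

definition PGL_quot :: "complex laurent \<Rightarrow> quot_map set monoid" where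
  "PGL_quot p = GL_quot p Mod scalars p"

definition ord_mod_scalars :: "complex laurent \<Rightarrow> quot_map \<Rightarrow> nat" where
  "ord_mod_scalars p g = group.ord (PGL_quot p) (scalars p #>\<^bsub>GL_quot p\<^esub> g)"

text \<open>If \<open>D\<close> does not preserve the ideal, the result is not a self-map of the quotient.\<close>

definition quot_op :: "complex laurent \<Rightarrow> (complex laurent \<Rightarrow> complex laurent) \<Rightarrow> quot_map" where
  "quot_op p D = (\<lambda>w\<in>carrier (quot p). \<Union>f\<in>w. quot_class p (D f))"


section \<open>DAHA modules\<close>

text \<open>
  A module structure on a quotient is recorded by the action of the generators \<open>X, Y, T\<close>.
  For an automorphism \<open>\<phi>\<close>, the operators of the twisted module \<open>\<phi>(V)\<close> are the images in \<open>V\<close>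
  of \<open>\<phi>(X), \<phi>(Y), \<phi>(T)\<close>.
\<close>

record daha_action =
  actX :: quot_map
  actY :: quot_map
  actT :: quot_map

definition is_daha_module :: "complex laurent \<Rightarrow> complex \<Rightarrow> complex \<Rightarrow> daha_action \<Rightarrow> bool" where
  "is_daha_module p u v M \<longleftrightarrow>
     (let G = GL_quot p; V = quot p; X = actX M; Y = actY M; T = actT M in
      X \<in> carrier G \<and> Y \<in> carrier G \<and> T \<in> carrier G
      \<and> (\<forall>w\<in>carrier V. let w' = T w \<oplus>\<^bsub>V\<^esub> scal p (inverse v) w in T w' \<ominus>\<^bsub>V\<^esub> scal p v w' = \<zero>\<^bsub>V\<^esub>)
      \<and> T \<otimes>\<^bsub>G\<^esub> X \<otimes>\<^bsub>G\<^esub> T = inv\<^bsub>G\<^esub> X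
      \<and> inv\<^bsub>G\<^esub> T \<otimes>\<^bsub>G\<^esub> Y \<otimes>\<^bsub>G\<^esub> inv\<^bsub>G\<^esub> T = inv\<^bsub>G\<^esub> Y
      \<and> inv\<^bsub>G\<^esub> Y \<otimes>\<^bsub>G\<^esub> inv\<^bsub>G\<^esub> X \<otimes>\<^bsub>G\<^esub> Y \<otimes>\<^bsub>G\<^esub> X \<otimes>\<^bsub>G\<^esub> T \<otimes>\<^bsub>G\<^esub> T \<otimes>\<^bsub>G\<^esub> scal p u = \<one>\<^bsub>G\<^esub>)"

definition quot_action :: "complex \<Rightarrow> complex \<Rightarrow> complex laurent \<Rightarrow> daha_action" where
  "quot_action u v p =
     \<lparr>actX = quot_op p pol_X, actY = quot_op p (pol_Y u v), actT = quot_op p (pol_T v)\<rparr>"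

definition tau_plus :: "complex laurent \<Rightarrow> complex \<Rightarrow> daha_action \<Rightarrow> daha_action" where
  "tau_plus p r M =
     M\<lparr>actY := scal p (inverse r) \<otimes>\<^bsub>GL_quot p\<^esub> actX M \<otimes>\<^bsub>GL_quot p\<^esub> actY M\<rparr>"

definition tau_minus :: "complex laurent \<Rightarrow> complex \<Rightarrow> daha_action \<Rightarrow> daha_action" where
  "tau_minus p r M =
     M\<lparr>actX := scal p r \<otimes>\<^bsub>GL_quot p\<^esub> actY M \<otimes>\<^bsub>GL_quot p\<^esub> actX M\<rparr>"

definition sigma_x :: "complex laurent \<Rightarrow> daha_action \<Rightarrow> daha_action" where
  "sigma_x p M = M\<lparr>actX := scal p (- 1) \<otimes>\<^bsub>GL_quot p\<^esub> actX M\<rparr>"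

definition sigma_y :: "complex laurent \<Rightarrow> daha_action \<Rightarrow> daha_action" where
  "sigma_y p M = M\<lparr>actY := scal p (- 1) \<otimes>\<^bsub>GL_quot p\<^esub> actY M\<rparr>"

text \<open>This is a module for the parameter \<open>t\<^sup>-\<^sup>1\<^sup>/\<^sup>2\<close> if \<open>M\<close> is one for \<open>t\<^sup>1\<^sup>/\<^sup>2\<close>.\<close>

definition iota :: "complex laurent \<Rightarrow> daha_action \<Rightarrow> daha_action" where
  "iota p M = M\<lparr>actT := scal p (- 1) \<otimes>\<^bsub>GL_quot p\<^esub> actT M\<rparr>"


section \<open>The parameters and the modules under consideration\<close>

text \<open>The half-integer \<open>k\<close> is represented by the integer \<open>k2 = 2k\<close>.\<close>

definition daha_parameters :: "nat \<Rightarrow> complex \<Rightarrow> complex \<Rightarrow> complex \<Rightarrow> int \<Rightarrow> bool" where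
  "daha_parameters N q14 q12 t12 k2 \<longleftrightarrow>
     primitive_root_of_unity (2 * N) q12 \<and> q14 ^ 2 = q12
     \<and> (if even k2 then t12 = q12 powi (k2 div 2) \<or> t12 = - (q12 powi (k2 div 2))
        else t12 = q14 powi k2)"

definition alpha_module ::
  "nat \<Rightarrow> complex \<Rightarrow> complex \<Rightarrow> int \<Rightarrow> complex laurent \<Rightarrow> daha_action \<Rightarrow> bool" where
  "alpha_module N u v k2 p M \<longleftrightarrow>
     0 < k2 \<and> k2 < int N
     \<and> p = e_poly u v (- (int N - k2))
     \<and> M = quot_action u v p"

text \<open>\<open>\<bar>k\<bar> < N/2\<close> is \<open>\<bar>k2\<bar> < N\<close>, and \<open>k = - 1/2 - l\<close> is \<open>k2 = - 1 - 2l\<close>.\<close>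

definition gamma_module ::
  "nat \<Rightarrow> complex \<Rightarrow> complex \<Rightarrow> int \<Rightarrow> complex laurent \<Rightarrow> daha_action \<Rightarrow> bool" where
  "gamma_module N u v k2 p M \<longleftrightarrow>
     (\<exists>l::nat. \<exists>\<epsilon>\<in>{0, 1::nat}. \<exists>\<delta>\<in>{0, 1::nat}.
        k2 = - 1 - 2 * int l \<and> \<bar>k2\<bar> < int N
        \<and> p = e_poly u v (int l + 1) - lconst (inverse v) * e_poly u v (- int l)
        \<and> M = (sigma_x p ^^ \<epsilon>) ((sigma_y p ^^ \<delta>) (quot_action u v p)))"

text \<open>
  For odd \<open>N\<close>, the types over \<open>\<H>\<close> with \<open>q\<^sup>1\<^sup>/\<^sup>2, t\<^sup>1\<^sup>/\<^sup>2\<close> replaced by \<open>q, t\<close>: the arguments \<open>u, v\<close>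
  below are still the original \<open>q\<^sup>1\<^sup>/\<^sup>2, t\<^sup>1\<^sup>/\<^sup>2\<close>.
\<close>

definition alpha_check_module ::
  "nat \<Rightarrow> complex \<Rightarrow> complex \<Rightarrow> int \<Rightarrow> complex laurent \<Rightarrow> daha_action \<Rightarrow> bool" where
  "alpha_check_module N u v k2 p M \<longleftrightarrow>
     (\<exists>n k. \<exists>\<epsilon>\<in>{0, 1::nat}. \<exists>\<delta>\<in>{0, 1::nat}.
        int N = 2 * n + 1 \<and> k2 = 2 * k \<and> 0 < k2 \<and> k2 < int N
        \<and> p = e_poly (u ^ 2) (v ^ 2) (n - k + 1)
               - lconst (inverse (v ^ 2)) * e_poly (u ^ 2) (v ^ 2) (k - n)
        \<and> M = (sigma_x p ^^ \<epsilon>) ((sigma_y p ^^ \<delta>) (quot_action (u ^ 2) (v ^ 2) p)))"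

definition gamma_check_module ::
  "nat \<Rightarrow> complex \<Rightarrow> complex \<Rightarrow> int \<Rightarrow> complex laurent \<Rightarrow> daha_action \<Rightarrow> bool" where
  "gamma_check_module N u v k2 p M \<longleftrightarrow> gamma_module N (u ^ 2) (v ^ 2) k2 p M"

text \<open>
  The excluded values are the ones for which \<open>T\<close> acts as a scalar: \<open>k = - 1/2\<close>, where
  \<open>V\<^sub>2\<^sub>|\<^sub>k\<^sub>|\<close> is one-dimensional, and \<open>2k = N - 1\<close>, where \<open>V\<^sub>2\<^sub>N\<^sub>-\<^sub>4\<^sub>k\<close> is
  two-dimensional and \<open>V\<^sub>N\<^sub>-\<^sub>2\<^sub>k\<close> is one-dimensional. There \<open>x, y, z\<close> have order 1 or 2 modulo scalars,
  so the formulas for the orders do not apply.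
\<close>

definition nondegenerate :: "nat \<Rightarrow> int \<Rightarrow> bool" where
  "nondegenerate N k2 \<longleftrightarrow> k2 \<noteq> - 1 \<and> k2 \<noteq> int N - 1"


section \<open>The action of the braid group and its image\<close>

definition is_B1_action ::
  "complex laurent \<Rightarrow> complex \<Rightarrow> daha_action \<Rightarrow> (B1_gen word set \<Rightarrow> quot_map) \<Rightarrow> bool" where
  "is_B1_action p r M \<rho> \<longleftrightarrow>
     \<rho> \<in> hom B1 (GL_quot p)
     \<and> \<rho> (pres_class B1_relators (gen bT)) = scal p r \<otimes>\<^bsub>GL_quot p\<^esub> actT M
     \<and> \<rho> (pres_class B1_relators (gen bY)) = scal p r \<otimes>\<^bsub>GL_quot p\<^esub> actY M
     \<and> \<rho> (pres_class B1_relators (gen bX)) = scal p (inverse r) \<otimes>\<^bsub>GL_quot p\<^esub> actX M"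

definition B_tilde :: "complex laurent \<Rightarrow> (B1_gen word set \<Rightarrow> quot_map) \<Rightarrow> quot_map monoid" where
  "B_tilde p \<rho> = GL_quot p \<lparr>carrier := \<rho> ` carrier B1\<rparr>"

definition B_dag :: "complex laurent \<Rightarrow> (B1_gen word set \<Rightarrow> quot_map) \<Rightarrow> quot_map set monoid" where
  "B_dag p \<rho> = B_tilde p \<rho> Mod group_center (B_tilde p \<rho>)"

definition to_B_dag ::
  "complex laurent \<Rightarrow> (B1_gen word set \<Rightarrow> quot_map) \<Rightarrow> quot_map \<Rightarrow> quot_map set" where
  "to_B_dag p \<rho> g = group_center (B_tilde p \<rho>) #>\<^bsub>B_tilde p \<rho>\<^esub> g"

definition ord_in_B_dag ::
  "complex laurent \<Rightarrow> (B1_gen word set \<Rightarrow> quot_map) \<Rightarrow> quot_map \<Rightarrow> nat" where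
  "ord_in_B_dag p \<rho> g = group.ord (B_dag p \<rho>) (to_B_dag p \<rho> g)"

definition A_img :: "complex laurent \<Rightarrow> daha_action \<Rightarrow> quot_map" where
  "A_img p M = actX M \<otimes>\<^bsub>GL_quot p\<^esub> actT M"

definition B_img :: "complex laurent \<Rightarrow> complex \<Rightarrow> daha_action \<Rightarrow> quot_map" where
  "B_img p r M = scal p r \<otimes>\<^bsub>GL_quot p\<^esub> actX M \<otimes>\<^bsub>GL_quot p\<^esub> actT M \<otimes>\<^bsub>GL_quot p\<^esub> actY M"

definition C_img :: "complex laurent \<Rightarrow> daha_action \<Rightarrow> quot_map" where
  "C_img p M = inv\<^bsub>GL_quot p\<^esub> (actT M) \<otimes>\<^bsub>GL_quot p\<^esub> actY M"

definition x_img :: "complex laurent \<Rightarrow> complex \<Rightarrow> daha_action \<Rightarrow> quot_map" where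
  "x_img p r M = scal p r \<otimes>\<^bsub>GL_quot p\<^esub> actY M"

definition y_img :: "complex laurent \<Rightarrow> complex \<Rightarrow> daha_action \<Rightarrow> quot_map" where
  "y_img p r M =
     scal p r \<otimes>\<^bsub>GL_quot p\<^esub> inv\<^bsub>GL_quot p\<^esub> (actT M) \<otimes>\<^bsub>GL_quot p\<^esub> inv\<^bsub>GL_quot p\<^esub> (actX M)
       \<otimes>\<^bsub>GL_quot p\<^esub> actT M"

definition z_img :: "complex laurent \<Rightarrow> daha_action \<Rightarrow> quot_map" where
  "z_img p M = inv\<^bsub>GL_quot p\<^esub> (actY M) \<otimes>\<^bsub>GL_quot p\<^esub> inv\<^bsub>GL_quot p\<^esub> (actX M)"

text \<open>
  Via \<open>a \<mapsto> A\<close>, \<open>b \<mapsto> B\<close>, \<open>c \<mapsto> C\<close> the group modulo its center is a quotient of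
  \<open>\<Delta>(m, m, m; m)\<close>; the elements \<open>x, y, z\<close> are the words \<open>ab, bc, ca\<close>.
\<close>

definition natural_triangle_quotient ::
  "nat \<Rightarrow> complex laurent \<Rightarrow> complex \<Rightarrow> daha_action \<Rightarrow> (B1_gen word set \<Rightarrow> quot_map) \<Rightarrow> bool" where
  "natural_triangle_quotient m p r M \<rho> \<longleftrightarrow>
     {A_img p M, B_img p r M, C_img p M} \<subseteq> carrier (B_tilde p \<rho>)
     \<and> (\<exists>\<phi>\<in>hom (triangle_group m m m m) (B_dag p \<rho>).
          \<phi> ` carrier (triangle_group m m m m) = carrier (B_dag p \<rho>)
          \<and> (let cl = pres_class (triangle_relators m m m m) in
             \<phi> (cl (gen ta)) = to_B_dag p \<rho> (A_img p M)
             \<and> \<phi> (cl (gen tb)) = to_B_dag p \<rho> (B_img p r M)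
             \<and> \<phi> (cl (gen tc)) = to_B_dag p \<rho> (C_img p M)
             \<and> \<phi> (cl (gen ta @ gen tb)) = to_B_dag p \<rho> (x_img p r M)
             \<and> \<phi> (cl (gen tb @ gen tc)) = to_B_dag p \<rho> (y_img p r M)
             \<and> \<phi> (cl (gen tc @ gen ta)) = to_B_dag p \<rho> (z_img p M)))"


section \<open>Integral structure\<close>

text \<open>The ring \<open>\<int>[d, d\<inverse>]\<close>.\<close>

definition int_laurent_ring :: "complex \<Rightarrow> complex set" where
  "int_laurent_ring d = {(\<Sum>i\<in>A. of_int (c i) * d powi i) | (A :: int set) (c :: int \<Rightarrow> int). finite A}"

definition ddot_q :: "complex \<Rightarrow> complex \<Rightarrow> int \<Rightarrow> complex" where
  "ddot_q q14 q12 k2 = (if even k2 then q14 else q12)"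

text \<open>
  The span over \<open>\<int>[d, d\<inverse>]\<close> of the classes of \<open>(r\<inverse> X)\<^sup>n\<close>, \<open>n \<in> \<int>\<close>, i.e. of the powers of the
  braid group generator normalized as \<open>q\<^sup>-\<^sup>1\<^sup>/\<^sup>4 X\<close>; if \<open>r\<close> is a unit of the ring, this is
  the image of the Laurent polynomials with coefficients in the ring.
\<close>

definition quot_lattice :: "complex laurent \<Rightarrow> complex \<Rightarrow> complex \<Rightarrow> complex laurent set set" where
  "quot_lattice p r d =
     {quot_class p f | f. \<forall>n. r powi n * Poly_Mapping.lookup f n \<in> int_laurent_ring d}"

end

theory Submission
  imports Defs
begin

text \<open>
  All the modules are quotients of the Laurent polynomials by a principal ideal \<open>(p)\<close> stable under
  \<open>T\<close> and \<open>\<pi>\<close>, with \<open>p\<close> an explicit product: of the \<open>X\<^sup>2 - t q\<^sup>i\<close> in type \<open>\<alpha>\<close>, and of the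
  \<open>X - r q\<^sup>j\<^sup>/\<^sup>2\<close> with \<open>-l \<le> j \<le> l\<close> and \<open>r\<^sup>2 = q\<^sup>1\<^sup>/\<^sup>2\<close> in the other types. The monomials in an
  interval of exponents represent the quotient. In the order \<open>0, 1, - 1, 2, - 2, \<dots>\<close> of exponents
  \<open>Y\<close> is triangular, and on this window its eigenvalues are distinct. Hence operators
  commuting with \<open>X\<close> and \<open>Y\<close> are determined by a \<open>Y\<close>-eigenvector, the image of \<open>1\<close>, and are
  scalar; so the center consists of the scalars, and the order of \<open>Y\<close> modulo scalars is read off the
  eigenvalues. The order of \<open>X\<close> is read off the roots of \<open>p\<close>.

  For the orders of the images of \<open>y\<close>, \<open>z\<close> and \<open>abac\<close> one needs that \<open>\<tau>\<^sub>-\<close> is inner: the map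
  \<open>f(X) \<mapsto> f(q\<^sup>1\<^sup>/\<^sup>4 Y X)(1)\<close> preserves \<open>(p)\<close>, because it would otherwise send \<open>p\<close> to a nonzero vector
  of the quotient whose \<open>Y\<close>- and \<open>X\<pi>\<close>-eigenvalues do not occur there together. It
  commutes with \<open>Y\<close> and conjugates \<open>X\<close> to \<open>Y X\<close> up to a scalar, so \<open>Y X\<close>, and
  with it \<open>Y\<^sup>2 X\<close>, which is conjugate to \<open>Y X Y\<close>, has the order of \<open>X\<close>. The other relations
  follow formally from those of the double affine Hecke algebra.
\<close>

section \<open>Presented groups and the braid relations\<close>

text \<open>In every module t^(-1) is an integral power of q^(1/2), so all Y-eigenvalues are t^(1/2)
  times powers of q^(1/2), and their distinctness is a question about integers modulo the order of
  q^(1/2). The obstacle is a coincidence outside type \<alpha>: the eigenvalues at l+1 and at -l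
  agree. Hence the product formula for the generic e_{l+1} cannot be specialized; e_{l+1} is reached
  from e_{-l} through the intertwiner X \<pi>. For the same reason Y alone does not show that the
  twist tau_- preserves the ideal, and the sign of X \<pi> has to decide. In type \<alpha> the
  eigenvalue of p is absent from the window, so Y suffices there. The checked type \<alpha> is no
  separate computation: since (q^(1/2))^N = -1, it is the \<gamma> computation with q in place of
  q^(1/2) and r = - q^(1/2). The twists by signs and by \<iota> only multiply generators by -1,
  which disappears modulo scalars, so signs are carried along as arguments of the operators.\<close>

lemma pres_eq_context: "pres_eq R v w \<Longrightarrow> pres_eq R (a @ v @ b) (a @ w @ b)"
proof (induction rule: pres_eq.induct)
  case (pres_cancel u g c w)
  then show ?case
    using pres_eq.pres_cancel[of R "a @ u" g c "w @ b"] by simp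
next
  case (pres_relator r u w)
  then show ?case
    using pres_eq.pres_relator[of r R "a @ u" "w @ b"] by simp
qed (blast intro: pres_eq.intros)+

lemma pres_eq_append: "pres_eq R u u' \<Longrightarrow> pres_eq R v v' \<Longrightarrow> pres_eq R (u @ v) (u' @ v')"
  using pres_eq_context[of R u u' "[]" v] pres_eq_context[of R v v' u' "[]"]
  by (auto intro: pres_eq.pres_trans)

lemma mem_pres_class: "w \<in> pres_class R w"
  by (simp add: pres_class_def pres_refl)

lemma pres_class_eq: "pres_eq R v w \<Longrightarrow> pres_class R v = pres_class R w"
  unfolding pres_class_def by (blast intro: pres_eq.intros)

lemma carrier_presented_group: "carrier (presented_group R) = range (pres_class R)"
  by (simp add: presented_group_def)

lemma presented_group_mult:
  "pres_class R v \<otimes>\<^bsub>presented_group R\<^esub> pres_class R w = pres_class R (v @ w)"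
proof -
  have "pres_class R (x @ y) = pres_class R (v @ w)"
    if "x \<in> pres_class R v" "y \<in> pres_class R w" for x y
    using that by (intro pres_class_eq pres_eq_append pres_sym[of R v x] pres_sym[of R w y])
      (simp_all add: pres_class_def)
  then have "(\<Union>x\<in>pres_class R v. \<Union>y\<in>pres_class R w. pres_class R (x @ y)) =
      (\<Union>x\<in>pres_class R v. \<Union>y\<in>pres_class R w. pres_class R (v @ w))"
    by (intro SUP_cong refl) blast
  also have "\<dots> = pres_class R (v @ w)"
    using mem_pres_class[of v R] mem_pres_class[of w R] by (simp only: UN_constant) auto
  finally show ?thesis
    by (simp add: presented_group_def)
qed

definition word_val :: "('a, 'b) monoid_scheme \<Rightarrow> ('g \<Rightarrow> 'a) \<Rightarrow> 'g word \<Rightarrow> 'a" where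
  "word_val G f w =
     foldr (\<lambda>(g, b) a. (if b then f g else inv\<^bsub>G\<^esub> (f g)) \<otimes>\<^bsub>G\<^esub> a) w \<one>\<^bsub>G\<^esub>"

lemma word_val_Nil [simp]: "word_val G f [] = \<one>\<^bsub>G\<^esub>"
  and word_val_Cons [simp]: "word_val G f ((g, b) # w) =
     (if b then f g else inv\<^bsub>G\<^esub> (f g)) \<otimes>\<^bsub>G\<^esub> word_val G f w"
  by (simp_all add: word_val_def)

definition pres_lift :: "('a, 'b) monoid_scheme \<Rightarrow> ('g \<Rightarrow> 'a) \<Rightarrow> 'g word set \<Rightarrow> 'a" where
  "pres_lift G f C = word_val G f (SOME w. w \<in> C)"

context group
begin

lemma word_val_closed [simp]: "range f \<subseteq> carrier G \<Longrightarrow> word_val G f w \<in> carrier G"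
  by (induction w) (auto simp: range_subsetD)

lemma word_val_append:
  "range f \<subseteq> carrier G \<Longrightarrow> word_val G f (v @ w) = word_val G f v \<otimes> word_val G f w"
  by (induction v) (auto simp: range_subsetD m_assoc)

lemma word_val_word_pow:
  "range f \<subseteq> carrier G \<Longrightarrow> word_val G f (word_pow w n) = word_val G f w [^] n"
proof (induction n)
  case (Suc n)
  then have "word_val G f (word_pow w (Suc n)) = word_val G f w \<otimes> word_val G f w [^] n"
    by (simp add: word_pow_def word_val_append)
  also have "\<dots> = word_val G f w [^] Suc n"
    using Suc.prems by (subst nat_pow_Suc2) simp_all
  finally show ?case .
qed (simp add: word_pow_def)

lemma word_val_pres_eq:
  assumes "range f \<subseteq> carrier G" and "\<And>r. r \<in> R \<Longrightarrow> word_val G f r = \<one>" and "pres_eq R v w"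
  shows "word_val G f v = word_val G f w"
  using assms(3)
proof (induction rule: pres_eq.induct)
  case (pres_cancel u g b w)
  have "f g \<in> carrier G"
    using assms(1) by auto
  then show ?case
    using assms(1) by (cases b) (simp_all add: word_val_append flip: m_assoc)
qed (use assms in \<open>simp_all add: word_val_append\<close>)

text \<open>The representative picked by \<open>SOME\<close> does not matter: by
  \<open>word_val_pres_eq\<close> the value is constant on a class.\<close>

lemma pres_lift_class:
  assumes "range f \<subseteq> carrier G" and "\<And>r. r \<in> R \<Longrightarrow> word_val G f r = \<one>"
  shows "pres_lift G f (pres_class R w) = word_val G f w"
proof -
  have "(SOME w'. w' \<in> pres_class R w) \<in> pres_class R w"
    using mem_pres_class by (rule someI)
  then show ?thesis
    unfolding pres_lift_def using word_val_pres_eq[OF assms] by (auto simp: pres_class_def)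
qed

lemma pres_lift_hom:
  assumes "range f \<subseteq> carrier G" and "\<And>r. r \<in> R \<Longrightarrow> word_val G f r = \<one>"
  shows "pres_lift G f \<in> hom (presented_group R) G"
proof (rule homI)
  fix x y
  assume "x \<in> carrier (presented_group R)" "y \<in> carrier (presented_group R)"
  then obtain v w where "x = pres_class R v" "y = pres_class R w"
    unfolding carrier_presented_group by blast
  then show "pres_lift G f x \<in> carrier G"
    and "pres_lift G f (x \<otimes>\<^bsub>presented_group R\<^esub> y) = pres_lift G f x \<otimes> pres_lift G f y"
    by (simp_all only: presented_group_mult pres_lift_class[OF assms]
        word_val_append[OF assms(1)] word_val_closed[OF assms(1)])
qed

lemma pres_lift_image:
  assumes "range f \<subseteq> carrier G" and "\<And>r. r \<in> R \<Longrightarrow> word_val G f r = \<one>"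
  shows "pres_lift G f ` carrier (presented_group R) = range (word_val G f)"
  by (simp only: carrier_presented_group image_image pres_lift_class[OF assms])

lemma inv_word_val:
  "range f \<subseteq> carrier G \<Longrightarrow> inv (word_val G f w) = word_val G f (rev (map (apsnd Not) w))"
proof (induction w)
  case (Cons x w)
  then have "f g \<in> carrier G" for g by auto
  with Cons show ?case
    by (cases x) (simp add: word_val_append inv_mult_group)
qed simp

lemma subgroup_range_word_val:
  assumes f: "range f \<subseteq> carrier G"
  shows "subgroup (range (word_val G f)) G"
proof (rule subgroupI)
  fix a b assume "a \<in> range (word_val G f)" "b \<in> range (word_val G f)"
  then obtain v w where "a = word_val G f v" "b = word_val G f w" by blast
  then show "inv a \<in> range (word_val G f)" "a \<otimes> b \<in> range (word_val G f)"
    using f by (auto simp: inv_word_val simp flip: word_val_append)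
qed (use f in auto)

lemma word_val_in_subgroup:
  assumes "subgroup H G" and "range f \<subseteq> H"
  shows "word_val G f w \<in> H"
proof (induction w)
  case (Cons x w)
  then show ?case
    using assms by (cases x) (auto simp: subgroup.m_closed subgroup.m_inv_closed range_subsetD)
qed (simp add: assms subgroup.one_closed)

end

lemma hom_word_val:
  assumes "group_hom G H h" and "range f \<subseteq> carrier G"
  shows "h (word_val G f w) = word_val H (h \<circ> f) w"
proof (induction w)
  case (Cons x w)
  interpret group_hom G H h by fact
  have "f g \<in> carrier G" for g
    using assms by auto
  then show ?case
    using Cons assms by (cases x) auto
qed (use assms group_hom.hom_one in fastforce)

section \<open>Centers, and orders in factor groups\<close>

lemma (in group) subgroup_group_center: "subgroup (group_center G) G"
proof (rule subgroupI)
  fix a b assume ab: "a \<in> group_center G" "b \<in> group_center G"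
  then have a: "a \<in> carrier G" and b: "b \<in> carrier G"
    and ac: "\<And>g. g \<in> carrier G \<Longrightarrow> a \<otimes> g = g \<otimes> a"
    and bc: "\<And>g. g \<in> carrier G \<Longrightarrow> b \<otimes> g = g \<otimes> b"
    by (simp_all add: group_center_def)
  have "inv a \<otimes> g = g \<otimes> inv a" if "g \<in> carrier G" for g
  proof -
    have "inv a \<otimes> g = inv a \<otimes> (g \<otimes> a) \<otimes> inv a"
      using a that by (simp add: m_assoc)
    also have "\<dots> = g \<otimes> inv a"
      using a that by (simp flip: ac m_assoc)
    finally show ?thesis .
  qed
  then show "inv a \<in> group_center G"
    using a by (simp add: group_center_def)
  have "a \<otimes> b \<otimes> g = g \<otimes> (a \<otimes> b)" if "g \<in> carrier G" for g
  proof -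
    have "a \<otimes> b \<otimes> g = a \<otimes> g \<otimes> b"
      using a b that bc[OF that] by (simp add: m_assoc)
    also have "\<dots> = g \<otimes> (a \<otimes> b)"
      using a b that ac[OF that] by (simp add: m_assoc)
    finally show ?thesis .
  qed
  then show "a \<otimes> b \<in> group_center G"
    using a b by (simp add: group_center_def)
qed (auto simp: group_center_def)

lemma (in group) normal_group_center: "group_center G \<lhd> G"
  by (rule normalI[OF subgroup_group_center]) (auto simp: r_coset_def l_coset_def group_center_def)

text \<open>Orders modulo the center and modulo scalars are both orders in a factor group; this
  turns them into the question which powers lie in the normal subgroup.\<close>

lemma (in normal) ord_FactGroup_eq:
  assumes "g \<in> carrier G" and "\<And>m::nat. g [^] m \<in> H \<longleftrightarrow> d dvd m"
  shows "group.ord (G Mod H) (H #> g) = d"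
proof -
  interpret F: group "G Mod H" by (rule factorgroup_is_group)
  interpret h: group_hom G "G Mod H" "\<lambda>a. H #> a"
    by unfold_locales (rule r_coset_hom_Mod)
  have "(H #> g) [^]\<^bsub>G Mod H\<^esub> m = \<one>\<^bsub>G Mod H\<^esub> \<longleftrightarrow> d dvd m" for m :: nat
  proof -
    have "(H #> g) [^]\<^bsub>G Mod H\<^esub> m = H #> (g [^] m)"
      using assms(1) by (simp add: h.hom_nat_pow)
    also have "\<dots> = \<one>\<^bsub>G Mod H\<^esub> \<longleftrightarrow> g [^] m \<in> H"
      using assms(1) by (metis nat_pow_closed one_FactGroup rcos_self coset_join2 is_subgroup)
    finally show ?thesis using assms(2) by simp
  qed
  then show ?thesis
    using assms(1) by (subst F.ord_unique) auto
qed

text \<open>The relations of the double affine Hecke algebra that make sense in a group. Here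
  \<open>s c\<close> is the scalar c and \<open>r\<close> is q^(1/4). The assumption
  \<open>commutant\<close> is Schur's lemma for the module; \<open>GL_commutant\<close> supplies
  it.\<close>

locale braid_triple = group G for G (structure) +
  fixes s :: "complex \<Rightarrow> 'a" and r :: complex and X Y T :: 'a
  assumes r_nonzero: "r \<noteq> 0"
    and s_closed: "c \<noteq> 0 \<Longrightarrow> s c \<in> carrier G"
    and s_mult: "c \<noteq> 0 \<Longrightarrow> d \<noteq> 0 \<Longrightarrow> s c \<otimes> s d = s (c * d)"
    and s_one: "s 1 = \<one>"
    and s_central: "c \<noteq> 0 \<Longrightarrow> g \<in> carrier G \<Longrightarrow> g \<otimes> s c = s c \<otimes> g"
    and X_closed [simp]: "X \<in> carrier G"
    and Y_closed [simp]: "Y \<in> carrier G"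
    and T_closed [simp]: "T \<in> carrier G"
    and TXT: "T \<otimes> X \<otimes> T = inv X"
    and TYT: "inv T \<otimes> Y \<otimes> inv T = inv Y"
    and XY_comm: "inv Y \<otimes> inv X \<otimes> Y \<otimes> X \<otimes> T \<otimes> T \<otimes> s (r ^ 2) = \<one>"
    and commutant: "g \<in> carrier G \<Longrightarrow> g \<otimes> X = X \<otimes> g \<Longrightarrow> g \<otimes> Y = Y \<otimes> g \<Longrightarrow> g \<in> s ` (- {0})"
begin

definition "Z = s ` (- {0})"

lemma s_in_Z [simp]: "c \<noteq> 0 \<Longrightarrow> s c \<in> Z"
  by (auto simp: Z_def)

lemma s_inv: "c \<noteq> 0 \<Longrightarrow> inv (s c) = s (inverse c)"
  by (rule inv_equality) (simp_all add: s_closed s_mult s_one)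

lemma subgroup_Z: "subgroup Z G"
proof (rule subgroupI)
  show "a \<otimes> b \<in> Z" if "a \<in> Z" "b \<in> Z" for a b
    using that by (auto simp: Z_def s_mult)
  show "inv a \<in> Z" if "a \<in> Z" for a
    using that by (auto simp: Z_def s_inv)
  have "s 1 \<in> Z" by simp
  then show "Z \<noteq> {}" by blast
  show "Z \<subseteq> carrier G"
    using s_closed by (force simp: Z_def)
qed

lemma Z_central: "z \<in> Z \<Longrightarrow> g \<in> carrier G \<Longrightarrow> g \<otimes> z = z \<otimes> g"
  unfolding Z_def using s_central by blast

lemma normal_Z: "Z \<lhd> G"
proof (rule normalI[OF subgroup_Z], rule ballI)
  fix x assume x: "x \<in> carrier G"
  show "Z #> x = x <# Z"
    unfolding r_coset_def l_coset_def using Z_central x by (intro SUP_cong refl) simp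
qed

lemma r_simps [simp]: "s r \<in> carrier G" "s (inverse r) \<in> carrier G" "s (r ^ 2) \<in> carrier G"
  using r_nonzero by (simp_all add: s_closed)

lemma r_inv: "inv (s r) = s (inverse r)" "inv (s (inverse r)) = s r"
  using r_nonzero by (simp_all add: s_inv)

lemma r_mult: "s r \<otimes> s r = s (r ^ 2)" "s r \<otimes> s (inverse r) = \<one>" "s (inverse r) \<otimes> s r = \<one>"
  using r_nonzero by (simp_all add: s_mult s_one power2_eq_square)

lemma scal_left:
  assumes "c \<noteq> 0" "g \<in> carrier G" "h \<in> carrier G"
  shows "g \<otimes> (s c \<otimes> h) = s c \<otimes> (g \<otimes> h)"
  using assms by (metis m_assoc s_central s_closed)

text \<open>Instances for the generators and their inverses only: with an arbitrary left factor the
  rule would also exchange two scalars, and rewriting would not terminate.\<close>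

lemmas scal_simps =
  scal_left[OF _ X_closed] scal_left[OF _ Y_closed] scal_left[OF _ T_closed]
  scal_left[OF _ inv_closed[OF X_closed]] scal_left[OF _ inv_closed[OF Y_closed]]
  scal_left[OF _ inv_closed[OF T_closed]]

lemma cancel_left: "a \<in> carrier G \<Longrightarrow> b \<in> carrier G \<Longrightarrow> inv a \<otimes> (a \<otimes> b) = b"
    "a \<in> carrier G \<Longrightarrow> b \<in> carrier G \<Longrightarrow> a \<otimes> (inv a \<otimes> b) = b"
  by (simp_all flip: m_assoc)

lemma TXTX: "T \<otimes> (X \<otimes> (T \<otimes> X)) = \<one>"
proof -
  have "T \<otimes> X \<otimes> T \<otimes> X = \<one>"
    by (simp only: TXT) simp
  then show ?thesis by (simp add: m_assoc)
qed

lemma XTXT: "X \<otimes> (T \<otimes> (X \<otimes> T)) = \<one>"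
proof -
  have "X \<otimes> (T \<otimes> X \<otimes> T) = \<one>"
    by (simp only: TXT) simp
  then show ?thesis by (simp add: m_assoc)
qed

lemma XTXT': "g \<in> carrier G \<Longrightarrow> X \<otimes> (T \<otimes> (X \<otimes> (T \<otimes> g))) = g"
  using arg_cong[OF XTXT, of "\<lambda>a. a \<otimes> g"] by (simp add: m_assoc)

lemma TYTY: "inv T \<otimes> (Y \<otimes> (inv T \<otimes> Y)) = \<one>"
proof -
  have "inv T \<otimes> Y \<otimes> inv T \<otimes> Y = \<one>"
    by (simp only: TYT) simp
  then show ?thesis by (simp add: m_assoc)
qed

lemma YTY: "Y \<otimes> (inv T \<otimes> Y) = T"
  using arg_cong[OF TYTY, of "\<lambda>a. T \<otimes> a"] by (simp add: cancel_left)

lemma r2_closed: "s (inverse (r ^ 2)) \<in> carrier G"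
  using r_nonzero by (simp add: s_closed)

lemma YX_conj: "X \<otimes> Y = Y \<otimes> X \<otimes> T \<otimes> T \<otimes> s (r ^ 2)"
proof -
  have "(X \<otimes> Y) \<otimes> (inv Y \<otimes> inv X \<otimes> Y \<otimes> X \<otimes> T \<otimes> T \<otimes> s (r ^ 2)) = X \<otimes> Y"
    unfolding XY_comm by simp
  then show ?thesis by (simp add: m_assoc cancel_left)
qed

text \<open>The commutation relation gives Y X T = q^(-1/2) X Y T^-1; then Y T^-1 Y = T collapses
  the word to T X T X = 1. Hence q^(1/4) T Y X is an involution, and B is its conjugate by
  X.\<close>

lemma TYX_square: "T \<otimes> (Y \<otimes> (X \<otimes> (T \<otimes> (Y \<otimes> X)))) = s (inverse (r ^ 2))"
proof -
  have "X \<otimes> Y \<otimes> s (inverse (r ^ 2)) = Y \<otimes> X \<otimes> T \<otimes> T"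
    using r_nonzero by (subst YX_conj) (simp add: m_assoc s_closed s_mult s_one)
  then have "s (inverse (r ^ 2)) \<otimes> (X \<otimes> Y) = Y \<otimes> X \<otimes> T \<otimes> T"
    using r_nonzero by (simp add: s_central)
  from arg_cong[OF this, of "\<lambda>a. a \<otimes> inv T"]
  have c: "Y \<otimes> (X \<otimes> T) = s (inverse (r ^ 2)) \<otimes> (X \<otimes> (Y \<otimes> inv T))"
    using r2_closed by (simp add: m_assoc)
  have "T \<otimes> (Y \<otimes> (X \<otimes> (T \<otimes> (Y \<otimes> X)))) = T \<otimes> ((Y \<otimes> (X \<otimes> T)) \<otimes> (Y \<otimes> X))"
    by (simp add: m_assoc)
  also have "\<dots> = s (inverse (r ^ 2)) \<otimes> (T \<otimes> (X \<otimes> ((Y \<otimes> (inv T \<otimes> Y)) \<otimes> X)))"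
    using r_nonzero unfolding c by (simp add: m_assoc s_closed scal_simps)
  also have "\<dots> = s (inverse (r ^ 2))"
    using r_nonzero by (simp add: YTY TXTX s_closed)
  finally show ?thesis .
qed

abbreviation "Xt \<equiv> s (inverse r) \<otimes> X"
abbreviation "Yt \<equiv> s r \<otimes> Y"
abbreviation "Tt \<equiv> s r \<otimes> T"
abbreviation "A \<equiv> X \<otimes> T"
abbreviation "B \<equiv> s r \<otimes> X \<otimes> T \<otimes> Y"
abbreviation "C \<equiv> inv T \<otimes> Y"

lemma AA: "A \<otimes> A = \<one>"
  by (simp add: m_assoc XTXT)

lemma BB: "B \<otimes> B = \<one>"
proof -
  have r2: "r ^ 2 \<noteq> 0" using r_nonzero by simp
  have "B \<otimes> B = s (r ^ 2) \<otimes> (X \<otimes> (T \<otimes> (Y \<otimes> (X \<otimes> (T \<otimes> Y)))))"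
    using r_nonzero by (simp add: m_assoc scal_simps flip: r_mult(1))
  also have "\<dots> = s (r ^ 2) \<otimes> (X \<otimes> ((T \<otimes> (Y \<otimes> (X \<otimes> (T \<otimes> (Y \<otimes> X))))) \<otimes> inv X))"
    by (simp add: m_assoc)
  also have "\<dots> = s (r ^ 2) \<otimes> s (inverse (r ^ 2))"
    using r2 by (simp add: TYX_square scal_simps s_closed)
  also have "\<dots> = \<one>"
    using r2 by (simp add: s_mult s_one)
  finally show ?thesis .
qed

lemma CC: "C \<otimes> C = \<one>"
  by (simp add: m_assoc TYTY)

lemma AB: "A \<otimes> B = s r \<otimes> Y"
  using r_nonzero by (simp add: m_assoc scal_simps XTXT' cancel_left)

text \<open>A and C are involutions, so C A is the inverse of A C, in which T cancels.\<close>

lemma CA: "C \<otimes> A = inv Y \<otimes> inv X"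
proof -
  have "A = inv A" "C = inv C"
    using AA CC by (simp_all add: inv_equality)
  then have "C \<otimes> A = inv C \<otimes> inv A" by simp
  also have "\<dots> = inv (A \<otimes> C)" by (simp add: inv_mult_group)
  also have "A \<otimes> C = X \<otimes> Y" by (simp add: m_assoc cancel_left)
  finally show ?thesis by (simp add: inv_mult_group)
qed

lemma inv_T_X: "inv T \<otimes> inv X = X \<otimes> T"
  using TXT by (metis T_closed X_closed cancel_left(1) m_assoc m_closed inv_closed)

lemma BC: "B \<otimes> C = s r \<otimes> inv T \<otimes> inv X \<otimes> T"
  using r_nonzero by (simp add: m_assoc YTY flip: inv_T_X)

text \<open>The two expressions for the image of y agree because T X T = X^-1 gives T^-1 X^-1 = X
  T.\<close>

lemma y_eq: "s r \<otimes> inv T \<otimes> inv X \<otimes> T = s r \<otimes> X \<otimes> T \<otimes> T"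
proof -
  have "inv T \<otimes> (inv X \<otimes> T) = X \<otimes> (T \<otimes> T)"
    by (metis T_closed X_closed inv_T_X inv_closed m_assoc)
  then show ?thesis by (simp add: m_assoc)
qed

text \<open>A B is q^(1/4) Y and A C is X Y.\<close>

lemma ABAC: "A \<otimes> B \<otimes> A \<otimes> C = s r \<otimes> (Y \<otimes> X \<otimes> Y)"
  using r_nonzero by (simp add: m_assoc scal_simps XTXT' cancel_left)

lemma ABC: "A \<otimes> B \<otimes> C = Tt"
  using r_nonzero by (simp add: m_assoc scal_simps XTXT' YTY)

text \<open>This is x z y = (ab)(ca)(bc) = (abc)(abc) written out in the generators.\<close>

lemma Tt_square: "Tt \<otimes> Tt = (s r \<otimes> Y) \<otimes> (inv Y \<otimes> inv X) \<otimes> (s r \<otimes> inv T \<otimes> inv X \<otimes> T)"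
  unfolding y_eq using r_nonzero by (simp add: m_assoc cancel_left scal_simps)

text \<open>The factor q^(1/4) Y X is tau_-(X), so up to a scalar z is conjugate to the inverse of
  tau_-(X).\<close>

lemma z_eq: "inv Y \<otimes> inv X = s r \<otimes> inv Y \<otimes> inv (s r \<otimes> Y \<otimes> X) \<otimes> Y"
proof -
  have "inv (s r \<otimes> Y \<otimes> X) = inv X \<otimes> inv Y \<otimes> inv (s r)"
    by (simp add: inv_mult_group m_assoc)
  also have "\<dots> = inv (s r) \<otimes> (inv X \<otimes> inv Y)"
    using r_nonzero by (simp add: r_inv s_central)
  finally have "inv (s r \<otimes> Y \<otimes> X) = inv (s r) \<otimes> (inv X \<otimes> inv Y)" .
  moreover have "s r \<otimes> (inv Y \<otimes> (inv (s r) \<otimes> g)) = inv Y \<otimes> g" if "g \<in> carrier G" for g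
    using that r_nonzero by (metis Y_closed cancel_left(2) inv_closed m_closed r_simps(1) scal_left)
  ultimately show ?thesis
    by (simp add: m_assoc)
qed

lemma tau_eq: "Y \<otimes> X \<otimes> Y = s (inverse r) \<otimes> (s r \<otimes> Y \<otimes> X) \<otimes> Y"
  unfolding r_inv(1)[symmetric] by (simp add: m_assoc cancel_left)

definition "braid_gens = case_B1_gen Xt Yt Tt"

lemma braid_gens_simps [simp]:
  "braid_gens bX = Xt" "braid_gens bY = Yt" "braid_gens bT = Tt"
  by (simp_all add: braid_gens_def)

lemma braid_gens_closed: "range braid_gens \<subseteq> carrier G"
proof
  fix x assume "x \<in> range braid_gens"
  then obtain g where "x = braid_gens g" by blast
  then show "x \<in> carrier G" by (cases g) simp_all
qed

text \<open>The normalization by q^(1/4) and q^(-1/4) contributes nothing to the first two relators.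
  In the third one X and Y occur with their inverses, and the two copies of T contribute exactly the
  q^(1/2) of the Hecke relation.\<close>

lemma braid_relators:
  assumes "w \<in> B1_relators"
  shows "word_val G braid_gens w = \<one>"
proof -
  have r0: "inverse r \<noteq> 0" using r_nonzero by simp
  have inv_Tt: "inv Tt = s (inverse r) \<otimes> inv T" and inv_Yt: "inv Yt = s (inverse r) \<otimes> inv Y"
    and inv_Xt: "inv Xt = s r \<otimes> inv X"
    using r_nonzero by (simp_all add: inv_mult_group r_inv s_central)
  have ss: "s r \<otimes> (s (inverse r) \<otimes> g) = g" "s (inverse r) \<otimes> (s r \<otimes> g) = g" if "g \<in> carrier G" for g
    using that by (simp_all add: r_mult flip: m_assoc)
  have tt: "s r \<otimes> (s r \<otimes> g) = s (r ^ 2) \<otimes> g" if "g \<in> carrier G" for g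
    using that by (simp add: r_mult flip: m_assoc)
  have r1: "Tt \<otimes> (Xt \<otimes> (Tt \<otimes> Xt)) = \<one>"
    using r_nonzero r0 by (simp add: m_assoc scal_simps ss TXTX r_mult)
  have r2: "inv Tt \<otimes> (Yt \<otimes> (inv Tt \<otimes> Yt)) = \<one>"
    unfolding inv_Tt using r_nonzero r0 by (simp add: m_assoc scal_simps ss TYTY r_mult)
  have "s (r ^ 2) \<otimes> (inv Y \<otimes> (inv X \<otimes> (Y \<otimes> (X \<otimes> (T \<otimes> T))))) =
      inv Y \<otimes> inv X \<otimes> Y \<otimes> X \<otimes> T \<otimes> T \<otimes> s (r ^ 2)"
    using r_nonzero by (simp add: s_central m_assoc)
  also have "\<dots> = \<one>"
    by (rule XY_comm)
  finally have "s (r ^ 2) \<otimes> (inv Y \<otimes> (inv X \<otimes> (Y \<otimes> (X \<otimes> (T \<otimes> T))))) = \<one>" .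
  then have r3: "inv Yt \<otimes> (inv Xt \<otimes> (Yt \<otimes> (Xt \<otimes> (Tt \<otimes> Tt)))) = \<one>"
    unfolding inv_Yt inv_Xt using r_nonzero r0 by (simp add: m_assoc scal_simps ss tt r_mult)
  show ?thesis
    using assms r1 r2 r3 by (auto simp: B1_relators_def gen_def gen_inv_def)
qed

definition "braid_rep = pres_lift G braid_gens"

lemma braid_rep_hom: "braid_rep \<in> hom B1 G"
  unfolding braid_rep_def B1_def by (rule pres_lift_hom[OF braid_gens_closed braid_relators])

lemma braid_rep_gen: "braid_rep (pres_class B1_relators (gen g)) = braid_gens g"
  using braid_gens_closed
  by (simp add: braid_rep_def pres_lift_class[OF braid_gens_closed braid_relators] gen_def range_subsetD)

definition "H = range (word_val G braid_gens)"

lemma braid_rep_image: "braid_rep ` carrier B1 = H"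
  unfolding braid_rep_def B1_def H_def by (rule pres_lift_image[OF braid_gens_closed braid_relators])

lemma subgroup_H: "subgroup H G"
  unfolding H_def by (rule subgroup_range_word_val[OF braid_gens_closed])

abbreviation "GH \<equiv> G\<lparr>carrier := H\<rparr>"

lemma group_GH: "Group.group GH"
  by (rule subgroup_imp_group[OF subgroup_H])

lemma gens_in_H: "braid_gens g \<in> H"
proof -
  have "braid_gens g = word_val G braid_gens [(g, True)]"
    using braid_gens_closed by (simp add: range_subsetD)
  then show ?thesis
    unfolding H_def by (metis rangeI)
qed

lemma Tt_in_H: "Tt \<in> H" and Xt_in_H: "Xt \<in> H" and Yt_in_H: "Yt \<in> H"
  using gens_in_H[of bT] gens_in_H[of bX] gens_in_H[of bY] by simp_all

lemma A_in_H: "A \<in> H" and B_in_H: "B \<in> H" and C_in_H: "C \<in> H"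
proof -
  have r0: "inverse r \<noteq> 0" using r_nonzero by simp
  have ss: "s (inverse r) \<otimes> (s r \<otimes> g) = g" if "g \<in> carrier G" for g
    using that by (simp add: r_mult flip: m_assoc)
  have A: "A = Xt \<otimes> Tt"
    using r_nonzero r0 by (simp add: m_assoc scal_simps ss)
  then show "A \<in> H"
    using subgroup.m_closed[OF subgroup_H Xt_in_H Tt_in_H] by simp
  moreover have "B = A \<otimes> Yt"
    using r_nonzero by (simp add: m_assoc scal_simps)
  ultimately show "B \<in> H"
    using subgroup.m_closed[OF subgroup_H _ Yt_in_H] by simp
  have "C = inv Tt \<otimes> Yt"
    using r_nonzero r0 by (simp add: m_assoc scal_simps ss inv_mult_group r_inv)
  then show "C \<in> H"
    using subgroup.m_closed[OF subgroup_H subgroup.m_inv_closed[OF subgroup_H Tt_in_H] Yt_in_H] by simp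
qed

text \<open>The image contains multiples of X and of Y, so a central element commutes with both and
  is scalar. This identifies orders modulo the center with orders modulo scalars.\<close>

lemma center_GH: "group_center GH = H \<inter> Z"
proof (intro equalityI subsetI)
  fix g assume "g \<in> group_center GH"
  then have g: "g \<in> H" and gc: "\<And>h. h \<in> H \<Longrightarrow> g \<otimes> h = h \<otimes> g"
    by (auto simp: group_center_def)
  have gG: "g \<in> carrier G"
    using g subgroup.subset[OF subgroup_H] by blast
  have r0: "inverse r \<noteq> 0" using r_nonzero by simp
  have "s (inverse r) \<otimes> (g \<otimes> X) = s (inverse r) \<otimes> (X \<otimes> g)"
    using gc[OF Xt_in_H] gG r0 by (simp add: scal_left m_assoc)
  then have 1: "g \<otimes> X = X \<otimes> g"
    using gG by simp
  have "s r \<otimes> (g \<otimes> Y) = s r \<otimes> (Y \<otimes> g)"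
    using gc[OF Yt_in_H] gG r_nonzero by (simp add: scal_left m_assoc)
  then have 2: "g \<otimes> Y = Y \<otimes> g"
    using gG by simp
  show "g \<in> H \<inter> Z"
    using g commutant[OF gG 1 2] by (simp add: Z_def)
next
  fix g assume g: "g \<in> H \<inter> Z"
  then show "g \<in> group_center GH"
    using Z_central[of g] subgroup.subset[OF subgroup_H] by (auto simp: group_center_def)
qed

definition "center_proj g = group_center GH #>\<^bsub>GH\<^esub> g"

lemma GH_simps [simp]: "carrier GH = H" "x \<otimes>\<^bsub>GH\<^esub> y = x \<otimes> y" "\<one>\<^bsub>GH\<^esub> = \<one>"
  by simp_all

lemma GH_nat_pow: "x [^]\<^bsub>GH\<^esub> (m::nat) = x [^] m"
  by (simp add: nat_pow_def)

lemma normal_center: "group_center GH \<lhd> GH"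
  by (rule group.normal_group_center[OF group_GH])

lemma ord_center_quotient:
  assumes "g \<in> H" and "\<And>m::nat. g [^] m \<in> Z \<longleftrightarrow> d dvd m"
  shows "group.ord (GH Mod group_center GH) (center_proj g) = d"
  unfolding center_proj_def
proof (rule normal.ord_FactGroup_eq[OF normal_center])
  fix m :: nat
  have "g [^]\<^bsub>GH\<^esub> m \<in> H"
    using monoid.nat_pow_closed[OF group.is_monoid[OF group_GH], of g m] assms(1) by simp
  then show "g [^]\<^bsub>GH\<^esub> m \<in> group_center GH \<longleftrightarrow> d dvd m"
    using assms(2)[of m] by (simp add: center_GH GH_nat_pow)
qed (use assms in simp)

lemma ord_scalar_quotient:
  assumes "g \<in> carrier G" and "\<And>m::nat. g [^] m \<in> Z \<longleftrightarrow> d dvd m"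
  shows "group.ord (G Mod Z) (Z #> g) = d"
  using assms by (rule normal.ord_FactGroup_eq[OF normal_Z])

text \<open>With \<open>pow_Z_mult\<close> and \<open>pow_inv_Z\<close>: orders modulo scalars do
  not change under conjugation, rescaling and inversion. All orders are reduced to those of X and Y
  in this way.\<close>

lemma pow_conj_Z:
  assumes "g \<in> carrier G" "h \<in> carrier G"
  shows "(h \<otimes> g \<otimes> inv h) [^] (m::nat) \<in> Z \<longleftrightarrow> g [^] m \<in> Z"
proof -
  have eq: "(h \<otimes> g \<otimes> inv h) [^] m = h \<otimes> g [^] m \<otimes> inv h"
  proof (induction m)
    case (Suc m)
    then show ?case
      using assms by (simp add: m_assoc cancel_left)
  qed (use assms in simp)
  have "g [^] m \<in> Z" if "h \<otimes> g [^] m \<otimes> inv h \<in> Z"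
  proof -
    have "inv h \<otimes> (h \<otimes> g [^] m \<otimes> inv h) \<otimes> h \<in> Z"
      using normal.inv_op_closed1[OF normal_Z assms(2) that] .
    then show ?thesis
      using assms by (simp add: m_assoc cancel_left)
  qed
  moreover have "h \<otimes> g [^] m \<otimes> inv h \<in> Z" if "g [^] m \<in> Z"
    using normal.inv_op_closed2[OF normal_Z assms(2) that] .
  ultimately show ?thesis
    unfolding eq by blast
qed

lemma Z_mult_iff:
  assumes "z \<in> Z" "g \<in> carrier G"
  shows "z \<otimes> g \<in> Z \<longleftrightarrow> g \<in> Z"
proof
  assume "z \<otimes> g \<in> Z"
  then have "inv z \<otimes> (z \<otimes> g) \<in> Z"
    using assms(1) subgroup_Z by (simp add: subgroup.m_closed subgroup.m_inv_closed)
  then show "g \<in> Z"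
    using assms subgroup.subset[OF subgroup_Z] by (auto simp: cancel_left)
qed (use assms subgroup_Z in \<open>simp add: subgroup.m_closed\<close>)

lemma pow_Z_mult:
  assumes "z \<in> Z" "g \<in> carrier G"
  shows "(z \<otimes> g) [^] (m::nat) \<in> Z \<longleftrightarrow> g [^] m \<in> Z"
proof -
  have z: "z \<in> carrier G"
    using assms(1) subgroup.subset[OF subgroup_Z] by blast
  have "(z \<otimes> g) [^] m = z [^] m \<otimes> g [^] m"
    using assms z Z_central[of z g] by (simp add: pow_mult_distrib)
  moreover have "z [^] m \<in> Z"
    using assms(1) by (induction m) (simp_all add: subgroup_Z subgroup.one_closed subgroup.m_closed)
  ultimately show ?thesis
    using assms Z_mult_iff by simp
qed

lemma pow_inv_Z:
  assumes "g \<in> carrier G"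
  shows "(inv g) [^] (m::nat) \<in> Z \<longleftrightarrow> g [^] m \<in> Z"
  using assms subgroup.m_inv_closed[OF subgroup_Z] nat_pow_inv[OF assms]
  by (metis inv_inv nat_pow_closed)

text \<open>The element h implements tau_-. The scalar \<open>c\<close> is left free, since only
  orders modulo scalars matter; this also absorbs the sign of a twisted Y.\<close>

definition "tau_minus_inner \<longleftrightarrow> (\<exists>h\<in>carrier G. \<exists>c. c \<noteq> 0 \<and>
  h \<otimes> X \<otimes> inv h = s c \<otimes> (Y \<otimes> X) \<and> h \<otimes> Y \<otimes> inv h = Y)"

lemma pow_x: "(s r \<otimes> Y) [^] (m::nat) \<in> Z \<longleftrightarrow> Y [^] m \<in> Z"
  using r_nonzero by (simp add: pow_Z_mult)

lemma pow_y: "(s r \<otimes> inv T \<otimes> inv X \<otimes> T) [^] (m::nat) \<in> Z \<longleftrightarrow> X [^] m \<in> Z"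
proof -
  have "s r \<otimes> inv T \<otimes> inv X \<otimes> T = s r \<otimes> (inv T \<otimes> inv X \<otimes> inv (inv T))"
    by (simp add: m_assoc)
  then show ?thesis
    using r_nonzero pow_conj_Z[OF inv_closed[OF X_closed] inv_closed[OF T_closed], of m]
    by (simp only: pow_Z_mult s_in_Z m_closed inv_closed X_closed T_closed pow_inv_Z not_False_eq_True)
qed

context
  assumes inner: tau_minus_inner
begin

lemma pow_YX: "(Y \<otimes> X) [^] (m::nat) \<in> Z \<longleftrightarrow> X [^] m \<in> Z"
proof -
  obtain h c where h: "h \<in> carrier G" "c \<noteq> 0" "h \<otimes> X \<otimes> inv h = s c \<otimes> (Y \<otimes> X)"
    using inner by (auto simp: tau_minus_inner_def)
  then show ?thesis
    using pow_conj_Z[of X h m] by (simp add: pow_Z_mult)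
qed

text \<open>Conjugation by h fixes Y and sends X to a multiple of Y X, so it sends Y X to a multiple
  of Y (Y X): a second application of tau_-.\<close>

lemma pow_YYX: "(Y \<otimes> (Y \<otimes> X)) [^] (m::nat) \<in> Z \<longleftrightarrow> X [^] m \<in> Z"
proof -
  obtain h c where h: "h \<in> carrier G" "c \<noteq> 0" "h \<otimes> X \<otimes> inv h = s c \<otimes> (Y \<otimes> X)"
      "h \<otimes> Y \<otimes> inv h = Y"
    using inner by (auto simp: tau_minus_inner_def)
  have "h \<otimes> (Y \<otimes> X) \<otimes> inv h = (h \<otimes> Y \<otimes> inv h) \<otimes> (h \<otimes> X \<otimes> inv h)"
    using h(1) by (simp add: m_assoc cancel_left)
  also have "\<dots> = s c \<otimes> (Y \<otimes> (Y \<otimes> X))"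
    using h(2) by (simp add: h(3,4) scal_simps)
  finally show ?thesis
    using pow_conj_Z[of "Y \<otimes> X" h m] h(1,2) by (simp add: pow_Z_mult pow_YX)
qed

lemma pow_z: "(inv Y \<otimes> inv X) [^] (m::nat) \<in> Z \<longleftrightarrow> X [^] m \<in> Z"
proof -
  have "inv Y \<otimes> inv X = inv (X \<otimes> Y)"
    by (simp add: inv_mult_group)
  moreover have "Y \<otimes> (X \<otimes> Y) \<otimes> inv Y = Y \<otimes> X"
    by (simp add: m_assoc)
  ultimately show ?thesis
    using pow_conj_Z[of "X \<otimes> Y" Y m] by (simp add: pow_inv_Z pow_YX)
qed

lemma pow_ABAC: "(A \<otimes> B \<otimes> A \<otimes> C) [^] (m::nat) \<in> Z \<longleftrightarrow> X [^] m \<in> Z"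
proof -
  have "Y \<otimes> (Y \<otimes> X \<otimes> Y) \<otimes> inv Y = Y \<otimes> (Y \<otimes> X)"
    by (simp add: m_assoc)
  then show ?thesis
    unfolding ABAC using r_nonzero pow_conj_Z[of "Y \<otimes> X \<otimes> Y" Y m]
    by (simp add: pow_Z_mult pow_YYX)
qed

lemma triangle_quotient:
  assumes M: "X [^] (M::nat) \<in> Z" "Y [^] M \<in> Z"
  shows "\<exists>\<phi>\<in>hom (triangle_group M M M M) (GH Mod group_center GH).
    \<phi> ` carrier (triangle_group M M M M) = carrier (GH Mod group_center GH) \<and>
    (let cl = pres_class (triangle_relators M M M M) in
       \<phi> (cl (gen ta)) = center_proj A \<and> \<phi> (cl (gen tb)) = center_proj B \<and>
       \<phi> (cl (gen tc)) = center_proj C \<and>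
       \<phi> (cl (gen ta @ gen tb)) = center_proj (s r \<otimes> Y) \<and>
       \<phi> (cl (gen tb @ gen tc)) = center_proj (s r \<otimes> inv T \<otimes> inv X \<otimes> T) \<and>
       \<phi> (cl (gen tc @ gen ta)) = center_proj (inv Y \<otimes> inv X))"
proof -
  let ?Q = "GH Mod group_center GH"
  define f where "f = case_tri_gen A B C"
  have f_simps [simp]: "f ta = A" "f tb = B" "f tc = C"
    by (simp_all add: f_def)
  have fH: "range f \<subseteq> H"
  proof
    fix x assume "x \<in> range f"
    then obtain g where "x = f g" by blast
    then show "x \<in> H" using A_in_H B_in_H C_in_H by (cases g) simp_all
  qed
  have fG: "range f \<subseteq> carrier G"
    using fH subgroup.subset[OF subgroup_H] by blast
  interpret Q: group ?Q
    by (rule normal.factorgroup_is_group[OF normal_center])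
  interpret p: group_hom GH ?Q center_proj
    unfolding center_proj_def[abs_def] using normal.r_coset_hom_Mod[OF normal_center] group_GH
    by (intro group_hom.intro group_hom_axioms.intro) (simp_all add: Q.group_axioms)
  have Z_imp: "center_proj g = \<one>\<^bsub>?Q\<^esub>" if "g \<in> H" "g \<in> Z" for g
  proof -
    have "g \<in> group_center GH"
      using that by (simp add: center_GH)
    then show ?thesis
      unfolding center_proj_def one_FactGroup
      by (intro group.coset_join2[OF group_GH] normal_imp_subgroup[OF normal_center])
        (simp_all add: that)
  qed
  have inv_GH: "inv\<^bsub>GH\<^esub> x = inv x" if "x \<in> H" for x
    using m_inv_consistent[OF subgroup_H that] .
  have val_GH: "word_val GH f w = word_val G f w" for w
  proof (induction w)
    case (Cons x w)
    then show ?case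
      using fH by (cases x) (simp add: inv_GH range_subsetD)
  qed simp
  have val: "word_val ?Q (center_proj \<circ> f) w = center_proj (word_val G f w)" for w
    using hom_word_val[OF p.group_hom_axioms, of f w] fH by (simp add: val_GH)
  have fQ: "range (center_proj \<circ> f) \<subseteq> carrier ?Q"
    using fH p.hom_closed by auto
  have rel: "word_val ?Q (center_proj \<circ> f) w = \<one>\<^bsub>?Q\<^esub>" if w: "w \<in> triangle_relators M M M M" for w
  proof -
    have 1: "word_val G f (gen ta @ gen ta) = \<one>" "word_val G f (gen tb @ gen tb) = \<one>"
      "word_val G f (gen tc @ gen tc) = \<one>"
      using AA BB CC by (simp_all add: gen_def)
    have 2: "word_val G f (gen ta @ gen tb) = s r \<otimes> Y"
        "word_val G f (gen tb @ gen tc) = s r \<otimes> inv T \<otimes> inv X \<otimes> T"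
        "word_val G f (gen tc @ gen ta) = inv Y \<otimes> inv X"
        "word_val G f (gen ta @ gen tb @ gen ta @ gen tc) = A \<otimes> B \<otimes> A \<otimes> C"
      by (simp_all add: gen_def flip: AB BC CA) (simp add: m_assoc)
    \<comment> \<open>The involution relators are trivial already in G; the power relators are
      scalar because the M-th powers of X and Y are.\<close>
    have "word_val G f w \<in> Z"
      using w M unfolding triangle_relators_def
      by (elim insertE emptyE)
        (simp_all only: 1 2 word_val_word_pow[OF fG] pow_x pow_y pow_z pow_ABAC
          subgroup.one_closed[OF subgroup_Z])
    then show ?thesis
      unfolding val using word_val_in_subgroup[OF subgroup_H fH] by (rule Z_imp[rotated])
  qed
  let ?phi = "pres_lift ?Q (center_proj \<circ> f)"
  have phi_class: "?phi (pres_class (triangle_relators M M M M) w) = center_proj (word_val G f w)" for w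
    using Q.pres_lift_class[OF fQ rel] by (simp add: val)
  \<comment> \<open>Surjectivity: A, B, C generate the image, since the normalized T is A B C, the
    normalized X is A times its inverse, and the normalized Y is T C.\<close>
  have "carrier ?Q \<subseteq> range (\<lambda>w. center_proj (word_val G f w))"
  proof
    fix q assume "q \<in> carrier ?Q"
    then obtain h where h: "h \<in> H" "q = center_proj h"
      by (auto simp: carrier_FactGroup center_proj_def)
    have sub: "subgroup (range (word_val G f)) G"
      by (rule subgroup_range_word_val[OF fG])
    have f_in: "f g \<in> range (word_val G f)" for g
    proof -
      have "f g = word_val G f [(g, True)]"
        using fG by (simp add: range_subsetD)
      then show ?thesis by blast
    qed
    have T: "Tt \<in> range (word_val G f)"
      using f_in[of ta] f_in[of tb] f_in[of tc] ABC sub by (metis f_simps subgroup.m_closed)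
    have "Xt = A \<otimes> inv Tt"
      using r_nonzero by (simp add: inv_mult_group r_inv m_assoc cancel_left s_central scal_simps)
    then have X: "Xt \<in> range (word_val G f)"
      using f_in[of ta] T sub by (metis f_simps(1) subgroup.m_closed subgroup.m_inv_closed)
    have "Yt = Tt \<otimes> C"
      by (simp add: m_assoc cancel_left)
    then have Y: "Yt \<in> range (word_val G f)"
      using f_in[of tc] T sub by (metis f_simps(3) subgroup.m_closed)
    have "range braid_gens \<subseteq> range (word_val G f)"
    proof
      fix x assume "x \<in> range braid_gens"
      then obtain g where "x = braid_gens g" by blast
      then show "x \<in> range (word_val G f)" using T X Y by (cases g) simp_all
    qed
    then have "h \<in> range (word_val G f)"
      using h(1) word_val_in_subgroup[OF sub] by (auto simp: H_def)
    then show "q \<in> range (\<lambda>w. center_proj (word_val G f w))"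
      using h(2) by blast
  qed
  moreover have "center_proj (word_val G f w) \<in> carrier ?Q" for w
    using word_val_in_subgroup[OF subgroup_H fH] p.hom_closed by simp
  ultimately have "?phi ` carrier (triangle_group M M M M) = carrier ?Q"
    by (auto simp: triangle_group_def carrier_presented_group image_image phi_class)
  moreover have "?phi \<in> hom (triangle_group M M M M) ?Q"
    unfolding triangle_group_def by (rule Q.pres_lift_hom[OF fQ rel])
  moreover have "word_val G f (gen ta @ gen tb) = A \<otimes> B"
      "word_val G f (gen tb @ gen tc) = B \<otimes> C" "word_val G f (gen tc @ gen ta) = C \<otimes> A"
      "word_val G f (gen ta) = A" "word_val G f (gen tb) = B" "word_val G f (gen tc) = C"
    by (simp_all add: gen_def)
  ultimately show ?thesis
    by (intro bexI[of _ ?phi]) (simp_all add: Let_def phi_class AB BC CA)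
qed

end

end

section \<open>Operators on Laurent polynomials\<close>

abbreviation lmon :: "int \<Rightarrow> 'a::field laurent" where "lmon n \<equiv> Poly_Mapping.single n 1"

lemma lookup_lconst_mult [simp]:
  "Poly_Mapping.lookup (lconst c * f) n = c * Poly_Mapping.lookup f n"
proof -
  have "lconst c * f = Poly_Mapping.map ((*) c) f"
    by (simp add: mult_map_scale_conv_mult lconst_def)
  then show ?thesis
    by (simp add: Poly_Mapping.map.rep_eq when_def)
qed

lemma lmon_mult: "lmon m * lmon n = lmon (m + n)"
  by (simp add: mult_single)

lemma lmon_0 [simp]: "lmon 0 = 1"
  by simp

lemma lmon_power: "lmon n ^ k = lmon (int k * n)"
  by (induction k) (simp_all add: lmon_mult algebra_simps)

lemma lconst_simps [simp]: "lconst 0 = 0" "lconst 1 = 1"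
  by (simp_all add: lconst_def)

lemma lconst_mult: "lconst (a * b) = lconst a * lconst b"
  and lconst_add: "lconst (a + b) = lconst a + lconst b"
  and lconst_diff: "lconst (a - b) = lconst a - lconst b"
  and lconst_minus: "lconst (- a) = - lconst a"
  by (simp_all add: lconst_def mult_single single_add single_diff single_uminus)

lemma lconst_eq_iff [simp]: "lconst a = lconst b \<longleftrightarrow> a = b"
  by (metis lconst_def lookup_single_eq)

lemma lconst_eq_0_iff [simp]: "lconst a = 0 \<longleftrightarrow> a = 0"
  using lconst_eq_iff[of a 0] by simp

lemma lconst_inverse [simp]: "c \<noteq> 0 \<Longrightarrow> lconst c * lconst (inverse c) = 1"
    "c \<noteq> 0 \<Longrightarrow> lconst (inverse c) * lconst c = 1"
  by (simp_all flip: lconst_mult)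

lemma lconst_inverse_left [simp]: "c \<noteq> 0 \<Longrightarrow> lconst c * (lconst (inverse c) * f) = f"
    "c \<noteq> 0 \<Longrightarrow> lconst (inverse c) * (lconst c * f) = f"
  by (simp_all flip: mult.assoc)

lemma single_eq_lmon: "Poly_Mapping.single n c = lconst c * lmon n"
  by (simp add: lconst_def mult_single)

lemma lookup_lmon_mult: "Poly_Mapping.lookup (lmon m * f) n = Poly_Mapping.lookup f (n - m)"
proof -
  have "n = m + k \<longleftrightarrow> k = n - m" for k
    by auto
  then show ?thesis
    by (simp add: lookup_mult lookup_single mult_when when_mult flip: Sum_any_right_distrib)
qed

lemma laurent_expand: "f = (\<Sum>n\<in>Poly_Mapping.keys f. lconst (Poly_Mapping.lookup f n) * lmon n)"
  by (rule poly_mapping_eqI)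
    (simp add: lookup_sum lookup_single when_def in_keys_iff if_distrib cong: if_cong)

lemma laurent_induct [case_names mon add scale]:
  assumes "\<And>n. P (lmon n)" and "\<And>f g. P f \<Longrightarrow> P g \<Longrightarrow> P (f + g)"
    and "\<And>c f. P f \<Longrightarrow> P (lconst c * f)"
  shows "P f"
proof -
  have zero: "P 0"
    using assms(3)[OF assms(1)[of 0], of 0] by simp
  have "P (\<Sum>n\<in>A. lconst (Poly_Mapping.lookup f n) * lmon n)" if "finite A" for A
    using that by induction (simp_all add: zero assms)
  then show ?thesis
    by (subst laurent_expand) simp
qed

definition laurent_linear :: "('a::field laurent \<Rightarrow> 'a laurent) \<Rightarrow> bool" where
  "laurent_linear D \<longleftrightarrow> (\<forall>f g. D (f + g) = D f + D g) \<and> (\<forall>c f. D (lconst c * f) = lconst c * D f)"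

lemma laurent_linearI:
  "(\<And>f g. D (f + g) = D f + D g) \<Longrightarrow> (\<And>c f. D (lconst c * f) = lconst c * D f) \<Longrightarrow> laurent_linear D"
  by (simp add: laurent_linear_def)

lemma linear_add: "laurent_linear D \<Longrightarrow> D (f + g) = D f + D g"
  and linear_scale: "laurent_linear D \<Longrightarrow> D (lconst c * f) = lconst c * D f"
  by (simp_all add: laurent_linear_def)

lemma linear_zero: "laurent_linear D \<Longrightarrow> D 0 = 0"
  using linear_scale[of D 0 0] by simp

lemma linear_minus: "laurent_linear D \<Longrightarrow> D (- f) = - D f"
  using linear_scale[of D "- 1" f] by (simp add: lconst_minus)

lemma linear_diff: "laurent_linear D \<Longrightarrow> D (f - g) = D f - D g"
  using linear_add[of D f "- g"] by (simp add: linear_minus)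

lemma linear_sum: "laurent_linear D \<Longrightarrow> D (sum F A) = (\<Sum>a\<in>A. D (F a))"
  by (induction A rule: infinite_finite_induct) (simp_all add: linear_add linear_zero)

lemma linear_compose: "laurent_linear D \<Longrightarrow> laurent_linear E \<Longrightarrow> laurent_linear (\<lambda>f. D (E f))"
  by (simp add: laurent_linear_def)

lemma linear_ident [intro]: "laurent_linear (\<lambda>f. f)"
  and linear_mult [intro]: "laurent_linear (\<lambda>f. g * f)"
  by (simp_all add: laurent_linear_def algebra_simps)

lemma linear_add_fun: "laurent_linear D \<Longrightarrow> laurent_linear E \<Longrightarrow> laurent_linear (\<lambda>f. D f + E f)"
  and linear_diff_fun: "laurent_linear D \<Longrightarrow> laurent_linear E \<Longrightarrow> laurent_linear (\<lambda>f. D f - E f)"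
  and linear_mult_fun: "laurent_linear D \<Longrightarrow> laurent_linear (\<lambda>f. g * D f)"
  by (simp_all add: laurent_linear_def algebra_simps)

lemma linear_ext:
  assumes "laurent_linear D" "laurent_linear E" "\<And>n. D (lmon n) = E (lmon n)"
  shows "D f = E f"
  by (induction f rule: laurent_induct) (use assms in \<open>simp_all add: linear_add linear_scale\<close>)

text \<open>The common form of s, \<pi>, the divided difference, evaluation at a point and
  substitution of an operator, so that linearity and multiplicativity are proved once.\<close>

definition lin :: "(int \<Rightarrow> 'a::field laurent) \<Rightarrow> 'a laurent \<Rightarrow> 'a laurent" where
  "lin F f = (\<Sum>n\<in>Poly_Mapping.keys f. lconst (Poly_Mapping.lookup f n) * F n)"

lemma lin_superset:
  assumes "finite A" "Poly_Mapping.keys f \<subseteq> A"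
  shows "lin F f = (\<Sum>n\<in>A. lconst (Poly_Mapping.lookup f n) * F n)"
  unfolding lin_def using assms
  by (intro sum.mono_neutral_left) (auto simp: in_keys_iff)

lemma linear_lin [intro]: "laurent_linear (lin F)"
proof (rule laurent_linearI)
  fix f g :: "'a laurent" and c
  let ?A = "Poly_Mapping.keys f \<union> Poly_Mapping.keys g"
  have "lin F (f + g) = (\<Sum>n\<in>?A. lconst (Poly_Mapping.lookup (f + g) n) * F n)"
    by (rule lin_superset) (auto simp: in_keys_iff lookup_add)
  then show "lin F (f + g) = lin F f + lin F g"
    by (simp add: lin_superset[of ?A] lookup_add lconst_add algebra_simps sum.distrib)
  have "lin F (lconst c * f) = (\<Sum>n\<in>?A. lconst (Poly_Mapping.lookup (lconst c * f) n) * F n)"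
    by (rule lin_superset) (auto simp: in_keys_iff)
  then show "lin F (lconst c * f) = lconst c * lin F f"
    by (simp add: lin_superset[of ?A] lconst_mult sum_distrib_left mult.assoc)
qed

lemma lin_lmon [simp]: "lin F (lmon n) = F n"
  by (simp add: lin_def)

lemma lin_mult:
  assumes "\<And>m n. F (m + n) = F m * F n"
  shows "lin F (f * g) = lin F f * lin F g"
proof (induction f rule: laurent_induct)
  case (mon m)
  show ?case
    by (induction g rule: laurent_induct)
      (simp_all add: linear_add[OF linear_lin] linear_scale[OF linear_lin] assms lmon_mult
        distrib_left mult.left_commute[of "lmon m"] mult.left_commute[of "F m"])
qed (simp_all add: linear_add[OF linear_lin] linear_scale[OF linear_lin] distrib_right mult.assoc)

lemma pol_s_lin: "pol_s = lin (\<lambda>n. lmon (- n))"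
  by (rule ext) (simp add: pol_s_def lin_def single_eq_lmon[of _ "Poly_Mapping.lookup _ _"])

lemma pol_pi_lin: "pol_pi u = lin (\<lambda>n. lconst (u powi n) * lmon (- n))"
  by (rule ext)
    (simp add: pol_pi_def lin_def single_eq_lmon[of _ "_ * Poly_Mapping.lookup _ _"] lconst_mult mult_ac)

lemma linear_s [intro]: "laurent_linear pol_s" and linear_pi [intro]: "laurent_linear (pol_pi u)"
  by (simp_all add: pol_s_lin pol_pi_lin linear_lin)

lemma pol_s_lmon [simp]: "pol_s (lmon n) = lmon (- n)"
  by (simp add: pol_s_lin)

lemma pol_pi_lmon [simp]: "pol_pi u (lmon n) = lconst (u powi n) * lmon (- n)"
  by (simp add: pol_pi_lin)

lemma pol_s_mult: "pol_s (f * g) = pol_s f * pol_s g"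
  unfolding pol_s_lin by (rule lin_mult) (simp add: lmon_mult)

lemma pol_pi_mult: "u \<noteq> 0 \<Longrightarrow> pol_pi u (f * g) = pol_pi u f * pol_pi u g"
  unfolding pol_pi_lin
  by (rule lin_mult) (simp add: power_int_add lconst_mult mult_ac lmon_mult flip: mult.assoc[of "lmon _" "lmon _"])

lemma pol_s_1 [simp]: "pol_s 1 = 1" and pol_pi_1 [simp]: "pol_pi u 1 = 1"
  using pol_s_lmon[of 0] pol_pi_lmon[of u 0]
  by (simp_all only: lmon_0 minus_zero power_int_0_right lconst_simps mult_1_left)

lemma pol_s_lconst [simp]: "pol_s (lconst c) = lconst c"
  and pol_pi_lconst [simp]: "pol_pi u (lconst c) = lconst c"
  using linear_scale[OF linear_s, of c 1] linear_scale[OF linear_pi, of u c 1] by simp_all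

lemma pol_s_s [simp]: "pol_s (pol_s f) = f"
  by (rule linear_ext[of "\<lambda>f. pol_s (pol_s f)" "\<lambda>f. f"]) (auto intro: linear_compose)

lemma pol_pi_pi [simp]: "u \<noteq> 0 \<Longrightarrow> pol_pi u (pol_pi u f) = f"
  by (rule linear_ext[of "\<lambda>f. pol_pi u (pol_pi u f)" "\<lambda>f. f"])
    (auto intro: linear_compose simp: linear_scale[OF linear_pi] power_int_minus)

abbreviation lXi :: "'a::field laurent" where "lXi \<equiv> lmon (- 1)"

lemma lX_lXi [simp]: "lX * lXi = 1" "lXi * lX = 1"
  by (simp_all add: lX_def lmon_mult)

lemma lX_lXi_left [simp]: "lX * (lXi * f) = f" "lXi * (lX * f) = f"
  by (simp_all flip: mult.assoc)

lemma pol_s_lX [simp]: "pol_s lX = lXi" "pol_s lXi = lX"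
  by (simp_all add: lX_def)

lemma pol_pi_lX [simp]: "pol_pi u lX = lconst u * lXi" "pol_pi u lXi = lconst (inverse u) * lX"
  by (simp_all add: lX_def power_int_minus)

lemma lX2_neq_1: "lX ^ 2 - 1 \<noteq> (0 :: 'a::field laurent)"
proof
  assume "lX ^ 2 - 1 = (0 :: 'a laurent)"
  then have "Poly_Mapping.lookup (lX ^ 2 - 1 :: 'a laurent) 2 = 0"
    by simp
  then show False
    by (simp add: lX_def lmon_power lookup_minus lookup_one)
qed

text \<open>The divided difference \<open>(X\<^sup>-\<^sup>n - X\<^sup>n) / (X\<^sup>2 - 1)\<close>.\<close>

definition ddiff_mon :: "int \<Rightarrow> 'a::field laurent" where
  "ddiff_mon n = (if 0 \<le> n then - (\<Sum>i\<in>{..<nat n}. lmon (- n + 2 * int i))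
     else (\<Sum>i\<in>{..<nat (- n)}. lmon (n + 2 * int i)))"

lemma geometric_lmon: "(lX ^ 2 - 1) * (\<Sum>i<k. lmon (m + 2 * int i)) = lmon (m + 2 * int k) - lmon m"
proof (induction k)
  case (Suc k)
  have "(lX ^ 2 - 1) * lmon (m + 2 * int k) = lmon (m + 2 * int (Suc k)) - lmon (m + 2 * int k)"
    by (simp add: lX_def lmon_power lmon_mult algebra_simps)
  with Suc show ?case
    by (simp add: ring_distribs)
qed simp

lemma ddiff_mon: "(lX ^ 2 - 1) * ddiff_mon n = lmon (- n) - lmon n"
proof (cases "0 \<le> n")
  case True
  then have "(lX ^ 2 - 1) * ddiff_mon n = - (lmon (- n + 2 * int (nat n)) - lmon (- n))"
    unfolding ddiff_mon_def by (simp only: if_True mult_minus_right geometric_lmon)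
  with True show ?thesis by simp
next
  case False
  then have "(lX ^ 2 - 1) * ddiff_mon n = lmon (n + 2 * int (nat (- n))) - lmon n"
    unfolding ddiff_mon_def by (simp only: if_False geometric_lmon)
  with False show ?thesis by simp
qed

lemma ddiff: "(lX ^ 2 - 1) * lin ddiff_mon f = pol_s f - f"
  by (rule linear_ext[of "\<lambda>f. (lX ^ 2 - 1) * lin ddiff_mon f" "\<lambda>f. pol_s f - f"])
    (auto intro: linear_mult_fun linear_diff_fun simp: ddiff_mon)

text \<open>The description by \<open>THE\<close> is resolved: the explicit divided difference
  solves the equation, and X^2 - 1 can be cancelled.\<close>

lemma pol_T_ddiff: "pol_T v f = lconst v * pol_s f + lconst (v - inverse v) * lin ddiff_mon f"
proof -
  have "(THE g. (lX ^ 2 - 1) * g = pol_s f - f) = lin ddiff_mon f"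
  proof (rule the_equality)
    fix g assume "(lX ^ 2 - 1) * g = pol_s f - f"
    with ddiff[of f] have "(lX ^ 2 - 1) * g = (lX ^ 2 - 1) * lin ddiff_mon f"
      by simp
    then show "g = lin ddiff_mon f"
      using lX2_neq_1 mult_left_cancel by blast
  qed (rule ddiff)
  then show ?thesis
    by (simp add: pol_T_def)
qed

lemma linear_T [intro]: "laurent_linear (pol_T v)"
  unfolding pol_T_ddiff[abs_def] by (intro linear_add_fun linear_mult_fun linear_s linear_lin)

lemma linear_Y [intro]: "laurent_linear (pol_Y u v)"
  unfolding pol_Y_def[abs_def] by (rule linear_compose[OF linear_pi linear_T])

lemma lX2_cancel: "(lX ^ 2 - 1) * f = (lX ^ 2 - 1) * g \<Longrightarrow> f = (g :: 'a::field laurent)"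
  using lX2_neq_1 mult_left_cancel by blast

text \<open>With \<open>pol_T_unique\<close> this replaces computations with divided differences: an
  identity for T is checked after multiplication by X^2 - 1, where only s occurs.\<close>

lemma pol_T_mult: "(lX ^ 2 - 1) * pol_T v f =
   (lconst v * lX ^ 2 - lconst (inverse v)) * pol_s f - lconst (v - inverse v) * f"
proof -
  have "(lX ^ 2 - 1) * pol_T v f =
      lconst v * (lX ^ 2 - 1) * pol_s f + lconst (v - inverse v) * ((lX ^ 2 - 1) * lin ddiff_mon f)"
    by (simp add: pol_T_ddiff algebra_simps)
  then show ?thesis
    unfolding ddiff by (simp add: lconst_diff algebra_simps)
qed

lemma pol_T_unique:
  "(lX ^ 2 - 1) * g = (lconst v * lX ^ 2 - lconst (inverse v)) * pol_s f - lconst (v - inverse v) * f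
   \<Longrightarrow> pol_T v f = g"
  by (rule lX2_cancel) (simp only: pol_T_mult)

text \<open>The quadratic relation reads T - T^-1 = t^(1/2) - t^(-1/2); hence this candidate for the
  inverse.\<close>

definition pol_T_inv :: "'a::field \<Rightarrow> 'a laurent \<Rightarrow> 'a laurent" where
  "pol_T_inv v f = pol_T v f - lconst (v - inverse v) * f"

lemma pol_T_1: "pol_T v 1 = lconst v"
  by (rule pol_T_unique) (simp add: lconst_diff algebra_simps)

lemma pol_Y_1: "pol_Y u v 1 = lconst v"
  by (simp add: pol_Y_def pol_T_1)

text \<open>Multiplication by - x^2 turns an identity in y = x^-1 into the corresponding one in x
  with the roles of f and s exchanged.\<close>

lemma reflect_square_eq:
  fixes x :: "'a::comm_ring_1"
  assumes "x * y = 1" "(y ^ 2 - 1) * S = (v * y ^ 2 - w) * f + (w * y ^ 2 - v) * s"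
  shows "(x ^ 2 - 1) * S = (v * x ^ 2 - w) * s + (w * x ^ 2 - v) * f"
proof -
  have xy: "x ^ 2 * y ^ 2 = 1"
    using assms(1) by (simp flip: power_mult_distrib)
  have "(x ^ 2 - 1) * S = (x ^ 2 - x ^ 2 * y ^ 2) * S"
    by (simp add: xy)
  also have "\<dots> = - (x ^ 2) * ((y ^ 2 - 1) * S)"
    by (simp add: algebra_simps)
  also have "\<dots> = (w * x ^ 2 - v * (x ^ 2 * y ^ 2)) * f + (v * x ^ 2 - w * (x ^ 2 * y ^ 2)) * s"
    unfolding assms(2) by (simp add: algebra_simps)
  finally show ?thesis
    by (simp add: xy)
qed

lemma pol_T_quadratic:
  assumes "v \<noteq> 0"
  shows "pol_T v (pol_T v f) = f + lconst (v - inverse v) * pol_T v f"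
proof -
  \<comment> \<open>The image of T + t^(-1/2) consists of s-invariant polynomials, and on these T
    acts as t^(1/2). Together this is the quadratic relation.\<close>
  define g where "g = pol_T v f + lconst (inverse v) * f"
  have 1: "(lX ^ 2 - 1) * g =
     (lconst v * lX ^ 2 - lconst (inverse v)) * pol_s f + (lconst (inverse v) * lX ^ 2 - lconst v) * f"
    unfolding g_def distrib_left pol_T_mult by (simp add: lconst_diff algebra_simps)
  have "pol_s ((lX ^ 2 - 1) * g) =
     (lconst v * lXi ^ 2 - lconst (inverse v)) * f + (lconst (inverse v) * lXi ^ 2 - lconst v) * pol_s f"
    unfolding 1 by (simp add: linear_add[OF linear_s] linear_diff[OF linear_s] pol_s_mult power2_eq_square)
  then have "(lXi ^ 2 - 1) * pol_s g =
     (lconst v * lXi ^ 2 - lconst (inverse v)) * f + (lconst (inverse v) * lXi ^ 2 - lconst v) * pol_s f"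
    by (simp add: linear_diff[OF linear_s] pol_s_mult power2_eq_square)
  from reflect_square_eq[OF lX_lXi(1) this] have "(lX ^ 2 - 1) * pol_s g = (lX ^ 2 - 1) * g"
    unfolding 1 by simp
  then have "pol_s g = g"
    by (rule lX2_cancel)
  then have "pol_T v g = lconst v * g"
    by (intro pol_T_unique) (simp add: lconst_diff algebra_simps)
  moreover have "pol_T v g = pol_T v (pol_T v f) + lconst (inverse v) * pol_T v f"
    by (simp add: g_def linear_add[OF linear_T] linear_scale[OF linear_T])
  moreover have "lconst v * g = lconst v * pol_T v f + f"
    using assms by (simp add: g_def algebra_simps)
  ultimately show ?thesis
    by (simp add: lconst_diff algebra_simps)
qed

lemma pol_T_T_inv: "v \<noteq> 0 \<Longrightarrow> pol_T v (pol_T_inv v f) = f"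
  and pol_T_inv_T: "v \<noteq> 0 \<Longrightarrow> pol_T_inv v (pol_T v f) = f"
  by (simp_all add: pol_T_inv_def linear_diff[OF linear_T] linear_scale[OF linear_T] pol_T_quadratic)

text \<open>With \<open>pol_T_Xi\<close> this moves T past X and X^-1, so inductions on the number
  of factors X reduce statements about T to its value on 1.\<close>

lemma pol_T_X: "pol_T v (lX * f) = lXi * pol_T_inv v f"
proof (rule pol_T_unique)
  have "(lX ^ 2 - 1) * (lXi * pol_T_inv v f) =
      lXi * ((lX ^ 2 - 1) * pol_T v f) - lXi * (lX ^ 2 - 1) * (lconst (v - inverse v) * f)"
    by (simp add: pol_T_inv_def algebra_simps)
  also have "\<dots> = (lconst v * lX ^ 2 - lconst (inverse v)) * (lXi * pol_s f)
      - lconst (v - inverse v) * ((lXi * lX) * lX) * f"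
    unfolding pol_T_mult by (simp add: power2_eq_square algebra_simps del: lX_lXi lX_lXi_left)
  finally show "(lX ^ 2 - 1) * (lXi * pol_T_inv v f) =
    (lconst v * lX ^ 2 - lconst (inverse v)) * pol_s (lX * f) - lconst (v - inverse v) * (lX * f)"
    by (simp add: pol_s_mult mult.assoc)
qed

lemma pol_T_Xi: "v \<noteq> 0 \<Longrightarrow> pol_T v (lXi * f) = lX * pol_T v f + lconst (v - inverse v) * (lXi * f)"
proof -
  assume v: "v \<noteq> 0"
  have "pol_T v (lX * pol_T v f) = lXi * f"
    using v by (simp add: pol_T_X pol_T_inv_T)
  then have "pol_T_inv v (lXi * f) = lX * pol_T v f"
    using pol_T_inv_T[OF v] by metis
  then show ?thesis
    by (simp add: pol_T_inv_def algebra_simps)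
qed

lemma pol_pi_X: "u \<noteq> 0 \<Longrightarrow> pol_pi u (lX * f) = lconst u * (lXi * pol_pi u f)"
  by (simp only: pol_pi_mult pol_pi_lX mult.assoc not_False_eq_True)

lemma pol_pi_Xi: "u \<noteq> 0 \<Longrightarrow> pol_pi u (lXi * f) = lconst (inverse u) * (lX * pol_pi u f)"
  by (simp only: pol_pi_mult pol_pi_lX mult.assoc not_False_eq_True)

section \<open>Triangularity of \<open>Y\<close>\<close>

text \<open>The position of \<open>n\<close> in the enumeration \<open>0, 1, - 1, 2, - 2, \<dots>\<close>, with respect to which
  \<open>Y\<close> is triangular.\<close>

definition rank :: "int \<Rightarrow> nat" where
  "rank n = (if 0 < n then 2 * nat n - 1 else 2 * nat (- n))"

definition unrank :: "nat \<Rightarrow> int" where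
  "unrank k = (if even k then - int (k div 2) else int (k div 2) + 1)"

lemma rank_unrank [simp]: "rank (unrank k) = k"
  by (auto simp: rank_def unrank_def elim: oddE evenE)

lemma unrank_rank [simp]: "unrank (rank n) = n"
proof (cases "0 < n")
  case True
  then obtain k where "n = int (Suc k)"
    by (metis gr0_implies_Suc zero_less_imp_eq_int)
  then show ?thesis by (simp add: rank_def unrank_def)
qed (simp add: rank_def unrank_def)

lemma rank_eq_iff: "rank m = rank n \<longleftrightarrow> m = n"
  by (metis unrank_rank)

lemma rank_less_iff: "rank m < rank n \<longleftrightarrow> m \<noteq> n \<and> (\<bar>m\<bar> < \<bar>n\<bar> \<or> n < 0 \<and> m = - n)"
  by (auto simp: rank_def nat_less_iff split: if_splits)

definition supp_lt :: "nat \<Rightarrow> 'a::field laurent \<Rightarrow> bool" where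
  "supp_lt k f \<longleftrightarrow> (\<forall>m. Poly_Mapping.lookup f m \<noteq> 0 \<longrightarrow> rank m < k)"

lemma supp_ltD: "supp_lt k f \<Longrightarrow> k \<le> rank m \<Longrightarrow> Poly_Mapping.lookup f m = 0"
  by (auto simp: supp_lt_def)

lemma supp_lt_0: "supp_lt 0 f \<longleftrightarrow> f = 0"
  by (auto simp: supp_lt_def poly_mapping_eq_iff fun_eq_iff)

lemma supp_lt_zero [simp]: "supp_lt k 0"
  by (simp add: supp_lt_def)

lemma supp_lt_add: "supp_lt k f \<Longrightarrow> supp_lt k g \<Longrightarrow> supp_lt k (f + g)"
  unfolding supp_lt_def lookup_add by (metis add_0)

lemma supp_lt_diff: "supp_lt k f \<Longrightarrow> supp_lt k g \<Longrightarrow> supp_lt k (f - g)"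
  unfolding supp_lt_def lookup_minus by (metis diff_zero)

lemma supp_lt_scale: "supp_lt k f \<Longrightarrow> supp_lt k (lconst c * f)"
  by (simp add: supp_lt_def)

lemma supp_lt_sum: "(\<And>i. i \<in> A \<Longrightarrow> supp_lt k (F i)) \<Longrightarrow> supp_lt k (sum F A)"
  by (induction A rule: infinite_finite_induct) (simp_all add: supp_lt_add)

lemma supp_lt_lmon: "rank n < k \<Longrightarrow> supp_lt k (lmon n)"
  by (simp add: supp_lt_def lookup_single when_def)

lemma supp_lt_mono: "supp_lt k f \<Longrightarrow> k \<le> k' \<Longrightarrow> supp_lt k' f"
  by (force simp: supp_lt_def)

lemma supp_lt_Suc: "supp_lt (Suc k) f \<Longrightarrow> Poly_Mapping.lookup f (unrank k) = 0 \<Longrightarrow> supp_lt k f"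
  unfolding supp_lt_def by (metis less_Suc_eq unrank_rank)

text \<open>The diagonal entry of the triangular operator Y at X^n, which is also the eigenvalue
  prescribed for e_n.\<close>

definition eval_Y :: "'a::field \<Rightarrow> 'a \<Rightarrow> int \<Rightarrow> 'a" where
  "eval_Y u v n = (v * u ^ nat \<bar>n\<bar>) powi (- sign0 n)"

lemma eval_Y_pos: "0 < n \<Longrightarrow> eval_Y u v n = inverse v * u powi (- n)"
  and eval_Y_nonpos: "n \<le> 0 \<Longrightarrow> eval_Y u v n = v * u powi (- n)"
  by (simp_all add: eval_Y_def sign0_def power_int_minus power_int_def power_inverse)

lemma eval_Y_0 [simp]: "eval_Y u v 0 = v"
  by (simp add: eval_Y_nonpos)

lemma linear_expand:
  assumes "laurent_linear D"
  shows "D f = (\<Sum>n\<in>Poly_Mapping.keys f. lconst (Poly_Mapping.lookup f n) * D (lmon n))"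
proof -
  have "D f = lin (\<lambda>n. D (lmon n)) f"
    by (rule linear_ext[OF assms linear_lin]) simp
  then show ?thesis
    by (simp only: lin_def)
qed

text \<open>After \<pi> the divided difference of X^n has the exponents |n|, |n| - 2, ..., 2 - |n|.
  For n > 0 this includes n itself, which changes the diagonal factor v into its inverse; for n <= 0
  all of them precede n.\<close>

lemma pol_Y_lmon:
  "supp_lt (rank n) (pol_Y u v (lmon n) - lconst (eval_Y u v n) * lmon n)"
proof -
  have pi_sum: "pol_pi u (\<Sum>i\<in>A. lmon (m + 2 * int i)) =
      (\<Sum>i\<in>A. lconst (u powi (m + 2 * int i)) * lmon (- m - 2 * int i))" for A m
    by (simp add: linear_sum[OF linear_pi])
  have Y: "pol_Y u v (lmon n) = lconst (v * u powi (- n)) * lmon n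
      + lconst (v - inverse v) * pol_pi u (ddiff_mon n)"
    by (simp add: pol_Y_def pol_T_ddiff linear_add[OF linear_pi] linear_scale[OF linear_pi]
        lconst_mult mult.assoc)
  show ?thesis
  proof (cases "0 < n")
    case True
    then obtain a where a: "n = int (Suc a)"
      by (metis gr0_implies_Suc zero_less_imp_eq_int)
    \<comment> \<open>The summands after the first one; the summand of index 0 is the multiple of
      X^n and goes into the diagonal entry.\<close>
    define S where
      "S = (\<Sum>i<a. lconst (u powi (- n + 2 * int (Suc i))) * lmon (- (- n) - 2 * int (Suc i)))"
    have nn: "nat n = Suc a"
      by (simp add: a)
    have "ddiff_mon n = - (\<Sum>i<Suc a. lmon (- n + 2 * int i) :: 'a laurent)"
      using True by (simp only: ddiff_mon_def nn less_imp_le if_True)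
    then have "pol_pi u (ddiff_mon n) =
        - (\<Sum>i<Suc a. lconst (u powi (- n + 2 * int i)) * lmon (- (- n) - 2 * int i))"
      by (simp only: linear_minus[OF linear_pi] pi_sum)
    also have "\<dots> = - (lconst (u powi (- n)) * lmon n + S)"
      unfolding sum.lessThan_Suc_shift S_def by simp
    finally have dd: "pol_pi u (ddiff_mon n) = - (lconst (u powi (- n)) * lmon n + S)" .
    have "pol_Y u v (lmon n) - lconst (eval_Y u v n) * lmon n = - (lconst (v - inverse v) * S)"
      unfolding Y dd using True by (simp add: eval_Y_pos lconst_mult lconst_diff algebra_simps)
    also have "\<dots> = lconst (inverse v - v) * S"
      by (simp add: lconst_diff algebra_simps)
    also have "supp_lt (rank n) \<dots>"
      unfolding S_def by (intro supp_lt_scale supp_lt_sum supp_lt_lmon) (simp add: rank_less_iff a)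
    finally show ?thesis .
  next
    case False
    have "supp_lt (rank n) (pol_pi u (ddiff_mon n))"
    proof (cases "n = 0")
      case False
      with \<open>\<not> 0 < n\<close> have "pol_pi u (ddiff_mon n) =
          (\<Sum>i<nat (- n). lconst (u powi (n + 2 * int i)) * lmon (- n - 2 * int i))"
        by (simp add: ddiff_mon_def pi_sum)
      moreover have "rank (- n - 2 * int i) < rank n" if "i < nat (- n)" for i
        using that False \<open>\<not> 0 < n\<close> by (auto simp: rank_less_iff)
      ultimately show ?thesis
        by (auto intro!: supp_lt_sum supp_lt_scale supp_lt_lmon)
    qed (simp add: ddiff_mon_def linear_zero[OF linear_pi])
    with False show ?thesis
      by (simp add: Y eval_Y_nonpos supp_lt_scale)
  qed
qed

lemma pol_Y_supp:
  assumes "supp_lt (Suc k) f"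
  shows "supp_lt k (pol_Y u v f - lconst (eval_Y u v (unrank k)) * f)"
proof -
  let ?D = "\<lambda>f. pol_Y u v f - lconst (eval_Y u v (unrank k)) * f"
  have "laurent_linear ?D"
    by (intro linear_diff_fun linear_mult linear_Y)
  have 1: "supp_lt k (?D (lmon n))" if "rank n < Suc k" for n
  proof -
    have eq: "?D (lmon n) = (pol_Y u v (lmon n) - lconst (eval_Y u v n) * lmon n)
        + lconst (eval_Y u v n - eval_Y u v (unrank k)) * lmon n"
      by (simp add: lconst_diff algebra_simps)
    have "supp_lt k (pol_Y u v (lmon n) - lconst (eval_Y u v n) * lmon n)"
      using pol_Y_lmon supp_lt_mono that by (metis less_Suc_eq_le)
    moreover have "supp_lt k (lconst (eval_Y u v n - eval_Y u v (unrank k)) * lmon n)"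
    proof (cases "n = unrank k")
      case False
      then have "rank n < k"
        using that by (metis less_Suc_eq unrank_rank)
      then show ?thesis
        by (intro supp_lt_scale supp_lt_lmon)
    qed simp
    ultimately show ?thesis
      unfolding eq by (rule supp_lt_add)
  qed
  have "?D f = (\<Sum>n\<in>Poly_Mapping.keys f. lconst (Poly_Mapping.lookup f n) * ?D (lmon n))"
    using \<open>laurent_linear ?D\<close> by (rule linear_expand)
  also have "supp_lt k \<dots>"
    using assms by (intro supp_lt_sum supp_lt_scale 1) (auto simp: supp_lt_def in_keys_iff)
  finally show ?thesis .
qed

lemma supp_lt_Y: "supp_lt k f \<Longrightarrow> supp_lt k (pol_Y u v f)"
proof (cases k)
  case 0
  assume "supp_lt k f"
  then show ?thesis using 0 by (simp add: supp_lt_0 linear_zero[OF linear_Y])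
next
  case (Suc j)
  assume f: "supp_lt k f"
  then have "supp_lt k (pol_Y u v f - lconst (eval_Y u v (unrank j)) * f)"
    using pol_Y_supp[of j f u v] Suc supp_lt_mono by (metis lessI less_imp_le)
  from supp_lt_add[OF this supp_lt_scale[OF f]] show ?thesis
    by (metis diff_add_cancel)
qed

lemma lookup_Y_top:
  "supp_lt (Suc (rank n)) f \<Longrightarrow>
    Poly_Mapping.lookup (pol_Y u v f) n = eval_Y u v n * Poly_Mapping.lookup f n"
  using supp_ltD[OF pol_Y_supp, of "rank n" f n u v] by (simp add: lookup_minus)

text \<open>Descending induction on the leading position: its coefficient vanishes by triangularity
  if the diagonal entry differs from c, and by assumption otherwise.\<close>

lemma Y_eigen_zero:
  assumes "pol_Y u v f = lconst c * f" "supp_lt k f"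
    and "\<And>m. rank m < k \<Longrightarrow> eval_Y u v m = c \<Longrightarrow> Poly_Mapping.lookup f m = 0"
  shows "f = 0"
  using assms(2,3)
proof (induction k)
  case (Suc k)
  have "Poly_Mapping.lookup (pol_Y u v f) (unrank k) =
      eval_Y u v (unrank k) * Poly_Mapping.lookup f (unrank k)"
    using lookup_Y_top[of "unrank k" f u v] Suc.prems(1) by simp
  then have "c * Poly_Mapping.lookup f (unrank k) =
      eval_Y u v (unrank k) * Poly_Mapping.lookup f (unrank k)"
    unfolding assms(1) lookup_lconst_mult .
  then have "Poly_Mapping.lookup f (unrank k) = 0"
    using Suc.prems(2)[of "unrank k"] by (metis lessI mult_right_cancel rank_unrank)
  then show ?case
    using Suc supp_lt_Suc by (metis less_SucI)
qed (simp add: supp_lt_0)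

text \<open>The lower terms allowed for e_n are exactly those of smaller rank, including X^(-n) for
  negative n.\<close>

lemma is_e_polynomial_iff:
  "is_e_polynomial u v n E \<longleftrightarrow> pol_Y u v E = lconst (eval_Y u v n) * E \<and>
     Poly_Mapping.lookup E n = 1 \<and> supp_lt (Suc (rank n)) E"
proof -
  have "(m \<noteq> n \<and> Poly_Mapping.lookup E m \<noteq> 0 \<longrightarrow> \<bar>m\<bar> < \<bar>n\<bar> \<or> n < 0 \<and> m = - n) \<longleftrightarrow>
      (Poly_Mapping.lookup E m \<noteq> 0 \<longrightarrow> rank m < Suc (rank n))" for m
    by (auto simp: less_Suc_eq rank_less_iff rank_eq_iff)
  then show ?thesis
    by (simp only: is_e_polynomial_def eval_Y_def supp_lt_def)
qed

lemma e_polynomial_unique: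
  assumes "is_e_polynomial u v n E" "is_e_polynomial u v n F"
    and "\<And>m. rank m < rank n \<Longrightarrow> eval_Y u v m \<noteq> eval_Y u v n"
  shows "E = F"
proof -
  have "E - F = 0"
  proof (rule Y_eigen_zero[where k = "Suc (rank n)" and c = "eval_Y u v n"])
    fix m assume "rank m < Suc (rank n)" "eval_Y u v m = eval_Y u v n"
    then have "m = n"
      using assms(3)[of m] by (auto simp: less_Suc_eq rank_eq_iff)
    then show "Poly_Mapping.lookup (E - F) m = 0"
      using assms(1,2) by (simp add: is_e_polynomial_iff lookup_minus)
  qed (use assms(1,2) in \<open>simp_all add: is_e_polynomial_iff supp_lt_diff linear_diff[OF linear_Y]
      algebra_simps\<close>)
  then show ?thesis by simp
qed

text \<open>The product of Y - y_i over the first k diagonal entries y_i. It projects onto the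
  eigenline of e_n up to a factor, and gives e_n by a formula whose coefficients can be
  specialized.\<close>

primrec Y_prod :: "'a::field \<Rightarrow> 'a \<Rightarrow> nat \<Rightarrow> 'a laurent \<Rightarrow> 'a laurent" where
  "Y_prod u v 0 f = f"
| "Y_prod u v (Suc k) f = Y_prod u v k (pol_Y u v f - lconst (eval_Y u v (unrank k)) * f)"

lemma linear_Y_prod: "laurent_linear (Y_prod u v k)"
proof (induction k)
  case (Suc k)
  have "laurent_linear (\<lambda>f. pol_Y u v f - lconst (eval_Y u v (unrank k)) * f)"
    by (intro linear_diff_fun linear_mult linear_Y)
  from linear_compose[OF Suc this] show ?case
    by (simp add: laurent_linear_def)
qed (simp add: laurent_linear_def)

lemma Y_prod_commute: "Y_prod u v k (pol_Y u v f) = pol_Y u v (Y_prod u v k f)"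
  by (induction k arbitrary: f)
    (simp_all add: linear_diff[OF linear_Y] linear_diff[OF linear_Y_prod]
      linear_scale[OF linear_Y_prod] linear_scale[OF linear_Y])

text \<open>Each factor removes the highest remaining position, in the manner of the Cayley-Hamilton
  theorem.\<close>

lemma Y_prod_zero: "supp_lt k f \<Longrightarrow> Y_prod u v k f = 0"
  by (induction k arbitrary: f) (simp_all add: supp_lt_0 pol_Y_supp)

lemma Y_prod_supp: "supp_lt k f \<Longrightarrow> supp_lt k (Y_prod u v j f)"
  by (induction j arbitrary: f) (simp_all add: supp_lt_diff supp_lt_Y supp_lt_scale)

lemma Y_prod_top:
  "supp_lt (Suc (rank n)) f \<Longrightarrow> Poly_Mapping.lookup (Y_prod u v j f) n =
    (\<Prod>i<j. eval_Y u v n - eval_Y u v (unrank i)) * Poly_Mapping.lookup f n"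
proof (induction j arbitrary: f)
  case (Suc j)
  have "supp_lt (Suc (rank n)) (pol_Y u v f - lconst (eval_Y u v (unrank j)) * f)"
    using Suc.prems by (intro supp_lt_diff supp_lt_Y supp_lt_scale)
  from Suc.IH[OF this] show ?case
    using Suc.prems by (simp only: Y_prod.simps prod.lessThan_Suc lookup_minus lookup_Y_top
      lookup_lconst_mult left_diff_distrib mult.assoc)
qed simp

text \<open>The denominator is the coefficient of X^n in the product, so the formula is regular
  wherever the eigenvalue of n differs from the preceding ones.\<close>

definition e_formula :: "'a::field \<Rightarrow> 'a \<Rightarrow> int \<Rightarrow> 'a laurent" where
  "e_formula u v n = lconst (inverse (\<Prod>i<rank n. eval_Y u v n - eval_Y u v (unrank i)))
     * Y_prod u v (rank n) (lmon n)"

lemma is_e_polynomial_e_formula: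
  assumes "\<And>m. rank m < rank n \<Longrightarrow> eval_Y u v m \<noteq> eval_Y u v n"
  shows "is_e_polynomial u v n (e_formula u v n)"
proof -
  let ?E = "Y_prod u v (rank n) (lmon n)"
  have supp: "supp_lt (Suc (rank n)) (lmon n :: 'a laurent)"
    by (simp add: supp_lt_lmon)
  have "Y_prod u v (rank n) (pol_Y u v (lmon n) - lconst (eval_Y u v n) * lmon n) = 0"
    by (rule Y_prod_zero[OF pol_Y_lmon])
  then have "pol_Y u v ?E = lconst (eval_Y u v n) * ?E"
    by (simp add: linear_diff[OF linear_Y_prod] linear_scale[OF linear_Y_prod] Y_prod_commute)
  moreover have "eval_Y u v n \<noteq> eval_Y u v (unrank i)" if "i < rank n" for i
    using assms[of "unrank i"] that by simp
  then have "(\<Prod>i<rank n. eval_Y u v n - eval_Y u v (unrank i)) \<noteq> 0"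
    by simp
  ultimately show ?thesis
    by (simp add: is_e_polynomial_iff e_formula_def linear_scale[OF linear_Y] Y_prod_top[OF supp]
        Y_prod_supp[OF supp] supp_lt_scale mult.left_commute)
qed

lemma linear_T_inv: "laurent_linear (pol_T_inv v)"
  unfolding pol_T_inv_def[abs_def] by (intro linear_diff_fun linear_mult linear_T)

text \<open>X \<pi> is an intertwiner: it exchanges the Y-eigenvalue c with the inverse of q^(1/2)
  c.\<close>

lemma pol_Y_X_pi:
  assumes "u \<noteq> 0" "v \<noteq> 0" "c \<noteq> 0" "pol_Y u v f = lconst c * f"
  shows "pol_Y u v (lX * pol_pi u f) = lconst (inverse (u * c)) * (lX * pol_pi u f)"
proof -
  have "pol_pi u (pol_T v f) = lconst c * f"
    using assms(4) by (simp add: pol_Y_def)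
  then have "pol_T v f = lconst c * pol_pi u f"
    using arg_cong[of _ _ "pol_pi u"] assms(1) linear_scale[OF linear_pi, of u c f] pol_pi_pi by metis
  then have "pol_T_inv v (pol_T v f) = lconst c * pol_T_inv v (pol_pi u f)"
    by (simp only: linear_scale[OF linear_T_inv])
  then have "lconst c * pol_T_inv v (pol_pi u f) = f"
    using assms(2) by (simp only: pol_T_inv_T not_False_eq_True)
  then have "pol_T_inv v (pol_pi u f) = lconst (inverse c) * f"
    using assms(3) by (metis lconst_inverse_left(2))
  then have "pol_Y u v (lX * pol_pi u f) = pol_pi u (lXi * (lconst (inverse c) * f))"
    by (simp add: pol_Y_def pol_T_X)
  also have "\<dots> = lconst (inverse (u * c)) * (lX * pol_pi u f)"
    using assms(1) by (simp only: pol_pi_Xi linear_scale[OF linear_pi] inverse_mult_distrib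
        lconst_mult mult.assoc mult.left_commute[of lX] not_False_eq_True)
  finally show ?thesis .
qed

lemma lookup_pi: "u \<noteq> 0 \<Longrightarrow> Poly_Mapping.lookup (pol_pi u f) m = u powi (- m) * Poly_Mapping.lookup f (- m)"
proof (induction f rule: laurent_induct)
  case (mon n)
  then show ?case by (auto simp: lookup_single when_def)
qed (simp_all add: linear_add[OF linear_pi] linear_scale[OF linear_pi] lookup_add distrib_left
    mult.left_commute)

lemma lookup_lX_mult: "Poly_Mapping.lookup (lX * f) m = Poly_Mapping.lookup f (m - 1)"
  by (simp add: lX_def lookup_lmon_mult)

text \<open>\<pi> reverses exponents and X shifts them, so the support of e_{-l} is carried to that
  of e_{l+1}. The factor u^l restores the leading coefficient, since \<pi> multiplies X^(-l) by
  u^(-l).\<close>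

lemma e_polynomial_succ:
  assumes "is_e_polynomial u v (- int l) E" "u \<noteq> 0" "v \<noteq> 0"
  shows "is_e_polynomial u v (int l + 1) (lconst (u ^ l) * (lX * pol_pi u E))"
proof -
  have E: "pol_Y u v E = lconst (eval_Y u v (- int l)) * E" "Poly_Mapping.lookup E (- int l) = 1"
      "supp_lt (Suc (rank (- int l))) E"
    using assms(1) by (simp_all add: is_e_polynomial_iff)
  have ev: "eval_Y u v (- int l) = v * u ^ l" "eval_Y u v (int l + 1) = inverse (u * (v * u ^ l))"
    using power_int_minus[of u "int (Suc l)"]
    by (simp_all add: eval_Y_nonpos eval_Y_pos power_int_of_nat[of u "Suc l"] del: of_nat_Suc
        flip: of_nat_Suc[of l, unfolded add.commute[of 1]])
  have look: "Poly_Mapping.lookup (lconst (u ^ l) * (lX * pol_pi u E)) m =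
      u ^ l * (u powi (1 - m) * Poly_Mapping.lookup E (1 - m))" for m
    using assms(2) by (simp add: lookup_lX_mult lookup_pi)
  have "supp_lt (Suc (rank (int l + 1))) (lconst (u ^ l) * (lX * pol_pi u E))"
    unfolding supp_lt_def
  proof (intro allI impI)
    fix m assume "Poly_Mapping.lookup (lconst (u ^ l) * (lX * pol_pi u E)) m \<noteq> 0"
    then have "rank (1 - m) < Suc (rank (- int l))"
      using E(3) look unfolding supp_lt_def by auto
    then show "rank m < Suc (rank (int l + 1))"
      unfolding less_Suc_eq rank_less_iff rank_eq_iff by auto
  qed
  moreover have Y: "pol_Y u v (lX * pol_pi u E) =
      lconst (inverse (u * (v * u ^ l))) * (lX * pol_pi u E)"
    using E(1) assms by (intro pol_Y_X_pi) (simp_all add: ev)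
  have "pol_Y u v (lconst (u ^ l) * (lX * pol_pi u E)) =
      lconst (eval_Y u v (int l + 1)) * (lconst (u ^ l) * (lX * pol_pi u E))"
    unfolding linear_scale[OF linear_Y] ev Y by (rule mult.left_commute)
  moreover have "Poly_Mapping.lookup (lconst (u ^ l) * (lX * pol_pi u E)) (int l + 1) = 1"
    unfolding look using assms(2) E(2) by (simp add: power_int_minus)
  ultimately show ?thesis
    by (simp only: is_e_polynomial_iff simp_thms)
qed

section \<open>Specialization of the generic polynomials\<close>

lemma eval2_simps [simp]: "eval2 u v (P + Q) = eval2 u v P + eval2 u v Q"
    "eval2 u v (P * Q) = eval2 u v P * eval2 u v Q" "eval2 u v 0 = 0" "eval2 u v 1 = 1"
    "eval2 u v (- P) = - eval2 u v P"
  by (simp_all add: eval2_def)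

lemma eval2_nonzero: "eval2 u v Q \<noteq> 0 \<Longrightarrow> Q \<noteq> 0"
  by auto

lemma specializes_to_unique:
  assumes "specializes_to u v F z" "specializes_to u v F z'"
  shows "z = z'"
proof -
  from assms(1) obtain P Q where PQ: "eval2 u v Q \<noteq> 0" "F = Fraction_Field.Fract P Q"
      "z = eval2 u v P / eval2 u v Q"
    by (auto simp: specializes_to_def)
  from assms(2) obtain P' Q' where PQ': "eval2 u v Q' \<noteq> 0" "F = Fraction_Field.Fract P' Q'"
      "z' = eval2 u v P' / eval2 u v Q'"
    by (auto simp: specializes_to_def)
  from PQ PQ' have "P * Q' = P' * Q"
    using eval2_nonzero by (metis eq_fract(1))
  then have "eval2 u v P * eval2 u v Q' = eval2 u v P' * eval2 u v Q"
    by (metis eval2_simps(2))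
  with PQ PQ' show ?thesis by (simp add: frac_eq_eq)
qed

lemma specializes_to_Fract:
  "eval2 u v Q \<noteq> 0 \<Longrightarrow> specializes_to u v (Fraction_Field.Fract P Q) (eval2 u v P / eval2 u v Q)"
  by (auto simp: specializes_to_def)

lemma specializes_to_0: "specializes_to u v 0 0" and specializes_to_1: "specializes_to u v 1 1"
  using specializes_to_Fract[of u v 1 0] specializes_to_Fract[of u v 1 1]
  by (simp_all add: Zero_fract_def One_fract_def)

lemma specializes_to_add:
  assumes "specializes_to u v F z" "specializes_to u v F' z'"
  shows "specializes_to u v (F + F') (z + z')"
proof -
  from assms(1) obtain P Q where PQ: "eval2 u v Q \<noteq> 0" "F = Fraction_Field.Fract P Q"
      "z = eval2 u v P / eval2 u v Q"
    by (auto simp: specializes_to_def)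
  from assms(2) obtain P' Q' where PQ': "eval2 u v Q' \<noteq> 0" "F' = Fraction_Field.Fract P' Q'"
      "z' = eval2 u v P' / eval2 u v Q'"
    by (auto simp: specializes_to_def)
  from PQ PQ' have "F + F' = Fraction_Field.Fract (P * Q' + P' * Q) (Q * Q')"
    using eval2_nonzero by (metis add_fract)
  with PQ PQ' specializes_to_Fract[of u v "Q * Q'" "P * Q' + P' * Q"] show ?thesis
    by (simp add: add_frac_eq)
qed

lemma specializes_to_mult:
  assumes "specializes_to u v F z" "specializes_to u v F' z'"
  shows "specializes_to u v (F * F') (z * z')"
proof -
  from assms(1) obtain P Q where PQ: "eval2 u v Q \<noteq> 0" "F = Fraction_Field.Fract P Q"
      "z = eval2 u v P / eval2 u v Q"
    by (auto simp: specializes_to_def)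
  from assms(2) obtain P' Q' where PQ': "eval2 u v Q' \<noteq> 0" "F' = Fraction_Field.Fract P' Q'"
      "z' = eval2 u v P' / eval2 u v Q'"
    by (auto simp: specializes_to_def)
  from PQ PQ' have "F * F' = Fraction_Field.Fract (P * P') (Q * Q')"
    by simp
  with PQ PQ' specializes_to_Fract[of u v "Q * Q'" "P * P'"] show ?thesis
    by simp
qed

lemma specializes_to_minus:
  assumes "specializes_to u v F z"
  shows "specializes_to u v (- F) (- z)"
proof -
  have "specializes_to u v (- 1) (- 1)"
    using specializes_to_Fract[of u v 1 "- 1"] by (simp add: One_fract_def)
  from specializes_to_mult[OF this assms] show ?thesis by simp
qed

lemma specializes_to_diff:
  "specializes_to u v F z \<Longrightarrow> specializes_to u v F' z' \<Longrightarrow> specializes_to u v (F - F') (z - z')"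
  using specializes_to_add[of u v F z "- F'" "- z'"] specializes_to_minus by simp

lemma specializes_to_inverse:
  assumes "specializes_to u v F z" "z \<noteq> 0"
  shows "specializes_to u v (inverse F) (inverse z)"
proof -
  obtain P Q where PQ: "eval2 u v Q \<noteq> 0" "F = Fraction_Field.Fract P Q"
      "z = eval2 u v P / eval2 u v Q"
    using assms by (auto simp: specializes_to_def)
  with assms(2) specializes_to_Fract[of u v P Q] show ?thesis
    by auto
qed

lemma specializes_to_sum:
  "(\<And>i. i \<in> A \<Longrightarrow> specializes_to u v (F i) (z i)) \<Longrightarrow> specializes_to u v (sum F A) (sum z A)"
  by (induction A rule: infinite_finite_induct) (simp_all add: specializes_to_0 specializes_to_add)

lemma specializes_to_prod:
  "(\<And>i. i \<in> A \<Longrightarrow> specializes_to u v (F i) (z i)) \<Longrightarrow> specializes_to u v (prod F A) (prod z A)"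
  by (induction A rule: infinite_finite_induct) (simp_all add: specializes_to_1 specializes_to_mult)

lemma specializes_to_power:
  "specializes_to u v F z \<Longrightarrow> specializes_to u v (F ^ n) (z ^ n)"
  by (induction n) (simp_all add: specializes_to_1 specializes_to_mult)

lemma specializes_to_powi:
  "specializes_to u v F z \<Longrightarrow> z \<noteq> 0 \<Longrightarrow> specializes_to u v (F powi n) (z powi n)"
  by (simp add: power_int_def specializes_to_power specializes_to_inverse)

lemma specializes_to_gens: "specializes_to u v gen_q12 u" "specializes_to u v gen_t12 v"
  using specializes_to_Fract[of u v 1 "[:[:0, 1:]:]"] specializes_to_Fract[of u v 1 "[:0, 1:]"]
  by (simp_all add: gen_q12_def gen_t12_def eval2_def)

definition lspec :: "complex \<Rightarrow> complex \<Rightarrow> ratfun laurent \<Rightarrow> complex laurent \<Rightarrow> bool" where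
  "lspec u v E p \<longleftrightarrow> (\<forall>m. specializes_to u v (Poly_Mapping.lookup E m) (Poly_Mapping.lookup p m))"

lemma lspec_unique: "lspec u v E p \<Longrightarrow> lspec u v E p' \<Longrightarrow> p = p'"
  by (rule poly_mapping_eqI) (auto simp: lspec_def intro: specializes_to_unique)

lemma lspec_add: "lspec u v E p \<Longrightarrow> lspec u v E' p' \<Longrightarrow> lspec u v (E + E') (p + p')"
  and lspec_diff: "lspec u v E p \<Longrightarrow> lspec u v E' p' \<Longrightarrow> lspec u v (E - E') (p - p')"
  and lspec_minus: "lspec u v E p \<Longrightarrow> lspec u v (- E) (- p)"
  and lspec_scale: "specializes_to u v c z \<Longrightarrow> lspec u v E p \<Longrightarrow> lspec u v (lconst c * E) (lconst z * p)"
  and lspec_X: "lspec u v E p \<Longrightarrow> lspec u v (lX * E) (lX * p)"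
  by (simp_all add: lspec_def lookup_add lookup_minus specializes_to_add specializes_to_diff
      specializes_to_minus specializes_to_mult lookup_lX_mult)

lemma lspec_sum: "(\<And>i. i \<in> A \<Longrightarrow> lspec u v (F i) (z i)) \<Longrightarrow> lspec u v (sum F A) (sum z A)"
  by (simp add: lspec_def lookup_sum specializes_to_sum)

lemma lspec_lmon: "lspec u v (lmon n) (lmon n)"
  by (simp add: lspec_def lookup_single when_def specializes_to_0 specializes_to_1)

lemma lspec_lin:
  assumes "lspec u v f p" "\<And>n. lspec u v (F n) (F' n)"
  shows "lspec u v (lin F f) (lin F' p)"
proof -
  let ?A = "Poly_Mapping.keys f \<union> Poly_Mapping.keys p"
  have "lspec u v (\<Sum>n\<in>?A. lconst (Poly_Mapping.lookup f n) * F n)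
      (\<Sum>n\<in>?A. lconst (Poly_Mapping.lookup p n) * F' n)"
    using assms(1) by (intro lspec_sum lspec_scale assms(2)) (simp add: lspec_def)
  then show ?thesis
    by (simp add: lin_superset[of ?A])
qed

lemma specializes_eval_Y:
  assumes "u \<noteq> 0" "v \<noteq> 0"
  shows "specializes_to u v (eval_Y gen_q12 gen_t12 n) (eval_Y u v n)"
  unfolding eval_Y_def using assms
  by (intro specializes_to_powi specializes_to_mult specializes_to_power specializes_to_gens) simp_all

lemma lspec_pi:
  assumes "u \<noteq> 0" "lspec u v f p"
  shows "lspec u v (pol_pi gen_q12 f) (pol_pi u p)"
  unfolding pol_pi_lin using assms
  by (intro lspec_lin lspec_scale lspec_lmon specializes_to_powi specializes_to_gens) simp_all

lemma lspec_Y: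
  assumes "u \<noteq> 0" "v \<noteq> 0" "lspec u v f p"
  shows "lspec u v (pol_Y gen_q12 gen_t12 f) (pol_Y u v p)"
proof -
  have dd: "lspec u v (ddiff_mon n) (ddiff_mon n)" for n
    by (simp add: ddiff_mon_def lspec_minus lspec_sum lspec_lmon)
  have "lspec u v (pol_T gen_t12 f) (pol_T v p)"
    unfolding pol_T_ddiff pol_s_lin using assms
    by (intro lspec_add lspec_scale lspec_lin dd lspec_lmon specializes_to_diff
        specializes_to_inverse specializes_to_gens) simp_all
  then show ?thesis
    unfolding pol_Y_def by (rule lspec_pi[OF assms(1)])
qed

lemma lspec_Y_prod:
  assumes "u \<noteq> 0" "v \<noteq> 0" "lspec u v f p"
  shows "lspec u v (Y_prod gen_q12 gen_t12 k f) (Y_prod u v k p)"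
  using assms(3)
  by (induction k arbitrary: f p)
    (simp_all add: lspec_diff lspec_Y lspec_scale specializes_eval_Y assms)

lemma lspec_e_formula:
  assumes "u \<noteq> 0" "v \<noteq> 0" "\<And>m. rank m < rank n \<Longrightarrow> eval_Y u v m \<noteq> eval_Y u v n"
  shows "lspec u v (e_formula gen_q12 gen_t12 n) (e_formula u v n)"
proof -
  have "eval_Y u v n \<noteq> eval_Y u v (unrank i)" if "i < rank n" for i
    using assms(3)[of "unrank i"] that by simp
  then have "(\<Prod>i<rank n. eval_Y u v n - eval_Y u v (unrank i)) \<noteq> 0"
    by simp
  then show ?thesis
    unfolding e_formula_def
    by (intro lspec_scale lspec_Y_prod lspec_lmon specializes_to_inverse specializes_to_prod
        specializes_to_diff specializes_eval_Y assms)
qed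

lemma powi_2_inj:
  assumes "(2 :: real) powi a = 2 powi b"
  shows "a = b"
proof (rule ccontr)
  assume "a \<noteq> b"
  then consider "a < b" | "b < a" by linarith
  then show False
    using assms power_int_strict_increasing[of a b "2 :: real"] power_int_strict_increasing[of b a "2 :: real"]
    by cases simp_all
qed

text \<open>The generic eigenvalues are distinct because their specializations at
  \<open>q\<^sup>1\<^sup>/\<^sup>2 = t\<^sup>1\<^sup>/\<^sup>2 = 2\<close> are.\<close>

lemma generic_eval_Y_inj:
  assumes "m \<noteq> n"
  shows "eval_Y gen_q12 gen_t12 m \<noteq> eval_Y gen_q12 gen_t12 n"
proof
  assume "eval_Y gen_q12 gen_t12 m = eval_Y gen_q12 gen_t12 n"
  then have "eval_Y 2 2 m = (eval_Y 2 2 n :: complex)"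
    using specializes_eval_Y[of 2 2 m] specializes_eval_Y[of 2 2 n] specializes_to_unique by simp
  moreover have "eval_Y 2 2 k = (2 :: complex) powi (if 0 < k then - 1 - k else 1 - k)" for k :: int
    using power_int_add[of "2 :: complex" "- 1" "- k"] power_int_add[of "2 :: complex" 1 "- k"]
    by (simp add: eval_Y_pos eval_Y_nonpos)
  ultimately have "(2 :: complex) powi (if 0 < m then - 1 - m else 1 - m) =
      2 powi (if 0 < n then - 1 - n else 1 - n)"
    by simp
  then have "norm ((2 :: complex) powi (if 0 < m then - 1 - m else 1 - m)) =
      norm ((2 :: complex) powi (if 0 < n then - 1 - n else 1 - n))"
    by (rule arg_cong)
  then have "(2 :: real) powi (if 0 < m then - 1 - m else 1 - m) =
      2 powi (if 0 < n then - 1 - n else 1 - n)"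
    by (simp add: norm_power_int)
  then have "(if 0 < m then - 1 - m else 1 - m) = (if 0 < n then - 1 - n else 1 - n)"
    by (rule powi_2_inj)
  with assms show False
    by (auto split: if_splits)
qed

text \<open>The generic polynomial is unique, its eigenvalues being distinct; so any expression for
  it that is regular at the given point may be specialized.\<close>

lemma e_poly_eqI:
  assumes "is_e_polynomial gen_q12 gen_t12 n E" "lspec u v E p"
  shows "e_poly u v n = p"
  unfolding e_poly_def
proof (rule the_equality)
  fix p'
  assume "\<exists>E. is_e_polynomial gen_q12 gen_t12 n E \<and>
    (\<forall>m. specializes_to u v (Poly_Mapping.lookup E m) (Poly_Mapping.lookup p' m))"
  then obtain E' where "is_e_polynomial gen_q12 gen_t12 n E'" "lspec u v E' p'"
    by (auto simp: lspec_def)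
  moreover from this(1) assms(1) have "E' = E"
    by (rule e_polynomial_unique) (metis generic_eval_Y_inj less_irrefl)
  ultimately show "p' = p"
    using assms(2) lspec_unique by blast
qed (use assms in \<open>auto simp: lspec_def\<close>)

lemma generic_e_polynomial: "is_e_polynomial gen_q12 gen_t12 n (e_formula gen_q12 gen_t12 n)"
  by (rule is_e_polynomial_e_formula) (metis generic_eval_Y_inj less_irrefl)

lemma e_poly_eq_e_formula:
  assumes "u \<noteq> 0" "v \<noteq> 0" "\<And>m. rank m < rank n \<Longrightarrow> eval_Y u v m \<noteq> eval_Y u v n"
  shows "e_poly u v n = e_formula u v n"
  using generic_e_polynomial lspec_e_formula[OF assms] by (rule e_poly_eqI)

lemma is_e_polynomial_e_poly:
  assumes "u \<noteq> 0" "v \<noteq> 0" "\<And>m. rank m < rank n \<Longrightarrow> eval_Y u v m \<noteq> eval_Y u v n"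
  shows "is_e_polynomial u v n (e_poly u v n)"
  using is_e_polynomial_e_formula[OF assms(3)] e_poly_eq_e_formula[OF assms] by simp

lemma gens_nonzero: "gen_q12 \<noteq> 0" "gen_t12 \<noteq> 0"
  using specializes_to_gens[of 1 1] specializes_to_0[of 1 1] specializes_to_unique
  by (metis zero_neq_one)+

text \<open>Only the positions before -l have to be separated from -l. Thus e_{l+1} exists also
  where its eigenvalue agrees with that of e_{-l} and \<open>e_formula\<close> for l+1 has a zero
  denominator.\<close>

lemma e_poly_succ:
  assumes "u \<noteq> 0" "v \<noteq> 0"
    and "\<And>m. rank m < rank (- int l) \<Longrightarrow> eval_Y u v m \<noteq> eval_Y u v (- int l)"
  shows "e_poly u v (int l + 1) = lconst (u ^ l) * (lX * pol_pi u (e_poly u v (- int l)))"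
proof (rule e_poly_eqI)
  let ?E = "e_formula gen_q12 gen_t12 (- int l)"
  show "is_e_polynomial gen_q12 gen_t12 (int l + 1)
      (lconst (gen_q12 ^ l) * (lX * pol_pi gen_q12 ?E))"
    using generic_e_polynomial gens_nonzero by (rule e_polynomial_succ)
  have "lspec u v ?E (e_poly u v (- int l))"
    using lspec_e_formula[OF assms] e_poly_eq_e_formula[OF assms] by simp
  then show "lspec u v (lconst (gen_q12 ^ l) * (lX * pol_pi gen_q12 ?E))
      (lconst (u ^ l) * (lX * pol_pi u (e_poly u v (- int l))))"
    by (intro lspec_scale lspec_X lspec_pi specializes_to_power specializes_to_gens assms)
qed

lemma lmon_Suc: "lmon (n + 1) = lX * lmon n" and lmon_pred: "lmon (n - 1) = lXi * lmon n"
  by (simp_all add: lX_def lmon_mult add.commute)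

text \<open>The induction for operators that are known by their value on 1 and by their commutation
  with X and X^-1.\<close>

lemma laurent_induct_X [case_names one X Xi add scale]:
  assumes "P 1" "\<And>f. P f \<Longrightarrow> P (lX * f)" "\<And>f. P f \<Longrightarrow> P (lXi * f)"
    and "\<And>f g. P f \<Longrightarrow> P g \<Longrightarrow> P (f + g)" and "\<And>c f. P f \<Longrightarrow> P (lconst c * f)"
  shows "P f"
proof (induction f rule: laurent_induct)
  case (mon n)
  have "P (lmon (int k))" for k
  proof (induction k)
    case (Suc k)
    then show ?case
      by (metis assms(2) lmon_Suc add.commute of_nat_Suc)
  qed (use assms(1) in simp)
  moreover have "P (lmon (- int k))" for k
  proof (induction k)
    case (Suc k)
    moreover have "- int (Suc k) = - int k - 1"
      by simp
    ultimately show ?case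
      by (metis assms(3) lmon_pred)
  qed (use assms(1) in simp)
  ultimately show ?case
    by (cases n rule: int_cases2) auto
qed (use assms in auto)

section \<open>Reduction of Laurent polynomials to a window\<close>

text \<open>Division with remainder by p, whose exponents span an interval of length W. The start
  \<open>a\<close> of the remainder window is independent of \<open>lo\<close>, so that the window
  can be chosen as an initial segment for \<open>rank\<close>.\<close>

locale laurent_window =
  fixes p :: "'a::field laurent" and lo a :: int and W :: nat
  assumes supp_p: "Poly_Mapping.lookup p m \<noteq> 0 \<Longrightarrow> lo \<le> m \<and> m \<le> lo + int W"
    and lo_p: "Poly_Mapping.lookup p lo \<noteq> 0" and hi_p: "Poly_Mapping.lookup p (lo + int W) \<noteq> 0"
begin

definition "in_window f \<longleftrightarrow>
  (\<forall>m. Poly_Mapping.lookup (f :: 'a laurent) m \<noteq> 0 \<longrightarrow> a \<le> m \<and> m < a + int W)"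

text \<open>The extreme terms of a nonzero multiple g p do not cancel, so its exponents span at
  least W + 1 places and do not fit into the window.\<close>

lemma window_zero:
  assumes "in_window f" "p dvd f"
  shows "f = 0"
proof (rule ccontr)
  assume "f \<noteq> 0"
  obtain g where g: "f = g * p"
    using assms(2) by (auto simp: dvd_def mult.commute)
  with \<open>f \<noteq> 0\<close> have ne: "Poly_Mapping.keys g \<noteq> {}"
    by auto
  define hi where "hi = Max (Poly_Mapping.keys g)"
  define lw where "lw = Min (Poly_Mapping.keys g)"
  have keys: "hi \<in> Poly_Mapping.keys g" "lw \<in> Poly_Mapping.keys g"
      "\<And>n. n \<in> Poly_Mapping.keys g \<Longrightarrow> lw \<le> n \<and> n \<le> hi"
    using ne by (simp_all add: hi_def lw_def)
  have look: "Poly_Mapping.lookup f m =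
      (\<Sum>n\<in>Poly_Mapping.keys g. Poly_Mapping.lookup g n * Poly_Mapping.lookup p (m - n))" for m
    unfolding g by (subst laurent_expand[of g])
      (simp add: sum_distrib_right lookup_sum mult.assoc lookup_lmon_mult)
  have "Poly_Mapping.lookup p (hi + (lo + int W) - n) = 0" if "n \<in> Poly_Mapping.keys g - {hi}" for n
    using that keys(3)[of n] supp_p[of "hi + (lo + int W) - n"] by force
  then have "Poly_Mapping.lookup f (hi + (lo + int W)) =
      Poly_Mapping.lookup g hi * Poly_Mapping.lookup p (lo + int W)"
    unfolding look using keys(1) by (subst sum.remove[of _ hi]) simp_all
  then have 1: "hi + (lo + int W) < a + int W"
    using assms(1) keys(1) hi_p by (auto simp: in_window_def in_keys_iff)
  have "Poly_Mapping.lookup p (lw + lo - n) = 0" if "n \<in> Poly_Mapping.keys g - {lw}" for n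
    using that keys(3)[of n] supp_p[of "lw + lo - n"] by force
  then have "Poly_Mapping.lookup f (lw + lo) = Poly_Mapping.lookup g lw * Poly_Mapping.lookup p lo"
    unfolding look using keys(2) by (subst sum.remove[of _ lw]) simp_all
  then have 2: "a \<le> lw + lo"
    using assms(1) keys(2) lo_p by (auto simp: in_window_def in_keys_iff)
  show False
    using 1 2 keys by fastforce
qed

lemma window_rep: "\<exists>g. in_window g \<and> p dvd f - g" if "0 < W"
proof (induction f rule: laurent_induct)
  case (add f g)
  then obtain f' g' where "in_window f'" "p dvd f - f'" "in_window g'" "p dvd g - g'"
    by blast
  moreover have "in_window (f' + g')"
    using calculation unfolding in_window_def lookup_add by (metis add_0)
  moreover have "p dvd f + g - (f' + g')"
    using calculation dvd_add[of p "f - f'" "g - g'"] by (simp add: algebra_simps)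
  ultimately show ?case by blast
next
  case (scale c f)
  then obtain f' where "in_window f'" "p dvd f - f'"
    by blast
  then show ?case
    using dvd_mult[of p "f - f'" "lconst c"]
    by (intro exI[of _ "lconst c * f'"]) (simp add: in_window_def right_diff_distrib)
next
  case (mon n)
  have X: "\<exists>g. in_window g \<and> p dvd lX * f - g" if "in_window f" for f
  proof -
    \<comment> \<open>Multiplication by X pushes at most one exponent out of the window; this
      multiple of the shifted p cancels it and has no exponent below \<open>a\<close>.\<close>
    define c where "c = Poly_Mapping.lookup f (a + int W - 1) / Poly_Mapping.lookup p (lo + int W)"
    define q where "q = lmon (a - lo) * p"
    have look: "Poly_Mapping.lookup (lX * f - lconst c * q) m =
        Poly_Mapping.lookup f (m - 1) - c * Poly_Mapping.lookup p (m - (a - lo))" for m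
      by (simp add: lookup_minus lookup_lX_mult q_def lookup_lmon_mult)
    have "in_window (lX * f - lconst c * q)"
      unfolding in_window_def
    proof (intro allI impI)
      fix m assume m: "Poly_Mapping.lookup (lX * f - lconst c * q) m \<noteq> 0"
      then have "Poly_Mapping.lookup f (m - 1) \<noteq> 0 \<or> Poly_Mapping.lookup p (m - (a - lo)) \<noteq> 0"
        unfolding look by auto
      then have "a \<le> m \<and> m \<le> a + int W"
        using that supp_p[of "m - (a - lo)"] unfolding in_window_def by force
      moreover have "m \<noteq> a + int W"
        using m hi_p unfolding look by (auto simp: c_def add.commute)
      ultimately show "a \<le> m \<and> m < a + int W" by simp
    qed
    moreover have "p dvd lX * f - (lX * f - lconst c * q)"
      by (simp add: q_def)
    ultimately show ?thesis by blast
  qed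
  have Xi: "\<exists>g. in_window g \<and> p dvd lXi * f - g" if "in_window f" for f
  proof -
    \<comment> \<open>The mirror image: X^-1 leaves the window at the bottom, and the lowest
      coefficient of p is used.\<close>
    define c where "c = Poly_Mapping.lookup f a / Poly_Mapping.lookup p lo"
    define q where "q = lmon (a - 1 - lo) * p"
    have look: "Poly_Mapping.lookup (lXi * f - lconst c * q) m =
        Poly_Mapping.lookup f (m + 1) - c * Poly_Mapping.lookup p (m - (a - 1 - lo))" for m
      by (simp add: lookup_minus lookup_lmon_mult q_def)
    have "in_window (lXi * f - lconst c * q)"
      unfolding in_window_def
    proof (intro allI impI)
      fix m assume m: "Poly_Mapping.lookup (lXi * f - lconst c * q) m \<noteq> 0"
      then have "Poly_Mapping.lookup f (m + 1) \<noteq> 0 \<or> Poly_Mapping.lookup p (m - (a - 1 - lo)) \<noteq> 0"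
        unfolding look by auto
      then have "a \<le> m + 1 \<and> m + 1 \<le> a + int W"
        using that supp_p[of "m - (a - 1 - lo)"] unfolding in_window_def by force
      moreover have "m \<noteq> a - 1"
        using m lo_p unfolding look by (auto simp: c_def)
      ultimately show "a \<le> m \<and> m < a + int W" by simp
    qed
    moreover have "p dvd lXi * f - (lXi * f - lconst c * q)"
      by (simp add: q_def)
    ultimately show ?thesis by blast
  qed
  have base: "in_window (lmon a)"
    using that by (simp add: in_window_def lookup_single when_def)
  have "\<exists>g. in_window g \<and> p dvd lmon (a + int k) - g" for k
  proof (induction k)
    case (Suc k)
    then obtain g where g: "in_window g" "p dvd lmon (a + int k) - g" by blast
    from X[OF g(1)] obtain h where h: "in_window h" "p dvd lX * g - h" by blast
    have "lmon (a + int (Suc k)) - h = lX * (lmon (a + int k) - g) + (lX * g - h)"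
      using lmon_Suc[of "a + int k"] by (simp add: algebra_simps)
    then show ?case
      using g h by (metis dvd_add dvd_mult)
  qed (use base in \<open>auto intro!: exI[of _ "lmon a"]\<close>)
  moreover have "\<exists>g. in_window g \<and> p dvd lmon (a - int k) - g" for k
  proof (induction k)
    case (Suc k)
    then obtain g where g: "in_window g" "p dvd lmon (a - int k) - g" by blast
    from Xi[OF g(1)] obtain h where h: "in_window h" "p dvd lXi * g - h" by blast
    have "lmon (a - int (Suc k)) - h = lXi * (lmon (a - int k) - g) + (lXi * g - h)"
      using lmon_pred[of "a - int k"] by (simp add: algebra_simps)
    then show ?case
      using g h by (metis dvd_add dvd_mult)
  qed (use base in \<open>auto intro!: exI[of _ "lmon a"]\<close>)
  moreover have "n = a + int (nat (n - a)) \<or> n = a - int (nat (a - n))"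
    by auto
  ultimately show ?case by metis
qed

end

section \<open>Substitution of an operator for \<open>X\<close>\<close>

text \<open>\<open>lsubst D D'\<close> is the map \<open>f(X) \<mapsto> f(D)(1)\<close>, where \<open>D'\<close> is the inverse of \<open>D\<close>.\<close>

definition lsubst ::
  "('a::field laurent \<Rightarrow> 'a laurent) \<Rightarrow> ('a laurent \<Rightarrow> 'a laurent) \<Rightarrow> 'a laurent \<Rightarrow> 'a laurent" where
  "lsubst D D' = lin (\<lambda>n. if 0 \<le> n then (D ^^ nat n) 1 else (D' ^^ nat (- n)) 1)"

text \<open>D satisfies with T and \<pi> the relations that X does. Hence f(X) -> f(D)(1) commutes
  with T and \<pi>: both orders of composition agree on 1 and obey the same rules for passing
  X.\<close>

locale laurent_twist =
  fixes u v :: "'a::field" and D D' :: "'a laurent \<Rightarrow> 'a laurent"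
  assumes u: "u \<noteq> 0" and v: "v \<noteq> 0"
    and lin_D: "laurent_linear D" and lin_D': "laurent_linear D'"
    and D_D': "D (D' f) = f" and D'_D: "D' (D f) = f"
    and T_D: "pol_T v (D f) = D' (pol_T_inv v f)"
    and pi_D: "pol_pi u (D f) = lconst u * D' (pol_pi u f)"
begin

lemma linear_lsubst: "laurent_linear (lsubst D D')"
  by (simp add: lsubst_def linear_lin)

lemma lsubst_1: "lsubst D D' 1 = 1"
  using lin_lmon[of "\<lambda>n. if 0 \<le> n then (D ^^ nat n) 1 else (D' ^^ nat (- n)) 1" 0]
  by (simp add: lsubst_def)

lemma lsubst_X: "lsubst D D' (lX * f) = D (lsubst D D' f)"
proof (rule linear_ext[of "\<lambda>f. lsubst D D' (lX * f)" "\<lambda>f. D (lsubst D D' f)"])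
  show "laurent_linear (\<lambda>f. lsubst D D' (lX * f))" "laurent_linear (\<lambda>f. D (lsubst D D' f))"
    using linear_compose[OF linear_lsubst linear_mult] linear_compose[OF lin_D linear_lsubst] .
  fix n :: int
  have "lsubst D D' (lmon (n + 1)) = D (lsubst D D' (lmon n))"
  proof (cases "0 \<le> n")
    case True
    then show ?thesis
      by (simp add: lsubst_def nat_add_distrib)
  next
    case False
    then obtain k where k: "n = - int (Suc k)"
      by (metis int_cases not_le not_less_eq_eq of_nat_0_le_iff)
    then have "nat (- n) = Suc k" "nat (- (n + 1)) = k"
      by simp_all
    \<comment> \<open>The change from powers of D' to powers of D happens only at n = - 1.\<close>
    moreover from k have "0 \<le> n + 1 \<Longrightarrow> k = 0" by simp
    ultimately show ?thesis
      using False k by (cases "0 \<le> n + 1") (simp_all add: lsubst_def D_D' del: of_nat_Suc)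
  qed
  then show "lsubst D D' (lX * lmon n) = D (lsubst D D' (lmon n))"
    by (simp only: lmon_Suc)
qed

lemma lsubst_Xi: "lsubst D D' (lXi * f) = D' (lsubst D D' f)"
  using lsubst_X[of "lXi * f"] by (simp add: D'_D)

lemma T_D': "pol_T v (D' f) = D (pol_T v f) + lconst (v - inverse v) * D' f"
proof -
  have "pol_T v (D (pol_T v f)) = D' f"
    using v by (simp add: T_D pol_T_inv_T)
  then have "pol_T_inv v (D' f) = D (pol_T v f)"
    using pol_T_inv_T[OF v] by metis
  then show ?thesis
    by (simp add: pol_T_inv_def algebra_simps)
qed

lemma pi_D': "pol_pi u (D' f) = lconst (inverse u) * D (pol_pi u f)"
proof -
  have "pol_pi u (D (pol_pi u f)) = lconst u * D' f"
    using u by (simp add: pi_D)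
  then have "lconst u * pol_pi u (D' f) = D (pol_pi u f)"
    using u by (metis linear_scale[OF linear_pi] pol_pi_pi)
  then show ?thesis
    using u by (metis lconst_inverse_left(2))
qed

lemma lsubst_T: "lsubst D D' (pol_T v f) = pol_T v (lsubst D D' f)"
proof (induction f rule: laurent_induct_X)
  case one
  then show ?case
    using linear_scale[OF linear_lsubst, of v 1] by (simp add: pol_T_1 lsubst_1)
next
  case (X f)
  then show ?case
    by (simp add: pol_T_X lsubst_Xi lsubst_X T_D pol_T_inv_def linear_diff[OF linear_lsubst]
        linear_scale[OF linear_lsubst] linear_diff[OF lin_D'] linear_scale[OF lin_D'])
next
  case (Xi f)
  then show ?case
    using v by (simp add: pol_T_Xi lsubst_Xi lsubst_X T_D' linear_add[OF linear_lsubst]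
        linear_scale[OF linear_lsubst])
qed (simp_all add: linear_add[OF linear_lsubst] linear_scale[OF linear_lsubst]
    linear_add[OF linear_T] linear_scale[OF linear_T])

lemma lsubst_pi: "lsubst D D' (pol_pi u f) = pol_pi u (lsubst D D' f)"
proof (induction f rule: laurent_induct_X)
  case (X f)
  then show ?case
    using u by (simp add: pol_pi_X lsubst_Xi lsubst_X pi_D linear_scale[OF linear_lsubst])
next
  case (Xi f)
  then show ?case
    using u by (simp add: pol_pi_Xi lsubst_Xi lsubst_X pi_D' linear_scale[OF linear_lsubst])
qed (simp_all add: lsubst_1 linear_add[OF linear_lsubst] linear_scale[OF linear_lsubst]
    linear_add[OF linear_pi] linear_scale[OF linear_pi])

lemma lsubst_Y: "lsubst D D' (pol_Y u v f) = pol_Y u v (lsubst D D' f)"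
  by (simp add: pol_Y_def lsubst_pi lsubst_T)

end

section \<open>The substitutions implementing tau_- and its inverse\<close>

definition pol_Y_inv :: "'a::field \<Rightarrow> 'a \<Rightarrow> 'a laurent \<Rightarrow> 'a laurent" where
  "pol_Y_inv u v f = pol_T_inv v (pol_pi u f)"

lemma linear_Y_inv: "laurent_linear (pol_Y_inv u v)"
  unfolding pol_Y_inv_def[abs_def] by (rule linear_compose[OF linear_T_inv linear_pi])

lemma pol_Y_Y_inv: "u \<noteq> 0 \<Longrightarrow> v \<noteq> 0 \<Longrightarrow> pol_Y u v (pol_Y_inv u v f) = f"
  and pol_Y_inv_Y: "u \<noteq> 0 \<Longrightarrow> v \<noteq> 0 \<Longrightarrow> pol_Y_inv u v (pol_Y u v f) = f"
  by (simp_all add: pol_Y_def pol_Y_inv_def pol_T_T_inv pol_T_inv_T)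

lemma pol_T_inv_Xi: "v \<noteq> 0 \<Longrightarrow> pol_T_inv v (lXi * f) = lX * pol_T v f"
  by (simp add: pol_T_inv_def pol_T_Xi)

text \<open>The automorphism \<open>\<tau>\<^sub>-\<close> replaces \<open>X\<close> by \<open>q\<^sup>1\<^sup>/\<^sup>4 Y X\<close>, and its inverse replaces \<open>X\<close> by
  \<open>q\<^sup>-\<^sup>1\<^sup>/\<^sup>4 Y\<^sup>-\<^sup>1 X\<close>; both signs of \<open>q\<^sup>1\<^sup>/\<^sup>4\<close> are admissible here.\<close>

lemma laurent_twist_tau:
  assumes "u \<noteq> 0" "v \<noteq> 0" "c ^ 2 = (u :: 'a::field)"
  shows "laurent_twist u v (\<lambda>f. lconst c * pol_Y u v (lX * f))
      (\<lambda>f. lconst (inverse c) * (lXi * pol_Y_inv u v f))"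
proof
  have c: "c \<noteq> 0" and cu: "u * inverse c = c" "c * inverse u = inverse c"
    using assms by (auto simp: power2_eq_square)
  fix f :: "'a laurent"
  show "laurent_linear (\<lambda>f. lconst c * pol_Y u v (lX * f))"
    by (intro linear_mult_fun linear_compose[OF linear_Y] linear_mult)
  show "laurent_linear (\<lambda>f. lconst (inverse c) * (lXi * pol_Y_inv u v f))"
    by (intro linear_mult_fun linear_Y_inv)
  show "lconst c * pol_Y u v (lX * (lconst (inverse c) * (lXi * pol_Y_inv u v f))) = f"
    using assms c by (simp add: mult.left_commute[of lX] linear_scale[OF linear_Y] pol_Y_Y_inv)
  show "lconst (inverse c) * (lXi * pol_Y_inv u v (lconst c * pol_Y u v (lX * f))) = f"
    using assms c by (simp add: mult.left_commute[of lXi] linear_scale[OF linear_Y_inv] pol_Y_inv_Y)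
  have "pol_T v (lconst c * pol_Y u v (lX * f)) = lconst c * pol_T v (pol_pi u (lXi * pol_T_inv v f))"
    by (simp add: linear_scale[OF linear_T] pol_Y_def pol_T_X)
  also have "\<dots> = lconst (c * inverse u) * (lXi * pol_T_inv v (pol_pi u (pol_T_inv v f)))"
    using assms(1) by (simp add: pol_pi_Xi linear_scale[OF linear_T] pol_T_X lconst_mult mult.assoc)
  finally show "pol_T v (lconst c * pol_Y u v (lX * f)) =
      lconst (inverse c) * (lXi * pol_Y_inv u v (pol_T_inv v f))"
    by (simp only: cu pol_Y_inv_def)
  have "pol_pi u (lconst c * pol_Y u v (lX * f)) = lconst c * (lXi * pol_T_inv v f)"
    using assms(1) by (simp add: linear_scale[OF linear_pi] pol_Y_def pol_T_X)
  also have "\<dots> = lconst (u * inverse c) * (lXi * pol_Y_inv u v (pol_pi u f))"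
    using assms(1) by (simp only: cu pol_Y_inv_def pol_pi_pi not_False_eq_True)
  finally show "pol_pi u (lconst c * pol_Y u v (lX * f)) =
      lconst u * (lconst (inverse c) * (lXi * pol_Y_inv u v (pol_pi u f)))"
    by (simp only: lconst_mult mult.assoc)
qed (use assms in simp_all)

lemma laurent_twist_tau_inv:
  assumes "u \<noteq> 0" "v \<noteq> 0" "c ^ 2 = (u :: 'a::field)"
  shows "laurent_twist u v (\<lambda>f. lconst (inverse c) * pol_Y_inv u v (lX * f))
      (\<lambda>f. lconst c * (lXi * pol_Y u v f))"
proof
  have c: "c \<noteq> 0" and cu: "inverse c * u = c"
    using assms by (auto simp: power2_eq_square)
  fix f :: "'a laurent"
  show "laurent_linear (\<lambda>f. lconst (inverse c) * pol_Y_inv u v (lX * f))"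
    by (intro linear_mult_fun linear_compose[OF linear_Y_inv] linear_mult)
  show "laurent_linear (\<lambda>f. lconst c * (lXi * pol_Y u v f))"
    by (intro linear_mult_fun linear_Y)
  show "lconst (inverse c) * pol_Y_inv u v (lX * (lconst c * (lXi * pol_Y u v f))) = f"
    using assms c by (simp add: mult.left_commute[of lX] linear_scale[OF linear_Y_inv] pol_Y_inv_Y)
  show "lconst c * (lXi * pol_Y u v (lconst (inverse c) * pol_Y_inv u v (lX * f))) = f"
    using assms c by (simp add: mult.left_commute[of lXi] linear_scale[OF linear_Y] pol_Y_Y_inv)
  have "pol_T v (lconst (inverse c) * pol_Y_inv u v (lX * f)) = lconst (inverse c * u) * (lXi * pol_pi u f)"
    using assms by (simp add: linear_scale[OF linear_T] pol_Y_inv_def pol_T_T_inv pol_pi_X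
        lconst_mult mult.assoc)
  then show "pol_T v (lconst (inverse c) * pol_Y_inv u v (lX * f)) =
      lconst c * (lXi * pol_Y u v (pol_T_inv v f))"
    using assms by (simp only: cu pol_Y_def pol_T_T_inv not_False_eq_True)
  have "pol_pi u (lconst (inverse c) * pol_Y_inv u v (lX * f)) =
      lconst (inverse c * u) * pol_pi u (lX * pol_T v (pol_pi u f))"
    using assms by (simp add: linear_scale[OF linear_pi] pol_Y_inv_def pol_pi_X
        linear_scale[OF linear_T_inv] pol_T_inv_Xi lconst_mult mult.assoc)
  also have "\<dots> = lconst c * (lconst u * (lXi * pol_Y u v (pol_pi u f)))"
    using assms(1) by (simp only: cu pol_pi_X pol_Y_def not_False_eq_True)
  finally show "pol_pi u (lconst (inverse c) * pol_Y_inv u v (lX * f)) =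
      lconst u * (lconst c * (lXi * pol_Y u v (pol_pi u f)))"
    by (simp only: mult.left_commute[of "lconst c"])
qed (use assms in simp_all)

definition tau_op :: "'a::field \<Rightarrow> 'a \<Rightarrow> 'a \<Rightarrow> 'a laurent \<Rightarrow> 'a laurent" where
  "tau_op u v c = lsubst (\<lambda>f. lconst c * pol_Y u v (lX * f))
     (\<lambda>f. lconst (inverse c) * (lXi * pol_Y_inv u v f))"

definition tau_op_inv :: "'a::field \<Rightarrow> 'a \<Rightarrow> 'a \<Rightarrow> 'a laurent \<Rightarrow> 'a laurent" where
  "tau_op_inv u v c = lsubst (\<lambda>f. lconst (inverse c) * pol_Y_inv u v (lX * f))
     (\<lambda>f. lconst c * (lXi * pol_Y u v f))"

text \<open>Both substitutions commute with Y, so each composition commutes with X and X^-1; as it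
  fixes 1, it is the identity.\<close>

lemma tau_op_inverse:
  assumes "u \<noteq> 0" "v \<noteq> 0" "c ^ 2 = (u :: 'a::field)"
  shows "tau_op u v c (tau_op_inv u v c f) = f" "tau_op_inv u v c (tau_op u v c f) = f"
proof -
  interpret t: laurent_twist u v "\<lambda>f. lconst c * pol_Y u v (lX * f)"
      "\<lambda>f. lconst (inverse c) * (lXi * pol_Y_inv u v f)"
    by (rule laurent_twist_tau[OF assms])
  interpret t': laurent_twist u v "\<lambda>f. lconst (inverse c) * pol_Y_inv u v (lX * f)"
      "\<lambda>f. lconst c * (lXi * pol_Y u v f)"
    by (rule laurent_twist_tau_inv[OF assms])
  note t = t.lsubst_1 t.lsubst_X t.lsubst_Xi t.lsubst_Y t.linear_lsubst
  note t = t[folded tau_op_def]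
  note t' = t'.lsubst_1 t'.lsubst_X t'.lsubst_Xi t'.lsubst_Y t'.linear_lsubst
  note t' = t'[folded tau_op_inv_def]
  have c: "c \<noteq> 0"
    using assms by auto
  have Yi: "tau_op u v c (pol_Y_inv u v f) = pol_Y_inv u v (tau_op u v c f)" for f
    using t(4)[of "pol_Y_inv u v f"] assms by (metis pol_Y_Y_inv pol_Y_inv_Y)
  have Yi': "tau_op_inv u v c (pol_Y_inv u v f) = pol_Y_inv u v (tau_op_inv u v c f)" for f
    using t'(4)[of "pol_Y_inv u v f"] assms by (metis pol_Y_Y_inv pol_Y_inv_Y)
  show "tau_op u v c (tau_op_inv u v c f) = f"
    by (induction f rule: laurent_induct_X)
      (use c assms in \<open>simp_all add: t t' linear_scale[OF t(5)] linear_scale[OF t'(5)] linear_add[OF t(5)]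
        linear_add[OF t'(5)] Yi linear_scale[OF linear_Y] linear_scale[OF linear_Y_inv]
        pol_Y_Y_inv pol_Y_inv_Y\<close>)
  show "tau_op_inv u v c (tau_op u v c f) = f"
    by (induction f rule: laurent_induct_X)
      (use c assms in \<open>simp_all add: t t' linear_scale[OF t(5)] linear_scale[OF t'(5)] linear_add[OF t(5)]
        linear_add[OF t'(5)] Yi' linear_scale[OF linear_Y] linear_scale[OF linear_Y_inv]
        pol_Y_Y_inv pol_Y_inv_Y\<close>)
qed

section \<open>Roots of unity and invariant ideals\<close>

lemma primitive_root_nonzero: "primitive_root_of_unity M u \<Longrightarrow> u \<noteq> 0"
  by (auto simp: primitive_root_of_unity_def power_0_left)

lemma dvd_abs_less_imp_zero:
  fixes x y :: int
  assumes "y dvd x" "\<bar>x\<bar> < y"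
  shows "x = 0"
  using assms dvd_imp_le_int[of x y] by linarith

lemma primitive_root_powi_eq:
  assumes "primitive_root_of_unity M u"
  shows "u powi a = u powi b \<longleftrightarrow> int M dvd a - b"
proof -
  have u: "u \<noteq> 0" and M: "0 < M" and uM: "u ^ M = 1"
    using assms primitive_root_nonzero by (auto simp: primitive_root_of_unity_def)
  have "u powi (a - b) = u powi ((a - b) mod int M)"
  proof -
    have "u powi (a - b) = u powi (int M * ((a - b) div int M) + (a - b) mod int M)"
      by simp
    also have "\<dots> = (u ^ M) powi ((a - b) div int M) * u powi ((a - b) mod int M)"
      by (simp only: power_int_add[OF disjI1[OF u]] power_int_mult power_int_of_nat)
    finally show ?thesis by (simp add: uM)
  qed
  moreover have "u powi ((a - b) mod int M) = 1 \<longleftrightarrow> (a - b) mod int M = 0"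
  proof
    assume 1: "u powi ((a - b) mod int M) = 1"
    define m where "m = nat ((a - b) mod int M)"
    have m: "int m = (a - b) mod int M" "m < M"
      using M by (simp_all add: m_def nat_less_iff)
    then have "u ^ m = 1"
      using 1 by (metis power_int_of_nat)
    moreover have "0 < m \<Longrightarrow> u ^ m \<noteq> 1"
      using assms m(2) by (simp add: primitive_root_of_unity_def)
    ultimately have "m = 0"
      by blast
    then show "(a - b) mod int M = 0"
      using m(1) by simp
  qed simp
  moreover have "u powi (a - b) = 1 \<longleftrightarrow> u powi a = u powi b"
    using u by (simp add: power_int_diff)
  ultimately show ?thesis
    by (simp add: dvd_eq_mod_eq_0)
qed

lemma primitive_root_pow_eq_1:
  assumes "primitive_root_of_unity M u"
  shows "u ^ m = 1 \<longleftrightarrow> M dvd m"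
  using primitive_root_powi_eq[OF assms, of "int m" 0] by simp

text \<open>Evaluation at x, with the value kept as a constant Laurent polynomial so that it is
  again an instance of \<open>lin\<close>.\<close>

definition leval :: "'a::field \<Rightarrow> 'a laurent \<Rightarrow> 'a laurent" where
  "leval x = lin (\<lambda>n. lconst (x powi n))"

lemma leval_mult: "x \<noteq> 0 \<Longrightarrow> leval x (f * g) = leval x f * leval x g"
  unfolding leval_def by (rule lin_mult) (simp add: power_int_add lconst_mult)

lemma leval_lmon [simp]: "leval x (lmon n) = lconst (x powi n)"
  by (simp add: leval_def)

lemma leval_lX [simp]: "leval x lX = lconst x"
  by (simp add: lX_def)

lemma leval_1 [simp]: "leval x 1 = 1"
  using leval_lmon[of x 0] by (simp only: lmon_0 power_int_0_right lconst_simps)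

lemma linear_leval: "laurent_linear (leval x)"
  by (simp add: leval_def linear_lin)

lemma leval_lconst [simp]: "leval x (lconst c) = lconst c"
  using linear_scale[OF linear_leval, of x c 1] by simp

lemma leval_power: "x \<noteq> 0 \<Longrightarrow> leval x (f ^ n) = leval x f ^ n"
  by (induction n) (simp_all add: leval_mult)

lemma leval_prod: "x \<noteq> 0 \<Longrightarrow> leval x (prod F A) = (\<Prod>i\<in>A. leval x (F i))"
  by (induction A rule: infinite_finite_induct) (simp_all add: leval_mult)

lemma lconst_power: "lconst c ^ n = lconst (c ^ n)"
  by (induction n) (simp_all add: lconst_mult)

text \<open>\<open>M\<close> is the order of u. As t^-1 = u^J, each diagonal entry of Y is v times a
  power of u, with exponent J - m for positive m and - m otherwise. The last two assumptions place
  these exponents injectively in [0, M), which makes the eigenvalues distinct;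
  \<open>window_rank\<close> makes the window stable under Y.\<close>

locale daha_window = laurent_window p lo a W for p :: "complex laurent" and lo a W +
  fixes u v :: complex and M :: nat and J :: int
  assumes u_primitive: "primitive_root_of_unity M u" and v: "v \<noteq> 0"
    and W_pos: "0 < W"
    and window_rank: "rank m < W \<longleftrightarrow> a \<le> m \<and> m < a + int W"
    and T_p: "p dvd pol_T v p" and pi_p: "p dvd pol_pi u p"
    and inverse_v: "inverse v = v * u powi J"
    and exponents: "rank m < W \<Longrightarrow> 0 \<le> (if 0 < m then J - m else - m) \<and>
      (if 0 < m then J - m else - m) < int M"
    and exponents_inj: "rank m < W \<Longrightarrow> rank n < W \<Longrightarrow>
      (if 0 < m then J - m else - m) = (if 0 < n then J - n else - n) \<Longrightarrow> m = n"
begin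

lemma u: "u \<noteq> 0"
  using u_primitive by (rule primitive_root_nonzero)

lemma in_window_iff: "in_window f \<longleftrightarrow> supp_lt W f"
  by (simp add: in_window_def supp_lt_def window_rank)

lemma supp_lt_zero_if_dvd: "supp_lt W f \<Longrightarrow> p dvd f \<Longrightarrow> f = 0"
  using window_zero by (simp add: in_window_iff)

lemma supp_lt_rep: "\<exists>g. supp_lt W g \<and> p dvd f - g"
  using window_rep[OF W_pos] by (simp add: in_window_iff)

lemma eval_Y_exponent: "eval_Y u v m = v * u powi (if 0 < m then J - m else - m)"
proof (cases "0 < m")
  case True
  have "u powi (J + (- m)) = u powi J * u powi (- m)"
    by (rule power_int_add) (simp add: u)
  with True show ?thesis
    by (simp add: eval_Y_pos inverse_v mult.assoc)
qed (simp add: eval_Y_nonpos)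

lemma eval_Y_inj:
  assumes "rank m < W" "rank n < W" "eval_Y u v m = eval_Y u v n"
  shows "m = n"
proof -
  let ?e = "\<lambda>m. if 0 < m then J - m else - m"
  have "int M dvd ?e m - ?e n"
    using assms(3) v primitive_root_powi_eq[OF u_primitive] by (simp add: eval_Y_exponent)
  moreover have "\<bar>?e m - ?e n\<bar> < int M"
    using exponents[OF assms(1)] exponents[OF assms(2)] by linarith
  ultimately have "?e m - ?e n = 0"
    by (rule dvd_abs_less_imp_zero)
  then have "?e m = ?e n"
    by (simp only: right_minus_eq)
  then show ?thesis
    using exponents_inj[OF assms(1,2)] by simp
qed

text \<open>All eigenvalues differ from v by M-th roots of unity. This is why the M-th power of Y is
  scalar on the window.\<close>

lemma eval_Y_power: "eval_Y u v m ^ M = v ^ M"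
proof -
  have "(u powi k) ^ M = 1" for k
  proof -
    have "(u powi k) ^ M = u powi (k * int M)"
      by (simp only: power_int_mult power_int_of_nat)
    also have "\<dots> = (u ^ M) powi k"
      by (subst mult.commute) (simp only: power_int_mult power_int_of_nat)
    finally show ?thesis
      using u_primitive by (simp add: primitive_root_of_unity_def)
  qed
  then show ?thesis
    unfolding eval_Y_exponent power_mult_distrib by simp
qed

text \<open>T is not linear over the Laurent polynomials, but its rules for X and X^-1 express T (g
  p) through multiples of T p and p.\<close>

lemma dvd_T: "p dvd f \<Longrightarrow> p dvd pol_T v f"
proof -
  have *: "p dvd pol_T v (g * p)" for g
  proof (induction g rule: laurent_induct_X)
    case (X f)
    then show ?case
      by (simp add: mult.assoc pol_T_X pol_T_inv_def dvd_diff dvd_mult)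
  next
    case (Xi f)
    then show ?case
      using v by (simp add: mult.assoc pol_T_Xi dvd_add dvd_mult)
  qed (simp_all add: T_p distrib_right mult.assoc linear_add[OF linear_T] linear_scale[OF linear_T]
      dvd_add dvd_mult)
  assume "p dvd f"
  then show ?thesis
    using * by (auto simp: dvd_def mult.commute)
qed

lemma dvd_pi: "p dvd f \<Longrightarrow> p dvd pol_pi u f"
  using pi_p u by (elim dvdE) (simp add: pol_pi_mult)

lemma dvd_T_inv: "p dvd f \<Longrightarrow> p dvd pol_T_inv v f"
  by (simp add: pol_T_inv_def dvd_T)

lemma dvd_Y: "p dvd f \<Longrightarrow> p dvd pol_Y u v f" and dvd_Y_inv: "p dvd f \<Longrightarrow> p dvd pol_Y_inv u v f"
  by (simp_all add: pol_Y_def pol_Y_inv_def dvd_T dvd_T_inv dvd_pi)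

text \<open>The remainder of f is a true eigenvector: its defect lies both in the ideal and, Y being
  triangular, in the window.\<close>

lemma window_eigenvector:
  assumes "p dvd pol_Y u v f - lconst c * f"
  shows "\<exists>g. supp_lt W g \<and> p dvd f - g \<and> pol_Y u v g = lconst c * g"
proof -
  obtain g where g: "supp_lt W g" "p dvd f - g"
    using supp_lt_rep by blast
  have "p dvd pol_Y u v (f - g) - lconst c * (f - g)"
    using g(2) by (simp add: dvd_Y dvd_diff)
  with assms have "p dvd (pol_Y u v f - lconst c * f) - (pol_Y u v (f - g) - lconst c * (f - g))"
    by (rule dvd_diff)
  then have "p dvd pol_Y u v g - lconst c * g"
    by (simp add: linear_diff[OF linear_Y] algebra_simps)
  moreover have "supp_lt W (pol_Y u v g - lconst c * g)"
    using g(1) by (intro supp_lt_diff supp_lt_Y supp_lt_scale)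
  ultimately show ?thesis
    using g supp_lt_zero_if_dvd by fastforce
qed

lemma dvd_if_eigenvector:
  assumes "p dvd pol_Y u v f - lconst c * f" "\<And>m. rank m < W \<Longrightarrow> eval_Y u v m \<noteq> c"
  shows "p dvd f"
  using window_eigenvector[OF assms(1)] Y_eigen_zero[of u v _ c W] assms(2) by fastforce

lemma eigenvector_unique:
  assumes "supp_lt W f" "pol_Y u v f = lconst (eval_Y u v n) * f"
    and "is_e_polynomial u v n E" "rank n < W"
  shows "f = lconst (Poly_Mapping.lookup f n) * E"
proof -
  let ?c = "Poly_Mapping.lookup f n"
  have E: "pol_Y u v E = lconst (eval_Y u v n) * E" "Poly_Mapping.lookup E n = 1"
      "supp_lt (Suc (rank n)) E"
    using assms(3) by (simp_all add: is_e_polynomial_iff)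
  have "f - lconst ?c * E = 0"
  proof (rule Y_eigen_zero)
    show "pol_Y u v (f - lconst ?c * E) = lconst (eval_Y u v n) * (f - lconst ?c * E)"
      by (simp add: linear_diff[OF linear_Y] linear_scale[OF linear_Y] assms(2) E(1) right_diff_distrib
        mult.left_commute)
    show "supp_lt W (f - lconst ?c * E)"
      using assms(1,4) by (intro supp_lt_diff supp_lt_scale supp_lt_mono[OF E(3)] Suc_leI)
    fix m assume "rank m < W" "eval_Y u v m = eval_Y u v n"
    then have "m = n"
      using eval_Y_inj assms(4) by blast
    then show "Poly_Mapping.lookup (f - lconst ?c * E) m = 0"
      by (simp add: lookup_minus E(2))
  qed
  then show ?thesis by simp
qed

lemma is_e_polynomial_window:
  assumes "rank n < W"
  shows "is_e_polynomial u v n (e_formula u v n)"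
  using assms eval_Y_inj by (intro is_e_polynomial_e_formula) (metis less_irrefl less_trans)

text \<open>The value v is the diagonal entry at exponent 0, and its eigenline in the window is
  spanned by 1.\<close>

lemma commutant_const:
  assumes "p dvd pol_Y u v f - lconst v * f"
  shows "\<exists>c. p dvd f - lconst c"
proof -
  obtain g where g: "supp_lt W g" "p dvd f - g" "pol_Y u v g = lconst v * g"
    using window_eigenvector[OF assms] by blast
  have "is_e_polynomial u v 0 1"
    by (simp add: is_e_polynomial_iff pol_Y_1 rank_def supp_lt_def lookup_one when_def)
  then have "g = lconst (Poly_Mapping.lookup g 0) * 1"
    using g W_pos by (intro eigenvector_unique) (simp_all add: rank_def)
  with g(2) show ?thesis by (metis mult_1_right)
qed

lemma linear_funpow: "laurent_linear D \<Longrightarrow> laurent_linear (D ^^ k)"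
  by (induction k) (simp_all add: laurent_linear_def)

lemma dvd_Y_power: "p dvd f \<Longrightarrow> p dvd (pol_Y u v ^^ k) f"
  by (induction k) (simp_all add: dvd_Y)

text \<open>Y is diagonalizable on the window: the e-polynomials are split off one position at a
  time, and the M-th powers of their eigenvalues agree.\<close>

lemma Y_power_window:
  assumes "supp_lt k f" "k \<le> W"
  shows "(pol_Y u v ^^ M) f = lconst (v ^ M) * f"
  using assms
proof (induction k arbitrary: f)
  case 0
  then show ?case
    using linear_zero[OF linear_funpow[OF linear_Y]] by (simp add: supp_lt_0)
next
  case (Suc k)
  define E where "E = e_formula u v (unrank k)"
  define c where "c = Poly_Mapping.lookup f (unrank k)"
  have "is_e_polynomial u v (unrank k) E"
    unfolding E_def using Suc.prems by (intro is_e_polynomial_window) simp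
  then have E: "pol_Y u v E = lconst (eval_Y u v (unrank k)) * E"
      "Poly_Mapping.lookup E (unrank k) = 1" "supp_lt (Suc k) E"
    by (simp_all add: is_e_polynomial_iff)
  have "supp_lt k (f - lconst c * E)"
    by (rule supp_lt_Suc) (use Suc.prems E in \<open>simp_all add: supp_lt_diff supp_lt_scale lookup_minus c_def\<close>)
  then have 1: "(pol_Y u v ^^ M) (f - lconst c * E) = lconst (v ^ M) * (f - lconst c * E)"
    using Suc by simp
  have "(pol_Y u v ^^ j) E = lconst (eval_Y u v (unrank k) ^ j) * E" for j
    by (induction j) (simp_all add: linear_scale[OF linear_Y] E(1) lconst_mult mult.assoc mult.left_commute)
  then have 2: "(pol_Y u v ^^ M) E = lconst (v ^ M) * E"
    by (simp add: eval_Y_power)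
  show ?case
    using 1 2 by (simp add: linear_diff[OF linear_funpow[OF linear_Y]]
        linear_scale[OF linear_funpow[OF linear_Y]] right_diff_distrib mult.left_commute)
qed

lemma Y_power_scalar: "p dvd (pol_Y u v ^^ M) f - lconst (v ^ M) * f"
proof -
  obtain g where g: "supp_lt W g" "p dvd f - g"
    using supp_lt_rep by blast
  have "(pol_Y u v ^^ M) f - lconst (v ^ M) * f =
      (pol_Y u v ^^ M) (f - g) - lconst (v ^ M) * (f - g)"
    using Y_power_window[OF g(1)]
    by (simp add: linear_diff[OF linear_funpow[OF linear_Y]] right_diff_distrib)
  then show ?thesis
    using g(2) by (simp add: dvd_Y_power dvd_diff)
qed

lemma Y_power_scalar_imp:
  assumes "3 \<le> W" and c: "\<And>f. p dvd (pol_Y u v ^^ m) f - lconst c * f"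
  shows "M dvd m"
proof -
  have supp: "supp_lt W ((pol_Y u v ^^ m) f - lconst c * f)" if "supp_lt W f" for f
  proof -
    have "supp_lt W ((pol_Y u v ^^ m) f)"
      using that by (induction m) (simp_all add: supp_lt_Y)
    with that show ?thesis by (intro supp_lt_diff supp_lt_scale)
  qed
  have eq: "eval_Y u v n ^ m = c" if "rank n < W" for n
  proof -
    have n: "supp_lt (Suc (rank n)) (lmon n :: complex laurent)"
      by (simp add: supp_lt_lmon)
    have "supp_lt (Suc (rank n)) ((pol_Y u v ^^ j) (lmon n)) \<and>
        Poly_Mapping.lookup ((pol_Y u v ^^ j) (lmon n)) n = eval_Y u v n ^ j" for j
      by (induction j) (simp_all add: n supp_lt_Y lookup_Y_top)
    moreover have "(pol_Y u v ^^ m) (lmon n) - lconst c * lmon n = 0"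
      using that by (intro supp_lt_zero_if_dvd supp c) (simp add: supp_lt_lmon)
    then have "Poly_Mapping.lookup ((pol_Y u v ^^ m) (lmon n) - lconst c * lmon n) n = 0"
      by (simp only: lookup_zero)
    ultimately show ?thesis
      by (simp add: lookup_minus)
  qed
  \<comment> \<open>The exponents 0 and - 1 have eigenvalues v and v u;
    \<open>rank (- 1) = 2\<close> is the reason for W being at least 3.\<close>
  have "v ^ m = c" "(v * u) ^ m = c"
    using eq[of 0] eq[of "- 1"] assms(1) by (simp_all add: rank_def eval_Y_nonpos)
  then have "u ^ m = 1"
    using v by (auto simp: power_mult_distrib)
  then show ?thesis
    using primitive_root_pow_eq_1[OF u_primitive] by simp
qed

text \<open>A congruence X^m = c modulo p is evaluated at two roots of p with quotient u.\<close>

lemma X_power_scalar_imp: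
  assumes "x \<noteq> 0" "leval x p = 0" "leval (u * x) p = 0" "p dvd lX ^ m - lconst c"
  shows "M dvd m"
proof -
  have "y ^ m = c" if "y \<noteq> 0" "leval y p = 0" for y
  proof -
    have "leval y (lX ^ m - lconst c) = 0"
      using assms(4) that by (elim dvdE) (simp add: leval_mult)
    then show ?thesis
      using that(1) by (simp add: linear_diff[OF linear_leval] leval_power lconst_power)
  qed
  then have "x ^ m = c" "(u * x) ^ m = c"
    using assms u by simp_all
  then have "u ^ m = 1"
    using assms(1) by (auto simp: power_mult_distrib)
  then show ?thesis
    using primitive_root_pow_eq_1[OF u_primitive] by simp
qed

text \<open>The substitution sends g p to g(D) applied to the image of p, and D and its inverse
  preserve the ideal.\<close>

lemma dvd_tau_op:
  assumes "p dvd tau_op u v c p" "c ^ 2 = u" "p dvd f"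
  shows "p dvd tau_op u v c f"
proof -
  interpret t: laurent_twist u v "\<lambda>f. lconst c * pol_Y u v (lX * f)"
      "\<lambda>f. lconst (inverse c) * (lXi * pol_Y_inv u v f)"
    using u v assms(2) by (rule laurent_twist_tau)
  note t = t.lsubst_X t.lsubst_Xi t.linear_lsubst
  note t = t[folded tau_op_def]
  have "p dvd tau_op u v c (g * p)" for g
    by (induction g rule: laurent_induct_X)
      (simp_all add: assms(1) mult.assoc t(1,2) distrib_right linear_add[OF t(3)] linear_scale[OF t(3)]
        dvd_add dvd_mult dvd_Y dvd_Y_inv)
  then show ?thesis
    using assms(3) by (auto simp: dvd_def mult.commute)
qed

lemma dvd_tau_op_inv:
  assumes "p dvd tau_op_inv u v c p" "c ^ 2 = u" "p dvd f"
  shows "p dvd tau_op_inv u v c f"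
proof -
  interpret t: laurent_twist u v "\<lambda>f. lconst (inverse c) * pol_Y_inv u v (lX * f)"
      "\<lambda>f. lconst c * (lXi * pol_Y u v f)"
    using u v assms(2) by (rule laurent_twist_tau_inv)
  note t = t.lsubst_X t.lsubst_Xi t.linear_lsubst
  note t = t[folded tau_op_inv_def]
  have "p dvd tau_op_inv u v c (g * p)" for g
    by (induction g rule: laurent_induct_X)
      (simp_all add: assms(1) mult.assoc t(1,2) distrib_right linear_add[OF t(3)] linear_scale[OF t(3)]
        dvd_add dvd_mult dvd_Y dvd_Y_inv)
  then show ?thesis
    using assms(3) by (auto simp: dvd_def mult.commute)
qed

end

section \<open>Operators on quotients\<close>

lemma laurent_ring_simps [simp]:
  "carrier laurent_ring = UNIV" "f \<otimes>\<^bsub>laurent_ring\<^esub> g = f * g" "f \<oplus>\<^bsub>laurent_ring\<^esub> g = f + g"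
  "\<zero>\<^bsub>laurent_ring\<^esub> = 0" "\<one>\<^bsub>laurent_ring\<^esub> = 1"
  by (simp_all add: laurent_ring_def)

lemma cring_laurent_ring: "cring laurent_ring"
proof (rule cringI)
  show "abelian_group laurent_ring"
  proof (rule abelian_groupI)
    fix x :: "complex laurent"
    show "\<exists>y\<in>carrier laurent_ring. y \<oplus>\<^bsub>laurent_ring\<^esub> x = \<zero>\<^bsub>laurent_ring\<^esub>"
      by (intro bexI[of _ "- x"]) simp_all
  qed (simp_all add: algebra_simps)
  show "Group.comm_monoid laurent_ring"
    by (rule comm_monoidI) (simp_all add: algebra_simps)
qed (simp_all add: algebra_simps)

interpretation laurent_ring: cring laurent_ring
  by (rule cring_laurent_ring)

lemma principal_ideal_eq: "PIdl\<^bsub>laurent_ring\<^esub> p = {f. p dvd f}"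
  by (auto simp: cgenideal_def dvd_def mult.commute)

lemma quot_class_eq: "quot_class p f = {g. p dvd g - f}"
  unfolding quot_class_def principal_ideal_eq a_r_coset_def'
proof (intro equalityI subsetI)
  fix g assume "g \<in> {g. p dvd g - f}"
  then show "g \<in> (\<Union>h\<in>{f. p dvd f}. {h \<oplus>\<^bsub>laurent_ring\<^esub> f})"
    by (intro UN_I[of "g - f"]) simp_all
qed auto

lemma quot_class_eq_iff: "quot_class p f = quot_class p g \<longleftrightarrow> p dvd f - g"
proof
  assume "quot_class p f = quot_class p g"
  moreover have "f \<in> quot_class p f"
    by (simp add: quot_class_eq)
  ultimately show "p dvd f - g"
    by (simp add: quot_class_eq)
next
  assume fg: "p dvd f - g"
  have "p dvd h - f \<longleftrightarrow> p dvd h - g" for h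
    using dvd_add_left_iff[OF fg, of "h - f"] by simp
  then show "quot_class p f = quot_class p g"
    by (simp add: quot_class_eq)
qed

lemma ideal_principal: "ideal (PIdl\<^bsub>laurent_ring\<^esub> p) laurent_ring"
  by (rule laurent_ring.cgenideal_ideal) simp

lemma cring_quot: "cring (quot p)"
  unfolding quot_def by (rule ideal.quotient_is_cring[OF ideal_principal cring_laurent_ring])

lemma carrier_quot: "carrier (quot p) = range (quot_class p)"
  by (auto simp: quot_def FactRing_def A_RCOSETS_def' quot_class_def a_r_coset_def')

lemma quot_class_closed [simp]: "quot_class p f \<in> carrier (quot p)"
  by (simp add: carrier_quot)

lemma quot_add [simp]: "quot_class p f \<oplus>\<^bsub>quot p\<^esub> quot_class p g = quot_class p (f + g)"
proof -
  interpret ideal "PIdl\<^bsub>laurent_ring\<^esub> p" laurent_ring by (rule ideal_principal)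
  show ?thesis
    using a_rcos_sum[of f g] by (simp add: quot_def FactRing_def quot_class_def)
qed

lemma quot_mult [simp]: "quot_class p f \<otimes>\<^bsub>quot p\<^esub> quot_class p g = quot_class p (f * g)"
proof -
  interpret ideal "PIdl\<^bsub>laurent_ring\<^esub> p" laurent_ring by (rule ideal_principal)
  show ?thesis
    using rcoset_mult_add[of f g] by (simp add: quot_def FactRing_def quot_class_def)
qed

lemma quot_zero: "\<zero>\<^bsub>quot p\<^esub> = quot_class p 0"
  by (simp add: quot_def FactRing_def quot_class_eq principal_ideal_eq)

lemma quot_minus: "quot_class p f \<ominus>\<^bsub>quot p\<^esub> quot_class p g = quot_class p (f - g)"
proof -
  interpret Q: cring "quot p" by (rule cring_quot)
  have "quot_class p (f - g) \<oplus>\<^bsub>quot p\<^esub> quot_class p g = quot_class p f"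
    by simp
  then show ?thesis
    by (metis Q.minus_eq Q.add.inv_solve_right' quot_class_closed)
qed

lemma quot_cases:
  assumes "w \<in> carrier (quot p)"
  obtains f where "w = quot_class p f"
  using assms by (auto simp: carrier_quot)

definition dvd_stable :: "complex laurent \<Rightarrow> (complex laurent \<Rightarrow> complex laurent) \<Rightarrow> bool" where
  "dvd_stable p D \<longleftrightarrow> laurent_linear D \<and> (\<forall>f. p dvd f \<longrightarrow> p dvd D f)"

lemma dvd_stableI: "laurent_linear D \<Longrightarrow> (\<And>f. p dvd f \<Longrightarrow> p dvd D f) \<Longrightarrow> dvd_stable p D"
  by (simp add: dvd_stable_def)

lemma dvd_stable_mult: "dvd_stable p (\<lambda>f. g * f)"
  by (rule dvd_stableI) (auto intro: linear_mult dvd_mult)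

lemma dvd_stable_compose: "dvd_stable p D \<Longrightarrow> dvd_stable p E \<Longrightarrow> dvd_stable p (\<lambda>f. D (E f))"
  by (simp add: dvd_stable_def linear_compose)

lemma dvd_stable_mult_fun: "dvd_stable p D \<Longrightarrow> dvd_stable p (\<lambda>f. g * D f)"
  by (rule dvd_stable_compose[OF dvd_stable_mult])

text \<open>Stability of the ideal makes all members of the union in \<open>quot_op\<close>
  coincide.\<close>

lemma quot_op_class:
  assumes "dvd_stable p D"
  shows "quot_op p D (quot_class p f) = quot_class p (D f)"
proof -
  have "quot_class p (D g) = quot_class p (D f)" if "g \<in> quot_class p f" for g
    using that assms
    by (auto simp: quot_class_eq_iff quot_class_eq[of p f] dvd_stable_def simp flip: linear_diff)
  moreover have "f \<in> quot_class p f"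
    by (simp add: quot_class_eq)
  ultimately have "(\<Union>g\<in>quot_class p f. quot_class p (D g)) = quot_class p (D f)"
    by blast
  then show ?thesis
    by (simp add: quot_op_def)
qed

lemma quot_op_extensional [simp]: "quot_op p D \<in> extensional (carrier (quot p))"
  by (simp add: quot_op_def)

lemma quot_map_eqI:
  assumes "g \<in> extensional (carrier (quot p))" "h \<in> extensional (carrier (quot p))"
    and "\<And>f. g (quot_class p f) = h (quot_class p f)"
  shows "g = h"
  using assms(1,2) by (rule extensionalityI) (auto elim!: quot_cases simp: assms(3))

lemma quot_op_eq_iff:
  assumes "dvd_stable p D" "dvd_stable p E"
  shows "quot_op p D = quot_op p E \<longleftrightarrow> (\<forall>f. p dvd D f - E f)"
proof
  assume "quot_op p D = quot_op p E"
  then show "\<forall>f. p dvd D f - E f"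
    using assms by (metis quot_op_class quot_class_eq_iff)
next
  assume "\<forall>f. p dvd D f - E f"
  then show "quot_op p D = quot_op p E"
    using assms by (intro quot_map_eqI[of _ p]) (simp_all add: quot_op_class quot_class_eq_iff)
qed

lemma scal_eq: "scal p c = quot_op p (\<lambda>f. lconst c * f)"
  by (rule quot_map_eqI[of _ p]) (simp_all add: quot_op_class[OF dvd_stable_mult], simp_all add: scal_def)

lemma group_GL: "Group.group (GL_quot p)"
proof -
  let ?V = "carrier (quot p)"
  let ?L = "{g \<in> Bij ?V.
        (\<forall>w\<in>?V. \<forall>w'\<in>?V. g (w \<oplus>\<^bsub>quot p\<^esub> w') = g w \<oplus>\<^bsub>quot p\<^esub> g w')
        \<and> (\<forall>c. \<forall>w\<in>?V. g (scal p c w) = scal p c (g w))}"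
  interpret Q: cring "quot p" by (rule cring_quot)
  have maps: "g w \<in> ?V" if "g \<in> Bij ?V" "w \<in> ?V" for g w
    using that Bij_imp_funcset by blast
  have scal_closed: "scal p c w \<in> ?V" if "w \<in> ?V" for c w
    using that by (auto elim!: quot_cases simp: scal_def)
  have "subgroup ?L (BijGroup ?V)"
  proof (rule group.subgroupI[OF group_BijGroup])
    show "?L \<noteq> {}"
    proof -
      have "(\<lambda>w\<in>?V. w) \<in> ?L"
        using id_Bij[of ?V] scal_closed by auto
      then show ?thesis by blast
    qed
    show "inv\<^bsub>BijGroup ?V\<^esub> g \<in> ?L" if "g \<in> ?L" for g
    proof -
      have g: "g \<in> Bij ?V" using that by blast
      have eq: "inv\<^bsub>BijGroup ?V\<^esub> g = (\<lambda>x\<in>?V. inv_into ?V g x)"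
        using inv_BijGroup[OF g] .
      have closed: "inv_into ?V g x \<in> ?V" if "x \<in> ?V" for x
        using Bij_inv_into_mem[OF g that] .
      have 1: "inv_into ?V g (g w) = w" if "w \<in> ?V" for w
        using g that by (auto simp: Bij_def bij_betw_def inv_into_f_f)
      have 2: "g (inv_into ?V g w) = w" if "w \<in> ?V" for w
        using g that by (auto simp: Bij_def bij_betw_def f_inv_into_f)
      have "inv_into ?V g (w \<oplus>\<^bsub>quot p\<^esub> w') = inv_into ?V g w \<oplus>\<^bsub>quot p\<^esub> inv_into ?V g w'"
        if "w \<in> ?V" "w' \<in> ?V" for w w'
        using \<open>g \<in> ?L\<close> that 1[of "inv_into ?V g w \<oplus>\<^bsub>quot p\<^esub> inv_into ?V g w'"] 2 closed by simp
      moreover have "inv_into ?V g (scal p c w) = scal p c (inv_into ?V g w)"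
        if "w \<in> ?V" for c w
        using \<open>g \<in> ?L\<close> that 1[of "scal p c (inv_into ?V g w)"] 2 closed scal_closed by simp
      ultimately show ?thesis
        unfolding eq using restrict_inv_into_Bij[OF g] scal_closed by simp
    qed
    show "g \<otimes>\<^bsub>BijGroup ?V\<^esub> h \<in> ?L" if "g \<in> ?L" "h \<in> ?L" for g h
    proof -
      have gh: "g \<in> Bij ?V" "h \<in> Bij ?V" using that by blast+
      then have "g \<otimes>\<^bsub>BijGroup ?V\<^esub> h = compose ?V g h"
        by (simp add: BijGroup_def)
      then show ?thesis
        using that compose_Bij[OF gh] maps scal_closed by (simp add: compose_eq)
    qed
  qed (auto simp: BijGroup_def)
  then show ?thesis
    unfolding GL_quot_def by (rule group.subgroup_imp_group[OF group_BijGroup])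
qed

lemma GL_carrier_iff: "g \<in> carrier (GL_quot p) \<longleftrightarrow> g \<in> Bij (carrier (quot p)) \<and>
    (\<forall>w\<in>carrier (quot p). \<forall>w'\<in>carrier (quot p). g (w \<oplus>\<^bsub>quot p\<^esub> w') = g w \<oplus>\<^bsub>quot p\<^esub> g w') \<and>
    (\<forall>c. \<forall>w\<in>carrier (quot p). g (scal p c w) = scal p c (g w))"
  by (simp add: GL_quot_def)

lemma GL_mult:
  assumes "g \<in> carrier (GL_quot p)" "h \<in> carrier (GL_quot p)"
  shows "g \<otimes>\<^bsub>GL_quot p\<^esub> h = compose (carrier (quot p)) g h"
  using assms by (simp add: GL_carrier_iff) (simp add: GL_quot_def BijGroup_def)

lemma GL_one: "\<one>\<^bsub>GL_quot p\<^esub> = quot_op p (\<lambda>f. f)"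
proof (rule quot_map_eqI)
  fix f
  have "dvd_stable p (\<lambda>f. f)"
    by (rule dvd_stableI) auto
  from quot_op_class[OF this]
  show "\<one>\<^bsub>GL_quot p\<^esub> (quot_class p f) = quot_op p (\<lambda>f. f) (quot_class p f)"
    by (simp add: GL_quot_def BijGroup_def)
qed (simp_all add: GL_quot_def BijGroup_def)

lemma quot_op_mult:
  assumes "quot_op p D \<in> carrier (GL_quot p)" "quot_op p E \<in> carrier (GL_quot p)"
    and "dvd_stable p D" "dvd_stable p E"
  shows "quot_op p D \<otimes>\<^bsub>GL_quot p\<^esub> quot_op p E = quot_op p (\<lambda>f. D (E f))"
  unfolding GL_mult[OF assms(1,2)]
  by (rule quot_map_eqI[of _ p])
    (simp_all add: compose_eq quot_op_class assms(3,4) dvd_stable_compose)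

lemma quot_op_in_GL:
  assumes "dvd_stable p D" "dvd_stable p D'" "\<And>f. p dvd D (D' f) - f" "\<And>f. p dvd D' (D f) - f"
  shows "quot_op p D \<in> carrier (GL_quot p)"
proof -
  let ?V = "carrier (quot p)"
  have "quot_class p (D (D' f)) = quot_class p f" "quot_class p (D' (D f)) = quot_class p f" for f
    by (simp_all add: quot_class_eq_iff assms)
  note inverse = this
  have "bij_betw (quot_op p D) ?V ?V"
  proof (rule bij_betw_byWitness[where f' = "quot_op p D'"])
    show "\<forall>w\<in>?V. quot_op p D' (quot_op p D w) = w" "\<forall>w\<in>?V. quot_op p D (quot_op p D' w) = w"
      "quot_op p D ` ?V \<subseteq> ?V" "quot_op p D' ` ?V \<subseteq> ?V"
      by (auto elim!: quot_cases simp: quot_op_class assms(1,2) inverse)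
  qed
  moreover have "laurent_linear D"
    using assms(1) by (simp add: dvd_stable_def)
  ultimately show ?thesis
    by (auto elim!: quot_cases simp: GL_carrier_iff Bij_def quot_op_class assms(1) scal_eq
        dvd_stable_mult linear_add linear_scale)
qed

lemma quot_op_inv:
  assumes "dvd_stable p D" "dvd_stable p D'" "\<And>f. p dvd D (D' f) - f" "\<And>f. p dvd D' (D f) - f"
  shows "inv\<^bsub>GL_quot p\<^esub> (quot_op p D) = quot_op p D'"
proof (rule group.inv_equality[OF group_GL])
  show in_GL: "quot_op p D \<in> carrier (GL_quot p)" "quot_op p D' \<in> carrier (GL_quot p)"
    using assms by (auto intro: quot_op_in_GL)
  have "dvd_stable p (\<lambda>f. f)"
    by (rule dvd_stableI) auto
  then show "quot_op p D' \<otimes>\<^bsub>GL_quot p\<^esub> quot_op p D = \<one>\<^bsub>GL_quot p\<^esub>"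
    using assms in_GL by (simp add: quot_op_mult GL_one quot_op_eq_iff dvd_stable_compose)
qed

lemma scal_in_GL: "c \<noteq> 0 \<Longrightarrow> scal p c \<in> carrier (GL_quot p)"
  unfolding scal_eq by (rule quot_op_in_GL[of p _ "\<lambda>f. lconst (inverse c) * f"]) (simp_all add: dvd_stable_mult)

lemma scal_mult:
  assumes "c \<noteq> 0" "d \<noteq> 0"
  shows "scal p c \<otimes>\<^bsub>GL_quot p\<^esub> scal p d = scal p (c * d)"
  using quot_op_mult[OF scal_in_GL[OF assms(1), unfolded scal_eq] scal_in_GL[OF assms(2), unfolded scal_eq]
      dvd_stable_mult dvd_stable_mult]
  by (simp add: scal_eq lconst_mult mult.assoc)

lemma scal_one: "scal p 1 = \<one>\<^bsub>GL_quot p\<^esub>"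
  by (simp add: scal_eq GL_one)

lemma scal_central:
  assumes "c \<noteq> 0" "g \<in> carrier (GL_quot p)"
  shows "g \<otimes>\<^bsub>GL_quot p\<^esub> scal p c = scal p c \<otimes>\<^bsub>GL_quot p\<^esub> g"
  unfolding GL_mult[OF assms(2) scal_in_GL[OF assms(1)]] GL_mult[OF scal_in_GL[OF assms(1)] assms(2)]
proof (rule quot_map_eqI)
  fix f
  show "compose (carrier (quot p)) g (scal p c) (quot_class p f) =
      compose (carrier (quot p)) (scal p c) g (quot_class p f)"
    using assms(2) by (simp add: compose_eq GL_carrier_iff)
qed (simp_all add: compose_extensional)

lemma complex_units_pow: "z \<noteq> 0 \<Longrightarrow> z [^]\<^bsub>complex_units\<^esub> (m::nat) = z ^ m"
  by (induction m) (simp_all add: nat_pow_def complex_units_def)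

lemma group_complex_units: "Group.group complex_units"
proof (rule groupI)
  fix z assume "z \<in> carrier complex_units"
  then show "\<exists>w\<in>carrier complex_units. w \<otimes>\<^bsub>complex_units\<^esub> z = \<one>\<^bsub>complex_units\<^esub>"
    by (intro bexI[of _ "inverse z"]) (simp_all add: complex_units_def)
qed (simp_all add: complex_units_def)

lemma pow_eq_1_iff_complex_ord: "z \<noteq> 0 \<Longrightarrow> z ^ m = 1 \<longleftrightarrow> complex_ord z dvd m"
  using group.pow_eq_id[OF group_complex_units, of z m] complex_units_pow[of z m]
  by (simp add: complex_ord_def) (simp add: complex_units_def)

lemma complex_ord_eqI:
  assumes "z \<noteq> 0" "\<And>m. z ^ m = 1 \<longleftrightarrow> d dvd m"
  shows "complex_ord z = d"
  using assms pow_eq_1_iff_complex_ord by (metis dvd_antisym dvd_refl)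

text \<open>\<open>c\<close> is some square root of u, chosen for the twist alone; the normalization
  of the braid group action uses its own root \<open>r\<close>, possibly of the other sign.\<close>

locale daha_rep = daha_window +
  fixes c :: complex
  assumes c_square: "c ^ 2 = u"
    and tau_p: "p dvd tau_op u v c p" and tau_inv_p: "p dvd tau_op_inv u v c p"
    and X_scalar: "\<exists>\<kappa>. \<kappa> \<noteq> 0 \<and> p dvd lX ^ M - lconst \<kappa>"
begin

lemma c_nonzero: "c \<noteq> 0"
  using c_square u by auto

lemma twists:
  "laurent_twist u v (\<lambda>f. lconst c * pol_Y u v (lX * f)) (\<lambda>f. lconst (inverse c) * (lXi * pol_Y_inv u v f))"
  "laurent_twist u v (\<lambda>f. lconst (inverse c) * pol_Y_inv u v (lX * f)) (\<lambda>f. lconst c * (lXi * pol_Y u v f))"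
  using laurent_twist_tau laurent_twist_tau_inv u v c_square by blast+

lemmas tau_simps =
  laurent_twist.lsubst_1[OF twists(1), folded tau_op_def]
  laurent_twist.lsubst_X[OF twists(1), folded tau_op_def]
  laurent_twist.lsubst_Y[OF twists(1), folded tau_op_def]

lemma linear_tau: "laurent_linear (tau_op u v c)" "laurent_linear (tau_op_inv u v c)"
  using laurent_twist.linear_lsubst[OF twists(1), folded tau_op_def]
    laurent_twist.linear_lsubst[OF twists(2), folded tau_op_inv_def] .

lemma stable:
  "dvd_stable p (\<lambda>f. lconst x * (lX * f))" "dvd_stable p (\<lambda>f. lconst x * (lXi * f))"
  "dvd_stable p (\<lambda>f. lconst x * pol_Y u v f)" "dvd_stable p (\<lambda>f. lconst x * pol_Y_inv u v f)"
  "dvd_stable p (\<lambda>f. lconst x * pol_T v f)" "dvd_stable p (\<lambda>f. lconst x * pol_T_inv v f)"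
  "dvd_stable p (tau_op u v c)" "dvd_stable p (tau_op_inv u v c)"
proof -
  show "dvd_stable p (\<lambda>f. lconst x * (lX * f))" "dvd_stable p (\<lambda>f. lconst x * (lXi * f))"
    by (rule dvd_stable_mult_fun[OF dvd_stable_mult])+
  show "dvd_stable p (\<lambda>f. lconst x * pol_Y u v f)"
    by (rule dvd_stable_mult_fun[OF dvd_stableI[OF linear_Y dvd_Y]])
  show "dvd_stable p (\<lambda>f. lconst x * pol_Y_inv u v f)"
    by (rule dvd_stable_mult_fun[OF dvd_stableI[OF linear_Y_inv dvd_Y_inv]])
  show "dvd_stable p (\<lambda>f. lconst x * pol_T v f)"
    by (rule dvd_stable_mult_fun[OF dvd_stableI[OF linear_T dvd_T]])
  show "dvd_stable p (\<lambda>f. lconst x * pol_T_inv v f)"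
    by (rule dvd_stable_mult_fun[OF dvd_stableI[OF linear_T_inv dvd_T_inv]])
  show "dvd_stable p (tau_op u v c)"
    by (rule dvd_stableI[OF linear_tau(1) dvd_tau_op[OF tau_p c_square]])
  show "dvd_stable p (tau_op_inv u v c)"
    by (rule dvd_stableI[OF linear_tau(2) dvd_tau_op_inv[OF tau_inv_p c_square]])
qed

abbreviation "G \<equiv> GL_quot p"
text \<open>The argument is the sign brought in by a twist of X, and similarly for
  \<open>opY\<close>; in \<open>opT\<close> it is the sign brought in by \<iota>. All twisted
  modules are treated at once.\<close>

definition "opX x = quot_op p (\<lambda>f. lconst x * (lX * f))"
definition "opY x = quot_op p (\<lambda>f. lconst x * pol_Y u v f)"
definition "opT x = quot_op p (\<lambda>f. lconst x * pol_T v f)"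
definition "opTau = quot_op p (tau_op u v c)"

lemma lconst_square: "x ^ 2 = 1 \<Longrightarrow> lconst x * (lconst x * f) = f"
  by (simp add: power2_eq_square flip: mult.assoc lconst_mult)

lemma lconst_square_left: "x ^ 2 = 1 \<Longrightarrow> lconst x * (lconst y * (lconst x * f)) = lconst y * f"
  by (simp only: mult.left_commute[of "lconst y" "lconst x"] lconst_square)

lemma lX_lconst: "lX * (lconst k * f) = lconst k * (lX * f)" "lXi * (lconst k * f) = lconst k * (lXi * f)"
  by (rule mult.left_commute)+

lemma op_inverses:
  assumes "x ^ 2 = 1"
  shows "lconst x * (lX * (lconst x * (lXi * f))) = f" "lconst x * (lXi * (lconst x * (lX * f))) = f"
    "lconst x * pol_Y u v (lconst x * pol_Y_inv u v f) = f"
    "lconst x * pol_Y_inv u v (lconst x * pol_Y u v f) = f"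
    "lconst x * pol_T v (lconst x * pol_T_inv v f) = f"
    "lconst x * pol_T_inv v (lconst x * pol_T v f) = f"
  using u v assms
  by (simp_all add: lX_lconst lconst_square
      linear_scale[OF linear_Y] linear_scale[OF linear_Y_inv] linear_scale[OF linear_T]
      linear_scale[OF linear_T_inv] pol_Y_Y_inv pol_Y_inv_Y pol_T_T_inv pol_T_inv_T)

lemma op_in_GL:
  assumes "x ^ 2 = 1"
  shows "opX x \<in> carrier G" "opY x \<in> carrier G" "opT x \<in> carrier G"
    and "quot_op p (\<lambda>f. lconst x * (lXi * f)) \<in> carrier G"
    and "quot_op p (\<lambda>f. lconst x * pol_Y_inv u v f) \<in> carrier G"
    and "quot_op p (\<lambda>f. lconst x * pol_T_inv v f) \<in> carrier G"
proof -
  note i = op_inverses[OF assms] diff_self dvd_0_right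
  show "opX x \<in> carrier G"
    unfolding opX_def by (rule quot_op_in_GL[OF stable(1)[of x] stable(2)[of x]]) (simp_all only: i)
  show "opY x \<in> carrier G"
    unfolding opY_def by (rule quot_op_in_GL[OF stable(3)[of x] stable(4)[of x]]) (simp_all only: i)
  show "opT x \<in> carrier G"
    unfolding opT_def by (rule quot_op_in_GL[OF stable(5)[of x] stable(6)[of x]]) (simp_all only: i)
  show "quot_op p (\<lambda>f. lconst x * (lXi * f)) \<in> carrier G"
    by (rule quot_op_in_GL[OF stable(2)[of x] stable(1)[of x]]) (simp_all only: i)
  show "quot_op p (\<lambda>f. lconst x * pol_Y_inv u v f) \<in> carrier G"
    by (rule quot_op_in_GL[OF stable(4)[of x] stable(3)[of x]]) (simp_all only: i)
  show "quot_op p (\<lambda>f. lconst x * pol_T_inv v f) \<in> carrier G"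
    by (rule quot_op_in_GL[OF stable(6)[of x] stable(5)[of x]]) (simp_all only: i)
qed

lemma op_inv:
  assumes "x ^ 2 = 1"
  shows "inv\<^bsub>G\<^esub> (opX x) = quot_op p (\<lambda>f. lconst x * (lXi * f))"
    and "inv\<^bsub>G\<^esub> (opY x) = quot_op p (\<lambda>f. lconst x * pol_Y_inv u v f)"
    and "inv\<^bsub>G\<^esub> (opT x) = quot_op p (\<lambda>f. lconst x * pol_T_inv v f)"
proof -
  note i = op_inverses[OF assms] diff_self dvd_0_right
  show "inv\<^bsub>G\<^esub> (opX x) = quot_op p (\<lambda>f. lconst x * (lXi * f))"
    unfolding opX_def by (rule quot_op_inv[OF stable(1)[of x] stable(2)[of x]]) (simp_all only: i)
  show "inv\<^bsub>G\<^esub> (opY x) = quot_op p (\<lambda>f. lconst x * pol_Y_inv u v f)"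
    unfolding opY_def by (rule quot_op_inv[OF stable(3)[of x] stable(4)[of x]]) (simp_all only: i)
  show "inv\<^bsub>G\<^esub> (opT x) = quot_op p (\<lambda>f. lconst x * pol_T_inv v f)"
    unfolding opT_def by (rule quot_op_inv[OF stable(5)[of x] stable(6)[of x]]) (simp_all only: i)
qed

lemma opTau_in_GL: "opTau \<in> carrier G" and opTau_inv: "inv\<^bsub>G\<^esub> opTau = quot_op p (tau_op_inv u v c)"
  unfolding opTau_def using tau_op_inverse[OF u v c_square]
  by (intro quot_op_in_GL[OF stable(7,8)] quot_op_inv[OF stable(7,8)]; simp)+

lemma GL_ext:
  assumes "g \<in> carrier G" "h \<in> carrier G" "\<And>f. g (quot_class p f) = h (quot_class p f)"
  shows "g = h"
  using assms by (intro quot_map_eqI[of _ p]) (auto simp: GL_carrier_iff Bij_def)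

lemma GL_mult_class:
  assumes "g \<in> carrier G" "h \<in> carrier G"
  shows "(g \<otimes>\<^bsub>G\<^esub> h) (quot_class p f) = g (h (quot_class p f))"
  using assms by (simp add: GL_mult compose_eq)

lemma op_class:
  "opX x (quot_class p f) = quot_class p (lconst x * (lX * f))"
  "opY x (quot_class p f) = quot_class p (lconst x * pol_Y u v f)"
  "opT x (quot_class p f) = quot_class p (lconst x * pol_T v f)"
  "opTau (quot_class p f) = quot_class p (tau_op u v c f)"
  "scal p x (quot_class p f) = quot_class p (lconst x * f)"
  "quot_op p (\<lambda>f. lconst x * (lXi * f)) (quot_class p f) = quot_class p (lconst x * (lXi * f))"
  "quot_op p (\<lambda>f. lconst x * pol_Y_inv u v f) (quot_class p f) = quot_class p (lconst x * pol_Y_inv u v f)"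
  "quot_op p (\<lambda>f. lconst x * pol_T_inv v f) (quot_class p f) = quot_class p (lconst x * pol_T_inv v f)"
  by (simp_all add: opX_def opY_def opT_def opTau_def scal_eq quot_op_class stable dvd_stable_mult)

lemma one_not_zero_class: "k \<noteq> 0 \<Longrightarrow> \<not> p dvd lconst k"
proof
  assume "k \<noteq> 0" "p dvd lconst k"
  moreover have "supp_lt W (lconst k)"
    using W_pos by (simp add: supp_lt_def lconst_def lookup_single when_def rank_def)
  ultimately show False
    using supp_lt_zero_if_dvd by fastforce
qed

lemma GL_commutant:
  assumes g: "g \<in> carrier G" and x: "x ^ 2 = 1" "y ^ 2 = 1"
    and gX: "g \<otimes>\<^bsub>G\<^esub> opX x = opX x \<otimes>\<^bsub>G\<^esub> g" and gY: "g \<otimes>\<^bsub>G\<^esub> opY y = opY y \<otimes>\<^bsub>G\<^esub> g"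
  shows "g \<in> scal p ` (- {0})"
proof -
  have x0: "x \<noteq> 0" "y \<noteq> 0"
    using x by auto
  have closed: "g (quot_class p f) \<in> carrier (quot p)" for f
    using g by (auto simp: GL_carrier_iff Bij_def dest: bij_betwE)
  have g_add: "g (quot_class p (f + h)) = g (quot_class p f) \<oplus>\<^bsub>quot p\<^esub> g (quot_class p h)" for f h
    using g by (simp add: GL_carrier_iff flip: quot_add)
  have g_scale: "g (quot_class p (lconst k * f)) = scal p k (g (quot_class p f))" for k f
    using g by (simp add: GL_carrier_iff flip: op_class(5))
  obtain w where w: "g (quot_class p 1) = quot_class p w"
    using closed[of 1] by (rule quot_cases)
  \<comment> \<open>The sign x occurs twice, once from the operator and once when it is moved out of
    it, and cancels.\<close>
  have gX': "g (quot_class p (lX * f)) = quot_class p (lX * h)"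
    if "g (quot_class p f) = quot_class p h" for f h
  proof -
    have "g (opX x (quot_class p f)) = opX x (g (quot_class p f))"
      using gX GL_mult_class[OF g op_in_GL(1)[OF x(1)]] GL_mult_class[OF op_in_GL(1)[OF x(1)] g] by metis
    then have "quot_class p (lconst x * (lconst x * (lX * h))) =
        scal p x (g (quot_class p (lconst x * (lX * f))))"
      by (simp add: op_class that)
    also have "\<dots> = g (quot_class p (lconst x * (lconst x * (lX * f))))"
      by (simp only: g_scale)
    finally show ?thesis
      using x(1) by (simp add: lconst_square)
  qed
  \<comment> \<open>Commuting with X, the map g is multiplication by its value w on 1; linearity
    over C alone would not give this.\<close>
  have g_eq: "g (quot_class p f) = quot_class p (f * w)" for f
  proof (induction f rule: laurent_induct_X)
    case (X f)
    then show ?case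
      using gX' by (simp add: mult.assoc)
  next
    case (Xi f)
    obtain h where h: "g (quot_class p (lXi * f)) = quot_class p h"
      using closed by (rule quot_cases)
    have "quot_class p (lX * h) = quot_class p (f * w)"
      using gX'[OF h] Xi by simp
    then have "p dvd lX * h - f * w"
      by (simp only: quot_class_eq_iff)
    then have "p dvd lXi * (lX * h - f * w)"
      by (rule dvd_mult)
    then show ?case
      by (simp add: h quot_class_eq_iff right_diff_distrib mult.assoc)
  qed (simp_all add: w g_add g_scale op_class distrib_right mult.assoc)
  have "g (opY y (quot_class p 1)) = opY y (g (quot_class p 1))"
    using gY GL_mult_class[OF g op_in_GL(2)[OF x(2)]] GL_mult_class[OF op_in_GL(2)[OF x(2)] g] by metis
  then have "quot_class p (lconst y * (lconst v * w)) = quot_class p (lconst y * pol_Y u v w)"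
    by (simp add: op_class g_eq pol_Y_1 w mult.assoc)
  then have "p dvd lconst y * (pol_Y u v w - lconst v * w)"
    by (simp only: quot_class_eq_iff[of p "lconst y * pol_Y u v w"] right_diff_distrib eq_commute[of _ "quot_class p (lconst y * pol_Y u v w)"])
  then have "p dvd lconst y * (lconst y * (pol_Y u v w - lconst v * w))"
    by (rule dvd_mult)
  then obtain k where k: "p dvd w - lconst k"
    using commutant_const x(2) by (auto simp: lconst_square)
  have gk: "g (quot_class p f) = scal p k (quot_class p f)" for f
    using dvd_mult[OF k, of f] by (simp add: g_eq op_class quot_class_eq_iff right_diff_distrib mult.commute)
  \<comment> \<open>For k = 0 the injective map g would identify the classes of 1 and 0, whereas a
    constant in the ideal is zero.\<close>
  have "k \<noteq> 0"
  proof
    assume "k = 0"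
    then have "g (quot_class p 1) = g (quot_class p 0)"
      by (simp add: gk op_class)
    moreover have "inj_on g (carrier (quot p))"
      using g by (simp add: GL_carrier_iff Bij_def bij_betw_def)
    ultimately have "quot_class p 1 = quot_class p 0"
      by (simp add: inj_on_eq_iff)
    then show False
      using one_not_zero_class[of 1] by (simp add: quot_class_eq_iff)
  qed
  moreover have "g = scal p k"
    using g scal_in_GL[OF \<open>k \<noteq> 0\<close>] gk by (rule GL_ext)
  ultimately show ?thesis by blast
qed

text \<open>The signs cancel: counting both sides of a relation together, each of X, Y and T occurs
  an even number of times.\<close>

lemma braid_triple_rep:
  assumes r: "r ^ 2 = u" and sq: "x ^ 2 = 1" "y ^ 2 = 1" "d ^ 2 = 1"
  shows "braid_triple G (scal p) r (opX x) (opY y) (opT d)"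
proof -
  interpret G: group G by (rule group_GL)
  have r0: "r \<noteq> 0" using r u by auto
  note GL = op_in_GL[OF sq(1)] op_in_GL[OF sq(2)] op_in_GL[OF sq(3)]
  note scale = linear_scale[OF linear_Y] linear_scale[OF linear_Y_inv] linear_scale[OF linear_T]
    linear_scale[OF linear_T_inv] lX_lconst
  show ?thesis
  proof
    show "opT d \<otimes>\<^bsub>G\<^esub> opX x \<otimes>\<^bsub>G\<^esub> opT d = inv\<^bsub>G\<^esub> opX x"
    proof (rule GL_ext)
      fix f
      show "(opT d \<otimes>\<^bsub>G\<^esub> opX x \<otimes>\<^bsub>G\<^esub> opT d) (quot_class p f) = (inv\<^bsub>G\<^esub> opX x) (quot_class p f)"
        using v sq by (simp add: GL_mult_class GL op_inv op_class scale pol_T_X pol_T_inv_T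
            lconst_square lconst_square_left)
    qed (simp_all add: GL)
    have tyt: "pol_T_inv v (pol_Y u v (pol_T_inv v f)) = pol_Y_inv u v f" for f
      using v by (simp add: pol_Y_def pol_Y_inv_def pol_T_T_inv)
    show "inv\<^bsub>G\<^esub> opT d \<otimes>\<^bsub>G\<^esub> opY y \<otimes>\<^bsub>G\<^esub> inv\<^bsub>G\<^esub> opT d = inv\<^bsub>G\<^esub> opY y"
    proof (rule GL_ext)
      fix f
      show "(inv\<^bsub>G\<^esub> opT d \<otimes>\<^bsub>G\<^esub> opY y \<otimes>\<^bsub>G\<^esub> inv\<^bsub>G\<^esub> opT d) (quot_class p f) = (inv\<^bsub>G\<^esub> opY y) (quot_class p f)"
        using v sq by (simp add: GL_mult_class GL op_inv op_class scale tyt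
            lconst_square lconst_square_left)
    qed (simp_all add: GL)
    have comm: "pol_Y_inv u v (lXi * pol_Y u v (lX * pol_T v (pol_T v f))) = lconst (inverse u) * f" for f
      using u v by (simp add: pol_Y_def pol_Y_inv_def pol_T_X pol_T_inv_T pol_pi_Xi scale
          linear_scale[OF linear_pi])
    show "inv\<^bsub>G\<^esub> opY y \<otimes>\<^bsub>G\<^esub> inv\<^bsub>G\<^esub> opX x \<otimes>\<^bsub>G\<^esub> opY y \<otimes>\<^bsub>G\<^esub> opX x \<otimes>\<^bsub>G\<^esub> opT d \<otimes>\<^bsub>G\<^esub> opT d
        \<otimes>\<^bsub>G\<^esub> scal p (r ^ 2) = \<one>\<^bsub>G\<^esub>"
    proof (rule GL_ext)
      fix f
      have "dvd_stable p (\<lambda>f. f)"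
        by (rule dvd_stableI) auto
      from quot_op_class[OF this]
      show "(inv\<^bsub>G\<^esub> opY y \<otimes>\<^bsub>G\<^esub> inv\<^bsub>G\<^esub> opX x \<otimes>\<^bsub>G\<^esub> opY y \<otimes>\<^bsub>G\<^esub> opX x \<otimes>\<^bsub>G\<^esub> opT d \<otimes>\<^bsub>G\<^esub> opT d
        \<otimes>\<^bsub>G\<^esub> scal p (r ^ 2)) (quot_class p f) = \<one>\<^bsub>G\<^esub> (quot_class p f)"
        using u sq by (simp add: GL_mult_class GL op_inv op_class scale scal_in_GL r comm GL_one
            lconst_square lconst_square_left)
    qed (use u r in \<open>simp_all add: GL scal_in_GL\<close>)
    show "g \<in> scal p ` (- {0})" if "g \<in> carrier G"
      "g \<otimes>\<^bsub>G\<^esub> opX x = opX x \<otimes>\<^bsub>G\<^esub> g" "g \<otimes>\<^bsub>G\<^esub> opY y = opY y \<otimes>\<^bsub>G\<^esub> g" for g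
      using that(1) sq(1,2) that(2,3) by (rule GL_commutant)
  qed (rule r0 GL(1) GL(8) GL(15) scal_in_GL scal_mult scal_one scal_central; assumption)+
qed

end

text \<open>Up to the factor v + v^-1, nonzero for t different from -1, f is the difference of
  T-eigenvectors for v and - v^-1. The two eigenvalues have the same m-th power exactly if (-t)^m =
  1.\<close>

lemma (in daha_window) T_power_eigen:
  assumes "v ^ 2 \<noteq> - 1" "(- (v ^ 2)) ^ m = 1"
  shows "(pol_T v ^^ m) f = lconst (v ^ m) * f"
proof -
  define g where "g = pol_T v f + lconst (inverse v) * f"
  define h where "h = pol_T v f - lconst v * f"
  have g: "pol_T v g = lconst v * g" and h: "pol_T v h = lconst (- inverse v) * h"
    using v by (simp_all add: g_def h_def linear_add[OF linear_T] linear_diff[OF linear_T]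
        linear_scale[OF linear_T] pol_T_quadratic distrib_left right_diff_distrib lconst_diff lconst_minus)
      (simp_all add: algebra_simps)
  have pow: "(pol_T v ^^ m) k = lconst (e ^ m) * k" if "pol_T v k = lconst e * k" for e k
    by (induction m) (simp_all add: that linear_scale[OF linear_T] lconst_mult mult.assoc mult.left_commute)
  have "(- inverse v) ^ m * (- (v ^ 2)) ^ m = v ^ m"
  proof -
    have "(- inverse v) * - (v ^ 2) = v"
      using v by (simp add: power2_eq_square)
    then show ?thesis
      by (simp only: power_mult_distrib[symmetric])
  qed
  then have e: "(- inverse v) ^ m = v ^ m"
    using assms(2) by simp
  have gh: "(pol_T v ^^ m) (g - h) = lconst (v ^ m) * (g - h)"
    using pow[OF g] pow[OF h]
    by (simp add: e linear_diff[OF linear_funpow[OF linear_T]] right_diff_distrib)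
  define k where "k = v + inverse v"
  have k: "k \<noteq> 0"
    using assms(1) v by (auto simp: k_def field_simps power2_eq_square add_eq_0_iff)
  have "g - h = lconst k * f"
    by (simp add: g_def h_def k_def lconst_add algebra_simps)
  then have "lconst k * (pol_T v ^^ m) f = lconst k * (lconst (v ^ m) * f)"
    using gh by (simp only: linear_scale[OF linear_funpow[OF linear_T]] mult.left_commute)
  then show ?thesis
    using k by (metis lconst_inverse_left(2))
qed

section \<open>Orders of X, Y and T modulo scalars\<close>

context daha_rep
begin

lemma quot_op_power:
  assumes "quot_op p D \<in> carrier G" "dvd_stable p D"
  shows "quot_op p D [^]\<^bsub>G\<^esub> (m::nat) = quot_op p (D ^^ m) \<and> dvd_stable p (D ^^ m)"
proof (induction m)
  case 0
  have "dvd_stable p (\<lambda>f. f)"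
    by (rule dvd_stableI) auto
  then show ?case
    using GL_one by (simp add: id_def)
next
  case (Suc m)
  interpret G: group G by (rule group_GL)
  have st: "dvd_stable p (\<lambda>f. (D ^^ m) (D f))"
    using Suc assms(2) dvd_stable_compose by blast
  have "quot_op p (D ^^ m) \<in> carrier G"
    using Suc assms(1) G.nat_pow_closed by metis
  then have "quot_op p D [^]\<^bsub>G\<^esub> Suc m = quot_op p (\<lambda>f. (D ^^ m) (D f))"
    using Suc assms by (simp add: quot_op_mult)
  then show ?case
    using st by (simp add: funpow_Suc_right comp_def del: funpow.simps)
qed

lemma scalars_eq: "scal p ` (- {0}) = scalars p"
  by (auto simp: scalars_def)

lemma quot_op_scalar_iff:
  assumes "quot_op p D \<in> carrier G" "dvd_stable p D"
  shows "quot_op p D [^]\<^bsub>G\<^esub> (m::nat) \<in> scalars p \<longleftrightarrow> (\<exists>k. k \<noteq> 0 \<and> (\<forall>f. p dvd (D ^^ m) f - lconst k * f))"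
  using quot_op_power[OF assms, of m]
  by (auto simp: scalars_def scal_eq quot_op_eq_iff dvd_stable_mult)

lemma funpow_scale:
  "laurent_linear D \<Longrightarrow> ((\<lambda>f. lconst x * D f) ^^ m) f = lconst (x ^ m) * (D ^^ m) f"
  by (induction m) (simp_all add: linear_scale lconst_mult mult.assoc mult.left_commute)

lemma scaled_dvd_iff:
  assumes "x \<noteq> 0"
  shows "(\<exists>k. k \<noteq> 0 \<and> (\<forall>f. p dvd lconst x * D f - lconst k * f)) \<longleftrightarrow>
    (\<exists>k. k \<noteq> 0 \<and> (\<forall>f. p dvd D f - lconst k * f))"
proof
  assume "\<exists>k. k \<noteq> 0 \<and> (\<forall>f. p dvd lconst x * D f - lconst k * f)"
  then obtain k where k: "k \<noteq> 0" "\<And>f. p dvd lconst x * D f - lconst k * f" by blast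
  have "p dvd D f - lconst (inverse x * k) * f" for f
    using dvd_mult[OF k(2)[of f], of "lconst (inverse x)"] assms
    by (simp add: right_diff_distrib lconst_mult mult.assoc)
  then show "\<exists>k. k \<noteq> 0 \<and> (\<forall>f. p dvd D f - lconst k * f)"
    using k(1) assms by (intro exI[of _ "inverse x * k"]) simp
next
  assume "\<exists>k. k \<noteq> 0 \<and> (\<forall>f. p dvd D f - lconst k * f)"
  then obtain k where k: "k \<noteq> 0" "\<And>f. p dvd D f - lconst k * f" by blast
  have "p dvd lconst x * D f - lconst (x * k) * f" for f
    using dvd_mult[OF k(2)[of f], of "lconst x"]
    by (simp add: right_diff_distrib lconst_mult mult.assoc)
  then show "\<exists>k. k \<noteq> 0 \<and> (\<forall>f. p dvd lconst x * D f - lconst k * f)"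
    using k(1) assms by (intro exI[of _ "x * k"]) simp
qed

lemma op_power_scalar_iff:
  assumes "x ^ 2 = 1"
  shows "opX x [^]\<^bsub>G\<^esub> (m::nat) \<in> scalars p \<longleftrightarrow> (\<exists>k. k \<noteq> 0 \<and> p dvd lX ^ m - lconst k)"
    and "opY x [^]\<^bsub>G\<^esub> (m::nat) \<in> scalars p \<longleftrightarrow> (\<exists>k. k \<noteq> 0 \<and> (\<forall>f. p dvd (pol_Y u v ^^ m) f - lconst k * f))"
    and "opT x [^]\<^bsub>G\<^esub> (m::nat) \<in> scalars p \<longleftrightarrow> (\<exists>k. k \<noteq> 0 \<and> (\<forall>f. p dvd (pol_T v ^^ m) f - lconst k * f))"
proof -
  have x: "x ^ m \<noteq> 0"
    using assms by auto
  have X: "((*) lX ^^ m) f = lX ^ m * f" for f :: "complex laurent"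
    by (induction m) (simp_all add: mult.assoc)
  have "(\<forall>f. p dvd lX ^ m * f - lconst k * f) \<longleftrightarrow> p dvd lX ^ m - lconst k" for k
  proof
    assume "\<forall>f. p dvd lX ^ m * f - lconst k * f"
    from this[rule_format, of 1] show "p dvd lX ^ m - lconst k" by simp
  next
    assume d: "p dvd lX ^ m - lconst k"
    have "p dvd lX ^ m * f - lconst k * f" for f
      using dvd_mult2[OF d, of f] by (simp add: left_diff_distrib)
    then show "\<forall>f. p dvd lX ^ m * f - lconst k * f" by blast
  qed
  then show "opX x [^]\<^bsub>G\<^esub> m \<in> scalars p \<longleftrightarrow> (\<exists>k. k \<noteq> 0 \<and> p dvd lX ^ m - lconst k)"
    using quot_op_scalar_iff[OF op_in_GL(1)[OF assms, unfolded opX_def] stable(1), of m]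
    by (simp only: opX_def funpow_scale[OF linear_mult] scaled_dvd_iff[OF x] X)
  show "opY x [^]\<^bsub>G\<^esub> m \<in> scalars p \<longleftrightarrow> (\<exists>k. k \<noteq> 0 \<and> (\<forall>f. p dvd (pol_Y u v ^^ m) f - lconst k * f))"
    using quot_op_scalar_iff[OF op_in_GL(2)[OF assms, unfolded opY_def] stable(3), of m]
    by (simp only: opY_def funpow_scale[OF linear_Y] scaled_dvd_iff[OF x])
  show "opT x [^]\<^bsub>G\<^esub> m \<in> scalars p \<longleftrightarrow> (\<exists>k. k \<noteq> 0 \<and> (\<forall>f. p dvd (pol_T v ^^ m) f - lconst k * f))"
    using quot_op_scalar_iff[OF op_in_GL(3)[OF assms, unfolded opT_def] stable(5), of m]
    by (simp only: opT_def funpow_scale[OF linear_T] scaled_dvd_iff[OF x])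
qed

lemma X_pow_M: "x ^ 2 = 1 \<Longrightarrow> opX x [^]\<^bsub>G\<^esub> M \<in> scalars p"
  using X_scalar by (simp add: op_power_scalar_iff)

lemma Y_pow_M: "x ^ 2 = 1 \<Longrightarrow> opY x [^]\<^bsub>G\<^esub> M \<in> scalars p"
  using Y_power_scalar v by (auto simp: op_power_scalar_iff intro!: exI[of _ "v ^ M"])

text \<open>Enough room to see the full order of u: two eigenvalues of Y with quotient u, for which
  W must be at least 3, and two roots of p, i.e. eigenvalues of X, with quotient u.\<close>

definition "nonscalar \<longleftrightarrow> 3 \<le> W \<and> (\<exists>x. x \<noteq> 0 \<and> leval x p = 0 \<and> leval (u * x) p = 0)"

lemma pow_dvd_Z:
  assumes "g \<in> carrier G" "g [^]\<^bsub>G\<^esub> (k::nat) \<in> scalars p" "k dvd m" "braid_triple G (scal p) r X Y T"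
  shows "g [^]\<^bsub>G\<^esub> m \<in> scalars p"
proof -
  interpret B: braid_triple G "scal p" r X Y T by fact
  obtain j where "m = k * j" using assms(3) by (auto simp: dvd_def)
  moreover have "(g [^]\<^bsub>G\<^esub> k) [^]\<^bsub>G\<^esub> j \<in> B.Z"
    using assms(2) B.subgroup_Z
    by (induction j) (simp_all add: subgroup.one_closed subgroup.m_closed B.Z_def scalars_eq)
  ultimately show ?thesis
    using assms(1) by (simp add: B.nat_pow_pow B.Z_def scalars_eq)
qed

lemma X_pow_iff:
  assumes "nonscalar" "x ^ 2 = 1" "braid_triple G (scal p) r X Y T"
  shows "opX x [^]\<^bsub>G\<^esub> (m::nat) \<in> scalars p \<longleftrightarrow> M dvd m"
  using assms X_power_scalar_imp pow_dvd_Z[OF op_in_GL(1)[OF assms(2)] X_pow_M[OF assms(2)] _ assms(3)]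
  by (auto simp: op_power_scalar_iff(1) nonscalar_def)

lemma Y_pow_iff:
  assumes "nonscalar" "x ^ 2 = 1" "braid_triple G (scal p) r X Y T"
  shows "opY x [^]\<^bsub>G\<^esub> (m::nat) \<in> scalars p \<longleftrightarrow> M dvd m"
  using assms Y_power_scalar_imp pow_dvd_Z[OF op_in_GL(2)[OF assms(2)] Y_pow_M[OF assms(2)] _ assms(3)]
  by (auto simp: op_power_scalar_iff(2) nonscalar_def)

text \<open>The exponents belonging to 0, 1 and - 1 are three distinct integers in [0, M).\<close>

lemma M_ge_3:
  assumes "nonscalar"
  shows "3 \<le> M"
proof -
  let ?e = "\<lambda>m. if 0 < m then J - m else - m"
  have r: "rank 0 < W" "rank 1 < W" "rank (- 1) < W"
    using assms by (simp_all add: nonscalar_def rank_def)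
  have "?e 0 \<noteq> ?e 1" "?e 1 \<noteq> ?e (- 1)" "?e 0 \<noteq> ?e (- 1)"
    using exponents_inj[of 0 1] exponents_inj[of 1 "- 1"] exponents_inj[of 0 "- 1"] r by force+
  then show ?thesis
    using exponents[OF r(1)] exponents[OF r(2)] exponents[OF r(3)] by auto
qed

text \<open>Both eigenvalues v and - v^-1 of T occur, so a scalar power forces their m-th powers to
  agree.\<close>

lemma T_pow_iff:
  assumes "nonscalar" "x ^ 2 = 1" "v ^ 2 \<noteq> - 1"
  shows "opT x [^]\<^bsub>G\<^esub> (m::nat) \<in> scalars p \<longleftrightarrow> (- (v ^ 2)) ^ m = 1"
proof
  assume "(- (v ^ 2)) ^ m = 1"
  then show "opT x [^]\<^bsub>G\<^esub> m \<in> scalars p"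
    using T_power_eigen assms v by (auto simp: op_power_scalar_iff(3) intro!: exI[of _ "v ^ m"])
next
  assume "opT x [^]\<^bsub>G\<^esub> m \<in> scalars p"
  then obtain k where k: "k \<noteq> 0" "\<And>f. p dvd (pol_T v ^^ m) f - lconst k * f"
    using assms by (auto simp: op_power_scalar_iff(3))
  have eigen: "e ^ m = k" if "pol_T v h = lconst e * h" "\<not> p dvd h" for e h
  proof (rule ccontr)
    assume ne: "e ^ m \<noteq> k"
    have "(pol_T v ^^ j) h = lconst (e ^ j) * h" for j
      by (induction j) (simp_all add: that linear_scale[OF linear_T] lconst_mult mult.assoc mult.left_commute)
    then have "p dvd lconst (e ^ m - k) * h"
      using k(2)[of h] by (simp add: lconst_diff left_diff_distrib)
    then have "p dvd lconst (inverse (e ^ m - k)) * (lconst (e ^ m - k) * h)"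
      by (rule dvd_mult)
    with ne that(2) show False by simp
  qed
  have vk: "v ^ m = k"
    using one_not_zero_class[of 1] by (intro eigen[of 1]) (simp_all add: pol_T_1)
  \<comment> \<open>If T were the scalar v, then T X = X^-1 T^-1 would give X^2 = v^-2 modulo p, so
    that M would divide 2.\<close>
  obtain f where f: "\<not> p dvd pol_T v f - lconst v * f"
  proof (rule ccontr)
    assume "\<not> thesis"
    then have all: "p dvd pol_T v f - lconst v * f" for f
      using that by blast
    have "p dvd (pol_T v (lX * 1) - lconst v * (lX * 1)) - lXi * (pol_T v 1 - lconst v * 1)"
      by (rule dvd_diff[OF all[of "lX * 1"] dvd_mult[OF all[of 1], of lXi]])
    then have "p dvd lconst (inverse v) * lXi - lconst v * lX"
      using pol_T_X[of v 1] by (simp add: pol_T_inv_def pol_T_1 lconst_diff algebra_simps)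
    then have "p dvd - (lconst (inverse v) * lX) * (lconst (inverse v) * lXi - lconst v * lX)"
      by (rule dvd_mult)
    also have "- (lconst (inverse v) * lX) * (lconst (inverse v) * lXi - lconst v * lX) =
        (lconst (inverse v) * lconst v) * lX ^ 2 - lconst (inverse v) * lconst (inverse v) * (lX * lXi)"
      by (simp add: algebra_simps power2_eq_square del: lX_lXi lX_lXi_left lconst_inverse lconst_inverse_left)
    also have "\<dots> = lX ^ 2 - lconst (inverse v * inverse v)"
      using v by (simp add: lconst_mult)
    finally have "M dvd 2"
      using assms(1) X_power_scalar_imp by (auto simp: nonscalar_def)
    then show False
      using M_ge_3[OF assms(1)] by (auto dest: dvd_imp_le)
  qed
  \<comment> \<open>By the quadratic relation, the image of T - v consists of eigenvectors for -
    v^-1.\<close>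
  have "pol_T v (pol_T v f - lconst v * f) = lconst (- inverse v) * (pol_T v f - lconst v * f)"
    using v by (simp add: linear_diff[OF linear_T] linear_scale[OF linear_T] pol_T_quadratic
        right_diff_distrib lconst_diff lconst_minus) (simp add: algebra_simps)
  then have "(- inverse v) ^ m = k"
    using f by (rule eigen)
  then have "v ^ m * (- (v ^ 2)) ^ m = v ^ m * 1"
    using vk v by (simp add: power2_eq_square flip: power_mult_distrib)
      (metis power_mult_distrib mult_minus_left mult_minus_right minus_minus left_inverse mult.assoc mult_1_left)
  then show "(- (v ^ 2)) ^ m = 1"
    using v by (simp only: mult_cancel_left power_eq_0_iff) auto
qed

lemma tau_inner:
  assumes "x ^ 2 = 1" "y ^ 2 = 1" "braid_triple G (scal p) r (opX x) (opY y) (opT d)"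
  shows "braid_triple.tau_minus_inner G (scal p) (opX x) (opY y)"
proof -
  interpret B: braid_triple G "scal p" r "opX x" "opY y" "opT d" by fact
  have y0: "y \<noteq> 0" using assms(2) by auto
  note GL = op_in_GL[OF assms(1)] op_in_GL[OF assms(2)] opTau_in_GL
  \<comment> \<open>The sign y in the scalar compensates the one contained in
    \<open>opY y\<close>.\<close>
  have "opTau \<otimes>\<^bsub>G\<^esub> opX x = (scal p (c * y) \<otimes>\<^bsub>G\<^esub> (opY y \<otimes>\<^bsub>G\<^esub> opX x)) \<otimes>\<^bsub>G\<^esub> opTau"
  proof (rule GL_ext)
    fix f
    show "(opTau \<otimes>\<^bsub>G\<^esub> opX x) (quot_class p f) =
        (scal p (c * y) \<otimes>\<^bsub>G\<^esub> (opY y \<otimes>\<^bsub>G\<^esub> opX x) \<otimes>\<^bsub>G\<^esub> opTau) (quot_class p f)"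
      using y0 c_nonzero assms(2) by (simp add: GL_mult_class GL op_class scal_in_GL tau_simps
          linear_scale[OF linear_tau(1)] linear_scale[OF linear_Y] lconst_mult lconst_square mult.assoc)
        (simp only: mult.left_commute[of "lconst x" "lconst c"])
  qed (use y0 c_nonzero in \<open>simp_all add: GL scal_in_GL\<close>)
  then have 1: "opTau \<otimes>\<^bsub>G\<^esub> opX x \<otimes>\<^bsub>G\<^esub> inv\<^bsub>G\<^esub> opTau = scal p (c * y) \<otimes>\<^bsub>G\<^esub> (opY y \<otimes>\<^bsub>G\<^esub> opX x)"
    using y0 c_nonzero by (simp add: GL scal_in_GL B.m_assoc)
  have "opTau \<otimes>\<^bsub>G\<^esub> opY y = opY y \<otimes>\<^bsub>G\<^esub> opTau"
  proof (rule GL_ext)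
    fix f
    show "(opTau \<otimes>\<^bsub>G\<^esub> opY y) (quot_class p f) = (opY y \<otimes>\<^bsub>G\<^esub> opTau) (quot_class p f)"
      by (simp add: GL_mult_class GL op_class tau_simps linear_scale[OF linear_tau(1)])
  qed (simp_all add: GL)
  then have 2: "opTau \<otimes>\<^bsub>G\<^esub> opY y \<otimes>\<^bsub>G\<^esub> inv\<^bsub>G\<^esub> opTau = opY y"
    by (simp add: GL B.m_assoc)
  show ?thesis
    unfolding B.tau_minus_inner_def using 1 2 GL(13) y0 c_nonzero
    by (intro bexI[of _ opTau] exI[of _ "c * y"]) simp_all
qed

end

context daha_rep
begin

lemma is_daha_module_rep:
  assumes sq: "x ^ 2 = 1" "y ^ 2 = 1" and vd: "d = 1 \<and> v' = v \<or> d = - 1 \<and> v' = inverse v"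
  shows "is_daha_module p u v' \<lparr>actX = opX x, actY = opY y, actT = opT d\<rparr>"
proof -
  \<comment> \<open>The module relations contain only u = r^2, so any square root serves.\<close>
  define r where "r = csqrt u"
  have r: "r ^ 2 = u"
    by (simp add: r_def)
  have d: "d ^ 2 = 1"
    using vd by auto
  interpret B: braid_triple G "scal p" r "opX x" "opY y" "opT d"
    using r sq d by (rule braid_triple_rep)
  have "(let w' = opT d w \<oplus>\<^bsub>quot p\<^esub> scal p (inverse v') w in opT d w' \<ominus>\<^bsub>quot p\<^esub> scal p v' w') = \<zero>\<^bsub>quot p\<^esub>"
    if w: "w \<in> carrier (quot p)" for w
  proof -
    obtain f where f: "w = quot_class p f"
      using w by (rule quot_cases)
    have "lconst d * pol_T v (lconst d * pol_T v f + lconst (inverse v') * f) -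
        lconst v' * (lconst d * pol_T v f + lconst (inverse v') * f) = 0"
      using vd v
      by (auto simp: linear_add[OF linear_T] linear_diff[OF linear_T] linear_scale[OF linear_T]
          linear_minus[OF linear_T] pol_T_quadratic lconst_minus lconst_diff; simp add: algebra_simps)
    then show ?thesis
      by (simp add: f Let_def op_class quot_minus quot_zero)
  qed
  then show ?thesis
    using B.X_closed B.Y_closed B.T_closed B.TXT B.TYT B.XY_comm
    by (simp add: is_daha_module_def Let_def r)
qed

text \<open>The clause about subgroups S says that the image is generated by the three normalized
  operators; it is used to pass from them to invariance of the integral lattice under the whole
  image.\<close>

lemma braid_image:
  assumes r: "r ^ 2 = u" and sq: "x ^ 2 = 1" "y ^ 2 = 1" "d ^ 2 = 1"
  defines "A \<equiv> \<lparr>actX = opX x, actY = opY y, actT = opT d\<rparr>"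
  shows "\<exists>\<rho>. is_B1_action p r A \<rho> \<and>
    (\<forall>S. subgroup S G \<longrightarrow> scal p (inverse r) \<otimes>\<^bsub>G\<^esub> opX x \<in> S \<longrightarrow> scal p r \<otimes>\<^bsub>G\<^esub> opY y \<in> S \<longrightarrow>
       scal p r \<otimes>\<^bsub>G\<^esub> opT d \<in> S \<longrightarrow> carrier (B_tilde p \<rho>) \<subseteq> S) \<and>
    group_center (B_tilde p \<rho>) = carrier (B_tilde p \<rho>) \<inter> scalars p \<and>
    natural_triangle_quotient M p r A \<rho> \<and>
    (nonscalar \<longrightarrow> (\<forall>g\<in>{x_img p r A, y_img p r A, z_img p A,
         A_img p A \<otimes>\<^bsub>G\<^esub> B_img p r A \<otimes>\<^bsub>G\<^esub> A_img p A \<otimes>\<^bsub>G\<^esub> C_img p A}.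
       ord_in_B_dag p \<rho> g = M \<and> ord_mod_scalars p g = M))"
proof -
  interpret B: braid_triple G "scal p" r "opX x" "opY y" "opT d"
    using r sq by (rule braid_triple_rep)
  have Z: "B.Z = scalars p"
    by (simp add: B.Z_def scalars_eq)
  have Bt: "B_tilde p B.braid_rep = B.GH"
    by (simp add: B_tilde_def B.braid_rep_image)
  have dag: "B_dag p B.braid_rep = B.GH Mod group_center B.GH"
    by (simp add: B_dag_def Bt)
  have to_dag: "to_B_dag p B.braid_rep = B.center_proj"
    by (rule ext) (simp add: to_B_dag_def Bt B.center_proj_def)
  have imgs: "A_img p A = B.A" "B_img p r A = B.B" "C_img p A = B.C"
    "x_img p r A = scal p r \<otimes>\<^bsub>G\<^esub> opY y"
    "y_img p r A = scal p r \<otimes>\<^bsub>G\<^esub> inv\<^bsub>G\<^esub> opT d \<otimes>\<^bsub>G\<^esub> inv\<^bsub>G\<^esub> opX x \<otimes>\<^bsub>G\<^esub> opT d"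
    "z_img p A = inv\<^bsub>G\<^esub> opY y \<otimes>\<^bsub>G\<^esub> inv\<^bsub>G\<^esub> opX x"
    by (simp_all add: A_img_def B_img_def C_img_def x_img_def y_img_def z_img_def A_def)
  have inner: B.tau_minus_inner
    using sq(1,2) B.braid_triple_axioms by (rule tau_inner)
  have 1: "is_B1_action p r A B.braid_rep"
    using B.braid_rep_hom B.braid_rep_gen by (simp add: is_B1_action_def A_def)
  have 2: "carrier (B_tilde p B.braid_rep) \<subseteq> S"
    if "subgroup S G" "B.Xt \<in> S" "B.Yt \<in> S" "B.Tt \<in> S" for S
  proof -
    have "range B.braid_gens \<subseteq> S"
    proof
      fix g assume "g \<in> range B.braid_gens"
      then obtain b where "g = B.braid_gens b" by blast
      then show "g \<in> S" using that by (cases b) simp_all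
    qed
    then show ?thesis
      using B.word_val_in_subgroup[OF that(1)] by (auto simp: Bt B.H_def)
  qed
  have 3: "group_center (B_tilde p B.braid_rep) = carrier (B_tilde p B.braid_rep) \<inter> scalars p"
    unfolding Bt B.center_GH Z by simp
  have 4: "natural_triangle_quotient M p r A B.braid_rep"
    using B.triangle_quotient[OF inner, of M] X_pow_M[OF sq(1)] Y_pow_M[OF sq(2)]
      B.A_in_H B.B_in_H B.C_in_H
    unfolding natural_triangle_quotient_def imgs dag to_dag Bt Z by simp
  have H: "subgroup B.H G"
    by (rule B.subgroup_H)
  have xH: "scal p r \<otimes>\<^bsub>G\<^esub> opY y \<in> B.H"
    by (rule B.Yt_in_H)
  have yH: "scal p r \<otimes>\<^bsub>G\<^esub> inv\<^bsub>G\<^esub> opT d \<otimes>\<^bsub>G\<^esub> inv\<^bsub>G\<^esub> opX x \<otimes>\<^bsub>G\<^esub> opT d \<in> B.H"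
    using subgroup.m_closed[OF H B.B_in_H B.C_in_H] by (simp only: B.BC)
  have zH: "inv\<^bsub>G\<^esub> opY y \<otimes>\<^bsub>G\<^esub> inv\<^bsub>G\<^esub> opX x \<in> B.H"
    using subgroup.m_closed[OF H B.C_in_H B.A_in_H] by (simp only: B.CA)
  have wH: "B.A \<otimes>\<^bsub>G\<^esub> B.B \<otimes>\<^bsub>G\<^esub> B.A \<otimes>\<^bsub>G\<^esub> B.C \<in> B.H"
    using H B.A_in_H B.B_in_H B.C_in_H by (simp add: subgroup.m_closed)
  have ord: "ord_in_B_dag p B.braid_rep g = M \<and> ord_mod_scalars p g = M"
    if "g \<in> B.H" "\<And>m::nat. g [^]\<^bsub>G\<^esub> m \<in> B.Z \<longleftrightarrow> M dvd m" for g
    unfolding ord_in_B_dag_def ord_mod_scalars_def PGL_quot_def dag to_dag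
    using B.ord_center_quotient[OF that] B.ord_scalar_quotient[OF _ that(2)]
      subgroup.subset[OF H] that(1) by (auto simp: Z)
  have 5: "ord_in_B_dag p B.braid_rep g = M \<and> ord_mod_scalars p g = M"
    if ns: nonscalar and g: "g \<in> {x_img p r A, y_img p r A, z_img p A,
         A_img p A \<otimes>\<^bsub>G\<^esub> B_img p r A \<otimes>\<^bsub>G\<^esub> A_img p A \<otimes>\<^bsub>G\<^esub> C_img p A}" for g
  proof -
    note X = X_pow_iff[OF ns sq(1) B.braid_triple_axioms, folded Z]
    note Y = Y_pow_iff[OF ns sq(2) B.braid_triple_axioms, folded Z]
    show ?thesis
      using g xH yH zH wH unfolding imgs
      by (elim insertE emptyE)
        (simp_all only: ord B.pow_x B.pow_y B.pow_z[OF inner] B.pow_ABAC[OF inner] X Y)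
  qed
  show ?thesis
    using 1 2 3 4 5 by (intro exI[of _ B.braid_rep]) blast
qed

lemma braid_identities:
  assumes r: "r ^ 2 = u" and sq: "x ^ 2 = 1" "y ^ 2 = 1" "d ^ 2 = 1"
  defines "D \<equiv> \<lparr>actX = opX x, actY = opY y, actT = opT d\<rparr>"
  defines "A \<equiv> A_img p D" and "B \<equiv> B_img p r D" and "C \<equiv> C_img p D"
    and "X \<equiv> actX D" and "Y \<equiv> actY D" and "T \<equiv> actT D" and "Tt \<equiv> scal p r \<otimes>\<^bsub>G\<^esub> actT D"
  shows "y_img p r D = scal p r \<otimes>\<^bsub>G\<^esub> X \<otimes>\<^bsub>G\<^esub> T \<otimes>\<^bsub>G\<^esub> T"
    and "z_img p D = scal p r \<otimes>\<^bsub>G\<^esub> inv\<^bsub>G\<^esub> Y \<otimes>\<^bsub>G\<^esub> inv\<^bsub>G\<^esub> (actX (tau_minus p r D)) \<otimes>\<^bsub>G\<^esub> Y"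
    and "\<exists>s\<in>scalars p. A \<otimes>\<^bsub>G\<^esub> B \<otimes>\<^bsub>G\<^esub> A \<otimes>\<^bsub>G\<^esub> C = s \<otimes>\<^bsub>G\<^esub> (Y \<otimes>\<^bsub>G\<^esub> X \<otimes>\<^bsub>G\<^esub> Y)"
    and "Y \<otimes>\<^bsub>G\<^esub> X \<otimes>\<^bsub>G\<^esub> Y = actY (tau_plus p r (tau_minus p r D))"
    and "Tt = A \<otimes>\<^bsub>G\<^esub> B \<otimes>\<^bsub>G\<^esub> C"
    and "Tt \<otimes>\<^bsub>G\<^esub> Tt = x_img p r D \<otimes>\<^bsub>G\<^esub> z_img p D \<otimes>\<^bsub>G\<^esub> y_img p r D"
    and "nonscalar \<Longrightarrow> v ^ 2 \<noteq> - 1 \<Longrightarrow> ord_mod_scalars p Tt = complex_ord (- (v ^ 2))"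
    and "nonscalar \<Longrightarrow> v ^ 2 \<noteq> - 1 \<Longrightarrow> ord_mod_scalars p (Tt \<otimes>\<^bsub>G\<^esub> Tt) = complex_ord ((v ^ 2) ^ 2)"
    and "nonscalar \<Longrightarrow> v ^ 2 \<noteq> - 1 \<Longrightarrow> ord_mod_scalars p (T \<otimes>\<^bsub>G\<^esub> T) = complex_ord ((v ^ 2) ^ 2)"
proof -
  interpret B: braid_triple G "scal p" r "opX x" "opY y" "opT d"
    using r sq by (rule braid_triple_rep)
  have Z: "B.Z = scalars p"
    by (simp add: B.Z_def scalars_eq)
  have D: "actX D = opX x" "actY D = opY y" "actT D = opT d"
    by (simp_all add: D_def)
  note defs = D A_def B_def C_def X_def Y_def T_def Tt_def A_img_def B_img_def C_img_def
    x_img_def y_img_def z_img_def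
  show "y_img p r D = scal p r \<otimes>\<^bsub>G\<^esub> X \<otimes>\<^bsub>G\<^esub> T \<otimes>\<^bsub>G\<^esub> T"
    unfolding defs by (rule B.y_eq)
  show "z_img p D = scal p r \<otimes>\<^bsub>G\<^esub> inv\<^bsub>G\<^esub> Y \<otimes>\<^bsub>G\<^esub> inv\<^bsub>G\<^esub> (actX (tau_minus p r D)) \<otimes>\<^bsub>G\<^esub> Y"
    using B.z_eq by (simp add: defs tau_minus_def)
  show "\<exists>s\<in>scalars p. A \<otimes>\<^bsub>G\<^esub> B \<otimes>\<^bsub>G\<^esub> A \<otimes>\<^bsub>G\<^esub> C = s \<otimes>\<^bsub>G\<^esub> (Y \<otimes>\<^bsub>G\<^esub> X \<otimes>\<^bsub>G\<^esub> Y)"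
    using B.ABAC B.s_in_Z[OF B.r_nonzero] unfolding defs Z by blast
  show "Y \<otimes>\<^bsub>G\<^esub> X \<otimes>\<^bsub>G\<^esub> Y = actY (tau_plus p r (tau_minus p r D))"
    using B.tau_eq by (simp add: defs tau_minus_def tau_plus_def)
  show "Tt = A \<otimes>\<^bsub>G\<^esub> B \<otimes>\<^bsub>G\<^esub> C"
    unfolding defs by (rule B.ABC[symmetric])
  show "Tt \<otimes>\<^bsub>G\<^esub> Tt = x_img p r D \<otimes>\<^bsub>G\<^esub> z_img p D \<otimes>\<^bsub>G\<^esub> y_img p r D"
    unfolding defs by (rule B.Tt_square)
  have v0: "- (v ^ 2) \<noteq> 0"
    using v by simp
  have ord: "ord_mod_scalars p g = complex_ord e"
    if "g \<in> carrier G" "e \<noteq> 0" "\<And>m::nat. g [^]\<^bsub>G\<^esub> m \<in> B.Z \<longleftrightarrow> e ^ m = 1" for g e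
    using B.ord_scalar_quotient[OF that(1)] that(2,3) pow_eq_1_iff_complex_ord
    by (simp add: ord_mod_scalars_def PGL_quot_def Z)
  have sq_pow: "(g \<otimes>\<^bsub>G\<^esub> g) [^]\<^bsub>G\<^esub> (m::nat) = g [^]\<^bsub>G\<^esub> (2 * m)" if "g \<in> carrier G" for g m
    using B.nat_pow_pow[OF that, of 2 m] that by (simp add: numeral_2_eq_2)
  have e: "(- (v ^ 2)) ^ (2 * m) = ((v ^ 2) ^ 2) ^ m" for m
    by (simp add: power_mult)
  assume ns: nonscalar and v2: "v ^ 2 \<noteq> - 1"
  have T: "opT d [^]\<^bsub>G\<^esub> m \<in> B.Z \<longleftrightarrow> (- (v ^ 2)) ^ m = 1" for m :: nat
    using T_pow_iff[OF ns sq(3) v2] by (simp add: Z)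
  have Tt: "B.Tt [^]\<^bsub>G\<^esub> m \<in> B.Z \<longleftrightarrow> (- (v ^ 2)) ^ m = 1" for m :: nat
    using B.r_nonzero by (simp add: B.pow_Z_mult T)
  show "ord_mod_scalars p Tt = complex_ord (- (v ^ 2))"
    unfolding defs by (rule ord) (use v0 Tt in simp_all)
  show "ord_mod_scalars p (Tt \<otimes>\<^bsub>G\<^esub> Tt) = complex_ord ((v ^ 2) ^ 2)"
    unfolding defs by (rule ord) (use v Tt sq_pow e in \<open>simp_all del: power2_eq_iff\<close>)
  show "ord_mod_scalars p (T \<otimes>\<^bsub>G\<^esub> T) = complex_ord ((v ^ 2) ^ 2)"
    unfolding defs by (rule ord) (use v T sq_pow e in \<open>simp_all del: power2_eq_iff\<close>)
qed

lemma quot_dim_W: "quot_dim p W"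
proof -
  interpret Q: cring "quot p" by (rule cring_quot)
  let ?K = "range (\<lambda>k. quot_class p (lconst k))"
  \<comment> \<open>A flag with one monomial added at each step in the order of \<open>rank\<close>.
    The new class is independent because the window meets the ideal only in 0.\<close>
  define E where "E k = {quot_class p f | f. supp_lt k f}" for k
  have "Q.dimension k ?K (E k)" if "k \<le> W" for k
    using that
  proof (induction k)
    case 0
    have "E 0 = {\<zero>\<^bsub>quot p\<^esub>}"
      by (auto simp: E_def supp_lt_0 quot_zero)
    then show ?case by simp
  next
    case (Suc k)
    let ?b = "lmon (unrank k) :: complex laurent"
    have notin: "quot_class p ?b \<notin> E k"
    proof
      assume "quot_class p ?b \<in> E k"
      then obtain f where f: "supp_lt k f" "p dvd ?b - f"
        by (auto simp: E_def quot_class_eq_iff)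
      have "supp_lt W (?b - f)"
        using f(1) Suc.prems by (intro supp_lt_diff supp_lt_lmon) (auto intro: supp_lt_mono)
      then have "?b - f = 0"
        using f(2) by (rule supp_lt_zero_if_dvd)
      then have "f = ?b" by simp
      then show False
        using supp_ltD[OF f(1), of "unrank k"] by simp
    qed
    have "E (Suc k) = Q.line_extension ?K (quot_class p ?b) (E k)"
    proof (intro equalityI subsetI)
      fix w assume "w \<in> E (Suc k)"
      then obtain f where f: "w = quot_class p f" "supp_lt (Suc k) f"
        by (auto simp: E_def)
      define a where "a = Poly_Mapping.lookup f (unrank k)"
      have "supp_lt (Suc k) (f - lconst a * ?b)"
        using f(2) by (intro supp_lt_diff supp_lt_scale supp_lt_lmon) simp_all
      then have "supp_lt k (f - lconst a * ?b)"
        by (rule supp_lt_Suc) (simp add: lookup_minus a_def)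
      then have "quot_class p (f - lconst a * ?b) \<in> E k"
        by (auto simp: E_def)
      moreover have "w = quot_class p (lconst a) \<otimes>\<^bsub>quot p\<^esub> quot_class p ?b
          \<oplus>\<^bsub>quot p\<^esub> quot_class p (f - lconst a * ?b)"
        by (simp add: f(1))
      ultimately show "w \<in> Q.line_extension ?K (quot_class p ?b) (E k)"
        unfolding Q.line_extension_mem_iff by blast
    next
      fix w assume "w \<in> Q.line_extension ?K (quot_class p ?b) (E k)"
      then obtain a f where "w = quot_class p (lconst a) \<otimes>\<^bsub>quot p\<^esub> quot_class p ?b \<oplus>\<^bsub>quot p\<^esub> quot_class p f"
          and f: "supp_lt k f"
        unfolding Q.line_extension_mem_iff by (auto simp: E_def)
      then have "w = quot_class p (lconst a * ?b + f)"
        by simp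
      moreover have "supp_lt (Suc k) (lconst a * ?b + f)"
        using f by (intro supp_lt_add supp_lt_scale supp_lt_lmon) (auto intro: supp_lt_mono)
      ultimately show "w \<in> E (Suc k)"
        by (auto simp: E_def)
    qed
    moreover have "Q.dimension (Suc k) ?K (Q.line_extension ?K (quot_class p ?b) (E k))"
      using Suc notin by (intro Q.Suc_dim) simp_all
    ultimately show ?case by simp
  qed
  moreover have "E W = carrier (quot p)"
  proof (intro equalityI subsetI)
    fix w assume "w \<in> carrier (quot p)"
    then obtain f where f: "w = quot_class p f"
      by (rule quot_cases)
    obtain g where "supp_lt W g" "p dvd f - g"
      using supp_lt_rep by blast
    then show "w \<in> E W"
      unfolding E_def f using quot_class_eq_iff by blast
  qed (auto simp: E_def)
  ultimately show ?thesis
    by (metis quot_dim_def order_refl)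
qed

end

section \<open>The integral structure\<close>

lemma int_laurent_ring_add:
  assumes "a \<in> int_laurent_ring d" "b \<in> int_laurent_ring d"
  shows "a + b \<in> int_laurent_ring d"
proof -
  obtain A e where A: "finite A" "a = (\<Sum>i\<in>A. of_int (e i) * d powi i)"
    using assms(1) by (auto simp: int_laurent_ring_def)
  obtain B h where B: "finite B" "b = (\<Sum>i\<in>B. of_int (h i) * d powi i)"
    using assms(2) by (auto simp: int_laurent_ring_def)
  define e' where "e' i = (if i \<in> A then e i else 0)" for i
  define h' where "h' i = (if i \<in> B then h i else 0)" for i
  have "a = (\<Sum>i\<in>A \<union> B. of_int (e' i) * d powi i)"
    unfolding A(2) using A(1) B(1) by (intro sum.mono_neutral_cong_left) (auto simp: e'_def)
  moreover have "b = (\<Sum>i\<in>A \<union> B. of_int (h' i) * d powi i)"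
    unfolding B(2) using A(1) B(1) by (intro sum.mono_neutral_cong_left) (auto simp: h'_def)
  ultimately have "a + b = (\<Sum>i\<in>A \<union> B. of_int (e' i + h' i) * d powi i)"
    by (simp add: distrib_right sum.distrib)
  then show ?thesis
    using A(1) B(1) unfolding int_laurent_ring_def
    by (intro CollectI exI[of _ "A \<union> B"] exI[of _ "\<lambda>i. e' i + h' i"]) simp
qed

lemma int_laurent_ring_powi: "of_int k * d powi i \<in> int_laurent_ring d"
  unfolding int_laurent_ring_def
  by (rule CollectI, rule exI[of _ "{i}"], rule exI[of _ "\<lambda>_. k"]) simp

lemma int_laurent_ring_0: "0 \<in> int_laurent_ring d"
  using int_laurent_ring_powi[of 0] by simp

lemma int_laurent_ring_sum:
  "(\<And>i. i \<in> A \<Longrightarrow> F i \<in> int_laurent_ring d) \<Longrightarrow> sum F A \<in> int_laurent_ring d"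
  by (induction A rule: infinite_finite_induct) (simp_all add: int_laurent_ring_0 int_laurent_ring_add)

lemma int_laurent_ring_mult:
  assumes "a \<in> int_laurent_ring d" "b \<in> int_laurent_ring d" "d \<noteq> 0"
  shows "a * b \<in> int_laurent_ring d"
proof -
  obtain A e where A: "finite A" "a = (\<Sum>i\<in>A. of_int (e i) * d powi i)"
    using assms(1) by (auto simp: int_laurent_ring_def)
  obtain B h where B: "finite B" "b = (\<Sum>i\<in>B. of_int (h i) * d powi i)"
    using assms(2) by (auto simp: int_laurent_ring_def)
  have "a * b = (\<Sum>i\<in>A. \<Sum>j\<in>B. of_int (e i * h j) * d powi (i + j))"
    using assms(3) unfolding A(2) B(2) sum_product by (simp add: power_int_add mult_ac)
  then show ?thesis
    by (simp only: int_laurent_ring_sum int_laurent_ring_powi)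
qed

lemma int_laurent_ring_minus: "a \<in> int_laurent_ring d \<Longrightarrow> d \<noteq> 0 \<Longrightarrow> - a \<in> int_laurent_ring d"
  using int_laurent_ring_mult[of "- 1" d a] int_laurent_ring_powi[of "- 1" d 0] by simp

definition lattice :: "complex \<Rightarrow> complex \<Rightarrow> complex laurent set" where
  "lattice r d = {f. \<forall>n. r powi n * Poly_Mapping.lookup f n \<in> int_laurent_ring d}"

context daha_rep
begin

text \<open>For odd 2k neither r = q^(1/4) nor v = t^(1/2) need lie in the ring generated by
  q^(1/2), but r v and r v^-1 do; this is why T and Y are integral only after multiplication by
  r.\<close>

context
  fixes r e :: complex
  assumes r: "r ^ 2 = u" and e0: "e \<noteq> 0"
    and units: "\<And>k. u powi k \<in> int_laurent_ring e"
    and rv: "r * v \<in> int_laurent_ring e" and rv': "r * inverse v \<in> int_laurent_ring e"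
begin

lemma r0: "r \<noteq> 0" using r u by auto

lemma lattice_add: "f \<in> lattice r e \<Longrightarrow> g \<in> lattice r e \<Longrightarrow> f + g \<in> lattice r e"
  by (simp add: lattice_def lookup_add distrib_left int_laurent_ring_add)

lemma lattice_scale: "z \<in> int_laurent_ring e \<Longrightarrow> f \<in> lattice r e \<Longrightarrow> lconst z * f \<in> lattice r e"
  by (simp add: lattice_def mult.left_commute[of _ z] int_laurent_ring_mult e0)

lemma lattice_minus: "f \<in> lattice r e \<Longrightarrow> - f \<in> lattice r e"
  by (simp add: lattice_def int_laurent_ring_minus e0)

lemma lattice_sum: "(\<And>i. i \<in> A \<Longrightarrow> F i \<in> lattice r e) \<Longrightarrow> sum F A \<in> lattice r e"
  by (induction A rule: infinite_finite_induct)
    (simp_all add: lattice_add, simp_all add: lattice_def int_laurent_ring_0)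

lemma lattice_lmon: "z * r powi n \<in> int_laurent_ring e \<Longrightarrow> lconst z * lmon n \<in> lattice r e"
  by (simp add: lattice_def lookup_single when_def int_laurent_ring_0 mult.commute)

text \<open>It suffices to test the powers of the normalized generator r^-1 X, which span the
  lattice over the ring.\<close>

lemma lattice_stable:
  assumes "laurent_linear D" "\<And>n. D (lconst (r powi (- n)) * lmon n) \<in> lattice r e" "f \<in> lattice r e"
  shows "D f \<in> lattice r e"
proof -
  have rr: "r powi n * z * r powi (- n) = z" for n z
    using r0 by (simp add: power_int_minus)
  have "lconst (Poly_Mapping.lookup f n) * D (lmon n) =
      lconst (r powi n * Poly_Mapping.lookup f n) * D (lconst (r powi (- n)) * lmon n)" for n
    unfolding linear_scale[OF assms(1)] mult.assoc[symmetric] lconst_mult[symmetric] rr ..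
  then have "D f = (\<Sum>n\<in>Poly_Mapping.keys f. lconst (r powi n * Poly_Mapping.lookup f n) *
      D (lconst (r powi (- n)) * lmon n))"
    by (subst linear_expand[OF assms(1)]) simp
  also have "\<dots> \<in> lattice r e"
    by (intro lattice_sum lattice_scale assms(2)) (use assms(3) in \<open>simp add: lattice_def\<close>)
  finally show ?thesis .
qed

lemma lattice_X: "f \<in> lattice r e \<Longrightarrow> lconst (inverse r) * (lX * f) \<in> lattice r e"
  and lattice_Xi: "f \<in> lattice r e \<Longrightarrow> lconst r * (lXi * f) \<in> lattice r e"
proof -
  assume f: "f \<in> lattice r e"
  have eq: "r powi n * (inverse r * z) = r powi (n - 1) * z" "r powi n * (r * z) = r powi (n + 1) * z" for n z
    using r0 by (simp_all add: power_int_diff power_int_add divide_inverse)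
  show "lconst (inverse r) * (lX * f) \<in> lattice r e" "lconst r * (lXi * f) \<in> lattice r e"
    using f by (simp_all add: lattice_def lookup_lX_mult lookup_lmon_mult eq)
qed

lemma lattice_pi:
  assumes "f \<in> lattice r e"
  shows "pol_pi u f \<in> lattice r e"
proof -
  have eq: "r powi n * (u powi (- n) * z) = r powi (- n) * z" for n z
    using r0 unfolding r[symmetric]
    by (simp add: power_int_minus power2_eq_square power_int_mult_distrib)
  show ?thesis
    using assms u by (simp add: lattice_def lookup_pi eq)
qed

text \<open>All exponents in T X^n have the parity of n. The comparison of normalizations therefore
  needs only even powers of r, which are powers of u.\<close>

lemma lattice_T:
  assumes "f \<in> lattice r e"
  shows "lconst r * pol_T v f \<in> lattice r e"
proof (rule lattice_stable[OF _ _ assms])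
  show "laurent_linear (\<lambda>f. lconst r * pol_T v f)"
    by (intro linear_mult_fun linear_T)
  fix n
  have rp: "r powi (2 * k) \<in> int_laurent_ring e" for k
    using units[of k] unfolding r[symmetric] by (simp add: power_int_mult)
  have mon: "lconst (a * r powi (- n)) * lmon (n + 2 * k) \<in> lattice r e"
    if "a \<in> int_laurent_ring e" for a k
  proof (rule lattice_lmon)
    have "a * r powi (- n) * r powi (n + 2 * k) = a * r powi (2 * k)"
      using r0 by (simp add: power_int_add power_int_minus)
    then show "a * r powi (- n) * r powi (n + 2 * k) \<in> int_laurent_ring e"
      by (simp only: int_laurent_ring_mult[OF that rp e0])
  qed
  define a where "a = r * v - r * inverse v"
  have a: "a \<in> int_laurent_ring e"
    using int_laurent_ring_add[OF rv int_laurent_ring_minus[OF rv' e0]] by (simp add: a_def)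
  have "lconst (a * r powi (- n)) * ddiff_mon n \<in> lattice r e"
  proof (cases "0 \<le> n")
    case True
    have "lconst (a * r powi (- n)) * lmon (- n + 2 * int i) \<in> lattice r e" for i
      using mon[OF a, of "int i - n"] by (simp add: algebra_simps)
    then have "(\<Sum>i\<in>{..<nat n}. lconst (a * r powi (- n)) * lmon (- n + 2 * int i)) \<in> lattice r e"
      by (intro lattice_sum)
    from lattice_minus[OF this] show ?thesis
      using True unfolding ddiff_mon_def by (simp only: if_True mult_minus_right sum_distrib_left)
  next
    case False
    have "(\<Sum>i\<in>{..<nat (- n)}. lconst (a * r powi (- n)) * lmon (n + 2 * int i)) \<in> lattice r e"
      by (intro lattice_sum mon a)
    then show ?thesis
      using False unfolding ddiff_mon_def by (simp only: if_False sum_distrib_left)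
  qed
  moreover have "lconst (r * v * r powi (- n)) * lmon (- n) \<in> lattice r e"
    using mon[OF rv, of "- n"] by simp
  ultimately have "lconst (r * v * r powi (- n)) * lmon (- n) +
      lconst (a * r powi (- n)) * ddiff_mon n \<in> lattice r e"
    by (rule lattice_add[rotated])
  also have "lconst (r * v * r powi (- n)) * lmon (- n) + lconst (a * r powi (- n)) * ddiff_mon n =
      lconst r * pol_T v (lconst (r powi (- n)) * lmon n)"
    unfolding linear_scale[OF linear_T] unfolding pol_T_ddiff pol_s_lmon lin_lmon
    by (simp add: a_def lconst_mult lconst_diff algebra_simps)
  finally show "lconst r * pol_T v (lconst (r powi (- n)) * lmon n) \<in> lattice r e" .
qed

text \<open>T^-1 differs from T by the scalar v - v^-1, and r^-1 = u^-1 r brings back the multiple r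
  T.\<close>

lemma lattice_T_inv:
  assumes "f \<in> lattice r e"
  shows "lconst (inverse r) * pol_T_inv v f \<in> lattice r e"
proof -
  have ui: "inverse u \<in> int_laurent_ring e"
    using units[of "- 1"] by (simp add: power_int_minus)
  have r': "inverse r = inverse u * r"
    using r0 unfolding r[symmetric] by (simp add: power2_eq_square)
  have a: "- (r * v - r * inverse v) \<in> int_laurent_ring e"
    using int_laurent_ring_add[OF rv int_laurent_ring_minus[OF rv' e0]] int_laurent_ring_minus e0 by force
  have "lconst (inverse u) * (lconst r * pol_T v f + lconst (- (r * v - r * inverse v)) * f) \<in> lattice r e"
    using assms ui a by (intro lattice_scale lattice_add lattice_T)
  also have "lconst (inverse u) * (lconst r * pol_T v f + lconst (- (r * v - r * inverse v)) * f) =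
      lconst (inverse r) * pol_T_inv v f"
    unfolding r' by (simp add: pol_T_inv_def lconst_mult lconst_diff lconst_minus algebra_simps)
  finally show ?thesis .
qed

lemma lattice_Y: "f \<in> lattice r e \<Longrightarrow> lconst r * pol_Y u v f \<in> lattice r e"
  using lattice_pi[OF lattice_T] by (simp add: pol_Y_def linear_scale[OF linear_pi])

lemma lattice_Y_inv: "f \<in> lattice r e \<Longrightarrow> lconst (inverse r) * pol_Y_inv u v f \<in> lattice r e"
  by (simp add: pol_Y_inv_def lattice_T_inv lattice_pi)

lemma quot_lattice_eq: "quot_lattice p r e = quot_class p ` lattice r e"
  by (auto simp: quot_lattice_def lattice_def)

text \<open>The condition is equality of the image with the lattice, not inclusion, so that inverses
  are covered.\<close>

lemma subgroup_lattice_stabilizer: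
  "subgroup {g \<in> carrier G. g ` quot_lattice p r e = quot_lattice p r e} G"
proof -
  interpret G: group G by (rule group_GL)
  let ?L = "quot_lattice p r e"
  have LV: "?L \<subseteq> carrier (quot p)"
    by (auto simp: quot_lattice_eq)
  have comp: "(g \<otimes>\<^bsub>G\<^esub> h) ` ?L = g ` h ` ?L" if "g \<in> carrier G" "h \<in> carrier G" for g h
    unfolding GL_mult[OF that] image_image using LV by (intro image_cong refl) (auto simp: compose_def)
  have one: "\<one>\<^bsub>G\<^esub> ` ?L = ?L"
  proof -
    have "\<one>\<^bsub>G\<^esub> w = w" if "w \<in> ?L" for w
      using that LV by (auto simp: GL_quot_def BijGroup_def)
    then show ?thesis by simp
  qed
  show ?thesis
  proof (rule G.subgroupI)
    show "inv\<^bsub>G\<^esub> g \<in> {g \<in> carrier G. g ` ?L = ?L}" if "g \<in> {g \<in> carrier G. g ` ?L = ?L}" for g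
      using that comp[of "inv\<^bsub>G\<^esub> g" g] one by simp
    show "g \<otimes>\<^bsub>G\<^esub> h \<in> {g \<in> carrier G. g ` ?L = ?L}"
      if "g \<in> {g \<in> carrier G. g ` ?L = ?L}" "h \<in> {g \<in> carrier G. g ` ?L = ?L}" for g h
      using that comp[of g h] by simp
  qed (use one in auto)
qed

lemma lattice_image:
  assumes "\<And>f. g (quot_class p f) = quot_class p (D f)" "\<And>f. D (D' f) = f"
    and "\<And>f. f \<in> lattice r e \<Longrightarrow> D f \<in> lattice r e" "\<And>f. f \<in> lattice r e \<Longrightarrow> D' f \<in> lattice r e"
  shows "g ` quot_lattice p r e = quot_lattice p r e"
proof -
  have "quot_class p f \<in> g ` quot_class p ` lattice r e" if "f \<in> lattice r e" for f
    using assms(1)[of "D' f"] assms(2)[of f] assms(4)[OF that] by (metis image_eqI)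
  then show ?thesis
    using assms(1,3) by (auto simp: quot_lattice_eq)
qed

lemma lattice_invariant:
  assumes sq: "x ^ 2 = 1" "y ^ 2 = 1" "d ^ 2 = 1"
  shows "(scal p (inverse r) \<otimes>\<^bsub>G\<^esub> opX x) ` quot_lattice p r e = quot_lattice p r e"
    and "(scal p r \<otimes>\<^bsub>G\<^esub> opY y) ` quot_lattice p r e = quot_lattice p r e"
    and "(scal p r \<otimes>\<^bsub>G\<^esub> opT d) ` quot_lattice p r e = quot_lattice p r e"
proof -
  note GL = op_in_GL[OF sq(1)] op_in_GL[OF sq(2)] op_in_GL[OF sq(3)]
  have sgn: "lconst z * f \<in> lattice r e" if "z ^ 2 = 1" "f \<in> lattice r e" for z f
  proof -
    have "z = 1 \<or> z = - 1"
      using that(1) by (simp add: power2_eq_1_iff)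
    then show ?thesis
      using that(2) lattice_minus by (auto simp: lconst_minus)
  qed
  have ri: "inverse r \<noteq> 0"
    using r0 by simp
  show "(scal p (inverse r) \<otimes>\<^bsub>G\<^esub> opX x) ` quot_lattice p r e = quot_lattice p r e"
  proof (rule lattice_image)
    show "(scal p (inverse r) \<otimes>\<^bsub>G\<^esub> opX x) (quot_class p f) =
        quot_class p (lconst x * (lconst (inverse r) * (lX * f)))" for f
      by (simp add: GL_mult_class scal_in_GL[OF ri] GL op_class mult.left_commute[of "lconst x"])
    show "lconst x * (lconst (inverse r) * (lX * (lconst x * (lconst r * (lXi * f))))) = f" for f
      using r0 sq by (simp add: lX_lconst lconst_square_left)
  qed (use sgn sq lattice_X lattice_Xi in blast)+
  show "(scal p r \<otimes>\<^bsub>G\<^esub> opY y) ` quot_lattice p r e = quot_lattice p r e"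
  proof (rule lattice_image)
    show "(scal p r \<otimes>\<^bsub>G\<^esub> opY y) (quot_class p f) = quot_class p (lconst y * (lconst r * pol_Y u v f))" for f
      by (simp add: GL_mult_class scal_in_GL[OF r0] GL op_class mult.left_commute[of "lconst y"])
    show "lconst y * (lconst r * pol_Y u v (lconst y * (lconst (inverse r) * pol_Y_inv u v f))) = f" for f
      using r0 sq u v by (simp add: linear_scale[OF linear_Y] lconst_square_left pol_Y_Y_inv)
  qed (use sgn sq lattice_Y lattice_Y_inv in blast)+
  show "(scal p r \<otimes>\<^bsub>G\<^esub> opT d) ` quot_lattice p r e = quot_lattice p r e"
  proof (rule lattice_image)
    show "(scal p r \<otimes>\<^bsub>G\<^esub> opT d) (quot_class p f) = quot_class p (lconst d * (lconst r * pol_T v f))" for f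
      by (simp add: GL_mult_class scal_in_GL[OF r0] GL op_class mult.left_commute[of "lconst d"])
    show "lconst d * (lconst r * pol_T v (lconst d * (lconst (inverse r) * pol_T_inv v f))) = f" for f
      using r0 sq v by (simp add: linear_scale[OF linear_T] lconst_square_left pol_T_T_inv)
  qed (use sgn sq lattice_T lattice_T_inv in blast)+
qed

end

end

section \<open>Products of linear factors and their reflections\<close>

lemma prod_linear_factors_dvd:
  fixes q :: "'a::idom poly" and K :: nat
  assumes "inj_on x {..<K}" "\<And>i. i < K \<Longrightarrow> poly q (x i) = 0"
  shows "(\<Prod>i<K. [:- x i, 1:]) dvd q"
  using assms
proof (induction K)
  case (Suc K)
  then have "(\<Prod>i<K. [:- x i, 1:]) dvd q"
    by (simp add: inj_on_def)
  then obtain g where g: "q = (\<Prod>i<K. [:- x i, 1:]) * g"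
    by (auto simp: dvd_def)
  have "poly (\<Prod>i<K. [:- x i, 1:]) (x K) \<noteq> 0"
  proof -
    have "x K \<noteq> x i" if "i < K" for i
      using inj_onD[OF Suc.prems(1), of K i] that by auto
    then show ?thesis
      by (auto simp: poly_prod)
  qed
  moreover have "poly q (x K) = 0"
    using Suc.prems(2) by simp
  ultimately have "poly g (x K) = 0"
    by (simp add: g)
  then have "[:- x K, 1:] dvd g"
    by (simp add: poly_eq_0_iff_dvd)
  then show ?case
    unfolding g prod.lessThan_Suc by (intro mult_dvd_mono dvd_refl)
qed simp

text \<open>The divisibility is proved for polynomials in a new variable over the Laurent
  polynomials, and then Z, which will be X or X^2, is put for the variable.\<close>

lemma root_product_dvd_power:
  fixes Z :: "'a::field laurent" and K :: nat
  assumes "inj_on \<rho> {..<K}" "\<And>i. i < K \<Longrightarrow> \<rho> i ^ m = \<kappa>"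
  shows "(\<Prod>i<K. Z - lconst (\<rho> i)) dvd Z ^ m - lconst \<kappa>"
proof -
  have "(\<Prod>i<K. [:- lconst (\<rho> i), 1:]) dvd Polynomial.monom 1 m - [:lconst \<kappa>:]"
  proof (rule prod_linear_factors_dvd[where x = "\<lambda>i. lconst (\<rho> i)"])
    show "inj_on (\<lambda>i. lconst (\<rho> i)) {..<K}"
      using assms(1) by (simp add: inj_on_def)
    show "poly (Polynomial.monom 1 m - [:lconst \<kappa>:]) (lconst (\<rho> i)) = 0" if "i < K" for i
      using assms(2)[OF that] by (simp add: poly_monom lconst_power)
  qed
  then obtain g where "Polynomial.monom 1 m - [:lconst \<kappa>:] = (\<Prod>i<K. [:- lconst (\<rho> i), 1:]) * g"
    by (auto simp: dvd_def)
  then have "poly (Polynomial.monom 1 m - [:lconst \<kappa>:]) Z = poly ((\<Prod>i<K. [:- lconst (\<rho> i), 1:]) * g) Z"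
    by simp
  then show ?thesis
    by (simp add: poly_monom poly_prod)
qed

text \<open>Each factor b/Z - \<rho> is - \<rho>/Z times Z - b/\<rho>, so reflection replaces the
  roots \<rho> by b/\<rho>. For s one has b = 1, for \<pi> it is u or u^2.\<close>

lemma reflect_root_product:
  fixes Z Zi :: "'a::field laurent"
  assumes "Z * Zi = 1" "\<And>i. i < K \<Longrightarrow> \<rho> i \<noteq> 0"
  shows "(\<Prod>i<K. lconst b * Zi - lconst (\<rho> i)) =
    Zi ^ K * lconst (\<Prod>i<K. - \<rho> i) * (\<Prod>i<K. Z - lconst (b / \<rho> i))"
  using assms(2)
proof (induction K)
  case (Suc K)
  have "Zi * lconst (- \<rho> K) * (Z - lconst (b / \<rho> K)) =
      lconst (- \<rho> K) * (Z * Zi) - lconst (- \<rho> K * (b / \<rho> K)) * Zi"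
    unfolding lconst_mult by (simp add: algebra_simps)
  also have "\<dots> = lconst b * Zi - lconst (\<rho> K)"
    using Suc.prems[of K] by (simp add: assms(1) lconst_minus)
  finally have eq: "lconst b * Zi - lconst (\<rho> K) = Zi * lconst (- \<rho> K) * (Z - lconst (b / \<rho> K))" ..
  have IH: "(\<Prod>i<K. lconst b * Zi - lconst (\<rho> i)) =
      Zi ^ K * lconst (\<Prod>i<K. - \<rho> i) * (\<Prod>i<K. Z - lconst (b / \<rho> i))"
    using Suc by simp
  show ?case
    unfolding prod.lessThan_Suc IH eq by (simp only: lconst_mult power_Suc mult_ac)
qed simp

lemma lookup_root_product:
  fixes \<rho> :: "nat \<Rightarrow> 'a::field"
  assumes "0 < e"
  defines "P \<equiv> \<lambda>K. \<Prod>i<K. lmon (int e) - lconst (\<rho> i)"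
  shows "Poly_Mapping.lookup (P K) m \<noteq> 0 \<Longrightarrow> 0 \<le> m \<and> m \<le> int (e * K)"
    and "Poly_Mapping.lookup (P K) 0 = (\<Prod>i<K. - \<rho> i)" and "Poly_Mapping.lookup (P K) (int (e * K)) = 1"
proof -
  have P: "P (Suc K) = (lmon (int e) - lconst (\<rho> K)) * P K" for K
    by (simp add: P_def mult.commute)
  have step: "Poly_Mapping.lookup (P (Suc K)) m =
      Poly_Mapping.lookup (P K) (m - int e) - \<rho> K * Poly_Mapping.lookup (P K) m" for K m
    unfolding P by (simp add: left_diff_distrib lookup_minus lookup_lmon_mult)
  have supp: "Poly_Mapping.lookup (P K) m \<noteq> 0 \<Longrightarrow> 0 \<le> m \<and> m \<le> int (e * K)" for K m
  proof (induction K arbitrary: m)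
    case 0
    then show ?case by (simp add: P_def lookup_one when_def split: if_splits)
  next
    case (Suc K)
    then have "Poly_Mapping.lookup (P K) (m - int e) \<noteq> 0 \<or> Poly_Mapping.lookup (P K) m \<noteq> 0"
      unfolding step by auto
    then show ?case
      using Suc.IH[of "m - int e"] Suc.IH[of m] by (auto simp: algebra_simps)
  qed
  then show "Poly_Mapping.lookup (P K) m \<noteq> 0 \<Longrightarrow> 0 \<le> m \<and> m \<le> int (e * K)" .
  show "Poly_Mapping.lookup (P K) 0 = (\<Prod>i<K. - \<rho> i)"
  proof (induction K)
    case (Suc K)
    have "Poly_Mapping.lookup (P K) (0 - int e) = 0"
      using supp[of K "0 - int e"] assms(1) by force
    then show ?case
      unfolding step using Suc by simp
  qed (simp add: P_def)
  show "Poly_Mapping.lookup (P K) (int (e * K)) = 1"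
  proof (induction K)
    case (Suc K)
    have "Poly_Mapping.lookup (P K) (int (e * Suc K)) = 0"
      using supp[of K "int (e * Suc K)"] assms(1) by force
    then show ?case
      unfolding step using Suc by (simp add: algebra_simps)
  qed (simp add: P_def)
qed

lemma pol_s_power: "pol_s (f ^ k) = pol_s f ^ k"
  by (induction k) (simp_all add: pol_s_mult)

lemma pol_s_prod: "pol_s (prod F A) = (\<Prod>i\<in>A. pol_s (F i))"
  by (induction A rule: infinite_finite_induct) (simp_all add: pol_s_mult)

lemma pol_pi_power: "u \<noteq> 0 \<Longrightarrow> pol_pi u (f ^ k) = pol_pi u f ^ k"
  by (induction k) (simp_all add: pol_pi_mult)

lemma pol_pi_prod: "u \<noteq> 0 \<Longrightarrow> pol_pi u (prod F A) = (\<Prod>i\<in>A. pol_pi u (F i))"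
  by (induction A rule: infinite_finite_induct) (simp_all add: pol_pi_mult)

lemma prod_powi: "x \<noteq> 0 \<Longrightarrow> (\<Prod>i\<in>A. x powi F i) = x powi (\<Sum>i\<in>A. F i)"
  for x :: "'a::field"
  by (induction A rule: infinite_finite_induct) (simp_all add: power_int_add)

text \<open>For roots in geometric progression, inversion amounts to a shift by one step; only the
  two end factors change.\<close>

lemma prod_telescope_shift:
  fixes f :: "nat \<Rightarrow> 'a::comm_ring_1"
  shows "(\<Prod>i<K. f i) * f K = (\<Prod>i<K. f (Suc i)) * f 0"
  using prod.lessThan_Suc[of f K] prod.lessThan_Suc_shift[of f K] by (simp add: mult.commute)

section \<open>The polynomial of type $(\alpha)$\<close>

text \<open>Here n is N - 2k, so that t q^(n/2) = (q^(1/2))^N = -1.\<close>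

locale alpha_setting =
  fixes N n :: nat and u v :: complex
  assumes u_primitive: "primitive_root_of_unity (2 * N) u" and n: "0 < n" "n < N"
    and v_square: "v ^ 2 * u ^ n = - 1"
begin

lemma u: "u \<noteq> 0" using u_primitive by (rule primitive_root_nonzero)

lemma v: "v \<noteq> 0" using v_square by auto

text \<open>Because v^2 = - u^(-n), these are t q^(i+1): the values of X^2 at the roots of the
  polynomial.\<close>

definition "\<tau> i = - (u powi (2 * int i + 2 - int n))"
definition "P = (\<Prod>i<n. lX ^ 2 - lconst (\<tau> i))"
text \<open>The constant term of \<open>P\<close> is u^n, so the scalar makes the coefficient of
  X^(-n) equal to 1, as required for e_{-n}.\<close>

definition "p = lconst (u powi (- int n)) * (lmon (- int n) * P)"

lemma tau_nonzero: "\<tau> i \<noteq> 0"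
  using u by (simp add: \<tau>_def)

lemma prod_tau: "(\<Prod>i<n. - \<tau> i) = u ^ n"
proof -
  have "(\<Sum>i<k. 2 * int i + 2 - int n) = int k * (int k + 1) - int n * int k" for k
    by (induction k) (simp_all add: algebra_simps)
  from this[of n] show ?thesis
    using u by (simp add: \<tau>_def prod_powi algebra_simps)
qed

lemma u_N: "u ^ N = - 1"
proof -
  have "(u ^ N) ^ 2 = 1"
    using u_primitive by (simp add: primitive_root_of_unity_def mult.commute flip: power_mult)
  moreover have "u ^ N \<noteq> 1"
    using u_primitive n by (simp add: primitive_root_of_unity_def)
  ultimately show ?thesis
    by (simp add: power2_eq_1_iff)
qed

text \<open>\<pi> replaces the roots by u^2 divided by them, which reverses their
  progression.\<close>

lemma pol_pi_p: "pol_pi u p = p"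
proof -
  have "(\<Prod>i<n. lconst (u ^ 2) * lXi ^ 2 - lconst (\<tau> i)) =
      (lXi ^ 2) ^ n * lconst (\<Prod>i<n. - \<tau> i) * (\<Prod>i<n. lX ^ 2 - lconst (u ^ 2 / \<tau> i))"
    by (rule reflect_root_product) (simp_all add: tau_nonzero flip: power_mult_distrib)
  also have "(\<Prod>i<n. lX ^ 2 - lconst (u ^ 2 / \<tau> i)) = (\<Prod>i<n. lX ^ 2 - lconst (\<tau> (n - Suc i)))"
  proof (rule prod.cong)
    fix i assume "i \<in> {..<n}"
    then have "2 * int (n - Suc i) + 2 - int n = 2 - (2 * int i + 2 - int n)"
      by (auto simp: of_nat_diff)
    then have "u powi (2 * int (n - Suc i) + 2 - int n) = u powi 2 / u powi (2 * int i + 2 - int n)"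
      by (simp only: power_int_diff[OF disjI1[OF u]])
    then show "lX ^ 2 - lconst (u ^ 2 / \<tau> i) = lX ^ 2 - lconst (\<tau> (n - Suc i))"
      by (simp add: \<tau>_def)
  qed simp
  also have "\<dots> = P"
    unfolding P_def by (rule prod.nat_diff_reindex)
  finally have 1: "pol_pi u P = (lXi ^ 2) ^ n * lconst (u ^ n) * P"
    unfolding P_def using u
    by (simp add: pol_pi_prod linear_diff[OF linear_pi] pol_pi_power power_mult_distrib lconst_power prod_tau)
  have "pol_pi u p = lconst (u powi (- int n)) * (lconst (u powi (- int n)) * lmon (int n) *
      ((lXi ^ 2) ^ n * lconst (u ^ n) * P))"
    using u by (simp add: p_def linear_scale[OF linear_pi] pol_pi_mult 1)
  also have "\<dots> = lconst (u powi (- int n)) * ((lconst (u powi (- int n)) * lconst (u ^ n)) *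
      ((lmon (int n) * (lXi ^ 2) ^ n) * P))"
    by (simp only: mult_ac)
  also have "lconst (u powi (- int n)) * lconst (u ^ n) = 1"
    using u by (simp add: power_int_minus flip: lconst_mult)
  also have "lmon (int n) * (lXi ^ 2) ^ n = lmon (- int n)"
    by (simp add: lmon_power lmon_mult)
  finally show ?thesis
    by (simp add: p_def)
qed

text \<open>Inverting the roots moves the progression one step down. The factor at t enters and the
  factor at t^-1 leaves.\<close>

lemma pol_s_P: "pol_s P * (lX ^ 2 - lconst (inverse (v ^ 2))) =
    (lXi ^ 2) ^ n * lconst (u ^ n) * (P * (lX ^ 2 - lconst (v ^ 2)))"
proof -
  define \<sigma> where "\<sigma> i = - (u powi (2 * int i - int n))" for i
  have "(\<Prod>i<n. lconst 1 * lXi ^ 2 - lconst (\<tau> i)) =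
      (lXi ^ 2) ^ n * lconst (\<Prod>i<n. - \<tau> i) * (\<Prod>i<n. lX ^ 2 - lconst (1 / \<tau> i))"
    by (rule reflect_root_product) (simp_all add: tau_nonzero flip: power_mult_distrib)
  also have "(\<Prod>i<n. lX ^ 2 - lconst (1 / \<tau> i)) = (\<Prod>i<n. lX ^ 2 - lconst (\<sigma> (n - Suc i)))"
  proof (rule prod.cong)
    fix i assume "i \<in> {..<n}"
    then have "2 * int (n - Suc i) - int n = - (2 * int i + 2 - int n)"
      by (auto simp: of_nat_diff)
    then have "u powi (2 * int (n - Suc i) - int n) = inverse (u powi (2 * int i + 2 - int n))"
      by (simp only: power_int_minus)
    then show "lX ^ 2 - lconst (1 / \<tau> i) = lX ^ 2 - lconst (\<sigma> (n - Suc i))"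
      by (simp add: \<tau>_def \<sigma>_def divide_inverse)
  qed simp
  also have "\<dots> = (\<Prod>i<n. lX ^ 2 - lconst (\<sigma> i))"
    by (rule prod.nat_diff_reindex)
  finally have 1: "pol_s P = (lXi ^ 2) ^ n * lconst (u ^ n) * (\<Prod>i<n. lX ^ 2 - lconst (\<sigma> i))"
    unfolding P_def by (simp add: pol_s_prod linear_diff[OF linear_s] pol_s_power prod_tau)
  have \<sigma>: "\<sigma> (Suc i) = \<tau> i" for i
    by (simp add: \<sigma>_def \<tau>_def algebra_simps)
  have "v ^ 2 = - inverse (u ^ n)"
    using v_square u by (metis divide_inverse eq_divide_eq minus_divide_left mult_1 power_not_zero mult_minus1)
  then have ends: "\<sigma> 0 = v ^ 2" "\<sigma> n = inverse (v ^ 2)"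
    by (simp_all add: \<sigma>_def power_int_minus)
  show ?thesis
    using prod_telescope_shift[of "\<lambda>i. lX ^ 2 - lconst (\<sigma> i)" n]
    unfolding 1 ends \<sigma> P_def[symmetric] by (simp only: mult.assoc)
qed

text \<open>The numerator v X^2 - v^-1 in front of s p supplies exactly the factor X^2 - t^-1 that
  \<open>pol_s_P\<close> asks for. So p spans the other eigenspace of T, with eigenvalue -
  v^-1.\<close>

lemma pol_T_p: "pol_T v p = lconst (- inverse v) * p"
proof (rule pol_T_unique)
  have e: "lconst v * (lX ^ 2 - lconst (inverse (v ^ 2))) = lconst v * lX ^ 2 - lconst (inverse v)"
    using v by (simp add: right_diff_distrib power2_eq_square flip: lconst_mult)
  have "pol_s p = lconst (u powi (- int n)) * (lmon (int n) * pol_s P)"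
    by (simp add: p_def linear_scale[OF linear_s] pol_s_mult)
  then have "(lconst v * lX ^ 2 - lconst (inverse v)) * pol_s p =
      lconst v * (lconst (u powi (- int n)) * (lmon (int n) * (pol_s P * (lX ^ 2 - lconst (inverse (v ^ 2))))))"
    unfolding e[symmetric] by (simp only: mult_ac)
  also have "\<dots> = (lconst v * lconst (u ^ n)) * (lconst (u powi (- int n)) *
      ((lmon (int n) * (lXi ^ 2) ^ n) * P)) * (lX ^ 2 - lconst (v ^ 2))"
    unfolding pol_s_P by (simp only: mult_ac)
  also have "lmon (int n) * (lXi ^ 2) ^ n = lmon (- int n)"
    by (simp add: lmon_power lmon_mult)
  also have "lconst v * lconst (u ^ n) = lconst (- inverse v)"
  proof -
    have "v * u ^ n = - inverse v"
      using v_square v by (simp add: power2_eq_square field_simps)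
    then show ?thesis by (simp flip: lconst_mult)
  qed
  also have "lconst (u powi (- int n)) * (lmon (- int n) * P) = p"
    by (simp add: p_def)
  also have "lconst (- inverse v) * p * (lX ^ 2 - lconst (v ^ 2)) =
      lconst (- inverse v) * (lX ^ 2 * p) + lconst v * p"
    using v by (simp add: right_diff_distrib lconst_minus power2_eq_square lconst_mult algebra_simps)
  finally show "(lX ^ 2 - 1) * (lconst (- inverse v) * p) =
      (lconst v * lX ^ 2 - lconst (inverse v)) * pol_s p - lconst (v - inverse v) * p"
    by (simp add: lconst_diff lconst_minus algebra_simps)
qed

lemma eval_Y_n: "eval_Y u v (- int n) = - inverse v"
  using v_square v by (simp add: eval_Y_nonpos power2_eq_square field_simps)

lemma pol_Y_p: "pol_Y u v p = lconst (- inverse v) * p"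
  unfolding pol_Y_def pol_T_p linear_scale[OF linear_pi] pol_pi_p ..

lemma lookup_p: "Poly_Mapping.lookup p m \<noteq> 0 \<Longrightarrow> - int n \<le> m \<and> m \<le> int n"
    "Poly_Mapping.lookup p (- int n) = 1" "Poly_Mapping.lookup p (int n) \<noteq> 0"
proof -
  have P: "P = (\<Prod>i<n. lmon (int 2) - lconst (\<tau> i))"
    by (simp add: P_def lX_def lmon_power)
  have L: "Poly_Mapping.lookup P m \<noteq> 0 \<Longrightarrow> 0 \<le> m \<and> m \<le> int (2 * n)"
      "Poly_Mapping.lookup P 0 = u ^ n" "Poly_Mapping.lookup P (int (2 * n)) = 1" for m
    unfolding P prod_tau[symmetric] by (rule lookup_root_product; simp)+
  have look: "Poly_Mapping.lookup p m = u powi (- int n) * Poly_Mapping.lookup P (m + int n)" for m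
    by (simp add: p_def lookup_lmon_mult)
  show "Poly_Mapping.lookup p m \<noteq> 0 \<Longrightarrow> - int n \<le> m \<and> m \<le> int n"
    using L(1)[of "m + int n"] unfolding look by auto
  show "Poly_Mapping.lookup p (- int n) = 1"
    using L(2) u unfolding look by (simp add: power_int_minus)
  have "int n + int n = int (2 * n)"
    by simp
  then show "Poly_Mapping.lookup p (int n) \<noteq> 0"
    using L(3) u unfolding look by simp
qed

text \<open>The summand N in the exponent accounts for the sign, since -1 = u^N.\<close>

lemma inverse_v: "inverse v = v * u powi (int N + int n)"
proof -
  have "u powi (int N + int n) = u ^ (N + n)"
    by (metis of_nat_add power_int_of_nat)
  then have "u powi (int N + int n) = - (u ^ n)"
    by (simp add: power_add u_N)
  then show ?thesis
    using v_square v by (simp add: power2_eq_square field_simps)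
qed

text \<open>The nonpositive exponents of the window give 0, ..., n-1 and the positive ones N, ...,
  N+n-1. As n < N these are disjoint and lie below 2N.\<close>

sublocale daha_window p "- int n" "1 - int n" "2 * n" u v "2 * N" "int N + int n"
proof
  show "rank m < 2 * n \<longleftrightarrow> 1 - int n \<le> m \<and> m < 1 - int n + int (2 * n)" for m
    by (auto simp: rank_def)
  show "p dvd pol_T v p" "p dvd pol_pi u p"
    by (simp_all add: pol_T_p pol_pi_p)
  fix m assume "rank m < 2 * n"
  then have m: "1 - int n \<le> m" "m \<le> int n"
    by (auto simp: rank_def split: if_splits)
  then show "0 \<le> (if 0 < m then int N + int n - m else - m) \<and>
      (if 0 < m then int N + int n - m else - m) < int (2 * N)"
    using n by auto
  fix k assume "rank k < 2 * n"
    "(if 0 < m then int N + int n - m else - m) = (if 0 < k then int N + int n - k else - k)"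
  moreover from this(1) have "1 - int n \<le> k" "k \<le> int n"
    by (auto simp: rank_def split: if_splits)
  ultimately show "m = k"
    using m n by (auto split: if_splits)
next
  fix m assume "Poly_Mapping.lookup p m \<noteq> 0"
  then show "- int n \<le> m \<and> m \<le> - int n + int (2 * n)"
    using lookup_p(1) by fastforce
qed (use u_primitive v n inverse_v lookup_p in simp_all)

text \<open>The eigenvalue of p is v u^n, and n lies in the gap between n-1 and N left by the
  exponents of the window.\<close>

lemma eval_Y_neq:
  assumes "rank m < 2 * n"
  shows "eval_Y u v m \<noteq> - inverse v"
proof
  assume "eval_Y u v m = - inverse v"
  then have "v * u powi (if 0 < m then int N + int n - m else - m) = v * u powi int n"
    unfolding eval_Y_exponent eval_Y_n[symmetric] by (simp add: eval_Y_nonpos)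
  then have "u powi (if 0 < m then int N + int n - m else - m) = u powi int n"
    using v mult_left_cancel by blast
  then have "int (2 * N) dvd (if 0 < m then int N + int n - m else - m) - int n"
    unfolding primitive_root_powi_eq[OF u_primitive] .
  moreover from assms have m: "1 - int n \<le> m" "m \<le> int n"
    by (auto simp: rank_def split: if_splits)
  then have "\<bar>(if 0 < m then int N + int n - m else - m) - int n\<bar> < int (2 * N)"
    using n by auto
  ultimately have "(if 0 < m then int N + int n - m else - m) - int n = 0"
    by (rule dvd_abs_less_imp_zero)
  then show False
    using m n by (auto split: if_splits)
qed

lemma e_poly_eq: "e_poly u v (- int n) = p"
proof -
  have r: "rank (- int n) = 2 * n"
    by (simp add: rank_def)
  have neq: "eval_Y u v m \<noteq> eval_Y u v (- int n)" if "rank m < rank (- int n)" for m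
    using eval_Y_neq that by (simp add: r eval_Y_n)
  have "is_e_polynomial u v (- int n) p"
    unfolding is_e_polynomial_iff supp_lt_def
    using lookup_p pol_Y_p by (auto simp: eval_Y_n rank_def) fastforce+
  then show ?thesis
    using e_polynomial_unique is_e_polynomial_e_poly[OF u v neq] neq by blast
qed

text \<open>The twists commute with Y, so they send p to a vector with the eigenvalue of p; this
  does not occur in the quotient, so the image lies in the ideal.\<close>

lemma daha_rep: "daha_rep p (- int n) (1 - int n) (2 * n) u v (2 * N) (int N + int n) (csqrt u)"
proof
  have c: "csqrt u ^ 2 = u" by simp
  then show "csqrt u ^ 2 = u" .
  interpret t: laurent_twist u v "\<lambda>f. lconst (csqrt u) * pol_Y u v (lX * f)"
      "\<lambda>f. lconst (inverse (csqrt u)) * (lXi * pol_Y_inv u v f)"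
    using u v c by (rule laurent_twist_tau)
  interpret t': laurent_twist u v "\<lambda>f. lconst (inverse (csqrt u)) * pol_Y_inv u v (lX * f)"
      "\<lambda>f. lconst (csqrt u) * (lXi * pol_Y u v f)"
    using u v c by (rule laurent_twist_tau_inv)
  have "pol_Y u v (tau_op u v (csqrt u) p) = lconst (- inverse v) * tau_op u v (csqrt u) p"
    using t.lsubst_Y[of p] unfolding pol_Y_p linear_scale[OF t.linear_lsubst] unfolding tau_op_def[symmetric] ..
  then have "p dvd pol_Y u v (tau_op u v (csqrt u) p) - lconst (- inverse v) * tau_op u v (csqrt u) p"
    by (simp only: diff_self dvd_0_right)
  then show "p dvd tau_op u v (csqrt u) p"
    by (rule dvd_if_eigenvector) (rule eval_Y_neq)
  have "pol_Y u v (tau_op_inv u v (csqrt u) p) = lconst (- inverse v) * tau_op_inv u v (csqrt u) p"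
    using t'.lsubst_Y[of p] unfolding pol_Y_p linear_scale[OF t'.linear_lsubst] unfolding tau_op_inv_def[symmetric] ..
  then have "p dvd pol_Y u v (tau_op_inv u v (csqrt u) p) - lconst (- inverse v) * tau_op_inv u v (csqrt u) p"
    by (simp only: diff_self dvd_0_right)
  then show "p dvd tau_op_inv u v (csqrt u) p"
    by (rule dvd_if_eigenvector) (rule eval_Y_neq)
  \<comment> \<open>In the variable X^2 the roots form a progression with ratio u^2, an N-th root of
    unity; so they are distinct and have a common N-th power.\<close>
  have "P dvd (lX ^ 2) ^ N - lconst (\<tau> 0 ^ N)"
    unfolding P_def
  proof (rule root_product_dvd_power)
    show "inj_on \<tau> {..<n}"
    proof (rule inj_onI)
      fix i j assume ij: "i \<in> {..<n}" "j \<in> {..<n}" "\<tau> i = \<tau> j"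
      then have "int (2 * N) dvd (2 * int i + 2 - int n) - (2 * int j + 2 - int n)"
        using primitive_root_powi_eq[OF u_primitive] by (simp add: \<tau>_def)
      moreover have "\<bar>(2 * int i + 2 - int n) - (2 * int j + 2 - int n)\<bar> < int (2 * N)"
        using ij(1,2) n by auto
      ultimately have "(2 * int i + 2 - int n) - (2 * int j + 2 - int n) = 0"
        by (rule dvd_abs_less_imp_zero)
      then show "i = j" by simp
    qed
    fix i
    have "\<tau> i = \<tau> 0 * u ^ (2 * i)"
    proof -
      have "2 * int i + 2 - int n = (2 - int n) + int (2 * i)" by simp
      then show ?thesis
        using u by (simp only: \<tau>_def power_int_add[OF disjI1[OF u]] power_int_of_nat) simp
    qed
    moreover have "(u ^ (2 * i)) ^ N = 1"
      using u_primitive by (simp add: primitive_root_of_unity_def mult_ac power_mult)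
        (metis mult.commute power_mult power_one)
    ultimately show "\<tau> i ^ N = \<tau> 0 ^ N"
      by (simp add: power_mult_distrib)
  qed
  moreover have "P = p * (lconst (u ^ n) * lmon (int n))"
  proof -
    have "p * (lconst (u ^ n) * lmon (int n)) =
        (lconst (u powi (- int n)) * lconst (u ^ n)) * ((lmon (- int n) * lmon (int n)) * P)"
      by (simp only: p_def mult_ac)
    also have "\<dots> = P"
      using u by (simp add: lmon_mult power_int_minus)
    finally show ?thesis ..
  qed
  then have "p dvd P" by simp
  ultimately have "p dvd lX ^ (2 * N) - lconst (\<tau> 0 ^ N)"
    by (metis dvd_trans power_mult)
  then show "\<exists>\<kappa>. \<kappa> \<noteq> 0 \<and> p dvd lX ^ (2 * N) - lconst \<kappa>"
    using tau_nonzero by (intro exI[of _ "\<tau> 0 ^ N"]) simp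
qed

text \<open>If x is a square root of the first root in X^2, then u x is one of the second.\<close>

lemma nonscalar:
  assumes "2 \<le> n"
  shows "daha_rep.nonscalar p (2 * n) u"
proof -
  interpret daha_rep p "- int n" "1 - int n" "2 * n" u v "2 * N" "int N + int n" "csqrt u"
    by (rule daha_rep)
  define x where "x = csqrt (\<tau> 0)"
  have x: "x ^ 2 = \<tau> 0" "x \<noteq> 0"
    using tau_nonzero[of 0] by (simp_all add: x_def)
  have root: "leval y p = 0" if "y \<noteq> 0" "i < n" "y ^ 2 = \<tau> i" for y i
  proof -
    have "leval y (lX ^ 2 - lconst (\<tau> i)) = 0"
      using that by (simp add: linear_diff[OF linear_leval] leval_power lconst_power)
    then have "leval y P = 0"
      using that(1,2) unfolding P_def by (subst leval_prod) (auto intro!: prod_zero)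
    then show ?thesis
      using that(1) by (simp add: p_def leval_mult)
  qed
  have "\<tau> 1 = u ^ 2 * \<tau> 0"
  proof -
    have "2 * int 1 + 2 - int n = (2 * int 0 + 2 - int n) + int 2" by simp
    then show ?thesis
      by (simp only: \<tau>_def power_int_add[OF disjI1[OF u]] power_int_of_nat) simp
  qed
  then have "leval (u * x) p = 0"
    using assms u x by (intro root[of _ 1]) (simp_all add: power_mult_distrib)
  moreover have "leval x p = 0"
    using assms x by (intro root[of _ 0]) simp_all
  ultimately show ?thesis
    using assms x(2) by (auto simp: nonscalar_def)
qed

end

section \<open>The polynomial of types $(\breve\gamma)$ and $(\breve\alpha^\checkmark)$\<close>

text \<open>One setting for three types. For \<gamma>: M = 2N, u = q^(1/2), r = q^(1/4). For checked
  \<gamma>: M = N, u = q, r = q^(1/2). For checked \<alpha>: M = N, u = q, r = - q^(1/2), 2l + 1 = N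
  - 2k. In each case t^(1/2), or its checked version, is r^(-2l-1).\<close>

locale gamma_setting =
  fixes M l :: nat and u r :: complex
  assumes u_primitive: "primitive_root_of_unity M u" and l: "2 * l + 1 < M"
    and r_square: "r ^ 2 = u"
begin

definition "v = inverse (r ^ (2 * l + 1))"
definition "\<rho> i = r powi (2 * int i + 1 - 2 * int l)"
definition "P = (\<Prod>i<2 * l + 1. lX - lconst (\<rho> i))"
definition "p = lmon (- int l) * P"

lemma u: "u \<noteq> 0" using u_primitive by (rule primitive_root_nonzero)

lemma r: "r \<noteq> 0" using u r_square by auto

lemma v: "v \<noteq> 0" using r by (simp add: v_def)

lemma u_powi: "u powi k = r powi (2 * k)"
  unfolding r_square[symmetric] by (simp add: power_int_mult)

lemma v_powi: "v = r powi (- (2 * int l + 1))"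
proof -
  have "r ^ (2 * l + 1) = r powi int (2 * l + 1)"
    by (rule power_int_of_nat[symmetric])
  also have "int (2 * l + 1) = 2 * int l + 1"
    by simp
  finally have e: "r ^ (2 * l + 1) = r powi (2 * int l + 1)" .
  show ?thesis
    unfolding v_def e power_int_minus ..
qed

lemma inverse_v: "inverse v = v * u powi (2 * int l + 1)"
proof -
  have "v * u powi (2 * int l + 1) = r powi (- (2 * int l + 1) + 2 * (2 * int l + 1))"
    by (simp only: v_powi u_powi power_int_add[OF disjI1[OF r]])
  also have "\<dots> = inverse (r powi (- (2 * int l + 1)))"
    unfolding power_int_minus[symmetric] by (rule arg_cong[where f = "power_int r"]) simp
  finally show ?thesis
    by (simp only: v_powi)
qed

lemma rho_nonzero: "\<rho> i \<noteq> 0"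
  using r by (simp add: \<rho>_def)

lemma prod_rho: "(\<Prod>i<2 * l + 1. - \<rho> i) = - inverse v"
proof -
  have "(\<Sum>i<k. 2 * int i + 1 - 2 * int l) = int k * int k - 2 * int l * int k" for k
    by (induction k) (simp_all add: algebra_simps)
  from this[of "2 * l + 1"] have S: "(\<Sum>i<2 * l + 1. 2 * int i + 1 - 2 * int l) = int (2 * l + 1)"
    by (simp add: algebra_simps)
  have "(\<Prod>i<2 * l + 1. - \<rho> i) = (- 1) ^ (2 * l + 1) * (\<Prod>i<2 * l + 1. \<rho> i)"
    by (subst prod_uminus) simp
  also have "(\<Prod>i<2 * l + 1. \<rho> i) = r powi int (2 * l + 1)"
    unfolding \<rho>_def prod_powi[OF r] S ..
  also have "\<dots> = inverse v"
    by (simp only: v_def power_int_of_nat inverse_inverse_eq)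
  finally show ?thesis by simp
qed

text \<open>As in type \<alpha>, inversion moves the progression of roots one step; the ends are now
  v and v^-1 themselves instead of their squares.\<close>

lemma pol_s_P: "pol_s P * (lX - lconst (inverse v)) =
    lXi ^ (2 * l + 1) * lconst (- inverse v) * (P * (lX - lconst v))"
proof -
  let ?K = "2 * l + 1"
  define \<sigma> where "\<sigma> i = r powi (2 * int i - 2 * int l - 1)" for i
  have "(\<Prod>i<?K. lconst 1 * lXi - lconst (\<rho> i)) =
      lXi ^ ?K * lconst (\<Prod>i<?K. - \<rho> i) * (\<Prod>i<?K. lX - lconst (1 / \<rho> i))"
    by (rule reflect_root_product) (simp_all add: rho_nonzero)
  also have "(\<Prod>i<?K. lX - lconst (1 / \<rho> i)) = (\<Prod>i<?K. lX - lconst (\<sigma> (?K - Suc i)))"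
  proof (rule prod.cong)
    fix i assume "i \<in> {..<?K}"
    then have "2 * int (?K - Suc i) - 2 * int l - 1 = - (2 * int i + 1 - 2 * int l)"
      by (auto simp: of_nat_diff)
    then have "\<sigma> (?K - Suc i) = inverse (\<rho> i)"
      by (simp only: \<sigma>_def \<rho>_def power_int_minus)
    then show "lX - lconst (1 / \<rho> i) = lX - lconst (\<sigma> (?K - Suc i))"
      by (simp add: divide_inverse)
  qed simp
  also have "\<dots> = (\<Prod>i<?K. lX - lconst (\<sigma> i))"
    by (rule prod.nat_diff_reindex)
  finally have 1: "pol_s P = lXi ^ ?K * lconst (- inverse v) * (\<Prod>i<?K. lX - lconst (\<sigma> i))"
    unfolding P_def pol_s_prod by (simp only: linear_diff[OF linear_s] pol_s_lX pol_s_lconst prod_rho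
        lconst_simps mult_1_left)
  have \<sigma>: "\<sigma> (Suc i) = \<rho> i" for i
    by (simp add: \<sigma>_def \<rho>_def algebra_simps)
  have "2 * int 0 - 2 * int l - 1 = - (2 * int l + 1)"
    "2 * int ?K - 2 * int l - 1 = - (- (2 * int l + 1))"
    by simp_all
  then have ends: "\<sigma> 0 = v" "\<sigma> ?K = inverse v"
    unfolding \<sigma>_def v_powi by (simp_all only: power_int_minus[of r "- _"])
  show ?thesis
    using prod_telescope_shift[of "\<lambda>i. lX - lconst (\<sigma> i)" ?K]
    unfolding 1 ends \<sigma> P_def[symmetric] by (simp only: mult.assoc)
qed

text \<open>Only the factor X - v^-1 of v X^2 - v^-1 is used up by the reflection. The remaining
  factor X + v^-1 makes T p a multiple of p by - X^-1 instead of a constant.\<close>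

lemma pol_T_p: "pol_T v p = - (lXi * p)"
proof (rule pol_T_unique)
  have e: "lconst v * (lX + lconst (inverse v)) * (lX - lconst (inverse v)) = lconst v * lX ^ 2 - lconst (inverse v)"
    using v by (simp add: algebra_simps power2_eq_square)
  have "pol_s p = lmon (int l) * pol_s P"
    by (simp add: p_def pol_s_mult)
  then have "(lconst v * lX ^ 2 - lconst (inverse v)) * pol_s p =
      lconst v * (lX + lconst (inverse v)) * (lmon (int l) * (pol_s P * (lX - lconst (inverse v))))"
    unfolding e[symmetric] by (simp only: mult_ac)
  also have "\<dots> = (lconst v * lconst (- inverse v)) * ((lmon (int l) * lXi ^ (2 * l + 1)) * P) *
      ((lX + lconst (inverse v)) * (lX - lconst v))"
    unfolding pol_s_P by (simp only: mult_ac)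
  also have "lmon (int l) * lXi ^ (2 * l + 1) = lXi * lmon (- int l)"
    by (simp only: lmon_power lmon_mult) (simp add: algebra_simps)
  also have "lconst v * lconst (- inverse v) = - 1"
    using v by (simp add: lconst_minus)
  also have "lXi * lmon (- int l) * P = lXi * p"
    by (simp only: p_def mult.assoc)
  finally have 1: "(lconst v * lX ^ 2 - lconst (inverse v)) * pol_s p =
      - 1 * (lXi * p) * ((lX + lconst (inverse v)) * (lX - lconst v))" .
  have F: "(lX + lconst (inverse v)) * (lX - lconst v) = lX ^ 2 - 1 - lconst (v - inverse v) * lX"
    using v by (simp add: algebra_simps power2_eq_square lconst_diff)
  have "- 1 * w * (x ^ 2 - 1 - k * x) = - w * (x ^ 2 - 1) + k * (w * x)" for w x k :: "complex laurent"
    by (simp add: algebra_simps)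
  then have "(lconst v * lX ^ 2 - lconst (inverse v)) * pol_s p =
      - (lXi * p) * (lX ^ 2 - 1) + lconst (v - inverse v) * ((lXi * p) * lX)"
    unfolding 1 F .
  also have "(lXi * p) * lX = p"
    by (simp add: mult.commute)
  finally show "(lX ^ 2 - 1) * - (lXi * p) =
      (lconst v * lX ^ 2 - lconst (inverse v)) * pol_s p - lconst (v - inverse v) * p"
    by (simp add: mult.commute)
qed

text \<open>\<pi> reverses the progression of roots. The minus sign, decisive in
  \<open>dvd_twisted_eigenvector\<close>, comes from their odd number.\<close>

lemma X_pi_p: "lX * pol_pi u p = lconst (- r) * p"
proof -
  let ?K = "2 * l + 1"
  have "(\<Prod>i<?K. lconst u * lXi - lconst (\<rho> i)) =
      lXi ^ ?K * lconst (\<Prod>i<?K. - \<rho> i) * (\<Prod>i<?K. lX - lconst (u / \<rho> i))"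
    by (rule reflect_root_product) (simp_all add: rho_nonzero)
  also have "(\<Prod>i<?K. lX - lconst (u / \<rho> i)) = (\<Prod>i<?K. lX - lconst (\<rho> (?K - Suc i)))"
  proof (rule prod.cong)
    fix i assume "i \<in> {..<?K}"
    then have "2 * int (?K - Suc i) + 1 - 2 * int l = 2 - (2 * int i + 1 - 2 * int l)"
      by (auto simp: of_nat_diff)
    then have "\<rho> (?K - Suc i) = r powi 2 / \<rho> i"
      by (simp only: \<rho>_def power_int_diff[OF disjI1[OF r]])
    then show "lX - lconst (u / \<rho> i) = lX - lconst (\<rho> (?K - Suc i))"
      by (simp add: r_square)
  qed simp
  also have "\<dots> = P"
    unfolding P_def by (rule prod.nat_diff_reindex)
  finally have 1: "pol_pi u P = lXi ^ ?K * lconst (- inverse v) * P"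
    unfolding P_def pol_pi_prod[OF u]
    by (simp only: linear_diff[OF linear_pi] pol_pi_lX pol_pi_lconst prod_rho)
  have "lX * pol_pi u p = (lconst (u powi (- int l)) * lconst (- inverse v)) *
      ((lX * (lmon (int l) * lXi ^ ?K)) * P)"
    unfolding p_def pol_pi_mult[OF u] 1 pol_pi_lmon by (simp add: mult_ac)
  also have "lX * (lmon (int l) * lXi ^ ?K) = lmon (- int l)"
    by (simp add: lX_def lmon_power lmon_mult del: power_add power_Suc)
  also have "lconst (u powi (- int l)) * lconst (- inverse v) = lconst (- r)"
  proof -
    have "u powi (- int l) * inverse v = r powi (2 * (- int l) + (2 * int l + 1))"
      unfolding u_powi v_powi power_int_minus[of r "2 * int l + 1"] inverse_inverse_eq
      by (simp only: power_int_add[OF disjI1[OF r]])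
    also have "\<dots> = r" by simp
    finally show ?thesis by (simp flip: lconst_mult)
  qed
  finally show ?thesis by (simp only: p_def)
qed

lemma pol_Y_p: "pol_Y u v p = lconst (inverse r) * p"
proof -
  have "pol_Y u v p = - (lconst (inverse u) * (lX * pol_pi u p))"
    using u by (simp add: pol_Y_def pol_T_p linear_minus[OF linear_pi] pol_pi_Xi)
  also have "\<dots> = lconst (inverse u * r) * p"
    unfolding X_pi_p by (simp add: lconst_minus lconst_mult mult.assoc)
  also have "inverse u * r = inverse r"
    using r unfolding r_square[symmetric] by (simp add: power2_eq_square)
  finally show ?thesis .
qed

lemma lookup_p: "Poly_Mapping.lookup p m \<noteq> 0 \<Longrightarrow> - int l \<le> m \<and> m \<le> int l + 1"
    "Poly_Mapping.lookup p (- int l) = - inverse v" "Poly_Mapping.lookup p (int l + 1) = 1"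
proof -
  have P: "P = (\<Prod>i<2 * l + 1. lmon (int 1) - lconst (\<rho> i))"
    by (simp add: P_def lX_def)
  have L: "Poly_Mapping.lookup P m \<noteq> 0 \<Longrightarrow> 0 \<le> m \<and> m \<le> int (1 * (2 * l + 1))"
      "Poly_Mapping.lookup P 0 = - inverse v" "Poly_Mapping.lookup P (int (1 * (2 * l + 1))) = 1" for m
    unfolding P prod_rho[symmetric] by (rule lookup_root_product; simp)+
  have look: "Poly_Mapping.lookup p m = Poly_Mapping.lookup P (m + int l)" for m
    by (simp add: p_def lookup_lmon_mult)
  show "Poly_Mapping.lookup p m \<noteq> 0 \<Longrightarrow> - int l \<le> m \<and> m \<le> int l + 1"
    using L(1)[of "m + int l"] unfolding look by auto
  show "Poly_Mapping.lookup p (- int l) = - inverse v"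
    using L(2) unfolding look by simp
  have "int l + 1 + int l = int (1 * (2 * l + 1))"
    by simp
  then show "Poly_Mapping.lookup p (int l + 1) = 1"
    unfolding look by (simp only: L(3))
qed

lemma window: "rank m < 2 * l + 1 \<longleftrightarrow> - int l \<le> m \<and> m \<le> int l"
  by (auto simp: rank_def)

text \<open>The nonpositive exponents of the window give 0, ..., l and the positive ones l+1, ...,
  2l, all below M.\<close>

sublocale daha_window p "- int l" "- int l" "2 * l + 1" u v M "2 * int l + 1"
proof
  show "rank m < 2 * l + 1 \<longleftrightarrow> - int l \<le> m \<and> m < - int l + int (2 * l + 1)" for m
    unfolding window by auto
  show "p dvd pol_T v p"
    by (simp add: pol_T_p)
  have "p dvd lXi * (lX * pol_pi u p)"
    unfolding X_pi_p by simp
  then show "p dvd pol_pi u p"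
    by simp
  fix m assume "rank m < 2 * l + 1"
  then have m: "- int l \<le> m" "m \<le> int l"
    unfolding window by simp_all
  then show "0 \<le> (if 0 < m then 2 * int l + 1 - m else - m) \<and>
      (if 0 < m then 2 * int l + 1 - m else - m) < int M"
    using l by auto
  fix k assume "rank k < 2 * l + 1"
    "(if 0 < m then 2 * int l + 1 - m else - m) = (if 0 < k then 2 * int l + 1 - k else - k)"
  moreover from this(1) have "- int l \<le> k" "k \<le> int l"
    unfolding window by simp_all
  ultimately show "m = k"
    using m by (auto split: if_splits)
next
  fix m assume "Poly_Mapping.lookup p m \<noteq> 0"
  then show "- int l \<le> m \<and> m \<le> - int l + int (2 * l + 1)"
    using lookup_p(1) by fastforce
next
  show "Poly_Mapping.lookup p (- int l) \<noteq> 0"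
    using lookup_p(2) v by simp
  have "- int l + int (2 * l + 1) = int l + 1" by simp
  then show "Poly_Mapping.lookup p (- int l + int (2 * l + 1)) \<noteq> 0"
    by (simp only: lookup_p(3)) simp
qed (use u_primitive v inverse_v in simp_all)

definition "E = e_poly u v (- int l)"

lemma rank_l: "rank (- int l) = 2 * l" "rank (int l + 1) = 2 * l + 1"
  by (simp_all add: rank_def)

lemma eval_Y_l: "eval_Y u v (- int l) = inverse r" "eval_Y u v (int l + 1) = inverse r"
proof -
  have "eval_Y u v (- int l) = r powi (- (2 * int l + 1) + 2 * int l)"
    unfolding power_int_add[OF disjI1[OF r]] v_powi[symmetric] u_powi[symmetric]
    by (simp add: eval_Y_nonpos)
  then show "eval_Y u v (- int l) = inverse r"
    by (simp add: power_int_minus)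
  have "inverse v = r powi (2 * int l + 1)"
    by (simp only: v_powi power_int_minus inverse_inverse_eq)
  then have "eval_Y u v (int l + 1) = r powi (2 * int l + 1 + 2 * (- (int l + 1)))"
    unfolding power_int_add[OF disjI1[OF r]] u_powi[symmetric]
    by (simp only: eval_Y_pos[of "int l + 1"] zero_less_one add_nonneg_pos of_nat_0_le_iff)
  then show "eval_Y u v (int l + 1) = inverse r"
    by (simp add: power_int_minus)
qed

lemma eval_Y_neq: "rank m < rank (- int l) \<Longrightarrow> eval_Y u v m \<noteq> eval_Y u v (- int l)"
  using eval_Y_inj[of m "- int l"] by (auto simp: rank_l)

lemma is_e_polynomial_E: "is_e_polynomial u v (- int l) E"
  unfolding E_def using u v eval_Y_neq by (rule is_e_polynomial_e_poly)

lemma E: "pol_Y u v E = lconst (inverse r) * E" "Poly_Mapping.lookup E (- int l) = 1"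
    "supp_lt (2 * l + 1) E"
  using is_e_polynomial_E by (simp_all add: is_e_polynomial_iff eval_Y_l rank_l)

text \<open>The leading terms of p and e_{l+1} cancel. The difference lies in the window and has the
  eigenvalue of e_{-l}, which is simple there, so it is a multiple of e_{-l}.\<close>

lemma e_poly_combination: "e_poly u v (int l + 1) - lconst (inverse v) * e_poly u v (- int l) = p"
proof -
  define F where "F = e_poly u v (int l + 1)"
  have F_eq: "F = lconst (u ^ l) * (lX * pol_pi u E)"
    unfolding F_def E_def using u v eval_Y_neq by (rule e_poly_succ)
  have "is_e_polynomial u v (int l + 1) F"
    unfolding F_eq using is_e_polynomial_E u v by (rule e_polynomial_succ)
  then have F: "pol_Y u v F = lconst (inverse r) * F" "Poly_Mapping.lookup F (int l + 1) = 1"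
      "supp_lt (Suc (2 * l + 1)) F"
    by (simp_all add: is_e_polynomial_iff eval_Y_l rank_l)
  have "supp_lt (Suc (2 * l + 1)) p"
    unfolding supp_lt_def
  proof (intro allI impI)
    fix m assume "Poly_Mapping.lookup p m \<noteq> 0"
    from lookup_p(1)[OF this] show "rank m < Suc (2 * l + 1)"
      by (auto simp: rank_def)
  qed
  then have "supp_lt (Suc (2 * l + 1)) (p - F)"
    using F(3) by (rule supp_lt_diff)
  then have "supp_lt (2 * l + 1) (p - F)"
  proof (rule supp_lt_Suc)
    have "unrank (2 * l + 1) = int l + 1"
      using unrank_rank[of "int l + 1"] by (simp add: rank_l)
    then show "Poly_Mapping.lookup (p - F) (unrank (2 * l + 1)) = 0"
      by (simp add: lookup_minus F(2) lookup_p(3))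
  qed
  moreover have "pol_Y u v (p - F) = lconst (eval_Y u v (- int l)) * (p - F)"
    by (simp add: linear_diff[OF linear_Y] F(1) pol_Y_p eval_Y_l right_diff_distrib)
  ultimately have "p - F = lconst (Poly_Mapping.lookup (p - F) (- int l)) * E"
    using is_e_polynomial_E by (rule eigenvector_unique) (simp add: rank_l)
  \<comment> \<open>The coefficient of X^(-l) in X \<pi> E comes from that of X^(l+1) in E, outside
    its support. So the multiple is read off from p alone.\<close>
  moreover have "Poly_Mapping.lookup F (- int l) = 0"
  proof -
    have "Poly_Mapping.lookup E (1 + int l) = 0"
      using E(3) by (rule supp_ltD) (simp add: rank_def)
    then show ?thesis
      using u by (simp add: F_eq lookup_lX_mult lookup_pi)
  qed
  ultimately have "p - F = - (lconst (inverse v) * E)"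
    by (simp add: lookup_minus lookup_p(2) lconst_minus)
  then show ?thesis
    unfolding F_def[symmetric] E_def[symmetric] by (simp add: algebra_simps)
qed

text \<open>X \<pi> E is u^(-l) e_{l+1}, and e_{l+1} = p + v^-1 E; the eigenvalue u^(-l) v^-1 on the
  class of E is r.\<close>

lemma X_pi_E: "lX * pol_pi u E = lconst (u powi (- int l)) * p + lconst r * E"
proof -
  have "lconst (u ^ l) * (lX * pol_pi u E) = p + lconst (inverse v) * E"
    using e_poly_combination e_poly_succ[OF u v eval_Y_neq] unfolding E_def by (simp add: algebra_simps)
  then have "lconst (u powi (- int l)) * (lconst (u ^ l) * (lX * pol_pi u E)) =
      lconst (u powi (- int l)) * p + lconst (u powi (- int l) * inverse v) * E"
    by (simp only: distrib_left lconst_mult mult.assoc)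
  moreover have "lconst (u powi (- int l)) * (lconst (u ^ l) * f) = f" for f
    using u by (simp add: power_int_minus)
  moreover have "u powi (- int l) * inverse v = r"
  proof -
    have "u powi (- int l) * inverse v = r powi (2 * (- int l) + (2 * int l + 1))"
      unfolding u_powi v_powi power_int_minus[of r "2 * int l + 1"] inverse_inverse_eq
      by (simp only: power_int_add[OF disjI1[OF r]])
    then show ?thesis by simp
  qed
  ultimately show ?thesis by simp
qed

text \<open>The eigenvalue of \<open>p\<close> under \<open>Y\<close> is also the one of \<open>E\<close>, but \<open>X\<pi>\<close> has the eigenvalue \<open>- r\<close>
  on \<open>p\<close> and \<open>r\<close> on the class of \<open>E\<close>.\<close>

lemma dvd_twisted_eigenvector:
  assumes "laurent_linear D" "\<And>f. p dvd f \<Longrightarrow> p dvd D f" "p dvd D (pol_pi u E) - lconst r * E"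
    and f: "D (pol_pi u f) = lconst (- r) * f" "pol_Y u v f = lconst (inverse r) * f"
  shows "p dvd f"
proof -
  obtain g where g: "supp_lt (2 * l + 1) g" "p dvd f - g" "pol_Y u v g = lconst (inverse r) * g"
    using window_eigenvector[of f "inverse r"] f(2) by auto
  define z where "z = Poly_Mapping.lookup g (- int l)"
  have gz: "g = lconst z * E"
    unfolding z_def using g(1,3) is_e_polynomial_E
    by (intro eigenvector_unique) (simp_all add: eval_Y_l rank_l)
  have "p dvd D (pol_pi u (f - g)) - lconst (- r) * (f - g)"
    using g(2) assms(2) dvd_pi by simp
  then have "p dvd D (pol_pi u g) - lconst (- r) * g"
    using dvd_minus_iff[of p "D (pol_pi u g) - lconst (- r) * g"]
    by (simp add: linear_diff[OF linear_pi] linear_diff[OF assms(1)] f(1) right_diff_distrib)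
  moreover have "D (pol_pi u g) = lconst z * D (pol_pi u E)"
    by (simp add: gz linear_scale[OF linear_pi] linear_scale[OF assms(1)])
  \<comment> \<open>The same vector has the eigenvalues - r and r. Subtraction leaves 2 r g, which
    lies in the window and in the ideal.\<close>
  ultimately have "p dvd (lconst z * D (pol_pi u E) - lconst (- r) * g) -
      lconst z * (D (pol_pi u E) - lconst r * E)"
    using assms(3) by (metis dvd_diff dvd_mult)
  also have "(lconst z * D (pol_pi u E) - lconst (- r) * g) - lconst z * (D (pol_pi u E) - lconst r * E) =
      lconst (2 * r) * g"
    unfolding mult_2 lconst_add by (simp add: gz lconst_minus algebra_simps)
  finally have "p dvd lconst (2 * r) * g" .
  then have "lconst (2 * r) * g = 0"
    by (rule supp_lt_zero_if_dvd[rotated]) (rule supp_lt_scale[OF g(1)])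
  then have "g = 0"
    using r by simp
  with g(2) show ?thesis by simp
qed

lemma daha_rep: "daha_rep p (- int l) (- int l) (2 * l + 1) u v M (2 * int l + 1) r"
proof
  show "r ^ 2 = u"
    by (rule r_square)
  interpret t: laurent_twist u v "\<lambda>f. lconst r * pol_Y u v (lX * f)"
      "\<lambda>f. lconst (inverse r) * (lXi * pol_Y_inv u v f)"
    using u v r_square by (rule laurent_twist_tau)
  interpret t': laurent_twist u v "\<lambda>f. lconst (inverse r) * pol_Y_inv u v (lX * f)"
      "\<lambda>f. lconst r * (lXi * pol_Y u v f)"
    using u v r_square by (rule laurent_twist_tau_inv)
  show "p dvd tau_op u v r p"
  proof (rule dvd_twisted_eigenvector)
    show "laurent_linear (\<lambda>f. lconst r * pol_Y u v (lX * f))"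
      by (rule t.lin_D)
    show "p dvd lconst r * pol_Y u v (lX * f)" if "p dvd f" for f
      using that by (intro dvd_mult dvd_Y)
    \<comment> \<open>E and p both have Y-eigenvalue r^-1, so r Y X \<pi> acts on the class of E by
      r, just as X \<pi> does.\<close>
    have "lconst r * pol_Y u v (lX * pol_pi u E) - lconst r * E =
        lconst r * (lconst (u powi (- int l)) * (lconst (inverse r) * p))"
      using r by (simp add: X_pi_E linear_add[OF linear_Y] linear_scale[OF linear_Y] E(1) pol_Y_p distrib_left)
    then show "p dvd lconst r * pol_Y u v (lX * pol_pi u E) - lconst r * E"
      by (simp only: dvd_mult dvd_refl)
    \<comment> \<open>The twist commutes with \<pi> and carries X to r Y X, so it transports
      \<open>X_pi_p\<close>.\<close>
    show "lconst r * pol_Y u v (lX * pol_pi u (tau_op u v r p)) = lconst (- r) * tau_op u v r p"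
      using arg_cong[OF X_pi_p, of "tau_op u v r"] unfolding tau_op_def
      by (simp only: t.lsubst_X t.lsubst_pi linear_scale[OF t.linear_lsubst])
    show "pol_Y u v (tau_op u v r p) = lconst (inverse r) * tau_op u v r p"
      using arg_cong[OF pol_Y_p, of "tau_op u v r"] unfolding tau_op_def
      by (simp only: t.lsubst_Y linear_scale[OF t.linear_lsubst])
  qed
  show "p dvd tau_op_inv u v r p"
  proof (rule dvd_twisted_eigenvector)
    show "laurent_linear (\<lambda>f. lconst (inverse r) * pol_Y_inv u v (lX * f))"
      by (rule t'.lin_D)
    show "p dvd lconst (inverse r) * pol_Y_inv u v (lX * f)" if "p dvd f" for f
      using that by (intro dvd_mult dvd_Y_inv)
    have inv: "pol_Y_inv u v f = lconst r * f" if "pol_Y u v f = lconst (inverse r) * f" for f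
    proof -
      have "f = lconst (inverse r) * pol_Y_inv u v f"
        using arg_cong[OF that, of "pol_Y_inv u v"] u v
        by (simp add: pol_Y_inv_Y linear_scale[OF linear_Y_inv])
      then show ?thesis
        using r by (metis lconst_inverse_left(1))
    qed
    have "lconst (inverse r) * pol_Y_inv u v (lX * pol_pi u E) - lconst r * E =
        lconst (inverse r) * (lconst (u powi (- int l)) * (lconst r * p))"
      using r by (simp add: X_pi_E linear_add[OF linear_Y_inv] linear_scale[OF linear_Y_inv] inv[OF E(1)]
          inv[OF pol_Y_p] distrib_left)
    then show "p dvd lconst (inverse r) * pol_Y_inv u v (lX * pol_pi u E) - lconst r * E"
      by (simp only: dvd_mult dvd_refl)
    show "lconst (inverse r) * pol_Y_inv u v (lX * pol_pi u (tau_op_inv u v r p)) =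
        lconst (- r) * tau_op_inv u v r p"
      using arg_cong[OF X_pi_p, of "tau_op_inv u v r"] unfolding tau_op_inv_def
      by (simp only: t'.lsubst_X t'.lsubst_pi linear_scale[OF t'.linear_lsubst])
    show "pol_Y u v (tau_op_inv u v r p) = lconst (inverse r) * tau_op_inv u v r p"
      using arg_cong[OF pol_Y_p, of "tau_op_inv u v r"] unfolding tau_op_inv_def
      by (simp only: t'.lsubst_Y linear_scale[OF t'.linear_lsubst])
  qed
  have rho: "\<rho> i = \<rho> 0 * u ^ i" for i
  proof -
    have e: "2 * int i + 1 - 2 * int l = (2 * int 0 + 1 - 2 * int l) + 2 * int i" by simp
    have "\<rho> i = \<rho> 0 * u powi int i"
      unfolding \<rho>_def u_powi e power_int_add[OF disjI1[OF r]] ..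
    then show ?thesis by simp
  qed
  have "P dvd lX ^ M - lconst (\<rho> 0 ^ M)"
    unfolding P_def
  proof (rule root_product_dvd_power)
    show "inj_on \<rho> {..<2 * l + 1}"
    proof (rule inj_onI)
      fix i j assume ij: "i \<in> {..<2 * l + 1}" "j \<in> {..<2 * l + 1}" "\<rho> i = \<rho> j"
      then have "u powi int i = u powi int j"
        using rho_nonzero[of 0] by (simp add: rho[of i] rho[of j])
      then have "int M dvd int i - int j"
        unfolding primitive_root_powi_eq[OF u_primitive] .
      moreover have "\<bar>int i - int j\<bar> < int M"
        using ij(1,2) l by auto
      ultimately have "int i - int j = 0"
        by (rule dvd_abs_less_imp_zero)
      then show "i = j" by simp
    qed
    fix i
    have "(u ^ i) ^ M = (u ^ M) ^ i"
      by (simp only: mult.commute flip: power_mult)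
    then have "(u ^ i) ^ M = 1"
      using u_primitive by (simp add: primitive_root_of_unity_def)
    then show "\<rho> i ^ M = \<rho> 0 ^ M"
      unfolding rho[of i] by (simp add: power_mult_distrib)
  qed
  moreover have "P = p * lmon (int l)"
  proof -
    have "p * lmon (int l) = (lmon (- int l) * lmon (int l)) * P"
      by (simp only: p_def mult_ac)
    then show ?thesis
      by (simp add: lmon_mult)
  qed
  then have "p dvd P" by simp
  ultimately have "p dvd lX ^ M - lconst (\<rho> 0 ^ M)"
    by (metis dvd_trans)
  then show "\<exists>\<kappa>. \<kappa> \<noteq> 0 \<and> p dvd lX ^ M - lconst \<kappa>"
    using rho_nonzero by (intro exI[of _ "\<rho> 0 ^ M"]) simp
qed

lemma nonscalar:
  assumes "1 \<le> l"
  shows "daha_rep.nonscalar p (2 * l + 1) u"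
proof -
  interpret daha_rep p "- int l" "- int l" "2 * l + 1" u v M "2 * int l + 1" r
    by (rule daha_rep)
  have root: "leval (\<rho> i) p = 0" if "i < 2 * l + 1" for i
  proof -
    have "leval (\<rho> i) (lX - lconst (\<rho> i)) = 0"
      by (simp add: linear_diff[OF linear_leval])
    then have "leval (\<rho> i) P = 0"
      unfolding P_def leval_prod[OF rho_nonzero]
      by (intro prod_zero bexI[of _ i]) (simp_all only: lessThan_iff that finite_lessThan)
    then show ?thesis
      using rho_nonzero by (simp add: p_def leval_mult)
  qed
  have e: "2 * int 1 + 1 - 2 * int l = 2 * 1 + (2 * int 0 + 1 - 2 * int l)" by simp
  have "\<rho> 1 = u powi 1 * \<rho> 0"
    unfolding \<rho>_def u_powi e power_int_add[OF disjI1[OF r]] ..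
  then have "leval (u * \<rho> 0) p = 0"
    using root[of 1] assms by simp
  then show ?thesis
    unfolding nonscalar_def using root[of 0] assms rho_nonzero[of 0] by auto
qed

end

section \<open>The orders at roots of unity\<close>

lemma complex_ord_primitive_root_powi:
  assumes "primitive_root_of_unity M u"
  shows "int (complex_ord (u powi a)) = int M div gcd (int M) a"
proof -
  have M: "0 < M"
    using assms by (simp add: primitive_root_of_unity_def)
  have u: "u \<noteq> 0"
    using assms by (rule primitive_root_nonzero)
  define g where "g = gcd (int M) a"
  have g: "0 < g" "int M = g * (int M div g)" "a = g * (a div g)"
    using M by (simp_all add: g_def)
  have d: "0 \<le> int M div g"
    using g(1) by (simp add: pos_imp_zdiv_nonneg_iff)
  have "(u powi a) ^ m = 1 \<longleftrightarrow> nat (int M div g) dvd m" for m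
  proof -
    have "(u powi a) ^ m = u powi (a * int m)"
      by (simp only: power_int_mult power_int_of_nat)
    then have "(u powi a) ^ m = 1 \<longleftrightarrow> int M dvd a * int m"
      using primitive_root_powi_eq[OF assms, of "a * int m" 0] by simp
    also have "\<dots> \<longleftrightarrow> g * (int M div g) dvd g * ((a div g) * int m)"
      using g(2,3) by (metis mult.assoc)
    also have "\<dots> \<longleftrightarrow> int M div g dvd (a div g) * int m"
      using g(1) by simp
    also have "\<dots> \<longleftrightarrow> int M div g dvd int m"
      using div_gcd_coprime[of "int M" a] M unfolding g_def
      by (intro coprime_dvd_mult_right_iff) simp
    also have "\<dots> \<longleftrightarrow> nat (int M div g) dvd m"
      using d by (metis int_dvd_int_iff int_nat_eq)
    finally show ?thesis .
  qed
  then have "complex_ord (u powi a) = nat (int M div g)"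
    using u by (intro complex_ord_eqI) simp_all
  then show ?thesis
    using d by (simp add: g_def)
qed

lemma primitive_root_half:
  assumes "primitive_root_of_unity (2 * N) u"
  shows "u ^ N = - 1" "primitive_root_of_unity N (u ^ 2)"
proof -
  have N: "0 < N"
    using assms by (simp add: primitive_root_of_unity_def)
  have "(u ^ N) ^ 2 = 1"
    using assms by (simp add: primitive_root_of_unity_def mult.commute flip: power_mult)
  moreover have "u ^ N \<noteq> 1"
    using assms N by (simp add: primitive_root_of_unity_def)
  ultimately show "u ^ N = - 1"
    by (simp add: power2_eq_1_iff)
  have "(u ^ 2) ^ m = 1 \<longleftrightarrow> N dvd m" for m
    using primitive_root_pow_eq_1[OF assms, of "2 * m"] by (simp add: power_mult)
  then show "primitive_root_of_unity N (u ^ 2)"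
    using N by (auto simp: primitive_root_of_unity_def dest: dvd_imp_le)
qed

context daha_rep
begin

lemma opX_1: "quot_action u v p = \<lparr>actX = opX 1, actY = opY 1, actT = opT 1\<rparr>"
proof -
  have "pol_X = (\<lambda>f. lX * f :: complex laurent)"
    by (simp add: pol_X_def fun_eq_iff)
  then show ?thesis
    by (simp add: quot_action_def opX_def opY_def opT_def)
qed

lemma negated_ops:
  assumes "x ^ 2 = 1"
  shows "scal p (- 1) \<otimes>\<^bsub>G\<^esub> opX x = opX (- x)" "scal p (- 1) \<otimes>\<^bsub>G\<^esub> opY x = opY (- x)"
    "scal p (- 1) \<otimes>\<^bsub>G\<^esub> opT x = opT (- x)"
proof -
  interpret G: group G by (rule group_GL)
  have x: "(- x) ^ 2 = 1" and m: "scal p (- 1) \<in> carrier G"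
    using assms by (simp_all add: scal_in_GL)
  note GL = op_in_GL[OF assms] op_in_GL[OF x] m
  show "scal p (- 1) \<otimes>\<^bsub>G\<^esub> opX x = opX (- x)" "scal p (- 1) \<otimes>\<^bsub>G\<^esub> opY x = opY (- x)"
    "scal p (- 1) \<otimes>\<^bsub>G\<^esub> opT x = opT (- x)"
    by (rule GL_ext; simp add: GL GL_mult_class op_class lconst_minus)+
qed

lemma sigma_action:
  assumes "\<epsilon> \<in> {0, 1}" "\<delta> \<in> {0, 1}"
  shows "\<exists>x y. x ^ 2 = 1 \<and> y ^ 2 = 1 \<and>
    (sigma_x p ^^ \<epsilon>) ((sigma_y p ^^ \<delta>) (quot_action u v p)) = \<lparr>actX = opX x, actY = opY y, actT = opT 1\<rparr>"
  using assms unfolding opX_1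
  by (intro exI[of _ "(- 1) ^ \<epsilon>"] exI[of _ "(- 1) ^ \<delta>"])
    (auto simp: sigma_x_def sigma_y_def negated_ops)

lemma iota_action:
  "iota p \<lparr>actX = opX x, actY = opY y, actT = opT 1\<rparr> = \<lparr>actX = opX x, actY = opY y, actT = opT (- 1)\<rparr>"
  by (simp add: iota_def negated_ops)

end


section \<open>Arithmetic of the parameters\<close>

lemma ddot_q_units:
  assumes "daha_parameters N q14 q12 t12 k2"
  defines "e \<equiv> ddot_q q14 q12 k2"
  shows "e \<noteq> 0" "q12 powi j \<in> int_laurent_ring e" "q14 * t12 \<in> int_laurent_ring e"
    "q14 * inverse t12 \<in> int_laurent_ring e"
proof -
  have prim: "primitive_root_of_unity (2 * N) q12" and sq: "q14 ^ 2 = q12"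
    using assms(1) by (simp_all add: daha_parameters_def)
  have q12: "q12 \<noteq> 0"
    using prim by (rule primitive_root_nonzero)
  then have q14: "q14 \<noteq> 0"
    using sq by auto
  show e: "e \<noteq> 0"
    using q12 q14 by (simp add: e_def ddot_q_def)
  have pow: "q12 powi i = q14 powi (2 * i)" for i
    unfolding sq[symmetric] by (simp add: power_int_mult)
  have mem: "e powi i \<in> int_laurent_ring e" for i
    using int_laurent_ring_powi[of 1 e i] by simp
  show "q12 powi j \<in> int_laurent_ring e"
    using mem[of j] mem[of "2 * j"] pow[of j] by (auto simp: e_def ddot_q_def)
  have "q14 * t12 \<in> int_laurent_ring e \<and> q14 * inverse t12 \<in> int_laurent_ring e"
  proof (cases "even k2")
    case True
    then have ee: "e = q14"
      by (simp add: e_def ddot_q_def)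
    have m: "- x \<in> int_laurent_ring e" if "x \<in> int_laurent_ring e" for x
      using that e by (rule int_laurent_ring_minus)
    have t: "t12 = q14 powi k2 \<or> t12 = - (q14 powi k2)"
      using assms(1) True pow[of "k2 div 2"] by (simp add: daha_parameters_def)
    have "q14 * q14 powi k2 = q14 powi (1 + k2)" "q14 * inverse (q14 powi k2) = q14 powi (1 + - k2)"
      using q14 by (simp_all add: power_int_add power_int_diff divide_inverse)
    then have "q14 * q14 powi k2 \<in> int_laurent_ring e" "q14 * inverse (q14 powi k2) \<in> int_laurent_ring e"
      using mem unfolding ee by simp_all
    then show ?thesis
      using t m by auto
  next
    case False
    then have ee: "e = q12" and t: "t12 = q14 powi k2"
      using assms(1) by (simp_all add: e_def ddot_q_def daha_parameters_def)
    have "q14 * q14 powi k2 = q14 powi (1 + k2)" "q14 * inverse (q14 powi k2) = q14 powi (1 + - k2)"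
      using q14 by (simp_all add: power_int_add power_int_diff divide_inverse)
    \<comment> \<open>For odd 2k the exponents of q^(1/4) in r t^(1/2) and r t^(-1/2) are even, so
      both products are powers of q^(1/2).\<close>
    moreover have "1 + k2 = 2 * ((1 + k2) div 2)" "1 + - k2 = 2 * ((1 + - k2) div 2)"
      using False by simp_all
    ultimately have "q14 * q14 powi k2 = q12 powi ((1 + k2) div 2)"
        "q14 * inverse (q14 powi k2) = q12 powi ((1 + - k2) div 2)"
      using pow[of "(1 + k2) div 2"] pow[of "(1 + - k2) div 2"] by simp_all
    then show ?thesis
      using mem unfolding ee t by simp
  qed
  then show "q14 * t12 \<in> int_laurent_ring e" "q14 * inverse t12 \<in> int_laurent_ring e"
    by simp_all
qed

lemma t_eq_powi:
  assumes "daha_parameters N q14 q12 t12 k2"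
  shows "t12 ^ 2 = q12 powi k2"
proof (cases "even k2")
  case True
  then have "t12 ^ 2 = (q12 powi (k2 div 2)) ^ 2"
    using assms by (auto simp: daha_parameters_def)
  also have "\<dots> = q12 powi (k2 div 2 * 2)"
    by (simp add: power_int_mult)
  finally show ?thesis
    using True by simp
next
  case False
  then have "t12 ^ 2 = q14 powi (2 * k2)"
    using assms by (simp add: daha_parameters_def power_int_mult mult.commute[of 2])
  also have "\<dots> = q12 powi k2"
    using assms by (simp add: daha_parameters_def power_int_mult)
  finally show ?thesis .
qed

text \<open>Everything is a power of q^(1/2), the sign being its N-th power: - t has exponent N +
  2k, t^2 has 4k, and - t^2 has N + 4k.\<close>

lemma order_formulas:
  assumes "daha_parameters N q14 q12 t12 k2"
  shows "int (complex_ord (- (t12 ^ 2))) = 2 * int N div gcd (2 * int N) (int N - \<bar>k2\<bar>)"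
    and "int (complex_ord ((t12 ^ 2) ^ 2)) = int N div gcd (int N) \<bar>k2\<bar>"
    and "odd N \<Longrightarrow> (t12 ^ 2) ^ 2 \<noteq> - 1"
    and "odd N \<Longrightarrow> int (complex_ord (- ((t12 ^ 2) ^ 2))) = 2 * int N div gcd (int N) \<bar>k2\<bar>"
    and "odd N \<Longrightarrow> int (complex_ord (((t12 ^ 2) ^ 2) ^ 2)) = int N div gcd (int N) \<bar>k2\<bar>"
proof -
  have prim: "primitive_root_of_unity (2 * N) q12"
    using assms by (simp add: daha_parameters_def)
  have q: "q12 \<noteq> 0"
    using prim by (rule primitive_root_nonzero)
  have qN: "q12 powi int N = - 1"
    using primitive_root_half(1)[OF prim] by simp
  have t: "t12 ^ 2 = q12 powi k2" "(t12 ^ 2) ^ 2 = q12 powi (2 * k2)"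
      "((t12 ^ 2) ^ 2) ^ 2 = q12 powi (4 * k2)"
    using t_eq_powi[OF assms] by (simp_all add: power_int_mult mult.commute[of _ k2] flip: power_mult)
  have neg: "- (q12 powi a) = q12 powi (int N + a)" for a
    using q qN by (simp add: power_int_add)
  have ord: "int (complex_ord (q12 powi a)) = 2 * int N div gcd (2 * int N) a" for a
    using complex_ord_primitive_root_powi[OF prim, of a] by simp
  \<comment> \<open>For nonnegative 2k the numbers N + 2k and N - 2k are opposite modulo 2N.\<close>
  have "gcd (2 * int N) (int N + k2) = gcd (2 * int N) (int N - \<bar>k2\<bar>)"
  proof (cases "0 \<le> k2")
    case True
    have "gcd (2 * int N) (int N - k2) = gcd (2 * int N) (2 * int N - (int N - k2))"
      by (metis gcd.commute gcd_diff1 gcd_diff2)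
    with True show ?thesis by simp
  qed simp
  then show "int (complex_ord (- (t12 ^ 2))) = 2 * int N div gcd (2 * int N) (int N - \<bar>k2\<bar>)"
    unfolding t(1) neg ord by simp
  have g2: "2 * int N div gcd (2 * int N) (2 * a) = int N div gcd (int N) \<bar>a\<bar>" for a
    by (simp add: gcd_mult_distrib_int[symmetric])
  then show "int (complex_ord ((t12 ^ 2) ^ 2)) = int N div gcd (int N) \<bar>k2\<bar>"
    unfolding t(2) ord by simp
  assume N: "odd N"
  \<comment> \<open>Equality would make the odd number 4k - N a multiple of 2N.\<close>
  have "q12 powi (2 * k2) \<noteq> q12 powi int N"
  proof
    assume "q12 powi (2 * k2) = q12 powi int N"
    then have "int (2 * N) dvd 2 * k2 - int N"
      unfolding primitive_root_powi_eq[OF prim] .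
    then have "2 dvd 2 * k2 - int N"
      by (metis dvd_mult_left of_nat_mult of_nat_numeral)
    then show False
      using N by simp
  qed
  then show "(t12 ^ 2) ^ 2 \<noteq> - 1"
    unfolding t(2) qN .
  have c2: "coprime (int N) 2"
    using N by simp
  have g1: "gcd (int N) (2 * a) = gcd (int N) \<bar>a\<bar>" for a
    using gcd_mult_left_right_cancel[OF c2, of a] by (simp add: gcd.commute mult.commute)
  \<comment> \<open>The second argument is odd, so the factor 2 of the first contributes
    nothing.\<close>
  have "gcd (2 * int N) (int N + 2 * k2) = gcd (int N) (int N + 2 * k2)"
    using N by (intro gcd_mult_left_left_cancel) simp
  also have "\<dots> = gcd (int N) \<bar>k2\<bar>"
    using g1[of k2] by simp
  finally show "int (complex_ord (- ((t12 ^ 2) ^ 2))) = 2 * int N div gcd (int N) \<bar>k2\<bar>"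
    unfolding t(2) neg ord by simp
  have "2 * int N div gcd (2 * int N) (4 * k2) = int N div gcd (int N) \<bar>2 * k2\<bar>"
    using g2[of "2 * k2"] by simp
  then show "int (complex_ord (((t12 ^ 2) ^ 2) ^ 2)) = int N div gcd (int N) \<bar>k2\<bar>"
    unfolding t(3) ord using g1[of "\<bar>k2\<bar>"] by (simp add: abs_mult)
qed

section \<open>Assembly of the results for the families of modules\<close>

context daha_rep
begin

text \<open>\<open>v'\<close> is the parameter of the module, possibly after \<iota>, while the
  orders are expressed by the original v: \<iota> changes the operator T only by a sign.\<close>

lemma integral_module:
  assumes r: "r ^ 2 = u" and sq: "x ^ 2 = 1" "y ^ 2 = 1"
    and vd: "d = 1 \<and> v' = v \<or> d = - 1 \<and> v' = inverse v"
    and e: "e \<noteq> 0" "\<And>k. u powi k \<in> int_laurent_ring e" "r * v \<in> int_laurent_ring e"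
      "r * inverse v \<in> int_laurent_ring e"
    and ns: "nd \<Longrightarrow> nonscalar"
    and ords: "int (complex_ord (- (v ^ 2))) = o1" "int (complex_ord ((v ^ 2) ^ 2)) = o2"
    and D: "D = \<lparr>actX = opX x, actY = opY y, actT = opT d\<rparr>"
  shows "is_daha_module p u v' D \<and>
       (\<exists>\<rho>. is_B1_action p r D \<rho> \<and>
         (let G = GL_quot p; A = A_img p D; B = B_img p r D; C = C_img p D;
              x = x_img p r D; y = y_img p r D; z = z_img p D;
              X = actX D; Y = actY D; T = actT D;
              Tt = scal p r \<otimes>\<^bsub>G\<^esub> T; L = quot_lattice p r e
          in
            (\<forall>g\<in>carrier (B_tilde p \<rho>). g ` L = L) \<and>
            group_center (B_tilde p \<rho>) = carrier (B_tilde p \<rho>) \<inter> scalars p \<and>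
            natural_triangle_quotient M p r D \<rho> \<and>
            y = scal p r \<otimes>\<^bsub>G\<^esub> X \<otimes>\<^bsub>G\<^esub> T \<otimes>\<^bsub>G\<^esub> T \<and>
            z = scal p r \<otimes>\<^bsub>G\<^esub> inv\<^bsub>G\<^esub> Y \<otimes>\<^bsub>G\<^esub> inv\<^bsub>G\<^esub> (actX (tau_minus p r D)) \<otimes>\<^bsub>G\<^esub> Y \<and>
            (\<exists>s\<in>scalars p. A \<otimes>\<^bsub>G\<^esub> B \<otimes>\<^bsub>G\<^esub> A \<otimes>\<^bsub>G\<^esub> C = s \<otimes>\<^bsub>G\<^esub> (Y \<otimes>\<^bsub>G\<^esub> X \<otimes>\<^bsub>G\<^esub> Y)) \<and>
            Y \<otimes>\<^bsub>G\<^esub> X \<otimes>\<^bsub>G\<^esub> Y = actY (tau_plus p r (tau_minus p r D)) \<and>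
            Tt = A \<otimes>\<^bsub>G\<^esub> B \<otimes>\<^bsub>G\<^esub> C \<and>
            Tt \<otimes>\<^bsub>G\<^esub> Tt = x \<otimes>\<^bsub>G\<^esub> z \<otimes>\<^bsub>G\<^esub> y \<and>
            (nd \<longrightarrow>
               ord_in_B_dag p \<rho> x = M \<and>
               ord_in_B_dag p \<rho> y = M \<and>
               ord_in_B_dag p \<rho> z = M \<and>
               ord_in_B_dag p \<rho> (A \<otimes>\<^bsub>G\<^esub> B \<otimes>\<^bsub>G\<^esub> A \<otimes>\<^bsub>G\<^esub> C) = M \<and>
               (v ^ 2 \<noteq> - 1 \<longrightarrow>
                  ord_mod_scalars p Tt = complex_ord (- (v ^ 2)) \<and>
                  int (complex_ord (- (v ^ 2))) = o1 \<and>
                  ord_mod_scalars p (Tt \<otimes>\<^bsub>G\<^esub> Tt) = complex_ord ((v ^ 2) ^ 2) \<and>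
                  int (complex_ord ((v ^ 2) ^ 2)) = o2))))"
proof -
  have d: "d ^ 2 = 1"
    using vd by auto
  interpret B: braid_triple G "scal p" r "opX x" "opY y" "opT d"
    using r sq d by (rule braid_triple_rep)
  obtain \<rho> where \<rho>: "is_B1_action p r D \<rho>"
    and gen: "\<And>S. subgroup S G \<Longrightarrow> B.Xt \<in> S \<Longrightarrow> B.Yt \<in> S \<Longrightarrow> B.Tt \<in> S \<Longrightarrow> carrier (B_tilde p \<rho>) \<subseteq> S"
    and center: "group_center (B_tilde p \<rho>) = carrier (B_tilde p \<rho>) \<inter> scalars p"
    and tri: "natural_triangle_quotient M p r D \<rho>"
    and ord: "nonscalar \<Longrightarrow> \<forall>g\<in>{x_img p r D, y_img p r D, z_img p D,
         A_img p D \<otimes>\<^bsub>G\<^esub> B_img p r D \<otimes>\<^bsub>G\<^esub> A_img p D \<otimes>\<^bsub>G\<^esub> C_img p D}.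
       ord_in_B_dag p \<rho> g = M \<and> ord_mod_scalars p g = M"
    using braid_image[OF r sq d, folded D] by blast
  have "carrier (B_tilde p \<rho>) \<subseteq> {g \<in> carrier G. g ` quot_lattice p r e = quot_lattice p r e}"
    using lattice_invariant[OF r e sq d] subgroup_lattice_stabilizer[OF r e]
    by (intro gen) simp_all
  then have lattice: "\<forall>g\<in>carrier (B_tilde p \<rho>). g ` quot_lattice p r e = quot_lattice p r e"
    by blast
  note ids = braid_identities[OF r sq d, folded D]
  show ?thesis
    unfolding Let_def
    using is_daha_module_rep[OF sq vd, folded D] \<rho> lattice center tri ids(1-6) ids(7,8)[OF ns] ords ord[OF ns]
    by (intro conjI exI[of _ \<rho>]) simp_all
qed

lemma check_module:
  assumes r: "r ^ 2 = u" and sq: "x ^ 2 = 1" "y ^ 2 = 1"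
    and v2: "v ^ 2 \<noteq> - 1"
    and ns: "nd \<Longrightarrow> nonscalar"
    and ords: "int (complex_ord (- (v ^ 2))) = o1" "int (complex_ord ((v ^ 2) ^ 2)) = o2"
    and D: "D = \<lparr>actX = opX x, actY = opY y, actT = opT 1\<rparr>"
  shows "is_daha_module p u v D \<and> quot_dim p W \<and>
       (\<exists>\<rho>. is_B1_action p r D \<rho> \<and>
         (let G = GL_quot p; A = A_img p D; B = B_img p r D; C = C_img p D;
              x = x_img p r D; y = y_img p r D; z = z_img p D;
              T = actT D; Tt = scal p r \<otimes>\<^bsub>G\<^esub> T
          in
            group_center (B_tilde p \<rho>) = carrier (B_tilde p \<rho>) \<inter> scalars p \<and>
            natural_triangle_quotient M p r D \<rho> \<and>
            Tt = A \<otimes>\<^bsub>G\<^esub> B \<otimes>\<^bsub>G\<^esub> C \<and>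
            (nd \<longrightarrow>
               ord_mod_scalars p x = M \<and>
               ord_mod_scalars p y = M \<and>
               ord_mod_scalars p z = M \<and>
               ord_mod_scalars p (A \<otimes>\<^bsub>G\<^esub> B \<otimes>\<^bsub>G\<^esub> A \<otimes>\<^bsub>G\<^esub> C) = M \<and>
               ord_mod_scalars p Tt = complex_ord (- (v ^ 2)) \<and>
               int (complex_ord (- (v ^ 2))) = o1 \<and>
               int (ord_mod_scalars p (T \<otimes>\<^bsub>G\<^esub> T)) = o2)))"
proof -
  have d: "(1 :: complex) ^ 2 = 1"
    by simp
  obtain \<rho> where \<rho>: "is_B1_action p r D \<rho>"
    and center: "group_center (B_tilde p \<rho>) = carrier (B_tilde p \<rho>) \<inter> scalars p"
    and tri: "natural_triangle_quotient M p r D \<rho>"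
    and ord: "nonscalar \<Longrightarrow> \<forall>g\<in>{x_img p r D, y_img p r D, z_img p D,
         A_img p D \<otimes>\<^bsub>G\<^esub> B_img p r D \<otimes>\<^bsub>G\<^esub> A_img p D \<otimes>\<^bsub>G\<^esub> C_img p D}.
       ord_in_B_dag p \<rho> g = M \<and> ord_mod_scalars p g = M"
    using braid_image[OF r sq d, folded D] by blast
  note ids = braid_identities[OF r sq d, folded D]
  show ?thesis
    unfolding Let_def
    using is_daha_module_rep[OF sq, of 1 v, folded D] quot_dim_W \<rho> center tri ids(5)
      ids(7,9)[OF ns v2] ords ord[OF ns]
    by (intro conjI exI[of _ \<rho>]) simp_all
qed

end

lemma integral_types:
  fixes N :: nat and q14 q12 t12 :: complex and k2 :: int
  assumes params: "daha_parameters N q14 q12 t12 k2"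
    and type: "alpha_module N q12 t12 k2 p M0 \<or> gamma_module N q12 t12 k2 p M0"
    and M: "M = M0 \<and> v = t12 \<or> M = iota p M0 \<and> v = inverse t12"
  shows "is_daha_module p q12 v M \<and>
       (\<exists>\<rho>. is_B1_action p q14 M \<rho> \<and>
         (let G = GL_quot p; A = A_img p M; B = B_img p q14 M; C = C_img p M;
              x = x_img p q14 M; y = y_img p q14 M; z = z_img p M;
              X = actX M; Y = actY M; T = actT M;
              Tt = scal p q14 \<otimes>\<^bsub>G\<^esub> T; L = quot_lattice p q14 (ddot_q q14 q12 k2)
          in
            (\<forall>g\<in>carrier (B_tilde p \<rho>). g ` L = L) \<and>
            group_center (B_tilde p \<rho>) = carrier (B_tilde p \<rho>) \<inter> scalars p \<and>
            natural_triangle_quotient (2 * N) p q14 M \<rho> \<and>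
            y = scal p q14 \<otimes>\<^bsub>G\<^esub> X \<otimes>\<^bsub>G\<^esub> T \<otimes>\<^bsub>G\<^esub> T \<and>
            z = scal p q14 \<otimes>\<^bsub>G\<^esub> inv\<^bsub>G\<^esub> Y \<otimes>\<^bsub>G\<^esub> inv\<^bsub>G\<^esub> (actX (tau_minus p q14 M)) \<otimes>\<^bsub>G\<^esub> Y \<and>
            (\<exists>s\<in>scalars p. A \<otimes>\<^bsub>G\<^esub> B \<otimes>\<^bsub>G\<^esub> A \<otimes>\<^bsub>G\<^esub> C = s \<otimes>\<^bsub>G\<^esub> (Y \<otimes>\<^bsub>G\<^esub> X \<otimes>\<^bsub>G\<^esub> Y)) \<and>
            Y \<otimes>\<^bsub>G\<^esub> X \<otimes>\<^bsub>G\<^esub> Y = actY (tau_plus p q14 (tau_minus p q14 M)) \<and>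
            Tt = A \<otimes>\<^bsub>G\<^esub> B \<otimes>\<^bsub>G\<^esub> C \<and>
            Tt \<otimes>\<^bsub>G\<^esub> Tt = x \<otimes>\<^bsub>G\<^esub> z \<otimes>\<^bsub>G\<^esub> y \<and>
            (nondegenerate N k2 \<longrightarrow>
               ord_in_B_dag p \<rho> x = 2 * N \<and>
               ord_in_B_dag p \<rho> y = 2 * N \<and>
               ord_in_B_dag p \<rho> z = 2 * N \<and>
               ord_in_B_dag p \<rho> (A \<otimes>\<^bsub>G\<^esub> B \<otimes>\<^bsub>G\<^esub> A \<otimes>\<^bsub>G\<^esub> C) = 2 * N \<and>
               (t12 ^ 2 \<noteq> - 1 \<longrightarrow>
                  ord_mod_scalars p Tt = complex_ord (- (t12 ^ 2)) \<and>
                  int (complex_ord (- (t12 ^ 2))) = 2 * int N div gcd (2 * int N) (int N - \<bar>k2\<bar>) \<and>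
                  ord_mod_scalars p (Tt \<otimes>\<^bsub>G\<^esub> Tt) = complex_ord ((t12 ^ 2) ^ 2) \<and>
                  int (complex_ord ((t12 ^ 2) ^ 2)) = int N div gcd (int N) \<bar>k2\<bar>))))"
proof -
  have prim: "primitive_root_of_unity (2 * N) q12" and sq: "q14 ^ 2 = q12"
    using params by (simp_all add: daha_parameters_def)
  have q12: "q12 \<noteq> 0"
    using prim by (rule primitive_root_nonzero)
  have qN: "q12 ^ N = - 1"
    by (rule primitive_root_half(1)[OF prim])
  have t: "t12 ^ 2 = q12 powi k2"
    by (rule t_eq_powi[OF params])
  note e = ddot_q_units[OF params]
  note ords = order_formulas[OF params]
  show ?thesis
    using type
  proof
    assume "alpha_module N q12 t12 k2 p M0"
    then have k2: "0 < k2" "k2 < int N" and p: "p = e_poly q12 t12 (- (int N - k2))"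
      and M0: "M0 = quot_action q12 t12 p"
      by (simp_all add: alpha_module_def)
    define n where "n = nat (int N - k2)"
    have n: "int n = int N - k2" "0 < n" "n < N"
      using k2 by (simp_all add: n_def)
    \<comment> \<open>The exponent 2k + n is N, which yields the value -1 required by
      \<open>alpha_setting\<close>.\<close>
    have "t12 ^ 2 * q12 ^ n = q12 powi (k2 + int n)"
      unfolding t power_int_add[OF disjI1[OF q12]] by simp
    then have tn: "t12 ^ 2 * q12 ^ n = - 1"
      using qN by (simp add: n(1))
    interpret A: alpha_setting N n q12 t12
      by unfold_locales (use prim n tn in simp_all)
    have pA: "p = A.p"
      using A.e_poly_eq by (simp add: p n(1))
    interpret R: daha_rep A.p "- int n" "1 - int n" "2 * n" q12 t12 "2 * N" "int N + int n" "csqrt q12"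
      by (rule A.daha_rep)
    have ns: "nondegenerate N k2 \<Longrightarrow> R.nonscalar"
      using n by (intro A.nonscalar) (simp add: nondegenerate_def)
    \<comment> \<open>The sign that \<iota> puts in front of T.\<close>
    define d :: complex where "d = (if M = M0 \<and> v = t12 then 1 else - 1)"
    have d: "d = 1 \<and> v = t12 \<or> d = - 1 \<and> v = inverse t12"
      using M by (auto simp: d_def)
    have D: "M = \<lparr>actX = R.opX 1, actY = R.opY 1, actT = R.opT d\<rparr>"
      using M R.iota_action[of 1 1] unfolding M0 pA R.opX_1 d_def by auto
    show ?thesis
      unfolding pA by (rule R.integral_module[OF sq _ _ d e ns ords(1,2) D]) simp_all
  next
    assume "gamma_module N q12 t12 k2 p M0"
    then obtain l :: nat and \<epsilon> \<delta> :: nat where ed: "\<epsilon> \<in> {0, 1}" "\<delta> \<in> {0, 1}"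
      and k2: "k2 = - 1 - 2 * int l" "\<bar>k2\<bar> < int N"
      and p: "p = e_poly q12 t12 (int l + 1) - lconst (inverse t12) * e_poly q12 t12 (- int l)"
      and M0: "M0 = (sigma_x p ^^ \<epsilon>) ((sigma_y p ^^ \<delta>) (quot_action q12 t12 p))"
      unfolding gamma_module_def by blast
    interpret A: gamma_setting "2 * N" l q12 q14
      by unfold_locales (use prim sq k2 in simp_all)
    have "odd k2"
      using k2(1) by simp
    then have "t12 = q14 powi k2"
      using params by (simp add: daha_parameters_def)
    moreover have "k2 = - (2 * int l + 1)"
      using k2(1) by simp
    ultimately have tA: "t12 = A.v"
      by (simp only: A.v_powi)
    have pA: "p = A.p"
      using A.e_poly_combination by (simp add: p tA)
    interpret R: daha_rep A.p "- int l" "- int l" "2 * l + 1" q12 A.v "2 * N" "2 * int l + 1" q14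
      by (rule A.daha_rep)
    have ns: "nondegenerate N k2 \<Longrightarrow> R.nonscalar"
      using k2 by (intro A.nonscalar) (simp add: nondegenerate_def)
    obtain x y where xy: "x ^ 2 = 1" "y ^ 2 = 1"
      and M0': "M0 = \<lparr>actX = R.opX x, actY = R.opY y, actT = R.opT 1\<rparr>"
      using R.sigma_action[OF ed] unfolding M0 pA tA by blast
    define d :: complex where "d = (if M = M0 \<and> v = t12 then 1 else - 1)"
    have d: "d = 1 \<and> v = A.v \<or> d = - 1 \<and> v = inverse A.v"
      using M by (auto simp: d_def tA)
    have D: "M = \<lparr>actX = R.opX x, actY = R.opY y, actT = R.opT d\<rparr>"
      using M R.iota_action[of x y] unfolding M0' pA d_def by auto
    show ?thesis
      unfolding pA tA by (rule R.integral_module[OF sq xy d e[unfolded tA] ns ords(1,2)[unfolded tA] D])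
  qed
qed

lemma check_types:
  fixes N :: nat and q14 q12 t12 :: complex and k2 :: int
  assumes params: "daha_parameters N q14 q12 t12 k2" and odd: "odd N"
    and type: "alpha_check_module N q12 t12 k2 p M \<or> gamma_check_module N q12 t12 k2 p M"
  shows "is_daha_module p (q12 ^ 2) (t12 ^ 2) M \<and>
       (alpha_check_module N q12 t12 k2 p M \<longrightarrow> quot_dim p (nat (int N - k2))) \<and>
       (gamma_check_module N q12 t12 k2 p M \<longrightarrow> quot_dim p (nat \<bar>k2\<bar>)) \<and>
       (t12 ^ 2) ^ 2 \<noteq> - 1 \<and>
       (\<exists>\<rho>. is_B1_action p q12 M \<rho> \<and>
         (let G = GL_quot p; A = A_img p M; B = B_img p q12 M; C = C_img p M;
              x = x_img p q12 M; y = y_img p q12 M; z = z_img p M;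
              T = actT M; Tt = scal p q12 \<otimes>\<^bsub>G\<^esub> T
          in
            group_center (B_tilde p \<rho>) = carrier (B_tilde p \<rho>) \<inter> scalars p \<and>
            natural_triangle_quotient N p q12 M \<rho> \<and>
            Tt = A \<otimes>\<^bsub>G\<^esub> B \<otimes>\<^bsub>G\<^esub> C \<and>
            (nondegenerate N k2 \<longrightarrow>
               ord_mod_scalars p x = N \<and>
               ord_mod_scalars p y = N \<and>
               ord_mod_scalars p z = N \<and>
               ord_mod_scalars p (A \<otimes>\<^bsub>G\<^esub> B \<otimes>\<^bsub>G\<^esub> A \<otimes>\<^bsub>G\<^esub> C) = N \<and>
               ord_mod_scalars p Tt = complex_ord (- ((t12 ^ 2) ^ 2)) \<and>
               int (complex_ord (- ((t12 ^ 2) ^ 2))) = 2 * int N div gcd (int N) \<bar>k2\<bar> \<and>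
               int (ord_mod_scalars p (T \<otimes>\<^bsub>G\<^esub> T)) = int N div gcd (int N) \<bar>k2\<bar>)))"
proof -
  have prim: "primitive_root_of_unity (2 * N) q12"
    using params by (simp add: daha_parameters_def)
  have q12: "q12 \<noteq> 0"
    using prim by (rule primitive_root_nonzero)
  have qN: "q12 ^ N = - 1" and prim': "primitive_root_of_unity N (q12 ^ 2)"
    using primitive_root_half[OF prim] .
  have t: "t12 ^ 2 = q12 powi k2"
    by (rule t_eq_powi[OF params])
  note ords = order_formulas[OF params]
  show ?thesis
    using type
  proof
    assume alpha: "alpha_check_module N q12 t12 k2 p M"
    then have not_gamma: "\<not> gamma_check_module N q12 t12 k2 p M"
      by (auto simp: alpha_check_module_def gamma_check_module_def gamma_module_def)
    from alpha obtain n k :: int and \<epsilon> \<delta> :: nat where ed: "\<epsilon> \<in> {0, 1}" "\<delta> \<in> {0, 1}"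
      and k2: "int N = 2 * n + 1" "k2 = 2 * k" "0 < k2" "k2 < int N"
      and p: "p = e_poly (q12 ^ 2) (t12 ^ 2) (n - k + 1)
             - lconst (inverse (t12 ^ 2)) * e_poly (q12 ^ 2) (t12 ^ 2) (k - n)"
      and M: "M = (sigma_x p ^^ \<epsilon>) ((sigma_y p ^^ \<delta>) (quot_action (q12 ^ 2) (t12 ^ 2) p))"
      unfolding alpha_check_module_def by blast
    define l where "l = nat (n - k)"
    have l: "int l = n - k" "2 * int l + 1 = int N - k2"
      using k2 by (simp_all add: l_def)
    \<comment> \<open>The sign is forced by the parameter: 2l + 1 = N - 2k is odd and q12^N = -1, so
      (- q12)^(-(2l+1)) equals q12^(2k) = t.\<close>
    interpret A: gamma_setting N l "q12 ^ 2" "- q12"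
      by unfold_locales (use prim' l k2 in simp_all)
    have "A.v = inverse ((- q12) ^ (2 * l + 1))"
      by (simp only: A.v_def)
    also have "\<dots> = - inverse (q12 powi (int N - k2))"
      using l(2) power_int_of_nat[of q12 "2 * l + 1"] by (simp add: add.commute)
    also have "\<dots> = t12 ^ 2"
      using q12 qN unfolding t by (simp add: power_int_diff)
    finally have tA: "t12 ^ 2 = A.v" ..
    have nk: "n - k + 1 = int l + 1" "k - n = - int l"
      using l by simp_all
    have pA: "p = A.p"
      unfolding p nk tA by (rule A.e_poly_combination)
    interpret R: daha_rep A.p "- int l" "- int l" "2 * l + 1" "q12 ^ 2" A.v N "2 * int l + 1" "- q12"
      by (rule A.daha_rep)
    have ns: "nondegenerate N k2 \<Longrightarrow> R.nonscalar"
      using l k2 by (intro A.nonscalar) (simp add: nondegenerate_def)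
    obtain x y where xy: "x ^ 2 = 1" "y ^ 2 = 1"
      and D: "M = \<lparr>actX = R.opX x, actY = R.opY y, actT = R.opT 1\<rparr>"
      using R.sigma_action[OF ed] unfolding M pA tA by blast
    have dim: "nat (int N - k2) = 2 * l + 1"
      using l(2) by simp
    show ?thesis
      \<comment> \<open>The braid group action is normalized by q12 itself, which has the same
        square as the root - q12 used for the ideal.\<close>
      using R.check_module[OF refl xy ords(3)[OF odd, unfolded tA] ns
          ords(4,5)[OF odd, unfolded tA] D] not_gamma ords(3)[OF odd]
      unfolding pA tA dim by blast
  next
    assume gamma: "gamma_check_module N q12 t12 k2 p M"
    then have not_alpha: "\<not> alpha_check_module N q12 t12 k2 p M"
      by (auto simp: alpha_check_module_def gamma_check_module_def gamma_module_def)
    from gamma obtain l :: nat and \<epsilon> \<delta> :: nat where ed: "\<epsilon> \<in> {0, 1}" "\<delta> \<in> {0, 1}"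
      and k2: "k2 = - 1 - 2 * int l" "\<bar>k2\<bar> < int N"
      and p: "p = e_poly (q12 ^ 2) (t12 ^ 2) (int l + 1)
             - lconst (inverse (t12 ^ 2)) * e_poly (q12 ^ 2) (t12 ^ 2) (- int l)"
      and M: "M = (sigma_x p ^^ \<epsilon>) ((sigma_y p ^^ \<delta>) (quot_action (q12 ^ 2) (t12 ^ 2) p))"
      unfolding gamma_check_module_def gamma_module_def by blast
    interpret A: gamma_setting N l "q12 ^ 2" q12
      by unfold_locales (use prim' k2 in simp_all)
    have "k2 = - (2 * int l + 1)"
      using k2(1) by simp
    then have tA: "t12 ^ 2 = A.v"
      by (simp only: A.v_powi t)
    have pA: "p = A.p"
      using A.e_poly_combination by (simp add: p tA)
    interpret R: daha_rep A.p "- int l" "- int l" "2 * l + 1" "q12 ^ 2" A.v N "2 * int l + 1" q12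
      by (rule A.daha_rep)
    have ns: "nondegenerate N k2 \<Longrightarrow> R.nonscalar"
      using k2 by (intro A.nonscalar) (simp add: nondegenerate_def)
    obtain x y where xy: "x ^ 2 = 1" "y ^ 2 = 1"
      and D: "M = \<lparr>actX = R.opX x, actY = R.opY y, actT = R.opT 1\<rparr>"
      using R.sigma_action[OF ed] unfolding M pA tA by blast
    have dim: "nat \<bar>k2\<bar> = 2 * l + 1"
      using k2 by simp
    show ?thesis
      using R.check_module[OF refl xy ords(3)[OF odd, unfolded tA] ns
          ords(4,5)[OF odd, unfolded tA] D] not_alpha ords(3)[OF odd]
      unfolding pA tA dim by blast
  qed
qed

theorem proposition2p4:
  fixes N :: nat and q14 q12 t12 :: complex and k2 :: int
  assumes params: "daha_parameters N q14 q12 t12 k2"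
  shows
    "(\<forall>p M0 M v.
       (alpha_module N q12 t12 k2 p M0 \<or> gamma_module N q12 t12 k2 p M0) \<and>
       (M = M0 \<and> v = t12 \<or> M = iota p M0 \<and> v = inverse t12) \<longrightarrow>
       is_daha_module p q12 v M \<and>
       (\<exists>\<rho>. is_B1_action p q14 M \<rho> \<and>
         (let G = GL_quot p; A = A_img p M; B = B_img p q14 M; C = C_img p M;
              x = x_img p q14 M; y = y_img p q14 M; z = z_img p M;
              X = actX M; Y = actY M; T = actT M;
              Tt = scal p q14 \<otimes>\<^bsub>G\<^esub> T; L = quot_lattice p q14 (ddot_q q14 q12 k2)
          in
            (\<forall>g\<in>carrier (B_tilde p \<rho>). g ` L = L) \<and>
            group_center (B_tilde p \<rho>) = carrier (B_tilde p \<rho>) \<inter> scalars p \<and>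
            natural_triangle_quotient (2 * N) p q14 M \<rho> \<and>
            y = scal p q14 \<otimes>\<^bsub>G\<^esub> X \<otimes>\<^bsub>G\<^esub> T \<otimes>\<^bsub>G\<^esub> T \<and>
            z = scal p q14 \<otimes>\<^bsub>G\<^esub> inv\<^bsub>G\<^esub> Y \<otimes>\<^bsub>G\<^esub> inv\<^bsub>G\<^esub> (actX (tau_minus p q14 M)) \<otimes>\<^bsub>G\<^esub> Y \<and>
            (\<exists>s\<in>scalars p. A \<otimes>\<^bsub>G\<^esub> B \<otimes>\<^bsub>G\<^esub> A \<otimes>\<^bsub>G\<^esub> C = s \<otimes>\<^bsub>G\<^esub> (Y \<otimes>\<^bsub>G\<^esub> X \<otimes>\<^bsub>G\<^esub> Y)) \<and>
            Y \<otimes>\<^bsub>G\<^esub> X \<otimes>\<^bsub>G\<^esub> Y = actY (tau_plus p q14 (tau_minus p q14 M)) \<and>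
            Tt = A \<otimes>\<^bsub>G\<^esub> B \<otimes>\<^bsub>G\<^esub> C \<and>
            Tt \<otimes>\<^bsub>G\<^esub> Tt = x \<otimes>\<^bsub>G\<^esub> z \<otimes>\<^bsub>G\<^esub> y \<and>
            (nondegenerate N k2 \<longrightarrow>
               ord_in_B_dag p \<rho> x = 2 * N \<and>
               ord_in_B_dag p \<rho> y = 2 * N \<and>
               ord_in_B_dag p \<rho> z = 2 * N \<and>
               ord_in_B_dag p \<rho> (A \<otimes>\<^bsub>G\<^esub> B \<otimes>\<^bsub>G\<^esub> A \<otimes>\<^bsub>G\<^esub> C) = 2 * N \<and>
               (t12 ^ 2 \<noteq> - 1 \<longrightarrow>
                  ord_mod_scalars p Tt = complex_ord (- (t12 ^ 2)) \<and>
                  int (complex_ord (- (t12 ^ 2))) = 2 * int N div gcd (2 * int N) (int N - \<bar>k2\<bar>) \<and>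
                  ord_mod_scalars p (Tt \<otimes>\<^bsub>G\<^esub> Tt) = complex_ord ((t12 ^ 2) ^ 2) \<and>
                  int (complex_ord ((t12 ^ 2) ^ 2)) = int N div gcd (int N) \<bar>k2\<bar>)))))
     \<and>
    (odd N \<longrightarrow>
     (\<forall>p M.
       (alpha_check_module N q12 t12 k2 p M \<or> gamma_check_module N q12 t12 k2 p M) \<longrightarrow>
       is_daha_module p (q12 ^ 2) (t12 ^ 2) M \<and>
       (alpha_check_module N q12 t12 k2 p M \<longrightarrow> quot_dim p (nat (int N - k2))) \<and>
       (gamma_check_module N q12 t12 k2 p M \<longrightarrow> quot_dim p (nat \<bar>k2\<bar>)) \<and>
       (t12 ^ 2) ^ 2 \<noteq> - 1 \<and>
       (\<exists>\<rho>. is_B1_action p q12 M \<rho> \<and>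
         (let G = GL_quot p; A = A_img p M; B = B_img p q12 M; C = C_img p M;
              x = x_img p q12 M; y = y_img p q12 M; z = z_img p M;
              T = actT M; Tt = scal p q12 \<otimes>\<^bsub>G\<^esub> T
          in
            group_center (B_tilde p \<rho>) = carrier (B_tilde p \<rho>) \<inter> scalars p \<and>
            natural_triangle_quotient N p q12 M \<rho> \<and>
            Tt = A \<otimes>\<^bsub>G\<^esub> B \<otimes>\<^bsub>G\<^esub> C \<and>
            (nondegenerate N k2 \<longrightarrow>
               ord_mod_scalars p x = N \<and>
               ord_mod_scalars p y = N \<and>
               ord_mod_scalars p z = N \<and>
               ord_mod_scalars p (A \<otimes>\<^bsub>G\<^esub> B \<otimes>\<^bsub>G\<^esub> A \<otimes>\<^bsub>G\<^esub> C) = N \<and>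
               ord_mod_scalars p Tt = complex_ord (- ((t12 ^ 2) ^ 2)) \<and>
               int (complex_ord (- ((t12 ^ 2) ^ 2))) = 2 * int N div gcd (int N) \<bar>k2\<bar> \<and>
               int (ord_mod_scalars p (T \<otimes>\<^bsub>G\<^esub> T)) = int N div gcd (int N) \<bar>k2\<bar>)))))"
proof (rule conjI; intro allI impI; (elim conjE)?)
qed (rule integral_types[OF params] check_types[OF params]; assumption)+

end
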